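(* Let $A$ be a $C^*$-algebra, let $X$ be an $A$-$A$-Hilbert bimodule, and let $\widehat{h}$ be the partial homeomorphism of the spectrum $\widehat{A}$ dual to $X$. If $\widehat{h}$ is free, then all ideals in the crossed product $A\rtimes_X\mathbb{Z}$ are gauge invariant and the map $J\mapsto\widehat{J\cap A}$ is a lattice isomorphism between the lattice of ideals in $A\rtimes_X\mathbb{Z}$ and the lattice of open $\widehat{h}$-invariant sets in $\widehat{A}$.
   Context: For bilinear or sesquilinear maps $\gamma$ (inner products, multiplications, representations), $\gamma(S,T)$ denotes the closed linear span of $\{\gamma(s,t): s\in S, t\in T\}$. Ideals in $C^*$-algebras are closed and two-sided. Hilbert bimodule: An $A$-$A$-Hilbert bimodule $X$ is an $A$-$A$-bimodule which is both a left and a right Hilbert module over $A$, with $A$-valued inner products $\langle\cdot,\cdot\rangle_L$ (linear in the first variable) and $\langle\cdot,\cdot\rangle_R$ (linear in the second variable), such that $x\cdot\langle y,z\rangle_R=\langle x,y\rangle_L\cdot z$ for all $x,y,z\in X$. (The inner products are not assumed full.) Put $I_L=\langle X,X\rangle_L$ and $I_R=\langle X,X\rangle_R$; these are ideals in $A$ and $X$ is an imprimitivity $I_L$-$I_R$-bimodule. Dual partial homeomorphism: $\widehat{A}$ is the spectrum of $A$ (unitary equivalence classes $[\pi]$ of irreducible representations, with the usual topology). For an ideal $I$ of $A$, $\widehat{I}$ is identified with the open subset $\{[\pi]\in\widehat{A}:\pi(I)\neq 0\}$. The partial homeomorphism dual to $X$ is the homeomorphism $\widehat{h}:\widehat{I_R}\to\widehat{I_L}$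 between open subsets of $\widehat{A}$ given by Rieffel induction: $\widehat{h}([\pi])=[X\text{-}\mathrm{Ind}(\pi)]$, where, for $\pi:A\to\mathcal{B}(H_\pi)$, $X\text{-}\mathrm{Ind}(\pi)$ acts on the Hilbert space $X\otimes_\pi H_\pi$ (with $\langle x_1\otimes_\pi h_1,x_2\otimes_\pi h_2\rangle=\langle h_1,\pi(\langle x_1,x_2\rangle_R)h_2\rangle$) by $X\text{-}\mathrm{Ind}(\pi)(a)(x\otimes_\pi h)=(ax)\otimes_\pi h$. Invariance and freeness: Let $\varphi:\Delta\to\varphi(\Delta)$ be a partial homeomorphism of a topological space (a homeomorphism between open subsets). It is topologically free if for every $n>0$ the set $F_n=\{x:\varphi^n(x)=x\}$ (a subset of the natural domain of the $n$-fold composition $\varphi^n$) has empty interior. A set $V$ is invariant under $\varphi$ if $\varphi(V\cap\Delta)=V\cap\varphi(\Delta)$. The map $\varphi$ is free if it is topologically free on every closed invariant set $V$, i.e. the restriction $\varphi:V\cap\Delta\to V\cap\varphi(\Delta)$ is a topologically free partial homeomorphism of $V$ with the subspace topology. Crossed product: A covariant representation of $(A,X)$ on a Hilbert space $H$ is a pair $(\pi_A,\pi_X)$, where $\pi_A:A\to\mathcal{B}(H)$ is a representation and $\pi_X:X\to\mathcal{B}(H)$ is linear, such that for all $a\in A$, $x,y\in X$: $\pi_X(ax)=\pi_A(a)\pi_X(x)$, $\pi_X(xa)=\pi_X(x)\pi_A(a)$, $\pi_A(\langle x,y\rangle_R)=\pi_X(x)^*\pi_X(y)$, $\pi_A(\langle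 x,y\rangle_L)=\pi_X(x)\pi_X(y)^*$. The crossed product $A\rtimes_X\mathbb{Z}$ is the $C^*$-algebra universal for covariant representations of $(A,X)$; it is generated by the images of $A$ and $X$ under the universal covariant representation, which is injective on $A$ and $X$, so $A$ and $X$ are regarded as subsets of $A\rtimes_X\mathbb{Z}$. The gauge circle action $\{\lambda\in\mathbb{C}:|\lambda|=1\}\ni\lambda\mapsto\gamma_\lambda\in\mathrm{Aut}(A\rtimes_X\mathbb{Z})$ is determined by $\gamma_\lambda(a)=a$ for $a\in A$ and $\gamma_\lambda(x)=\lambda x$ for $x\in X$. An ideal $J$ of $A\rtimes_X\mathbb{Z}$ is gauge invariant if $\gamma_\lambda(J)=J$ for all $\lambda$. *)

theory Defs
  imports "HOL-Analysis.Analysis" "HOL-Algebra.Lattice"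
begin

section \<open>Complex vector spaces, Hilbert spaces and C*-algebras\<close>

class scaleC =
  fixes scaleC :: "complex \<Rightarrow> 'a \<Rightarrow> 'a"  (infixr \<open>*\<^sub>C\<close> 75)

class complex_vector = scaleC + ab_group_add +
  assumes scaleC_add_right: "c *\<^sub>C (x + y) = c *\<^sub>C x + c *\<^sub>C y"
    and scaleC_add_left: "(c + d) *\<^sub>C x = c *\<^sub>C x + d *\<^sub>C x"
    and scaleC_scaleC: "c *\<^sub>C d *\<^sub>C x = (c * d) *\<^sub>C x"
    and scaleC_one: "1 *\<^sub>C x = x"

global_interpretation complex_vector: vector_space "scaleC :: complex \<Rightarrow> 'a \<Rightarrow> 'a::complex_vector"
  defines csubspace = complex_vector.subspace
    and cspan = complex_vector.span
  by unfold_locales (simp_all add: scaleC_add_right scaleC_add_left scaleC_scaleC scaleC_one)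

abbreviation clinear :: "('a::complex_vector \<Rightarrow> 'b::complex_vector) \<Rightarrow> bool"
  where "clinear \<equiv> Vector_Spaces.linear scaleC scaleC"

text \<open>The complex inner product is linear in the second variable.\<close>

class chilbert_space = complex_vector + real_inner + complete_space +
  fixes cinner :: "'a \<Rightarrow> 'a \<Rightarrow> complex"
  assumes scaleC_of_real: "complex_of_real r *\<^sub>C x = r *\<^sub>R x"
    and cinner_commute: "cinner x y = cnj (cinner y x)"
    and cinner_add_right: "cinner x (y + z) = cinner x y + cinner x z"
    and cinner_scaleC_right: "cinner x (c *\<^sub>C y) = c * cinner x y"
    and Re_cinner: "Re (cinner x y) = inner x y"

text \<open>C*-algebras are not assumed to be unital, and the zero algebra is allowed.\<close>

class cstar_algebra = complex_vector + real_normed_algebra + complete_space +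
  fixes star :: "'a \<Rightarrow> 'a"
  assumes scaleC_of_real_alg: "complex_of_real r *\<^sub>C x = r *\<^sub>R x"
    and mult_scaleC_left: "(c *\<^sub>C x) * y = c *\<^sub>C (x * y)"
    and mult_scaleC_right: "x * (c *\<^sub>C y) = c *\<^sub>C (x * y)"
    and norm_scaleC: "norm (c *\<^sub>C x) = cmod c * norm x"
    and star_add: "star (x + y) = star x + star y"
    and star_scaleC: "star (c *\<^sub>C x) = cnj c *\<^sub>C star x"
    and star_mult: "star (x * y) = star y * star x"
    and star_star: "star (star x) = x"
    and cstar_identity: "norm (star x * x) = (norm x)\<^sup>2"


section \<open>The Hilbert space of square-summable families\<close>

definition square_summable :: "('i \<Rightarrow> complex) \<Rightarrow> bool"
  where "square_summable f \<longleftrightarrow> (\<lambda>i. (cmod (f i))\<^sup>2) summable_on UNIV"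

typedef 'i ell2 = "{f :: 'i \<Rightarrow> complex. square_summable f}"
  by (rule exI[of _ "\<lambda>_. 0"]) (simp add: square_summable_def)

setup_lifting type_definition_ell2

lemma square_summable_add:
  assumes "square_summable f" "square_summable g"
  shows "square_summable (\<lambda>i. f i + g i)"
proof -
  have "(\<lambda>i. 2 * (cmod (f i))\<^sup>2 + 2 * (cmod (g i))\<^sup>2) summable_on UNIV"
    using assms unfolding square_summable_def
    by (intro summable_on_add summable_on_cmult_right)
  moreover have "(cmod (f i + g i))\<^sup>2 \<le> 2 * (cmod (f i))\<^sup>2 + 2 * (cmod (g i))\<^sup>2" for i
  proof -
    have "(cmod (f i + g i))\<^sup>2 \<le> (cmod (f i) + cmod (g i))\<^sup>2"
      by (simp add: norm_triangle_ineq power_mono)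
    also have "\<dots> \<le> 2 * (cmod (f i))\<^sup>2 + 2 * (cmod (g i))\<^sup>2"
      using sum_squares_bound[of "cmod (f i)" "cmod (g i)"] by (simp add: power2_sum)
    finally show ?thesis .
  qed
  ultimately show ?thesis
    unfolding square_summable_def by (rule summable_on_comparison_test) simp_all
qed

lemma square_summable_scale:
  assumes "square_summable f"
  shows "square_summable (\<lambda>i. c * f i)"
  using assms unfolding square_summable_def
  by (simp add: norm_mult power_mult_distrib summable_on_cmult_right)

lemma square_summable_uminus: "square_summable f \<Longrightarrow> square_summable (\<lambda>i. - f i)"
  unfolding square_summable_def by simp

lemma square_summable_cinner:
  assumes "square_summable f" "square_summable g"
  shows "(\<lambda>i. cnj (f i) * g i) summable_on UNIV"
proof (rule abs_summable_summable)
  have "(\<lambda>i. (cmod (f i))\<^sup>2 + (cmod (g i))\<^sup>2) summable_on UNIV"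
    using assms unfolding square_summable_def by (rule summable_on_add)
  moreover have "cmod (cnj (f i) * g i) \<le> (cmod (f i))\<^sup>2 + (cmod (g i))\<^sup>2" for i
  proof -
    have "2 * (cmod (f i) * cmod (g i)) \<le> (cmod (f i))\<^sup>2 + (cmod (g i))\<^sup>2"
      using sum_squares_bound[of "cmod (f i)" "cmod (g i)"] by simp
    moreover have "0 \<le> cmod (f i) * cmod (g i)" by simp
    ultimately show ?thesis unfolding norm_mult complex_mod_cnj by linarith
  qed
  ultimately show "(\<lambda>i. cmod (cnj (f i) * g i)) summable_on UNIV"
    by (rule summable_on_comparison_test) simp_all
qed

lemma Re_cnj_mult_self: "Re (cnj c * c) = (cmod c)\<^sup>2"
  unfolding cmod_power2 by (simp add: power2_eq_square)

instantiation ell2 :: (type) complex_vector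
begin

lift_definition zero_ell2 :: "'a ell2" is "\<lambda>_. 0" by (simp add: square_summable_def)
lift_definition plus_ell2 :: "'a ell2 \<Rightarrow> 'a ell2 \<Rightarrow> 'a ell2" is "\<lambda>f g i. f i + g i"
  by (simp add: square_summable_add)
lift_definition uminus_ell2 :: "'a ell2 \<Rightarrow> 'a ell2" is "\<lambda>f i. - f i"
  by (simp add: square_summable_uminus)
lift_definition minus_ell2 :: "'a ell2 \<Rightarrow> 'a ell2 \<Rightarrow> 'a ell2" is "\<lambda>f g i. f i - g i"
  using square_summable_add[OF _ square_summable_uminus] by simp
lift_definition scaleC_ell2 :: "complex \<Rightarrow> 'a ell2 \<Rightarrow> 'a ell2" is "\<lambda>c f i. c * f i"
  by (simp add: square_summable_scale)

instance
  by standard (transfer; simp add: algebra_simps fun_eq_iff)+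

end

instantiation ell2 :: (type) scaleR
begin

definition scaleR_ell2 :: "real \<Rightarrow> 'a ell2 \<Rightarrow> 'a ell2"
  where "scaleR_ell2 r x = complex_of_real r *\<^sub>C x"

instance ..

end

instantiation ell2 :: (type) real_inner
begin

lift_definition inner_ell2 :: "'a ell2 \<Rightarrow> 'a ell2 \<Rightarrow> real"
  is "\<lambda>f g. \<Sum>\<^sub>\<infinity>i. Re (cnj (f i) * g i)" .
definition norm_ell2 :: "'a ell2 \<Rightarrow> real" where "norm_ell2 x = sqrt (inner x x)"
definition sgn_ell2 :: "'a ell2 \<Rightarrow> 'a ell2" where "sgn_ell2 x = x /\<^sub>R norm x"
definition dist_ell2 :: "'a ell2 \<Rightarrow> 'a ell2 \<Rightarrow> real" where "dist_ell2 x y = norm (x - y)"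
definition uniformity_ell2 :: "('a ell2 \<times> 'a ell2) filter"
  where "uniformity_ell2 = (INF e\<in>{0 <..}. principal {(x, y). dist x y < e})"
definition open_ell2 :: "'a ell2 set \<Rightarrow> bool"
  where "open_ell2 U \<longleftrightarrow> (\<forall>x\<in>U. eventually (\<lambda>(x', y). x' = x \<longrightarrow> y \<in> U) uniformity)"

instance
proof
  fix x y z :: "'a ell2" and r s :: real
  show "r *\<^sub>R (x + y) = r *\<^sub>R x + r *\<^sub>R y" "(r + s) *\<^sub>R x = r *\<^sub>R x + s *\<^sub>R x"
    "r *\<^sub>R s *\<^sub>R x = (r * s) *\<^sub>R x" "1 *\<^sub>R x = x"
    unfolding scaleR_ell2_def
    by (simp_all add: scaleC_add_right scaleC_add_left scaleC_scaleC scaleC_one)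
  show "sgn x = x /\<^sub>R norm x" "dist x y = norm (x - y)" "norm x = sqrt (inner x x)"
    "uniformity = (INF e\<in>{0 <..}. principal {(x :: 'a ell2, y). dist x y < e})"
    by (fact sgn_ell2_def dist_ell2_def norm_ell2_def uniformity_ell2_def)+
  show "open U \<longleftrightarrow> (\<forall>x\<in>U. eventually (\<lambda>(x', y). x' = x \<longrightarrow> y \<in> U) uniformity)"
    for U :: "'a ell2 set" by (fact open_ell2_def)
  show "inner x y = inner y x"
    by transfer (simp add: algebra_simps)
  have summ: "(\<lambda>i. Re (cnj (f i) * g i)) summable_on UNIV"
    if "square_summable f" "square_summable g" for f g :: "'a \<Rightarrow> complex"
    using square_summable_cinner[OF that] by (rule summable_on_Re)
  show "inner (x + y) z = inner x z + inner y z"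
  proof (transfer, goal_cases)
    case (1 x y z)
    have "(\<Sum>\<^sub>\<infinity>i. Re (cnj (x i + y i) * z i))
        = (\<Sum>\<^sub>\<infinity>i. Re (cnj (x i) * z i) + Re (cnj (y i) * z i))"
      by (rule infsum_cong) (simp add: algebra_simps)
    also have "\<dots> = (\<Sum>\<^sub>\<infinity>i. Re (cnj (x i) * z i)) + (\<Sum>\<^sub>\<infinity>i. Re (cnj (y i) * z i))"
      using 1 by (intro infsum_add summ) auto
    finally show ?case .
  qed
  show "inner (r *\<^sub>R x) y = r * inner x y"
    unfolding scaleR_ell2_def
  proof (transfer, goal_cases)
    case (1 r x y)
    have "(\<Sum>\<^sub>\<infinity>i. Re (cnj (complex_of_real r * x i) * y i)) = (\<Sum>\<^sub>\<infinity>i. r * Re (cnj (x i) * y i))"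
      by (rule infsum_cong) (simp add: algebra_simps)
    also have "\<dots> = r * (\<Sum>\<^sub>\<infinity>i. Re (cnj (x i) * y i))"
      by (rule infsum_cmult_right')
    finally show ?case .
  qed
  note sq = Re_cnj_mult_self
  show "0 \<le> inner x x"
    by transfer (unfold sq, rule infsum_nonneg, simp)
  show "inner x x = 0 \<longleftrightarrow> x = 0"
  proof (transfer, goal_cases)
    case (1 x)
    then have s: "(\<lambda>i. (cmod (x i))\<^sup>2) summable_on UNIV"
      by (simp add: square_summable_def)
    show ?case
    proof
      assume "(\<Sum>\<^sub>\<infinity>i. Re (cnj (x i) * x i)) = 0"
      then have "(\<Sum>\<^sub>\<infinity>i. (cmod (x i))\<^sup>2) = 0" unfolding sq .
      then have "(cmod (x i))\<^sup>2 = 0" for i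
        using nonneg_infsum_le_0D[of "\<lambda>i. (cmod (x i))\<^sup>2" UNIV i] s by simp
      then show "x = (\<lambda>_. 0)" by (simp add: fun_eq_iff)
    qed simp
  qed
qed

end

lemma ell2_norm_square: "(norm x)\<^sup>2 = (\<Sum>\<^sub>\<infinity>i. (cmod (Rep_ell2 x i))\<^sup>2)"
  by (simp only: power2_norm_eq_inner inner_ell2.rep_eq Re_cnj_mult_self)

lemma ell2_summable: "(\<lambda>i. (cmod (Rep_ell2 x i))\<^sup>2) summable_on UNIV"
  using Rep_ell2[of x] by (simp add: square_summable_def)

lemma ell2_finite_sum_bound:
  "finite F \<Longrightarrow> (\<Sum>i\<in>F. (cmod (Rep_ell2 x i))\<^sup>2) \<le> (norm x)\<^sup>2"
  unfolding ell2_norm_square by (rule finite_sum_le_infsum[OF ell2_summable]) auto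

lemma ell2_coordinate_bound: "cmod (Rep_ell2 x i) \<le> norm x"
proof (rule power2_le_imp_le)
  show "(cmod (Rep_ell2 x i))\<^sup>2 \<le> (norm x)\<^sup>2"
    using ell2_finite_sum_bound[of "{i}" x] by simp
qed simp

lemma ell2_norm_le:
  assumes "\<And>F. finite F \<Longrightarrow> (\<Sum>i\<in>F. (cmod (Rep_ell2 x i))\<^sup>2) \<le> e\<^sup>2" "0 \<le> e"
  shows "norm x \<le> e"
proof -
  have "(norm x)\<^sup>2 \<le> e\<^sup>2"
    unfolding ell2_norm_square using assms(1) by (rule infsum_le_finite_sums[OF ell2_summable])
  then show ?thesis using assms(2) by (rule power2_le_imp_le)
qed

instance ell2 :: (type) complete_space
proof
  fix X :: "nat \<Rightarrow> 'a ell2"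
  assume C: "Cauchy X"
  have minus: "Rep_ell2 (x - y) i = Rep_ell2 x i - Rep_ell2 y i" for x y :: "'a ell2" and i
    by (simp add: minus_ell2.rep_eq)
  have "Cauchy (\<lambda>n. Rep_ell2 (X n) i)" for i
  proof (rule metric_CauchyI)
    fix e :: real assume "0 < e"
    with C obtain M where M: "\<And>m n. m \<ge> M \<Longrightarrow> n \<ge> M \<Longrightarrow> dist (X m) (X n) < e"
      by (meson metric_CauchyD)
    have "dist (Rep_ell2 (X m) i) (Rep_ell2 (X n) i) < e" if "m \<ge> M" "n \<ge> M" for m n
      using ell2_coordinate_bound[of "X m - X n" i] M[OF that] by (simp add: dist_norm minus)
    then show "\<exists>M. \<forall>m\<ge>M. \<forall>n\<ge>M. dist (Rep_ell2 (X m) i) (Rep_ell2 (X n) i) < e" by blast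
  qed
  then have "\<exists>l. (\<lambda>n. Rep_ell2 (X n) i) \<longlonglongrightarrow> l" for i
    using Cauchy_convergent convergent_def by blast
  then obtain l where l: "(\<lambda>n. Rep_ell2 (X n) i) \<longlonglongrightarrow> l i" for i
    by metis
  have tail: "\<exists>M. \<forall>n\<ge>M. \<forall>F. finite F \<longrightarrow> (\<Sum>i\<in>F. (cmod (Rep_ell2 (X n) i - l i))\<^sup>2) \<le> e\<^sup>2"
    if "0 < e" for e :: real
  proof -
    from C \<open>0 < e\<close> obtain M where M: "\<And>m n. m \<ge> M \<Longrightarrow> n \<ge> M \<Longrightarrow> dist (X m) (X n) < e"
      by (meson metric_CauchyD)
    have "(\<Sum>i\<in>F. (cmod (Rep_ell2 (X n) i - l i))\<^sup>2) \<le> e\<^sup>2" if "n \<ge> M" "finite F" for n F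
    proof (rule tendsto_upperbound)
      show "(\<lambda>m. \<Sum>i\<in>F. (cmod (Rep_ell2 (X n) i - Rep_ell2 (X m) i))\<^sup>2)
          \<longlonglongrightarrow> (\<Sum>i\<in>F. (cmod (Rep_ell2 (X n) i - l i))\<^sup>2)"
        by (intro tendsto_intros l)
      show "\<forall>\<^sub>F m in sequentially. (\<Sum>i\<in>F. (cmod (Rep_ell2 (X n) i - Rep_ell2 (X m) i))\<^sup>2) \<le> e\<^sup>2"
        using eventually_ge_at_top[of M]
      proof eventually_elim
        case (elim m)
        have "(\<Sum>i\<in>F. (cmod (Rep_ell2 (X n) i - Rep_ell2 (X m) i))\<^sup>2) \<le> (norm (X n - X m))\<^sup>2"
          using ell2_finite_sum_bound[OF \<open>finite F\<close>, of "X n - X m"] by (simp add: minus)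
        also have "\<dots> \<le> e\<^sup>2"
          using M[OF \<open>n \<ge> M\<close> elim] by (intro power_mono) (auto simp: dist_norm)
        finally show ?case .
      qed
    qed simp
    then show ?thesis by blast
  qed
  obtain M where M: "\<And>F. finite F \<Longrightarrow> (\<Sum>i\<in>F. (cmod (Rep_ell2 (X M) i - l i))\<^sup>2) \<le> 1"
    using tail[of 1] by (metis less_numeral_extra(1) one_power2 order_refl)
  have "square_summable (\<lambda>i. Rep_ell2 (X M) i - l i)"
    unfolding square_summable_def
    using M by (intro nonneg_bdd_above_summable_on bdd_aboveI[where M = 1]) auto
  moreover have "square_summable (Rep_ell2 (X M))"
    using Rep_ell2[of "X M"] by simp
  ultimately have "square_summable (\<lambda>i. Rep_ell2 (X M) i + - (Rep_ell2 (X M) i - l i))"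
    by (intro square_summable_add square_summable_uminus)
  then have "square_summable l" by simp
  then obtain L where L: "Rep_ell2 L = l"
    by (metis Abs_ell2_inverse mem_Collect_eq)
  have "X \<longlonglongrightarrow> L"
  proof (rule metric_LIMSEQ_I)
    fix e :: real assume "0 < e"
    then obtain N where N: "\<And>n F. n \<ge> N \<Longrightarrow> finite F \<Longrightarrow>
        (\<Sum>i\<in>F. (cmod (Rep_ell2 (X n) i - l i))\<^sup>2) \<le> (e / 2)\<^sup>2"
      using tail[of "e / 2"] by (metis half_gt_zero)
    have "dist (X n) L < e" if "n \<ge> N" for n
    proof -
      have "norm (X n - L) \<le> e / 2"
        using N[OF that] \<open>0 < e\<close> by (intro ell2_norm_le) (auto simp: minus L)
      then show ?thesis using \<open>0 < e\<close> by (simp add: dist_norm)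
    qed
    then show "\<exists>N. \<forall>n\<ge>N. dist (X n) L < e" by blast
  qed
  then show "convergent X" by (auto simp: convergent_def)
qed

instantiation ell2 :: (type) chilbert_space
begin

lift_definition cinner_ell2 :: "'a ell2 \<Rightarrow> 'a ell2 \<Rightarrow> complex"
  is "\<lambda>f g. \<Sum>\<^sub>\<infinity>i. cnj (f i) * g i" .

instance
proof
  fix x y z :: "'a ell2" and r :: real and c :: complex
  show "complex_of_real r *\<^sub>C x = r *\<^sub>R x" by (simp add: scaleR_ell2_def)
  show "cinner x y = cnj (cinner y x)"
    by transfer (simp flip: infsum_cnj add: mult.commute)
  show "cinner x (y + z) = cinner x y + cinner x z"
    by transfer (simp add: distrib_left infsum_add square_summable_cinner)
  show "cinner x (c *\<^sub>C y) = c * cinner x y"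
    by transfer (simp flip: infsum_cmult_right' add: mult.left_commute)
  show "Re (cinner x y) = inner x y"
    by transfer (simp add: square_summable_cinner flip: infsum_Re)
qed

end


section \<open>Ideals, homomorphisms and representations\<close>

definition cstar_ideal :: "'a::cstar_algebra set \<Rightarrow> bool"
  where "cstar_ideal J \<longleftrightarrow> csubspace J \<and> closed J \<and> (\<forall>a. \<forall>j\<in>J. a * j \<in> J \<and> j * a \<in> J)"

definition cstar_subalgebra :: "'a::cstar_algebra set \<Rightarrow> bool"
  where "cstar_subalgebra S \<longleftrightarrow>
    csubspace S \<and> closed S \<and> (\<forall>a\<in>S. \<forall>b\<in>S. a * b \<in> S) \<and> (\<forall>a\<in>S. star a \<in> S)"

definition cstar_generated :: "'a::cstar_algebra set \<Rightarrow> 'a set"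
  where "cstar_generated G = \<Inter>{S. cstar_subalgebra S \<and> G \<subseteq> S}"

definition star_hom :: "('a::cstar_algebra \<Rightarrow> 'b::cstar_algebra) \<Rightarrow> bool"
  where "star_hom f \<longleftrightarrow>
    clinear f \<and> (\<forall>a b. f (a * b) = f a * f b) \<and> (\<forall>a. f (star a) = star (f a))"

definition positive_elem :: "'a::cstar_algebra \<Rightarrow> bool"
  where "positive_elem a \<longleftrightarrow> (\<exists>b. a = star b * b)"

text \<open>
  Hilbert spaces are taken to be the closed subspaces \<^term>\<open>H\<close> of an ambient Hilbert space,
  and operators on \<^term>\<open>H\<close> are functions on the ambient space of which only the values on
  \<^term>\<open>H\<close> matter. This makes it possible to quantify over Hilbert spaces: up to unitary
  equivalence, the closed subspaces of \<^typ>\<open>'i ell2\<close> are exactly the Hilbert spaces whose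
  dimension is at most the cardinality of \<^typ>\<open>'i\<close>.
\<close>

definition hilbert_subspace :: "'h::chilbert_space set \<Rightarrow> bool"
  where "hilbert_subspace H \<longleftrightarrow> csubspace H \<and> closed H"

definition linear_into :: "'h::chilbert_space set \<Rightarrow> 'h set \<Rightarrow> ('h \<Rightarrow> 'h) \<Rightarrow> bool"
  where "linear_into H K T \<longleftrightarrow> (\<forall>h\<in>H. T h \<in> K) \<and>
    (\<forall>h\<in>H. \<forall>k\<in>H. T (h + k) = T h + T k) \<and> (\<forall>c. \<forall>h\<in>H. T (c *\<^sub>C h) = c *\<^sub>C T h)"

definition bounded_operator :: "'h::chilbert_space set \<Rightarrow> ('h \<Rightarrow> 'h) \<Rightarrow> bool"
  where "bounded_operator H T \<longleftrightarrow>
    linear_into H H T \<and> (\<exists>M. \<forall>h\<in>H. norm (T h) \<le> M * norm h)"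

definition adjoint_on :: "'h::chilbert_space set \<Rightarrow> ('h \<Rightarrow> 'h) \<Rightarrow> 'h \<Rightarrow> 'h"
  where "adjoint_on H T h = (THE k. k \<in> H \<and> (\<forall>g\<in>H. cinner k g = cinner h (T g)))"

text \<open>Representations are *-homomorphisms into the bounded operators; they may be degenerate.\<close>

type_synonym ('a, 'h) rep = "'h set \<times> ('a \<Rightarrow> 'h \<Rightarrow> 'h)"

definition representation :: "'h::chilbert_space set \<Rightarrow> ('a::cstar_algebra \<Rightarrow> 'h \<Rightarrow> 'h) \<Rightarrow> bool"
  where "representation H \<pi> \<longleftrightarrow>
    hilbert_subspace H \<and> (\<forall>a. bounded_operator H (\<pi> a)) \<and>
    (\<forall>a b. \<forall>h\<in>H. \<pi> (a + b) h = \<pi> a h + \<pi> b h) \<and>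
    (\<forall>c a. \<forall>h\<in>H. \<pi> (c *\<^sub>C a) h = c *\<^sub>C \<pi> a h) \<and>
    (\<forall>a b. \<forall>h\<in>H. \<pi> (a * b) h = \<pi> a (\<pi> b h)) \<and>
    (\<forall>a. \<forall>h\<in>H. \<pi> (star a) h = adjoint_on H (\<pi> a) h)"

definition irreducible_rep :: "('a::cstar_algebra, 'h::chilbert_space) rep \<Rightarrow> bool"
  where "irreducible_rep = (\<lambda>(H, \<pi>). representation H \<pi> \<and> (\<exists>a. \<exists>h\<in>H. \<pi> a h \<noteq> 0) \<and>
    (\<forall>L. hilbert_subspace L \<and> L \<subseteq> H \<and> (\<forall>a. \<forall>h\<in>L. \<pi> a h \<in> L) \<longrightarrow> L = {0} \<or> L = H))"

definition unitarily_equivalent ::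
    "('a::cstar_algebra, 'h::chilbert_space) rep \<Rightarrow> ('a, 'h) rep \<Rightarrow> bool"
  where "unitarily_equivalent = (\<lambda>(H, \<pi>) (K, \<rho>). \<exists>U. linear_into H K U \<and> U ` H = K \<and>
    (\<forall>h\<in>H. \<forall>k\<in>H. cinner (U h) (U k) = cinner h k) \<and>
    (\<forall>a. \<forall>h\<in>H. U (\<pi> a h) = \<rho> a (U h)))"


section \<open>The spectrum\<close>

text \<open>
  Irreducible representations are realized on closed subspaces of \<^typ>\<open>'a ell2\<close>, where
  \<^typ>\<open>'a\<close> is the algebra itself. No class is lost: an irreducible representation is cyclic,
  so its dimension is at most the cardinality of the algebra.
\<close>

definition spectrum :: "('a::cstar_algebra, 'a ell2) rep set set"
  where "spectrum = {p. irreducible_rep p} //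
    {(p, q). irreducible_rep p \<and> irreducible_rep q \<and> unitarily_equivalent p q}"

definition hat :: "'a::cstar_algebra set \<Rightarrow> ('a, 'a ell2) rep set set"
  where "hat I = {c \<in> spectrum. \<exists>(H, \<pi>)\<in>c. \<exists>a\<in>I. \<exists>h\<in>H. \<pi> a h \<noteq> 0}"

text \<open>
  The hull-kernel topology: its open sets are exactly the sets \<^term>\<open>hat I\<close> for ideals
  \<^term>\<open>I\<close> (this family is closed under finite intersections and arbitrary unions).
\<close>

definition spectrum_topology :: "('a::cstar_algebra, 'a ell2) rep set topology"
  where "spectrum_topology = topology_generated_by {hat I |I. cstar_ideal I}"


section \<open>Hilbert bimodules and their dual maps\<close>

text \<open>
  Completeness with respect to a norm given as a function, since a Hilbert bimodule a priori
  carries two norms, one for each inner product.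
\<close>

definition complete_wrt :: "('x::ab_group_add \<Rightarrow> real) \<Rightarrow> bool"
  where "complete_wrt N \<longleftrightarrow>
    (\<forall>s :: nat \<Rightarrow> 'x. (\<forall>e>0. \<exists>M. \<forall>m\<ge>M. \<forall>n\<ge>M. N (s m - s n) < e) \<longrightarrow>
      (\<exists>x. (\<lambda>n. N (s n - x)) \<longlonglongrightarrow> 0))"

locale left_hilbert_module =
  fixes lact :: "'a::cstar_algebra \<Rightarrow> 'x::complex_vector \<Rightarrow> 'x"
    and innerL :: "'x \<Rightarrow> 'x \<Rightarrow> 'a"
  assumes lact_add_left: "lact (a + b) x = lact a x + lact b x"
    and lact_add_right: "lact a (x + y) = lact a x + lact a y"
    and lact_scaleC_left: "lact (c *\<^sub>C a) x = c *\<^sub>C lact a x"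
    and lact_scaleC_right: "lact a (c *\<^sub>C x) = c *\<^sub>C lact a x"
    and lact_mult: "lact (a * b) x = lact a (lact b x)"
    and innerL_add: "innerL (x + y) z = innerL x z + innerL y z"
    and innerL_scaleC: "innerL (c *\<^sub>C x) y = c *\<^sub>C innerL x y"
    and innerL_lact: "innerL (lact a x) y = a * innerL x y"
    and innerL_star: "star (innerL x y) = innerL y x"
    and innerL_positive: "positive_elem (innerL x x)"
    and innerL_definite: "innerL x x = 0 \<Longrightarrow> x = 0"
    and innerL_complete: "complete_wrt (\<lambda>x. sqrt (norm (innerL x x)))"

locale right_hilbert_module =
  fixes ract :: "'x::complex_vector \<Rightarrow> 'a::cstar_algebra \<Rightarrow> 'x"
    and innerR :: "'x \<Rightarrow> 'x \<Rightarrow> 'a"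
  assumes ract_add_left: "ract (x + y) a = ract x a + ract y a"
    and ract_add_right: "ract x (a + b) = ract x a + ract x b"
    and ract_scaleC_left: "ract (c *\<^sub>C x) a = c *\<^sub>C ract x a"
    and ract_scaleC_right: "ract x (c *\<^sub>C a) = c *\<^sub>C ract x a"
    and ract_mult: "ract x (a * b) = ract (ract x a) b"
    and innerR_add: "innerR x (y + z) = innerR x y + innerR x z"
    and innerR_scaleC: "innerR x (c *\<^sub>C y) = c *\<^sub>C innerR x y"
    and innerR_ract: "innerR x (ract y a) = innerR x y * a"
    and innerR_star: "star (innerR x y) = innerR y x"
    and innerR_positive: "positive_elem (innerR x x)"
    and innerR_definite: "innerR x x = 0 \<Longrightarrow> x = 0"
    and innerR_complete: "complete_wrt (\<lambda>x. sqrt (norm (innerR x x)))"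

locale hilbert_bimodule =
  left_hilbert_module lact innerL + right_hilbert_module ract innerR
  for lact :: "'a::cstar_algebra \<Rightarrow> 'x::complex_vector \<Rightarrow> 'x"
    and ract :: "'x \<Rightarrow> 'a \<Rightarrow> 'x"
    and innerL innerR :: "'x \<Rightarrow> 'x \<Rightarrow> 'a" +
  assumes lact_ract: "lact a (ract x b) = ract (lact a x) b"
    and compatible: "ract x (innerR y z) = lact (innerL x y) z"

definition inner_ideal :: "('x \<Rightarrow> 'x \<Rightarrow> 'a::cstar_algebra) \<Rightarrow> 'a set"
  where "inner_ideal ip = closure (cspan {ip x y |x y. True})"

text \<open>
  \<^term>\<open>induced_rep lact innerR (H, \<pi>) (K, \<rho>)\<close> says that \<^term>\<open>K\<close> is (a realization of) the
  internal tensor product of \<open>X\<close> and \<^term>\<open>H\<close> over \<^term>\<open>\<pi>\<close>, with \<^term>\<open>T x h\<close> as the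
  elementary tensors, and that \<^term>\<open>\<rho>\<close> is the representation on it induced from
  \<^term>\<open>\<pi>\<close> by \<open>X\<close>. Its left-hand pair determines the right-hand one up to unitary equivalence.
\<close>

definition induced_rep ::
    "('a::cstar_algebra \<Rightarrow> 'x::complex_vector \<Rightarrow> 'x) \<Rightarrow> ('x \<Rightarrow> 'x \<Rightarrow> 'a) \<Rightarrow>
      ('a, 'h::chilbert_space) rep \<Rightarrow> ('a, 'h) rep \<Rightarrow> bool"
  where "induced_rep lact innerR = (\<lambda>(H, \<pi>) (K, \<rho>). representation K \<rho> \<and>
    (\<exists>T :: 'x \<Rightarrow> 'h \<Rightarrow> 'h.
      (\<forall>h\<in>H. clinear (\<lambda>x. T x h)) \<and> (\<forall>x. linear_into H K (T x)) \<and>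
      (\<forall>x\<^sub>1 x\<^sub>2. \<forall>h\<^sub>1\<in>H. \<forall>h\<^sub>2\<in>H.
        cinner (T x\<^sub>1 h\<^sub>1) (T x\<^sub>2 h\<^sub>2) = cinner h\<^sub>1 (\<pi> (innerR x\<^sub>1 x\<^sub>2) h\<^sub>2)) \<and>
      closure (cspan {T x h |x h. h \<in> H}) = K \<and>
      (\<forall>a x. \<forall>h\<in>H. \<rho> a (T x h) = T (lact a x) h)))"

text \<open>The dual map; it is meaningful on its domain \<^term>\<open>hat (inner_ideal innerR)\<close>.\<close>

definition dual_map ::
    "('a::cstar_algebra \<Rightarrow> 'x::complex_vector \<Rightarrow> 'x) \<Rightarrow> ('x \<Rightarrow> 'x \<Rightarrow> 'a) \<Rightarrow>
      ('a, 'a ell2) rep set \<Rightarrow> ('a, 'a ell2) rep set"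
  where "dual_map lact innerR c =
    {q. irreducible_rep q \<and> (\<exists>p\<in>c. induced_rep lact innerR p q)}"


section \<open>Freeness of partial homeomorphisms\<close>

text \<open>
  A partial homeomorphism of \<^term>\<open>S\<close> is given by its domain \<^term>\<open>D\<close> and a function
  \<^term>\<open>f\<close> whose values outside \<^term>\<open>D\<close> are irrelevant.
\<close>

definition iterate_domain :: "'p set \<Rightarrow> ('p \<Rightarrow> 'p) \<Rightarrow> nat \<Rightarrow> 'p set"
  where "iterate_domain D f n = {x. \<forall>k<n. (f ^^ k) x \<in> D}"

definition topologically_free :: "'p topology \<Rightarrow> 'p set \<Rightarrow> ('p \<Rightarrow> 'p) \<Rightarrow> bool"
  where "topologically_free S D f \<longleftrightarrow>
    (\<forall>n>0. S interior_of {x \<in> iterate_domain D f n. (f ^^ n) x = x} = {})"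

definition invariant_set :: "'p set \<Rightarrow> ('p \<Rightarrow> 'p) \<Rightarrow> 'p set \<Rightarrow> bool"
  where "invariant_set D f V \<longleftrightarrow> f ` (V \<inter> D) = V \<inter> f ` D"

definition free_map :: "'p topology \<Rightarrow> 'p set \<Rightarrow> ('p \<Rightarrow> 'p) \<Rightarrow> bool"
  where "free_map S D f \<longleftrightarrow>
    (\<forall>V. closedin S V \<and> invariant_set D f V \<longrightarrow>
      topologically_free (subtopology S V) (V \<inter> D) f)"


section \<open>The crossed product and its gauge action\<close>

definition covariant_rep ::
    "('a::cstar_algebra \<Rightarrow> 'x::complex_vector \<Rightarrow> 'x) \<Rightarrow> ('x \<Rightarrow> 'a \<Rightarrow> 'x) \<Rightarrow>
      ('x \<Rightarrow> 'x \<Rightarrow> 'a) \<Rightarrow> ('x \<Rightarrow> 'x \<Rightarrow> 'a) \<Rightarrow>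
      'h::chilbert_space set \<Rightarrow> ('a \<Rightarrow> 'h \<Rightarrow> 'h) \<Rightarrow> ('x \<Rightarrow> 'h \<Rightarrow> 'h) \<Rightarrow> bool"
  where "covariant_rep lact ract innerL innerR H \<pi>A \<pi>X \<longleftrightarrow>
    representation H \<pi>A \<and> (\<forall>x. bounded_operator H (\<pi>X x)) \<and>
    (\<forall>h\<in>H. clinear (\<lambda>x. \<pi>X x h)) \<and>
    (\<forall>a x. \<forall>h\<in>H. \<pi>X (lact a x) h = \<pi>A a (\<pi>X x h)) \<and>
    (\<forall>a x. \<forall>h\<in>H. \<pi>X (ract x a) h = \<pi>X x (\<pi>A a h)) \<and>
    (\<forall>x y. \<forall>h\<in>H. \<pi>A (innerR x y) h = adjoint_on H (\<pi>X x) (\<pi>X y h)) \<and>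
    (\<forall>x y. \<forall>h\<in>H. \<pi>A (innerL x y) h = \<pi>X x (adjoint_on H (\<pi>X y) h))"

text \<open>
  \<^typ>\<open>'b\<close> together with the maps \<^term>\<open>iA\<close> and \<^term>\<open>iX\<close> is the crossed product of the
  algebra \<^typ>\<open>'a\<close> by the Hilbert bimodule \<^typ>\<open>'x\<close>: it is generated by a covariant pair
  through which every covariant representation factors (uniquely, because of generation).
  It suffices to test this on closed subspaces of \<^typ>\<open>('a + 'x) ell2\<close>: a C*-algebra
  generated by \<^typ>\<open>'a\<close> and \<^typ>\<open>'x\<close> is faithfully represented by a sum of cyclic
  representations, and the dimensions of these are at most the cardinality of
  \<^typ>\<open>'a + 'x\<close> (unless both are zero).
\<close>

definition is_crossed_product ::
    "('a::cstar_algebra \<Rightarrow> 'x::complex_vector \<Rightarrow> 'x) \<Rightarrow> ('x \<Rightarrow> 'a \<Rightarrow> 'x) \<Rightarrow>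
      ('x \<Rightarrow> 'x \<Rightarrow> 'a) \<Rightarrow> ('x \<Rightarrow> 'x \<Rightarrow> 'a) \<Rightarrow>
      ('a \<Rightarrow> 'b::cstar_algebra) \<Rightarrow> ('x \<Rightarrow> 'b) \<Rightarrow> bool"
  where "is_crossed_product lact ract innerL innerR iA iX \<longleftrightarrow>
    star_hom iA \<and> clinear iX \<and>
    (\<forall>a x. iX (lact a x) = iA a * iX x) \<and>
    (\<forall>a x. iX (ract x a) = iX x * iA a) \<and>
    (\<forall>x y. iA (innerR x y) = star (iX x) * iX y) \<and>
    (\<forall>x y. iA (innerL x y) = iX x * star (iX y)) \<and>
    cstar_generated (range iA \<union> range iX) = UNIV \<and>
    (\<forall>(H :: ('a + 'x) ell2 set) \<pi>A \<pi>X.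
      covariant_rep lact ract innerL innerR H \<pi>A \<pi>X \<longrightarrow>
      (\<exists>\<Phi> :: 'b \<Rightarrow> ('a + 'x) ell2 \<Rightarrow> ('a + 'x) ell2. representation H \<Phi> \<and>
        (\<forall>a. \<forall>h\<in>H. \<Phi> (iA a) h = \<pi>A a h) \<and> (\<forall>x. \<forall>h\<in>H. \<Phi> (iX x) h = \<pi>X x h)))"

definition gauge_action ::
    "('a \<Rightarrow> 'b::cstar_algebra) \<Rightarrow> ('x \<Rightarrow> 'b) \<Rightarrow> complex \<Rightarrow> 'b \<Rightarrow> 'b"
  where "gauge_action iA iX z =
    (THE \<gamma>. star_hom \<gamma> \<and> bij \<gamma> \<and> (\<forall>a. \<gamma> (iA a) = iA a) \<and> (\<forall>x. \<gamma> (iX x) = z *\<^sub>C iX x))"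

definition gauge_invariant ::
    "('a \<Rightarrow> 'b::cstar_algebra) \<Rightarrow> ('x \<Rightarrow> 'b) \<Rightarrow> 'b set \<Rightarrow> bool"
  where "gauge_invariant iA iX J \<longleftrightarrow> (\<forall>z. cmod z = 1 \<longrightarrow> gauge_action iA iX z ` J = J)"


section \<open>Lattices of sets\<close>

definition inclusion_order :: "'p set set \<Rightarrow> 'p set gorder"
  where "inclusion_order F = \<lparr>carrier = F, eq = (=), le = (\<subseteq>)\<rparr>"

definition lattice_iso :: "'p gorder \<Rightarrow> 'q gorder \<Rightarrow> ('p \<Rightarrow> 'q) \<Rightarrow> bool"
  where "lattice_iso L M f \<longleftrightarrow>
    bij_betw f (carrier L) (carrier M) \<and> join_pres L M f \<and> meet_pres L M f"

end

theory Submission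
 imports Defs "HOL-Computational_Algebra.Polynomial" "HOL-Real_Asymp.Real_Asymp"
begin

text \<open>
 Points of the spectrum separate ideals (extreme states), and irreducible representations linked by
 \<open>X\<close> represent the dual map. Gluing the representations along an orbit gives a covariant
 representation, so every open invariant set comes from an ideal of the crossed product. If \<open>h\<close> is
 free, then by Schur's lemma the homogeneous components of degree \<open>n\<close>, \<open>0 < \<bar>n\<bar> \<le> N\<close>,
 move a suitable vector to orthogonal subspaces, whence \<open>\<parallel>\<pi>(a)\<parallel> \<le> \<parallel>c - j\<parallel>\<close> for \<open>j \<in> J\<close>, \<open>a\<close> the degree zero part of \<open>c\<close>, and \<open>\<pi>\<close> killing
 \<open>J \<inter> A\<close>. Applied to the powers \<open>(c\<^sup>* c)\<^sup>m\<close>, which have only \<open>O(m)\<close> homogeneous components, this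
 determines \<open>J\<close> by \<open>J \<inter> A\<close> and makes the gauge automorphisms preserve \<open>J\<close>.\<close>

text \<open>The universal property is tested only on \<open>('a + 'x) ell2\<close>, and the grading
  comes without projections: no gauge action and no expectation onto A is available at the start.
  Estimates drawn from freeness take their place, the case J = 0 included, and the gauge
  automorphisms are built from them. They control one homogeneous component at a time; adding the
  components of an element costs a factor. For powers this factor grows polynomially and the norms
  exponentially, so roots remove it. The same device gives the sharp bound for polynomials in a
  self-adjoint element, on which functional calculus rests.

  Freeness speaks of open sets, never of a given point. A norm seen at one representation is first
  spread to an open set by a positive part of x - d and then read off at a point without small
  periods.

  Hilbert spaces are closed subspaces of fixed types, so their size must be controlled. Gram-Schmidt
  along a well-order realizes a form on a family indexed by \<open>'i\<close> inside
  \<open>'i ell2\<close>. GNS and induced spaces find their place this way, and an orbit is spread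
  out by an injection of int x \<open>'a\<close> into \<open>'a\<close>.\<close>

abbreviation (input) seq_limit ("(_)/ ----> (_)" [60, 60] 60)
 where "f ----> l == f \<longlonglongrightarrow> l"

abbreviation (input) iff_infix (infixr "<->" 25)
 where "A <-> B == A \<longleftrightarrow> B"

notation (input) scaleC (infixr "*C" 75)
 and scaleR (infixr "*R" 75)

abbreviation (input) "cor == complex_of_real"

abbreviation (input) "irrep H \<pi> == irreducible_rep (H, \<pi>)"

type_synonym 'a action = "'a => 'a ell2 => 'a ell2"

instance cstar_algebra \<subseteq> banach ..
instance chilbert_space \<subseteq> banach ..

text \<open>Unital and nonzero. Functional calculus lives here; a general algebra is treated inside
  its unitization \<open>unitz\<close>.\<close>

class cstar_1 = cstar_algebra + real_normed_algebra_1

subsection \<open>Square roots in Banach spaces\<close>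

text \<open>The limit s of this iteration satisfies 2 s - s s = Q, so 1 - s is a square root of 1 -
  Q. It is written for operators on vectors so that it serves both an algebra
  (\<open>sqrt_one_minus\<close>) and a Hilbert space
  (\<open>irreducible_selfadj_scalar\<close>).\<close>

primrec sqit :: "('h::real_vector => 'h) => nat => 'h => 'h"
 where "sqit Q 0 x = 0"
 | "sqit Q (Suc n) x = (1/2) *R (Q x + sqit Q n (sqit Q n x))"

definition sqrt_lim :: "('h::real_normed_vector => 'h) => 'h => 'h"
 where "sqrt_lim Q x = lim (%n. sqit Q n x)"

locale contraction_on =
 fixes H :: "'h::banach set" and Q :: "'h => 'h"
 assumes subspace: "subspace H" and closed: "closed H"
  and maps: "x : H ==> Q x : H"
  and add: "x : H ==> y : H ==> Q (x + y) = Q x + Q y"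
  and scaleR: "x : H ==> Q (r *R x) = r *R Q x"
  and contr: "x : H ==> norm (Q x) <= norm x"
begin

text \<open>The same iteration for the number 1. It majorizes the iterates, and its increments
  majorize theirs, so convergence reduces to that of one increasing real sequence bounded by
  1.\<close>

primrec bound :: "nat => real"
 where "bound 0 = 0" | "bound (Suc n) = (1/2) * (1 + bound n * bound n)"

lemma bound_mono: "0 <= bound n & bound n <= bound (Suc n) & bound (Suc n) <= 1"
proof (induction n)
 case (Suc n)
 hence "bound n * bound n <= bound (Suc n) * bound (Suc n)"
  by (intro mult_mono) auto
 moreover have "bound (Suc n) * bound (Suc n) <= 1 * 1"
  using Suc by (intro mult_mono) auto
 ultimately show ?case using Suc by auto
qed simp

lemma iter_props:
 "(ALL x:H. sqit Q n x : H & norm (sqit Q n x) <= bound n * norm x &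
   (ALL y:H. sqit Q n (x + y) = sqit Q n x + sqit Q n y) &
   (ALL r. sqit Q n (r *R x) = r *R sqit Q n x))"
proof (induction n)
 case 0
 show ?case using subspace by (simp add: subspace_0)
next
 case (Suc n)
 have "norm (sqit Q (Suc n) x) <= bound (Suc n) * norm x" if "x : H" for x
 proof -
  have "norm (sqit Q n (sqit Q n x)) <= bound n * norm (sqit Q n x)"
   using Suc that by blast
  also have "... <= bound n * (bound n * norm x)"
   using Suc that bound_mono[of n] by (intro mult_left_mono) auto
  finally have "norm (sqit Q n (sqit Q n x)) <= bound n * bound n * norm x"
   by (simp add: mult.assoc)
  hence "norm (Q x + sqit Q n (sqit Q n x)) <= (1 + bound n * bound n) * norm x"
   using contr[OF that] norm_triangle_ineq[of "Q x" "sqit Q n (sqit Q n x)"]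
   by (simp add: algebra_simps)
  thus ?thesis by simp
 qed
 moreover have "sqit Q (Suc n) x : H" if "x : H" for x
  using Suc that maps subspace by (simp add: subspace_scale subspace_add)
 moreover have "sqit Q (Suc n) (x + y) = sqit Q (Suc n) x + sqit Q (Suc n) y"
  if "x : H" "y : H" for x y
  using Suc that add by (simp add: algebra_simps)
 moreover have "sqit Q (Suc n) (r *R x) = r *R sqit Q (Suc n) x"
  if "x : H" for x r
  using Suc that scaleR by (simp add: algebra_simps)
 ultimately show ?case by blast
qed

lemma iter_in: "x : H ==> sqit Q n x : H"
 and iter_norm: "x : H ==> norm (sqit Q n x) <= bound n * norm x"
 and iter_add: "x : H ==> y : H ==> sqit Q n (x + y) = sqit Q n x + sqit Q n y"
 and iter_scaleR: "x : H ==> sqit Q n (r *R x) = r *R sqit Q n x"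
 using iter_props[of n] by blast+

lemma iter_diff: "x : H ==> y : H ==> sqit Q n (x - y) = sqit Q n x - sqit Q n y"
 using iter_add[of x "(-1) *R y" n] iter_scaleR[of y n "-1"] subspace
 by (simp add: subspace_neg)

lemma iter_norm1: "x : H ==> norm (sqit Q n x) <= norm x"
 using iter_norm[of x n] bound_mono[of n]
 by (meson dual_order.trans mult_left_le_one_le norm_ge_zero)

text \<open>For consecutive iterates A and B, A A - B B = A (A - B) + (A - B) B, and the scalar
  sequence obeys the same identity. The last summand uses the induction hypothesis at B x, hence the
  arbitrary x.\<close>

lemma iter_step:
 "x : H ==> norm (sqit Q (Suc n) x - sqit Q n x) <= (bound (Suc n) - bound n) * norm x"
proof (induction n arbitrary: x)
 case 0
 thus ?case using contr[of x] subspace by (simp add: subspace_0)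
next
 case (Suc n)
 define A where "A = sqit Q (Suc n)"
 define B where "B = sqit Q n"
 have [simp]: "A x : H" "B x : H" "A (A x) : H"
  unfolding A_def B_def using Suc.prems iter_in by blast+
 have eq: "sqit Q (Suc (Suc n)) x - sqit Q (Suc n) x =
   (1/2) *R (A (A x - B x) + (A (B x) - B (B x)))"
  unfolding A_def B_def using Suc.prems iter_in[OF Suc.prems]
  by (simp add: iter_diff algebra_simps del: sqit.simps(2))
    (simp add: algebra_simps)
 have d: "0 <= bound (Suc n) - bound n" using bound_mono[of n] by simp
 have "norm (A (A x - B x)) <= bound (Suc n) * norm (A x - B x)"
  unfolding A_def B_def using Suc.prems iter_in[OF Suc.prems] subspace
  by (intro iter_norm) (simp add: subspace_diff del: sqit.simps(2))
 also have "... <= bound (Suc n) * ((bound (Suc n) - bound n) * norm x)"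
  using Suc.IH[OF Suc.prems] bound_mono[of n] unfolding A_def B_def
  by (intro mult_left_mono) (auto simp del: sqit.simps(2) bound.simps(2))
 finally have 1: "norm (A (A x - B x)) <= bound (Suc n) * ((bound (Suc n) - bound n) * norm x)" .
 have "norm (A (B x) - B (B x)) <= (bound (Suc n) - bound n) * norm (B x)"
  unfolding A_def B_def using Suc.IH iter_in[OF Suc.prems] by blast
 also have "... <= (bound (Suc n) - bound n) * (bound n * norm x)"
  unfolding B_def by (intro mult_left_mono iter_norm Suc.prems d)
 finally have 2: "norm (A (B x) - B (B x)) <= (bound (Suc n) - bound n) * (bound n * norm x)" .
 have "norm (A (A x - B x) + (A (B x) - B (B x))) <=
  (bound (Suc n) * bound (Suc n) - bound n * bound n) * norm x"
  using norm_triangle_ineq[of "A (A x - B x)" "A (B x) - B (B x)"] 1 2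
  by (simp add: algebra_simps del: bound.simps(2))
 moreover have "bound (Suc (Suc n)) - bound (Suc n) =
  (1/2) * (bound (Suc n) * bound (Suc n) - bound n * bound n)"
  by (simp add: field_simps)
 ultimately have "norm (A (A x - B x) + (A (B x) - B (B x))) <=
  2 * (bound (Suc (Suc n)) - bound (Suc n)) * norm x"
  by (simp only: mult.assoc[symmetric])
 thus ?case unfolding eq norm_scaleR by (simp add: algebra_simps del: bound.simps(2))
qed

lemma iter_diff_le:
 assumes "x : H" "n <= m"
 shows "norm (sqit Q m x - sqit Q n x) <= (bound m - bound n) * norm x"
 using assms(2)
proof (induction m rule: dec_induct)
 case (step m)
 have "norm (sqit Q (Suc m) x - sqit Q n x) <=
  norm (sqit Q (Suc m) x - sqit Q m x) + norm (sqit Q m x - sqit Q n x)"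
  by (metis norm_triangle_ineq diff_add_cancel add_diff_eq)
 also have "... <= (bound (Suc m) - bound m) * norm x + (bound m - bound n) * norm x"
  using iter_step[OF assms(1), of m] step by (intro add_mono) auto
 finally show ?case by (simp add: algebra_simps)
qed simp

lemma iter_tendsto:
 assumes "x : H" shows "(%n. sqit Q n x) ----> sqrt_lim Q x"
proof -
 have "incseq bound" using bound_mono by (simp add: incseq_Suc_iff)
 moreover have "0 <= bound n" "bound n <= 1" for n using bound_mono[of n] by linarith+
 hence "bounded (range bound)"
  unfolding bounded_iff by (intro exI[of _ 1]) auto
 ultimately have "convergent bound"
  by (meson Bseq_eq_bounded Bseq_mono_convergent incseqD)
 hence c: "Cauchy bound" using convergent_Cauchy by blast
 have "Cauchy (%n. sqit Q n x)"
 proof (rule metric_CauchyI)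
  fix e :: real assume "0 < e"
  hence "0 < e / (norm x + 1)" by (simp add: add_nonneg_pos)
  then obtain M where M: "!!m n. m >= M ==> n >= M ==> dist (bound m) (bound n) < e / (norm x + 1)"
   using c by (meson metric_CauchyD)
  have key: "norm (sqit Q m x - sqit Q n x) < e" if "m >= n" "n >= M" for m n
  proof -
   have "bound m - bound n < e / (norm x + 1)"
    using M[of m n] that by (simp add: dist_real_def)
   hence "(bound m - bound n) * (norm x + 1) < e"
    by (simp add: pos_less_divide_eq add_nonneg_pos)
   moreover have "(bound m - bound n) * norm x <= (bound m - bound n) * (norm x + 1)"
    using `incseq bound` that by (intro mult_left_mono) (auto simp: incseq_def)
   ultimately show ?thesis using iter_diff_le[OF assms that(1)] by linarith
  qed
  thus "EX M. ALL m>=M. ALL n>=M. dist (sqit Q m x) (sqit Q n x) < e"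
   unfolding dist_norm by (metis le_cases norm_minus_commute)
 qed
 thus ?thesis unfolding sqrt_lim_def
  using Cauchy_convergent convergent_LIMSEQ_iff by blast
qed

lemma lim_in: "x : H ==> sqrt_lim Q x : H"
 using closed_sequentially[OF closed _ iter_tendsto] iter_in by blast

lemma lim_add: "x : H ==> y : H ==> sqrt_lim Q (x + y) = sqrt_lim Q x + sqrt_lim Q y"
 using tendsto_add[OF iter_tendsto iter_tendsto, of x y] iter_tendsto[of "x + y"] subspace
 by (simp add: iter_add subspace_add LIMSEQ_unique)

lemma lim_norm: "x : H ==> norm (sqrt_lim Q x) <= norm x"
 using Lim_bounded[OF tendsto_norm[OF iter_tendsto], of x 0] iter_norm1 by blast

lemma lim_square:
 assumes "x : H" shows "2 *R sqrt_lim Q x - sqrt_lim Q (sqrt_lim Q x) = Q x"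
proof -
 let ?s = "sqrt_lim Q"
 have "(%n. sqit Q n (sqit Q n x) - sqit Q n (?s x)) ----> 0"
 proof (rule Lim_null_comparison)
  show "\<forall>\<^sub>F n in sequentially. norm (sqit Q n (sqit Q n x) - sqit Q n (?s x))
   <= norm (sqit Q n x - ?s x)"
   using assms iter_in lim_in iter_norm1 subspace
   by (intro always_eventually allI) (metis iter_diff subspace_diff)
  show "(%n. norm (sqit Q n x - ?s x)) ----> 0"
   using iter_tendsto[OF assms] by (simp add: LIM_zero tendsto_norm_zero)
 qed
 from tendsto_add[OF this iter_tendsto[OF lim_in[OF assms]]]
 have 1: "(%n. sqit Q n (sqit Q n x)) ----> ?s (?s x)" by simp
 have "(%n. sqit Q (Suc n) x) ----> (1/2) *R (Q x + ?s (?s x))"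
  unfolding sqit.simps by (intro tendsto_intros 1)
 moreover have "(%n. sqit Q (Suc n) x) ----> ?s x"
  using iter_tendsto[OF assms] by (rule LIMSEQ_Suc)
 ultimately have "?s x = (1/2) *R (Q x + ?s (?s x))" by (rule LIMSEQ_unique[rotated])
 hence "2 *R ?s x = Q x + ?s (?s x)" by (metis scaleR_half_double scaleR_2 scaleR_scaleR scaleR_right_distrib)
 thus ?thesis by simp
qed

lemma iter_intertwine:
 assumes C: "!!x. x : H ==> C x : H" "!!x. x : H ==> C (Q x) = Q (C x)"
  and Cadd: "!!x y. x : H ==> y : H ==> C (x + y) = C x + C y"
  and Csc: "!!x r. x : H ==> C (r *R x) = r *R C x"
  and "x : H"
 shows "C (sqit Q n x) = sqit Q n (C x)"
 using `x : H`
proof (induction n arbitrary: x)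
 case 0
 thus ?case using Csc[of x 0] by simp
next
 case (Suc n)
 thus ?case using iter_in maps subspace C Cadd Csc by (simp add: subspace_add)
qed

text \<open>Whatever commutes with Q commutes with the iterates and their limit. For right
  multiplications this shows that the limit is a left multiplication; for a representation, that it
  is an intertwiner.\<close>

lemma lim_intertwine:
 assumes C: "!!x. x : H ==> C x : H" "!!x. x : H ==> C (Q x) = Q (C x)"
  and Cadd: "!!x y. x : H ==> y : H ==> C (x + y) = C x + C y"
  and Csc: "!!x r. x : H ==> C (r *R x) = r *R C x"
  and Cb: "!!x. x : H ==> norm (C x) <= M * norm x"
  and "x : H"
 shows "C (sqrt_lim Q x) = sqrt_lim Q (C x)"
proof -
 have "(%n. C (sqit Q n x) - C (sqrt_lim Q x)) ----> 0"
 proof (rule Lim_null_comparison)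
  have "C (u - v) = C u - C v" if "u : H" "v : H" for u v
   using Cadd[of u "(-1) *R v"] Csc[of v "-1"] that subspace by (simp add: subspace_neg)
  thus "\<forall>\<^sub>F n in sequentially. norm (C (sqit Q n x) - C (sqrt_lim Q x))
   <= M * norm (sqit Q n x - sqrt_lim Q x)"
   using assms(6) iter_in lim_in subspace Cb
   by (intro always_eventually allI) (metis subspace_diff)
  show "(%n. M * norm (sqit Q n x - sqrt_lim Q x)) ----> 0"
   using iter_tendsto[OF assms(6)] by (intro tendsto_mult_right_zero) (simp add: LIM_zero tendsto_norm_zero)
 qed
 hence "(%n. C (sqit Q n x)) ----> C (sqrt_lim Q x)" by (rule LIM_zero_cancel)
 moreover have "(%n. C (sqit Q n x)) ----> sqrt_lim Q (C x)"
  using iter_tendsto[OF C(1)[OF assms(6)]] iter_intertwine[OF assms(1-4) assms(6)] by simp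
 ultimately show ?thesis by (rule LIMSEQ_unique)
qed

end

subsection \<open>Elementary properties of C*-algebras\<close>

lemma scaleC_simps [simp]:
 fixes x :: "'a::complex_vector"
 shows "0 *C x = 0" "c *C (0::'a) = 0" "1 *C x = x" "(- c) *C x = - (c *C x)" "c *C (- x) = - (c *C x)"
  "c *C d *C x = (c * d) *C x"
 by (auto simp: scaleC_one scaleC_scaleC)

lemma scaleC_diff_right: "c *C (x - y) = c *C x - c *C (y::'a::complex_vector)"
 by (rule complex_vector.scale_right_diff_distrib)

lemma scaleR_conv_scaleC: "r *R x = cor r *C (x::'a::cstar_algebra)"
 by (simp add: scaleC_of_real_alg)

lemma scaleC_scaleR_commute: "c *C (r *R x) = r *R (c *C (x::'a::cstar_algebra))"
 by (simp add: scaleR_conv_scaleC mult.commute)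

context cstar_algebra
begin

lemma star_0 [simp]: "star 0 = 0"
 using star_add[of 0 0] by simp

lemma star_minus: "star (- x) = - star x"
 using star_add[of x "- x"] by (simp add: eq_neg_iff_add_eq_0 add.commute)

lemma star_diff: "star (x - y) = star x - star y"
 using star_add[of x "- y"] by (simp add: star_minus)

end

lemma star_scaleR: "star (r *R x) = r *R star (x::'a::cstar_algebra)"
 by (simp add: scaleR_conv_scaleC star_scaleC)

lemma norm_star [simp]: "norm (star x) = norm (x::'a::cstar_algebra)"
proof -
 have le: "norm y <= norm (star y)" for y :: 'a
 proof (cases "y = 0")
  case False
  have "norm y * norm y <= norm (star y) * norm y"
   using cstar_identity[of y] norm_mult_ineq[of "star y" y] by (simp add: power2_eq_square)
  thus ?thesis using False by simp
 qed simp
 show ?thesis using le[of x] le[of "star x"] by (simp add: star_star)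
qed

lemma cstar_identity': "norm (x * star x) = (norm (x::'a::cstar_algebra))^2"
 using cstar_identity[of "star x"] by (simp add: star_star)

lemma bounded_linear_star: "bounded_linear (star :: 'a::cstar_algebra => 'a)"
 by (rule bounded_linear_intro[where K = 1]) (auto simp: star_add star_scaleR)

lemma bounded_linear_scaleC: "bounded_linear (%x::'a::cstar_algebra. c *C x)"
 by (rule bounded_linear_intro[where K = "cmod c"])
   (auto simp: scaleC_add_right scaleC_scaleR_commute norm_scaleC)

lemmas tendsto_star = bounded_linear.tendsto[OF bounded_linear_star]
lemmas tendsto_scaleC_alg = bounded_linear.tendsto[OF bounded_linear_scaleC]

lemma star_eq_0_iff [simp]: "star x = 0 <-> x = (0::'a::cstar_algebra)"
 by (metis star_0 star_star)

lemma star_mult_eq_0_iff: "star x * x = 0 <-> x = (0::'a::cstar_algebra)"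
 using cstar_identity[of x] by auto

lemma selfadj_square_norm: "star x = x ==> norm (x * x) = (norm (x::'a::cstar_algebra))^2"
 using cstar_identity[of x] by simp

lemma star_1 [simp]: "star 1 = (1::'a::cstar_1)"
 by (metis mult.right_neutral mult_1 star_mult star_star)

lemma star_of_real: "star (of_real r) = (of_real r::'a::cstar_1)"
 by (simp add: of_real_def star_scaleR)

lemma star_power: "star (x ^ n) = star (x::'a::cstar_1) ^ n"
 by (induction n) (auto simp: star_mult power_commutes)

lemma selfadj_norm_power2:
 "star x = x ==> norm (x ^ (2 ^ k)) = norm (x::'a::cstar_1) ^ (2 ^ k)"
proof (induction k)
 case (Suc k)
 have "star (x ^ (2^k)) = x ^ (2^k)" using Suc.prems by (simp add: star_power)
 thus ?case using Suc selfadj_square_norm[of "x ^ (2^k)"]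
  by (simp add: power_mult power2_eq_square power_mult_distrib mult.commute[of 2])
qed simp

text \<open>Q is left multiplication by z. The limit commutes with right multiplications, so it is
  left multiplication by its value s at 1, and w = 1 - s.\<close>

lemma sqrt_one_minus:
 fixes z :: "'a::cstar_1"
 assumes "star z = z" "norm z <= 1"
 obtains w where "star w = w" "w * w = 1 - z" "!!x. x * z = z * x ==> x * w = w * x"
proof -
 interpret contraction_on UNIV "(*) z"
  using assms norm_mult_ineq[of z] mult_right_mono[OF assms(2)]
  by unfold_locales (auto simp: algebra_simps, metis mult_1 norm_ge_zero norm_mult_ineq order_trans)
 let ?s = "sqrt_lim ((*) z)"
 have n: "norm (y * x) <= norm x * norm y" for x y :: 'a
  by (metis mult.commute norm_mult_ineq)
 have "?s 1 * x = ?s (1 * x)" for x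
  by (rule lim_intertwine[of "%y. y * x" "norm x"]) (auto simp: distrib_right mult.assoc n)
 hence s: "?s x = ?s 1 * x" for x by simp
 have sc: "y * ?s 1 = ?s 1 * y" if "y * z = z * y" for y
 proof -
  have "y * ?s 1 = ?s (y * 1)"
  proof (rule lim_intertwine[of "%x. y * x" "norm y"])
   show "y * (z * x) = z * (y * x)" for x using that by (metis mult.assoc)
  qed (simp_all add: distrib_left norm_mult_ineq)
  thus ?thesis using s[of y] by simp
 qed
 have "star (sqit ((*) z) n 1) = sqit ((*) z) n 1" for n
 proof (induction n)
  case (Suc n)
  have "sqit ((*) z) n (sqit ((*) z) n 1) = sqit ((*) z) n 1 * sqit ((*) z) n 1"
   using iter_intertwine[of "%y. y * sqit ((*) z) n 1" 1 n] by (simp add: algebra_simps)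
  thus ?case using Suc assms by (simp add: star_add star_scaleR star_mult)
 qed simp
 hence "star (?s 1) = ?s 1"
  using tendsto_star[OF iter_tendsto[of 1]] iter_tendsto[of 1] by (simp add: LIMSEQ_unique)
 moreover have "2 *R ?s 1 - ?s 1 * ?s 1 = z" using lim_square[of 1] s[of "?s 1"] by simp
 ultimately have "star (1 - ?s 1) = 1 - ?s 1" "(1 - ?s 1) * (1 - ?s 1) = 1 - z"
  by (simp_all add: star_diff algebra_simps scaleR_2)
 moreover have "x * (1 - ?s 1) = (1 - ?s 1) * x" if "x * z = z * x" for x
  using sc[OF that] by (simp add: algebra_simps)
 ultimately show thesis by (rule that)
qed

text \<open>With w the square root of 1 - a a, the element u = a + i w is unitary and a is its real
  part. The third equation is this fact multiplied by u, the form that turns polynomials in a into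
  polynomials in u.\<close>

lemma unitary_dilation:
 fixes a :: "'a::cstar_1"
 assumes "star a = a" "norm a <= 1"
 obtains u where "star u * u = 1" "u * star u = 1" "u * a = (1/2) *R (u * u + 1)" "norm u = 1"
proof -
 have "norm (a * a) <= 1"
  using assms selfadj_square_norm[of a] by (simp add: power_le_one)
 then obtain w where w: "star w = w" "w * w = 1 - a * a" "!!x. x * (a*a) = (a*a) * x ==> x * w = w * x"
  using sqrt_one_minus[of "a * a"] assms by (metis star_mult)
 have aw: "a * w = w * a" by (rule w(3)) (simp add: mult.assoc)
 define u where "u = a + \<i> *C w"
 have su: "star u = a - \<i> *C w"
  by (simp add: u_def star_add star_scaleC assms w)
 have 1: "star u * u = 1" "u * star u = 1"
  unfolding su unfolding u_def
  by (simp_all add: algebra_simps mult_scaleC_left mult_scaleC_right w aw)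
 have "u + star u = a + a" unfolding su by (simp add: u_def)
 hence "a = (1/2) *R (u + star u)" by (simp flip: scaleR_2)
 hence "u * a = (1/2) *R (u * u + u * star u)"
  by (metis distrib_left mult_scaleR_right)
 moreover have "norm u = 1" using cstar_identity[of u] 1
  by (metis abs_norm_cancel norm_one power2_eq_1_iff power2_eq_square real_sqrt_abs real_sqrt_one)
 ultimately show thesis using that 1 by simp
qed

subsection \<open>Polynomials in a self-adjoint element\<close>

definition reval :: "real poly => 'a::real_algebra_1 => 'a"
 where "reval p a = fold_coeffs (%c x. of_real c + a * x) p 0"

lemma reval_0 [simp]: "reval 0 a = 0"
 by (simp add: reval_def)

lemma reval_pCons [simp]: "reval (pCons c p) a = of_real c + a * reval p a"
 by (cases "p = 0 & c = 0") (auto simp: reval_def)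

lemma reval_1 [simp]: "reval 1 a = 1"
 by (simp add: one_pCons)

lemma reval_add [simp]: "reval (p + q) a = reval p a + reval q a"
proof (induction p q rule: poly_induct2)
 case (pCons c p d q)
 thus ?case by (simp add: algebra_simps)
qed simp

lemma reval_smult [simp]: "reval (smult c p) a = c *R reval p a"
 by (induction p) (auto simp: of_real_def algebra_simps)

lemma reval_minus [simp]: "reval (- p) a = - reval p a"
 using reval_smult[of "-1" p a] by simp

lemma reval_diff [simp]: "reval (p - q) a = reval p a - reval q a"
 using reval_add[of p "- q" a] by simp

lemma reval_mult [simp]: "reval (p * q) a = reval p a * reval q a"
 by (induction p) (auto simp: of_real_def algebra_simps)

lemma reval_power [simp]: "reval (p ^ n) a = reval p a ^ n"
 by (induction n) auto

lemma reval_monom [simp]: "reval (monom c n) a = c *R a ^ n"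
 by (induction n) (auto simp: monom_0 monom_Suc of_real_def algebra_simps)

lemma reval_sum [simp]: "reval (\<Sum>i\<in>A. p i) a = (\<Sum>i\<in>A. reval (p i) a)"
 by (induction A rule: infinite_finite_induct) auto

lemma reval_altdef:
 assumes "degree p <= d" shows "reval p a = (\<Sum>i\<le>d. coeff p i *R a ^ i)"
 by (subst poly_as_sum_of_monoms'[OF assms, symmetric]) (simp del: poly_as_sum_of_monoms')

lemma reval_of_real: "reval p (of_real t :: 'a::real_algebra_1) = of_real (poly p t)"
 by (induction p) (auto simp: of_real_def algebra_simps)

lemma reval_intertwine: "x * a = b * x ==> x * reval p a = reval p b * x"
proof (induction p)
 case (pCons c p)
 have "x * reval (pCons c p) a = of_real c * x + (x * a) * reval p a"
  by (simp add: algebra_simps of_real_def)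
 also have "... = of_real c * x + b * (x * reval p a)"
  unfolding pCons.prems by (simp add: mult.assoc)
 also have "... = reval (pCons c p) b * x"
  by (simp add: pCons.IH[OF pCons.prems] algebra_simps)
 finally show ?case .
qed simp

lemma star_reval: "star (reval p a) = reval p (star (a::'a::cstar_1))"
proof (induction p)
 case (pCons c p)
 thus ?case
  using reval_intertwine[of "star a" "star a" "star a" p] by (simp add: star_add star_mult star_of_real)
qed simp

definition root_of_unity :: "nat => complex"
 where "root_of_unity L = cis (2 * pi / real L)"

lemma norm_root_of_unity [simp]: "norm (root_of_unity L) = 1"
 by (simp add: root_of_unity_def)

lemma sum_roots_powi:
 assumes "L > 0"
 shows "(\<Sum>j<L. (root_of_unity L ^ j) powi m) = (if int L dvd m then of_nat L else 0)"
proof -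
 let ?z = "root_of_unity L powi m"
 have nz: "root_of_unity L ~= 0" by (simp add: root_of_unity_def)
 have sw: "(root_of_unity L ^ j) powi m = ?z ^ j" for j
  by (metis power_int_mult power_int_of_nat mult.commute power_int_power)
 have "real L * (2 * pi / real L) = 2 * pi" using assms by simp
 hence rL: "root_of_unity L ^ L = 1"
  unfolding root_of_unity_def by (metis Complex.DeMoivre cis_2pi)
 hence zL: "?z ^ L = 1" by (simp flip: sw)
 show ?thesis
 proof (cases "int L dvd m")
  case True
  then obtain k where k: "m = int L * k" by blast
  have "?z = 1" unfolding k by (simp add: power_int_mult rL)
  thus ?thesis using True by (simp add: sw)
 next
  case False
  have "?z ~= 1"
  proof
   assume "?z = 1"
   hence "cis (of_int m * (2 * pi / real L)) = 1"
    by (simp add: root_of_unity_def cis_power_int)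
   hence "cos (of_int m * (2 * pi / real L)) = 1"
    by (metis cis.simps(1) one_complex.simps(1))
   then obtain k :: int where "of_int m * (2 * pi / real L) = of_int k * (2 * pi)"
    unfolding cos_one_2pi_int by (auto simp: mult.commute)
   hence "of_int m = (of_int k * real L :: real)" using assms by (simp add: field_simps)
   hence "m = k * int L" by (metis of_int_eq_iff of_int_mult of_int_of_nat_eq)
   thus False using False by simp
  qed
  thus ?thesis using False zL by (simp add: sw sum_gp_strict)
 qed
qed

text \<open>The k-th coefficient is the mean of R(z) z^(-k) over the roots of unity of order D + 1,
  a finite form of the Fourier integral.\<close>

lemma coeff_bound:
 assumes "degree R <= D" and M: "!!z::complex. cmod z = 1 ==> cmod (reval R z) <= M"
 shows "\<bar>coeff R k\<bar> <= M"
proof (cases "k <= D")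
 case False
 hence "coeff R k = 0" using assms(1) by (simp add: coeff_eq_0)
 moreover have "0 <= M" using M[of 1] by (metis norm_ge_zero norm_one order_trans)
 ultimately show ?thesis by simp
next
 case True
 \<comment> \<open>More roots than exponents: all differences i - k have absolute value below
   L.\<close>
 define L where "L = Suc D"
 define w where "w j = root_of_unity L ^ j" for j
 have wn: "cmod (w j) = 1" for j by (simp add: w_def norm_power)
 have w0: "w j ~= 0" for j using wn[of j] by auto
 have "(\<Sum>j<L. w j powi (- int k) * reval R (w j)) =
   (\<Sum>j<L. \<Sum>i\<le>D. coeff R i *R (w j powi (int i - int k)))"
  unfolding reval_altdef[OF assms(1)] sum_distrib_left
  by (intro sum.cong refl) (simp add: power_int_diff power_int_minus w0 field_simps)
 also have "... = (\<Sum>i\<le>D. coeff R i *R (\<Sum>j<L. w j powi (int i - int k)))"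
  by (subst sum.swap) (simp add: scaleR_sum_right)
 also have "... = (\<Sum>i\<le>D. if i = k then of_real (coeff R k * real L) else 0)"
 proof (intro sum.cong refl)
  fix i assume "i : {..D}"
  have "int L dvd int i - int k <-> i = k"
  proof
   assume d: "int L dvd int i - int k"
   have "\<bar>int i - int k\<bar> < int L" using `i : {..D}` True by (auto simp: L_def)
   thus "i = k" using d dvd_imp_le_int[of "int i - int k" "int L"] by auto
  qed simp
  thus "coeff R i *R (\<Sum>j<L. w j powi (int i - int k)) =
   (if i = k then of_real (coeff R k * real L) else 0)"
   using sum_roots_powi[of L "int i - int k"] by (simp add: w_def L_def scaleR_conv_of_real)
 qed
 also have "... = of_real (coeff R k * real L)" using True by simp
 finally have "cor (coeff R k * real L) = (\<Sum>j<L. w j powi (- int k) * reval R (w j))" by simp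
 hence "cmod (cor (coeff R k * real L)) <= (\<Sum>j<L. cmod (w j powi (- int k) * reval R (w j)))"
  by (simp only: norm_sum)
 also have "... <= (\<Sum>j<L. M)"
  by (intro sum_mono) (simp add: norm_mult norm_power_int wn M)
 finally show ?thesis by (simp add: L_def abs_mult mult.commute norm_mult del: of_nat_Suc)
qed

text \<open>If \<open>a = (u + v) / 2\<close> with \<open>u v = 1\<close>, then \<open>u\<^sup>d q(a)\<close> is a polynomial in \<open>u\<close>.\<close>

definition dilate :: "nat => real poly => real poly"
 where "dilate d q = (\<Sum>m\<le>d. smult (coeff q m / 2 ^ m) (monom 1 (d - m) * (monom 1 2 + 1) ^ m))"

lemma degree_dilate: "degree (dilate d q) <= 2 * d"
 unfolding dilate_def
proof (intro degree_sum_le)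
 fix m assume "m : {..d}"
 have "degree ((monom 1 2 + 1 :: real poly) ^ m) <= 2 * m"
  using degree_power_le[of "monom 1 2 + 1 :: real poly" m]
   degree_add_le[of "monom 1 2 :: real poly" 2 1] degree_monom_le[of "1::real" 2]
  by (metis degree_1 le_trans mult_le_mono1 zero_le)
 hence "degree (monom 1 (d - m) * (monom 1 2 + 1 :: real poly) ^ m) <= (d - m) + 2 * m"
  using degree_mult_le[of "monom 1 (d - m)" "(monom 1 2 + 1 :: real poly) ^ m"]
   degree_monom_le[of "1::real" "d - m"] by linarith
 thus "degree (smult (coeff q m / 2 ^ m) (monom 1 (d - m) * (monom 1 2 + 1) ^ m)) <= 2 * d"
  using `m : {..d}` degree_smult_le[of "coeff q m / 2 ^ m" "monom 1 (d - m) * (monom 1 2 + 1) ^ m"]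
  by simp
qed auto

lemma reval_dilate:
 fixes u a :: "'a::real_algebra_1"
 assumes "degree q <= d" "u * a = (1/2) *R (u * u + 1)"  "a * u = u * a"
 shows "u ^ d * reval q a = reval (dilate d q) u"
proof -
 have "u ^ m * a ^ m = (1 / 2 ^ m) *R (u * u + 1) ^ m" for m
 proof (induction m)
  case (Suc m)
  have "a * u ^ m = u ^ m * a" using assms(3) by (induction m) (auto simp: algebra_simps, metis mult.assoc)
  hence "u ^ Suc m * a ^ Suc m = (u * a) * (u ^ m * a ^ m)"
   by (simp add: mult.assoc) (metis mult.assoc)
  thus ?case unfolding Suc assms(2) by simp
 qed simp
 hence "u ^ d * a ^ m = (1 / 2 ^ m) *R (u ^ (d - m) * (u * u + 1) ^ m)" if "m <= d" for m
  using that by (metis le_add_diff_inverse2 mult.assoc mult_scaleR_right power_add)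
 thus ?thesis unfolding reval_altdef[OF assms(1)] dilate_def
  by (simp add: sum_distrib_left power2_eq_square)
qed

text \<open>By \<open>dilate\<close>, u^d q(a) is a polynomial of degree at most 2 d in the unitary
  u. On the unit circle its modulus is |q(Re z)| <= M, so each of its 2 d + 1 coefficients is at
  most M.\<close>

lemma reval_bound_crude:
 fixes a :: "'a::cstar_1"
 assumes "star a = a" "norm a <= 1" and M: "!!t. \<bar>t\<bar> <= 1 ==> \<bar>poly q t\<bar> <= M"
 shows "norm (reval q a) <= (2 * real (degree q) + 1) * M"
proof -
 let ?d = "degree q"
 let ?R = "dilate ?d q"
 obtain u where u: "star u * u = 1" "u * star u = 1" "u * a = (1/2) *R (u * u + 1)" "norm u = 1"
  using unitary_dilation[OF assms(1,2)] .
 have "a = star u * (u * a)" by (simp add: u(1) flip: mult.assoc)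
 also have "... = (1/2) *R (u + star u)"
  unfolding u(3) by (simp add: algebra_simps u(1) flip: mult.assoc)
 finally have a: "a = (1/2) *R (u + star u)" .
 hence au: "a * u = u * a" using u(1,2) by (simp add: algebra_simps)
 have R: "u ^ ?d * reval q a = reval ?R u"
  using reval_dilate[of q ?d u a] u(3) au by simp
 have co: "\<bar>coeff ?R k\<bar> <= M" for k
 proof (rule coeff_bound[OF degree_dilate])
  fix z :: complex assume z: "cmod z = 1"
  have "cnj z * z = 1" using z by (simp add: complex_norm_square[symmetric] mult.commute)
  hence "z * of_real (Re z) = (1/2) *R (z * z + 1)"
   by (simp add: complex_eq_iff algebra_simps)
  hence "reval ?R z = z ^ ?d * of_real (poly q (Re z))"
   using reval_dilate[of q ?d z "of_real (Re z)"] by (simp add: reval_of_real mult.commute)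
  hence "cmod (reval ?R z) = \<bar>poly q (Re z)\<bar>" by (simp add: norm_mult norm_power z)
  also have "... <= M" using M abs_Re_le_cmod[of z] z by simp
  finally show "cmod (reval ?R z) <= M" .
 qed
 have "star u ^ n * u ^ n = 1" for n
 proof (induction n)
  case (Suc n)
  have "star u ^ Suc n * u ^ Suc n = star u ^ n * (star u * u) * u ^ n"
   by (simp only: power_Suc2[of "star u"] power_Suc[of u] mult.assoc)
  thus ?case using Suc u(1) by simp
 qed simp
 hence "reval q a = star u ^ ?d * reval ?R u" by (simp flip: R mult.assoc)
 also have "norm ... <= norm (star u ^ ?d) * norm (reval ?R u)" by (rule norm_mult_ineq)
 also have "... <= 1 * norm (reval ?R u)"
  using norm_power_ineq[of "star u" ?d] u(4) by (intro mult_right_mono) auto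
 also have "norm (reval ?R u) <= (\<Sum>i\<le>2 * ?d. norm (coeff ?R i *R u ^ i))"
  unfolding reval_altdef[OF degree_dilate] by (rule norm_sum)
 also have "... <= (\<Sum>i\<le>2 * ?d. M)"
 proof (intro sum_mono)
  fix i
  have "norm (u ^ i) <= 1" using norm_power_ineq[of u i] u(4) by simp
  hence "\<bar>coeff ?R i\<bar> * norm (u ^ i) <= M * 1"
   using co[of i] by (intro mult_mono) (auto intro: order_trans[OF abs_ge_zero])
  thus "norm (coeff ?R i *R u ^ i) <= M" by simp
 qed
 finally show ?thesis by (simp add: algebra_simps)
qed

lemma linear_exp_bound:
 fixes r :: real
 assumes "0 < D" "1 < r" shows "EX k. 2 * real (2 ^ k) * D + 1 < r ^ (2 ^ k)"
proof -
 have "(%n. (2 * real n * D + 1) / r ^ n) ----> 0"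
  using assms by real_asymp
 hence "eventually (%n. (2 * real n * D + 1) / r ^ n < 1) sequentially"
  by (rule order_tendstoD) simp
 then obtain N where N: "!!n. n >= N ==> (2 * real n * D + 1) / r ^ n < 1"
  by (auto simp: eventually_sequentially)
 have "N <= 2 ^ N" using less_exp[of N] by (simp add: less_imp_le)
 from N[OF this] show ?thesis using assms by (intro exI[of _ N]) (simp add: field_simps)
qed

text \<open>The factor 2 d + 1 disappears when the crude bound is applied to the powers p^(2^k): the
  norm of a self-adjoint element is multiplicative under squaring, while the factor grows only
  linearly in 2^k.\<close>

lemma reval_bound_1:
 fixes a :: "'a::cstar_1"
 assumes a: "star a = a" "norm a <= 1" and M: "!!t. \<bar>t\<bar> <= 1 ==> \<bar>poly p t\<bar> <= M"
 shows "norm (reval p a) <= M"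
proof (rule ccontr)
 assume "\<not> ?thesis"
 \<comment> \<open>The strict bound is positive even for M = 0, so one may divide by it.\<close>
 then obtain M' where M': "M < M'" "M' < norm (reval p a)" using dense not_le by blast
 have "0 <= M" using M[of 0] by simp
 hence "0 < M'" using M' by simp
 define r where "r = norm (reval p a) / M'"
 have "1 < r" using M' `0 < M'` by (simp add: r_def)
 then obtain k where k: "2 * real (2 ^ k) * (real (degree p) + 1) + 1 < r ^ (2 ^ k)"
  using linear_exp_bound[of "real (degree p) + 1" r] by auto
 let ?n = "2 ^ k :: nat"
 have "star (reval p a) = reval p a" using a by (simp add: star_reval)
 hence "norm (reval p a) ^ ?n = norm (reval (p ^ ?n) a)"
  by (simp add: selfadj_norm_power2)
 also have "... <= (2 * real (degree (p ^ ?n)) + 1) * M' ^ ?n"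
 proof (rule reval_bound_crude[OF a])
  fix t :: real assume "\<bar>t\<bar> <= 1"
  thus "\<bar>poly (p ^ ?n) t\<bar> <= M' ^ ?n"
   using M[of t] M' by (simp add: power_abs power_mono)
 qed
 also have "... <= (2 * real ?n * (real (degree p) + 1) + 1) * M' ^ ?n"
 proof (intro mult_right_mono)
  have "real (degree (p ^ ?n)) <= real (degree p * ?n)" using degree_power_le[of p ?n] of_nat_mono by blast
  also have "... <= real ?n * (real (degree p) + 1)" by (simp add: algebra_simps)
  finally show "2 * real (degree (p ^ ?n)) + 1 <= 2 * real ?n * (real (degree p) + 1) + 1" by simp
 qed (use `0 < M'` in simp)
 finally have "r ^ ?n <= 2 * real ?n * (real (degree p) + 1) + 1"
  using `0 < M'` unfolding r_def power_divide by (simp add: divide_le_eq)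
 thus False using k by simp
qed

lemma reval_bound:
 fixes a :: "'a::cstar_1"
 assumes a: "star a = a" "norm a <= r" and M: "!!t. \<bar>t\<bar> <= r ==> \<bar>poly p t\<bar> <= M"
 shows "norm (reval p a) <= M"
proof (cases "r = 0")
 case True
 hence "a = of_real 0" using a by simp
 hence "norm (reval p a) = \<bar>poly p 0\<bar>" by (simp only: reval_of_real norm_of_real)
 thus ?thesis using M[of 0] True by simp
next
 case False
 hence r: "0 < r" using a norm_ge_zero[of a] by linarith
 define q where "q = pcompose p [:0, r:]"
 have q: "reval q x = reval p (r *R x)" for x :: 'a
  unfolding q_def by (induction p) (auto simp: pcompose_pCons)
 have "norm (reval q ((1/r) *R a)) <= M"
 proof (rule reval_bound_1)
  show "star ((1/r) *R a) = (1/r) *R a" by (simp add: a star_scaleR)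
  show "norm ((1/r) *R a) <= 1" using a r by simp
  fix t :: real assume "\<bar>t\<bar> <= 1"
  hence "\<bar>r * t\<bar> <= r" using r by (simp add: abs_mult)
  thus "\<bar>poly q t\<bar> <= M" using M[of "r * t"] by (simp add: q_def poly_pcompose mult.commute)
 qed
 thus ?thesis using r by (simp add: q)
qed

subsection \<open>Continuous functional calculus\<close>

lemma real_poly_function_poly:
 assumes "real_polynomial_function (f :: real => real)"
 obtains p where "!!x. f x = poly p x"
proof -
 obtain a n where "f = (%x. \<Sum>i\<le>n. a i * x ^ i)"
  using assms real_polynomial_function_iff_sum by blast
 hence "f x = poly (\<Sum>i\<le>n. monom (a i) i) x" for x
  by (simp add: poly_sum poly_monom)
 thus thesis by (rule that)
qed

lemma poly_approx:
 fixes \<phi> :: "real => real"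
 assumes "continuous_on UNIV \<phi>" "0 < e"
 obtains p where "!!t. \<bar>t\<bar> <= r ==> \<bar>poly p t - \<phi> t\<bar> < e"
proof -
 have "continuous_on {-r..r} \<phi>" using assms(1) continuous_on_subset by blast
 then obtain g where g: "real_polynomial_function g" "!!x. x : {-r..r} ==> \<bar>\<phi> x - g x\<bar> < e"
  using Stone_Weierstrass_real_polynomial_function[of "{-r..r}" \<phi> e] assms(2) by auto
 obtain p where p: "!!x. g x = poly p x" using real_poly_function_poly[OF g(1)] by blast
 have "\<bar>poly p t - \<phi> t\<bar> < e" if "\<bar>t\<bar> <= r" for t
  using g(2)[of t] that p[of t] by (auto simp: abs_le_iff abs_minus_commute)
 thus thesis by (rule that)
qed

definition is_cfc :: "(real => real) => 'a::cstar_1 => 'a => bool"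
 where "is_cfc \<phi> a x <->
  (ALL r. ALL e>0. EX p. (ALL t. \<bar>t\<bar> <= r --> \<bar>poly p t - \<phi> t\<bar> < e) & norm (reval p a - x) < e)"

definition cfc :: "(real => real) => 'a::cstar_1 => 'a"
 where "cfc \<phi> a = (THE x. is_cfc \<phi> a x)"

lemma reval_dist:
 fixes a :: "'a::cstar_1"
 assumes "star a = a" "norm a <= r"
  and "!!t. \<bar>t\<bar> <= r ==> \<bar>poly p t - \<phi> t\<bar> < d" "!!t. \<bar>t\<bar> <= r ==> \<bar>poly q t - \<psi> t\<bar> < e"
  and "!!t. \<bar>t\<bar> <= r ==> \<bar>\<phi> t - \<psi> t\<bar> <= M"
 shows "norm (reval p a - reval q a) <= d + e + M"
proof -
 have "norm (reval (p - q) a) <= d + e + M"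
 proof (rule reval_bound[OF assms(1,2)])
  fix t :: real assume "\<bar>t\<bar> <= r"
  from assms(3-5)[OF this] show "\<bar>poly (p - q) t\<bar> <= d + e + M" by auto
 qed
 thus ?thesis by simp
qed

lemma is_cfc_norm_diff:
 fixes a :: "'a::cstar_1"
 assumes a: "star a = a" "norm a <= r"
  and x: "is_cfc \<phi> a x" and y: "is_cfc \<psi> a y"
  and M: "!!t. \<bar>t\<bar> <= r ==> \<bar>\<phi> t - \<psi> t\<bar> <= M"
 shows "norm (x - y) <= M"
proof (rule field_le_epsilon)
 fix e :: real assume "0 < e"
 hence e: "0 < e/4" by simp
 obtain p where p: "!!t. \<bar>t\<bar> <= r ==> \<bar>poly p t - \<phi> t\<bar> < e/4" "norm (reval p a - x) < e/4"
  using x e unfolding is_cfc_def by meson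
 obtain q where q: "!!t. \<bar>t\<bar> <= r ==> \<bar>poly q t - \<psi> t\<bar> < e/4" "norm (reval q a - y) < e/4"
  using y e unfolding is_cfc_def by meson
 have "norm (reval p a - reval q a) <= e/4 + e/4 + M"
  by (rule reval_dist[OF a p(1) q(1) M])
 moreover have "norm (x - y) <= norm (reval p a - x) + norm (reval p a - reval q a) + norm (reval q a - y)"
  by (smt (verit, ccfv_threshold) norm_minus_commute norm_triangle_sub norm_triangle_ineq diff_diff_eq2 add_diff_eq diff_add_cancel norm_diff_triangle_ineq)
 ultimately show "norm (x - y) <= M + e" using p(2) q(2) by simp
qed

lemma is_cfc_unique:
 fixes a :: "'a::cstar_1"
 assumes "star a = a" "is_cfc \<phi> a x" "is_cfc \<phi> a y" shows "x = y"
 using is_cfc_norm_diff[OF assms(1) order_refl assms(2,3), of 0] by simp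

lemma is_cfc_exists:
 fixes a :: "'a::cstar_1"
 assumes a: "star a = a" and c: "continuous_on UNIV \<phi>"
 obtains x where "is_cfc \<phi> a x"
proof -
 have "EX p. ALL t. \<bar>t\<bar> <= norm a + real n --> \<bar>poly p t - \<phi> t\<bar> < 1 / real (Suc n)" for n
  using poly_approx[OF c, of "1 / real (Suc n)" "norm a + real n"] by (metis of_nat_0_less_iff zero_less_Suc zero_less_divide_1_iff)
 then obtain p where p: "!!n t. \<bar>t\<bar> <= norm a + real n ==> \<bar>poly (p n) t - \<phi> t\<bar> < 1 / real (Suc n)"
  by metis
 have d: "norm (reval (p m) a - reval (p n) a) <= 1 / real (Suc m) + 1 / real (Suc n)" for m n
  using reval_dist[OF a order_refl, of "p m" \<phi> "1 / real (Suc m)" "p n" \<phi> "1 / real (Suc n)" 0] p by simp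
 have lim0: "(%n. 1 / real (Suc n)) ----> 0" by real_asymp
 have "Cauchy (%n. reval (p n) a)"
 proof (rule metric_CauchyI)
  fix e :: real assume "0 < e"
  hence "eventually (%n. 1 / real (Suc n) < e/2) sequentially"
   using lim0 by (intro order_tendstoD) auto
  then obtain N where N: "!!n. n >= N ==> 1 / real (Suc n) < e/2"
   by (auto simp: eventually_sequentially)
  have "dist (reval (p m) a) (reval (p n) a) < e" if "m >= N" "n >= N" for m n
   using d[of m n] N[OF that(1)] N[OF that(2)] by (simp add: dist_norm)
  thus "EX M. ALL m>=M. ALL n>=M. dist (reval (p m) a) (reval (p n) a) < e" by blast
 qed
 then obtain x where x: "(%n. reval (p n) a) ----> x"
  using Cauchy_convergent convergent_def by blast
 have "is_cfc \<phi> a x"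
  unfolding is_cfc_def
 proof (intro allI impI)
  fix r e :: real assume "0 < e"
  have "eventually (%n. norm (reval (p n) a - x) < e) sequentially"
   using x `0 < e` by (metis (mono_tags, lifting) LIMSEQ_iff eventually_sequentially)
  moreover have "eventually (%n. 1 / real (Suc n) < e) sequentially"
   using lim0 `0 < e` by (intro order_tendstoD) auto
  moreover have "eventually (%n. r <= real n) sequentially"
   using filterlim_real_sequentially by (simp add: filterlim_at_top)
  ultimately have "eventually (%n. norm (reval (p n) a - x) < e & 1 / real (Suc n) < e & r <= real n) sequentially"
   by eventually_elim auto
  then obtain n where n: "norm (reval (p n) a - x) < e" "1 / real (Suc n) < e" "r <= real n"
   by (auto simp: eventually_sequentially)
  have "\<bar>poly (p n) t - \<phi> t\<bar> < e" if "\<bar>t\<bar> <= r" for t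
   using p[of t n] that n(2,3) norm_ge_zero[of a] by linarith
  thus "EX p. (ALL t. \<bar>t\<bar> <= r --> \<bar>poly p t - \<phi> t\<bar> < e) & norm (reval p a - x) < e"
   using n(1) by blast
 qed
 thus thesis by (rule that)
qed

lemma is_cfc_cfc:
 fixes a :: "'a::cstar_1"
 assumes "star a = a" "continuous_on UNIV \<phi>" shows "is_cfc \<phi> a (cfc \<phi> a)"
 unfolding cfc_def using is_cfc_exists[OF assms] is_cfc_unique[OF assms(1)] by (metis theI)

lemma cfc_eqI:
 fixes a :: "'a::cstar_1"
 assumes "star a = a" "is_cfc \<phi> a x" shows "cfc \<phi> a = x"
 unfolding cfc_def using is_cfc_unique[OF assms(1)] assms(2) by blast

lemma norm_cfc_diff_le:
 fixes a :: "'a::cstar_1"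
 assumes "star a = a" "norm a <= r" "continuous_on UNIV \<phi>" "continuous_on UNIV \<psi>"
  and "!!t. \<bar>t\<bar> <= r ==> \<bar>\<phi> t - \<psi> t\<bar> <= M"
 shows "norm (cfc \<phi> a - cfc \<psi> a) <= M"
 using assms is_cfc_norm_diff[OF assms(1,2) is_cfc_cfc is_cfc_cfc] by blast

lemma is_cfc_poly: "is_cfc (poly p) a (reval p a)"
 unfolding is_cfc_def by (intro allI impI exI[of _ p]) auto

lemma cfc_poly:
 fixes a :: "'a::cstar_1"
 assumes "star a = a" shows "cfc (poly p) a = reval p a"
 by (rule cfc_eqI[OF assms is_cfc_poly])

lemma cfc_const:
 fixes a :: "'a::cstar_1"
 assumes "star a = a" shows "cfc (%t. c) a = of_real c"
proof -
 have "(%t. c) = poly [:c:]" by (rule ext) simp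
 thus ?thesis using cfc_poly[OF assms, of "[:c:]"] by simp
qed

lemma cfc_id:
 fixes a :: "'a::cstar_1"
 assumes "star a = a" shows "cfc (%t. t) a = a"
proof -
 have "(%t. t) = poly [:0, 1::real:]" by (rule ext) simp
 thus ?thesis using cfc_poly[OF assms, of "[:0, 1:]"] by simp
qed

lemma norm_cfc_le:
 fixes a :: "'a::cstar_1"
 assumes "star a = a" "norm a <= r" "continuous_on UNIV \<phi>" "!!t. \<bar>t\<bar> <= r ==> \<bar>\<phi> t\<bar> <= M"
 shows "norm (cfc \<phi> a) <= M"
 using norm_cfc_diff_le[OF assms(1-3), of "%t. 0" M] assms cfc_const[OF assms(1), of 0] by simp

lemma cfc_cong:
 fixes a :: "'a::cstar_1"
 assumes "star a = a" "norm a <= r" "continuous_on UNIV \<phi>" "continuous_on UNIV \<psi>"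
  and "!!t. \<bar>t\<bar> <= r ==> \<phi> t = \<psi> t"
 shows "cfc \<phi> a = cfc \<psi> a"
 using norm_cfc_diff_le[OF assms(1-4), of 0] assms(5) by simp

lemma cfc_approx:
 fixes a :: "'a::cstar_1"
 assumes "star a = a" "continuous_on UNIV \<phi>"
 obtains p where "(%n. reval (p n) a) ----> cfc \<phi> a"
  "!!n t. \<bar>t\<bar> <= r ==> \<bar>poly (p n) t - \<phi> t\<bar> < 1 / real (Suc n)"
proof -
 have "EX p. (ALL t. \<bar>t\<bar> <= r --> \<bar>poly p t - \<phi> t\<bar> < 1 / real (Suc n)) & norm (reval p a - cfc \<phi> a) < 1 / real (Suc n)" for n
  using is_cfc_cfc[OF assms] unfolding is_cfc_def by (metis of_nat_0_less_iff zero_less_Suc zero_less_divide_1_iff)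
 then obtain p where p: "!!n t. \<bar>t\<bar> <= r ==> \<bar>poly (p n) t - \<phi> t\<bar> < 1 / real (Suc n)"
  "!!n. norm (reval (p n) a - cfc \<phi> a) < 1 / real (Suc n)" by metis
 have "(%n. reval (p n) a - cfc \<phi> a) ----> 0"
 proof (rule Lim_null_comparison)
  show "\<forall>\<^sub>F n in sequentially. norm (reval (p n) a - cfc \<phi> a) <= 1 / real (Suc n)"
   using p(2) less_imp_le by (intro always_eventually) blast
  show "(%n. 1 / real (Suc n)) ----> 0" by real_asymp
 qed
 thus thesis using that p(1) by (metis LIM_zero_iff)
qed

lemma cfc_limI:
 fixes a :: "'a::cstar_1"
 assumes "star a = a" "continuous_on UNIV \<phi>" "norm a <= r"
  "!!n t. \<bar>t\<bar> <= r ==> \<bar>poly (p n) t - \<phi> t\<bar> <= e n" "e ----> 0"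
 shows "(%n. reval (p n) a) ----> cfc \<phi> a"
proof -
 have "(%n. reval (p n) a - cfc \<phi> a) ----> 0"
 proof (rule Lim_null_comparison[OF _ assms(5)], intro always_eventually allI)
  fix n
  have "continuous_on UNIV (poly (p n))" by (intro continuous_intros)
  thus "norm (reval (p n) a - cfc \<phi> a) <= e n"
   using norm_cfc_diff_le[OF assms(1,3), of "poly (p n)" \<phi> "e n"] assms by (simp add: cfc_poly)
 qed
 thus ?thesis by (rule LIM_zero_cancel)
qed

text \<open>One sequence of polynomials serves all self-adjoint elements of norm at most r in two
  algebras at once. Comparing the calculus at two elements, or across a homomorphism, then reduces
  to polynomials.\<close>

lemma uniform_poly_approx:
 fixes \<phi> :: "real => real"
 assumes "continuous_on UNIV \<phi>"
 obtains p where "!!a::'a::cstar_1. star a = a ==> norm a <= r ==> (%n. reval (p n) a) ----> cfc \<phi> a"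
  and "!!a::'b::cstar_1. star a = a ==> norm a <= r ==> (%n. reval (p n) a) ----> cfc \<phi> a"
  and "!!n t. \<bar>t\<bar> <= r ==> \<bar>poly (p n) t - \<phi> t\<bar> <= 1 / real (Suc n)"
proof -
 have "EX p. ALL t. \<bar>t\<bar> <= r --> \<bar>poly p t - \<phi> t\<bar> < 1 / real (Suc n)" for n
  using poly_approx[OF assms, of "1 / real (Suc n)" r] by (metis of_nat_0_less_iff zero_less_Suc zero_less_divide_1_iff)
 then obtain p where p: "!!n t. \<bar>t\<bar> <= r ==> \<bar>poly (p n) t - \<phi> t\<bar> <= 1 / real (Suc n)"
  by (metis less_imp_le)
 have l: "(%n. 1 / real (Suc n)) ----> 0" by real_asymp
 show thesis by (rule that[OF cfc_limI[OF _ assms _ p l] cfc_limI[OF _ assms _ p l] p])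
qed

text \<open>In \<open>pos_star_mult\<close> an element w intertwines two different elements,
  \<open>star w * w\<close> and \<open>w * star w\<close> up to sign; hence the form with both a and
  b.\<close>

lemma cfc_intertwine:
 fixes a b x :: "'a::cstar_1"
 assumes "star a = a" "star b = b" "continuous_on UNIV \<phi>" "x * a = b * x"
 shows "x * cfc \<phi> a = cfc \<phi> b * x"
proof -
 obtain p where p: "!!a::'a. star a = a ==> norm a <= max (norm a) (norm b) ==> True"
  "!!c::'a. star c = c ==> norm c <= max (norm a) (norm b) ==> (%n. reval (p n) c) ----> cfc \<phi> c"
  using uniform_poly_approx[OF assms(3), of "max (norm a) (norm b)"] by metis
 have "(%n. x * reval (p n) a) ----> x * cfc \<phi> a" "(%n. reval (p n) b * x) ----> cfc \<phi> b * x"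
  using assms p(2) by (auto intro!: tendsto_intros)
 moreover have "x * reval (p n) a = reval (p n) b * x" for n
  by (rule reval_intertwine[OF assms(4)])
 ultimately show ?thesis by (simp add: LIMSEQ_unique)
qed

lemma star_cfc:
 fixes a :: "'a::cstar_1"
 assumes "star a = a" "continuous_on UNIV \<phi>"
 shows "star (cfc \<phi> a) = cfc \<phi> a"
proof -
 obtain p where p: "(%n. reval (p n) a) ----> cfc \<phi> a" by (rule cfc_approx[OF assms])
 from tendsto_star[OF p] p show ?thesis by (simp add: star_reval assms LIMSEQ_unique)
qed

lemma cfc_add:
 fixes a :: "'a::cstar_1"
 assumes a: "star a = a" and c: "continuous_on UNIV \<phi>" "continuous_on UNIV \<psi>"
 shows "cfc (%t. \<phi> t + \<psi> t) a = cfc \<phi> a + cfc \<psi> a"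
proof -
 obtain p where p: "(%n. reval (p n) a) ----> cfc \<phi> a"
  "!!n t. \<bar>t\<bar> <= norm a ==> \<bar>poly (p n) t - \<phi> t\<bar> < 1 / real (Suc n)" using cfc_approx[OF a c(1)] by metis
 obtain q where q: "(%n. reval (q n) a) ----> cfc \<psi> a"
  "!!n t. \<bar>t\<bar> <= norm a ==> \<bar>poly (q n) t - \<psi> t\<bar> < 1 / real (Suc n)" using cfc_approx[OF a c(2)] by metis
 have "(%n. reval (p n + q n) a) ----> cfc (%t. \<phi> t + \<psi> t) a"
 proof (rule cfc_limI[OF a _ order_refl])
  show "\<bar>poly (p n + q n) t - (\<phi> t + \<psi> t)\<bar> <= 2 / real (Suc n)" if "\<bar>t\<bar> <= norm a" for n t
   using p(2)[OF that, of n] q(2)[OF that, of n] by (auto simp: abs_less_iff)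
  show "(%n. 2 / real (Suc n)) ----> 0" by real_asymp
 qed (intro continuous_intros c)
 moreover have "(%n. reval (p n + q n) a) ----> cfc \<phi> a + cfc \<psi> a"
  using tendsto_add[OF p(1) q(1)] by simp
 ultimately show ?thesis by (rule LIMSEQ_unique)
qed

lemma cfc_mult:
 fixes a :: "'a::cstar_1"
 assumes a: "star a = a" and c: "continuous_on UNIV \<phi>" "continuous_on UNIV \<psi>"
 shows "cfc (%t. \<phi> t * \<psi> t) a = cfc \<phi> a * cfc \<psi> a"
proof -
 let ?I = "{- norm a..norm a}"
 obtain p where p: "(%n. reval (p n) a) ----> cfc \<phi> a"
  "!!n t. \<bar>t\<bar> <= norm a ==> \<bar>poly (p n) t - \<phi> t\<bar> < 1 / real (Suc n)" using cfc_approx[OF a c(1)] by metis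
 obtain q where q: "(%n. reval (q n) a) ----> cfc \<psi> a"
  "!!n t. \<bar>t\<bar> <= norm a ==> \<bar>poly (q n) t - \<psi> t\<bar> < 1 / real (Suc n)" using cfc_approx[OF a c(2)] by metis
 have "compact (\<phi> ` ?I)" "compact (\<psi> ` ?I)"
  using c continuous_on_subset by (blast intro!: compact_continuous_image)+
 hence "bounded (\<phi> ` ?I)" "bounded (\<psi> ` ?I)" by (auto intro: compact_imp_bounded)
 then obtain B C where B: "!!t. t : ?I ==> \<bar>\<phi> t\<bar> <= B" and C: "!!t. t : ?I ==> \<bar>\<psi> t\<bar> <= C"
  unfolding bounded_iff by (metis imageI real_norm_def)
 have "(%n. reval (p n * q n) a) ----> cfc (%t. \<phi> t * \<psi> t) a"
 proof (rule cfc_limI[OF a _ order_refl])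
  show "\<bar>poly (p n * q n) t - (\<phi> t * \<psi> t)\<bar> <= (1 / real (Suc n)) * (C + 1 + B)" if t: "\<bar>t\<bar> <= norm a" for n t
  proof -
   let ?e = "1 / real (Suc n)"
   have e: "?e <= 1" by simp
   have "t : ?I" using t by (auto simp: abs_le_iff)
   note BC = B[OF this] C[OF this]
   have "poly (p n * q n) t - \<phi> t * \<psi> t = (poly (p n) t - \<phi> t) * poly (q n) t + \<phi> t * (poly (q n) t - \<psi> t)"
    by (simp add: algebra_simps)
   also have "\<bar>...\<bar> <= \<bar>poly (p n) t - \<phi> t\<bar> * \<bar>poly (q n) t\<bar> + \<bar>\<phi> t\<bar> * \<bar>poly (q n) t - \<psi> t\<bar>"
    by (metis abs_mult abs_triangle_ineq)
   also have "... <= ?e * (C + 1) + B * ?e"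
   proof (intro add_mono mult_mono)
    show "\<bar>poly (q n) t\<bar> <= C + 1" using q(2)[OF t, of n] BC(2) e by linarith
    show "\<bar>\<phi> t\<bar> <= B" "0 <= B" using BC(1) by auto
   qed (use p(2)[OF t, of n] q(2)[OF t, of n] in auto)
   finally show ?thesis by (simp only: distrib_left mult.commute[of B])
  qed
  show "(%n. (1 / real (Suc n)) * (C + 1 + B)) ----> 0" by real_asymp
 qed (intro continuous_intros c)
 moreover have "(%n. reval (p n * q n) a) ----> cfc \<phi> a * cfc \<psi> a"
  using tendsto_mult[OF p(1) q(1)] by simp
 ultimately show ?thesis by (rule LIMSEQ_unique)
qed

lemma cfc_cmult:
 fixes a :: "'a::cstar_1"
 assumes a: "star a = a" and c: "continuous_on UNIV \<phi>"
 shows "cfc (%t. r * \<phi> t) a = r *R cfc \<phi> a"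
 using cfc_mult[OF a continuous_on_const c, of r] cfc_const[OF a, of r] by (simp add: of_real_def)

text \<open>For polynomial phi this is additivity and multiplicativity of the calculus; uniform
  approximation does the rest.\<close>

lemma cfc_compose:
 fixes a :: "'a::cstar_1"
 assumes a: "star a = a" and c: "continuous_on UNIV \<phi>" "continuous_on UNIV \<psi>"
 shows "cfc \<phi> (cfc \<psi> a) = cfc (%t. \<phi> (\<psi> t)) a"
proof -
 have "compact (\<psi> ` {- norm a..norm a})"
  using c continuous_on_subset by (blast intro!: compact_continuous_image)
 hence "bounded (\<psi> ` {- norm a..norm a})" by (rule compact_imp_bounded)
 then obtain C0 where C0: "!!t. t : {- norm a..norm a} ==> \<bar>\<psi> t\<bar> <= C0"
  unfolding bounded_iff by (metis imageI real_norm_def)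
 \<comment> \<open>C bounds the values of psi, where the polynomials must be close to phi, and the
   norm of \<open>cfc \<psi> a\<close>, where they must converge.\<close>
 define C where "C = max C0 (norm (cfc \<psi> a))"
 have C: "\<bar>\<psi> t\<bar> <= C" if "\<bar>t\<bar> <= norm a" for t
 proof -
  have "t : {- norm a..norm a}" using that by (auto simp: abs_le_iff)
  thus ?thesis using C0[of t] by (simp add: C_def)
 qed
 obtain p where p: "!!x::'a. star x = x ==> norm x <= C ==> (%n. reval (p n) x) ----> cfc \<phi> x"
  "!!n t. \<bar>t\<bar> <= C ==> \<bar>poly (p n) t - \<phi> t\<bar> <= 1 / real (Suc n)"
  using uniform_poly_approx[OF c(1), of C] by metis
 have pc: "cfc (%t. poly q (\<psi> t)) a = reval q (cfc \<psi> a)" for q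
 proof (induction q)
  case 0
  thus ?case using cfc_const[OF a, of 0] by simp
 next
  case (pCons d q)
  have "continuous_on UNIV (%t. poly q (\<psi> t))" by (intro continuous_intros c)
  hence "cfc (%t. d + \<psi> t * poly q (\<psi> t)) a = of_real d + cfc \<psi> a * cfc (%t. poly q (\<psi> t)) a"
   by (subst cfc_add[OF a]) (auto simp: cfc_const[OF a] cfc_mult[OF a c(2)] intro!: continuous_intros c)
  thus ?case by (simp add: pCons.IH)
 qed
 have cc: "continuous_on UNIV (%t. \<phi> (\<psi> t))"
  by (rule continuous_on_compose2[OF c(1) c(2)]) auto
 have "(%n. reval (p n) (cfc \<psi> a) - cfc (%t. \<phi> (\<psi> t)) a) ----> 0"
 proof (rule Lim_null_comparison)
  show "\<forall>\<^sub>F n in sequentially. norm (reval (p n) (cfc \<psi> a) - cfc (%t. \<phi> (\<psi> t)) a) <= 1 / real (Suc n)"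
  proof (intro always_eventually allI)
   fix n
   have "continuous_on UNIV (%t. poly (p n) (\<psi> t))" by (intro continuous_intros c)
   from norm_cfc_diff_le[OF a order_refl this cc, of "1 / real (Suc n)"]
   show "norm (reval (p n) (cfc \<psi> a) - cfc (%t. \<phi> (\<psi> t)) a) <= 1 / real (Suc n)"
    using p(2) C by (simp add: pc)
  qed
  show "(%n. 1 / real (Suc n)) ----> 0" by real_asymp
 qed
 hence "(%n. reval (p n) (cfc \<psi> a)) ----> cfc (%t. \<phi> (\<psi> t)) a" by (rule LIM_zero_cancel)
 moreover have "(%n. reval (p n) (cfc \<psi> a)) ----> cfc \<phi> (cfc \<psi> a)"
  by (rule p(1)) (simp_all add: star_cfc a c C_def)
 ultimately show ?thesis using LIMSEQ_unique by blast
qed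

subsection \<open>Positive elements\<close>

text \<open>Positivity as being the square of a self-adjoint element; that every
  \<open>star b * b\<close> of a unital algebra has this form is
  \<open>pos_star_mult\<close>.\<close>

definition pos :: "'a::cstar_algebra => bool"
 where "pos x <-> (EX y. star y = y & x = y * y)"

lemma pos_selfadj: "pos x ==> star x = x"
 by (auto simp: pos_def star_mult)

lemma pos_shift:
 fixes z :: "'a::cstar_1"
 assumes z: "star z = z" "norm z <= r" shows "pos (of_real r - z)"
proof -
 let ?f = "%t. sqrt (max (r - t) 0)"
 have c: "continuous_on UNIV ?f" by (intro continuous_intros)
 have "cfc ?f z * cfc ?f z = cfc (%t. ?f t * ?f t) z" using cfc_mult[OF z(1) c c] by simp
 also have "... = cfc (poly [:r, -1:]) z"
  by (rule cfc_cong[OF z]) (auto intro!: continuous_intros)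
 also have "... = of_real r - z" by (simp add: cfc_poly[OF z(1)])
 finally show ?thesis unfolding pos_def using star_cfc[OF z(1) c] by metis
qed

text \<open>r - y y is the polynomial r - t^2 at y, with values in [0, r]. Together with
  \<open>pos_shift\<close> this turns positivity into the inequality norm (r - x) <= r, which is
  stable under sums.\<close>

lemma pos_norm:
 fixes x :: "'a::cstar_1"
 assumes "pos x" "norm x <= r" shows "norm (of_real r - x) <= r"
proof -
 obtain y where y: "star y = y" "x = y * y" using assms(1) by (auto simp: pos_def)
 have "norm (reval [:r, 0, -1:] y) <= r"
 proof (rule reval_bound[OF y(1) order_refl])
  fix t assume t: "\<bar>t\<bar> <= norm y"
  have "(norm y)^2 <= r" using assms(2) selfadj_square_norm[OF y(1)] y(2) by simp
  moreover have "t^2 <= (norm y)^2" using t by (metis abs_le_square_iff abs_norm_cancel)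
  ultimately show "\<bar>poly [:r, 0, - 1:] t\<bar> <= r" using zero_le_power2[of t]
   by (simp add: power2_eq_square abs_le_iff)
 qed
 thus ?thesis by (simp add: y(2) algebra_simps)
qed

lemma pos_add:
 fixes x y :: "'a::cstar_1"
 assumes "pos x" "pos y" shows "pos (x + y)"
proof -
 let ?r = "norm x + norm y"
 have "norm ((of_real (norm x) - x) + (of_real (norm y) - y)) <= ?r"
  by (intro norm_triangle_mono pos_norm assms order_refl)
 hence "norm (of_real ?r - (x + y)) <= ?r" by (simp add: algebra_simps)
 moreover have "star (of_real ?r - (x + y)) = of_real ?r - (x + y)"
  using assms by (simp add: star_diff star_add star_of_real pos_selfadj)
 ultimately have "pos (of_real ?r - (of_real ?r - (x + y)))" by (intro pos_shift)
 thus ?thesis by (simp add: add.commute)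
qed

lemma pos_cfc:
 fixes a :: "'a::cstar_1"
 assumes a: "star a = a" and "continuous_on UNIV \<phi>" "!!t. 0 <= \<phi> t"
 shows "pos (cfc \<phi> a)"
proof -
 have c: "continuous_on UNIV (%t. sqrt (\<phi> t))" by (intro continuous_intros assms)
 have "cfc \<phi> a = cfc (%t. sqrt (\<phi> t)) a * cfc (%t. sqrt (\<phi> t)) a"
  using cfc_mult[OF a c c] assms(3) by simp
 thus ?thesis unfolding pos_def using star_cfc[OF a c] by blast
qed

lemma cfc_pos_part_pos:
 fixes x :: "'a::cstar_1"
 assumes "pos x" shows "cfc (%t. max t 0) x = x" "cfc (%t. max t 0) (- x) = 0"
proof -
 obtain y where y: "star y = y" "x = y * y" using assms by (auto simp: pos_def)
 have c: "continuous_on UNIV (%t::real. max t 0)" by (intro continuous_intros)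
 have x: "x = cfc (poly [:0, 0, 1:]) y" "- x = cfc (poly [:0, 0, -1:]) y"
  by (simp_all add: cfc_poly[OF y(1)] y(2))
 show "cfc (%t. max t 0) x = x"
  unfolding x(1) by (subst cfc_compose[OF y(1) c]) (auto intro!: cfc_cong[OF y(1) order_refl] continuous_intros)
 have "cfc (%t. max t 0) (- x) = cfc (%t. 0) y"
  unfolding x(2) by (subst cfc_compose[OF y(1) c]) (auto intro!: cfc_cong[OF y(1) order_refl] continuous_intros)
 thus "cfc (%t. max t 0) (- x) = 0" by (simp add: cfc_const[OF y(1)])
qed

text \<open>With \<open>d\<close> the negative part of \<open>b\<^sup>* b\<close>, the element \<open>w = b d\<close> satisfies \<open>w\<^sup>* w = - d\<^sup>3\<close>, while
 \<open>w w\<^sup>*\<close> is positive because \<open>w\<^sup>* w + w w\<^sup>*\<close> is; intertwining the positive part function forces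
 \<open>w = 0\<close>.\<close>

lemma pos_star_mult:
 fixes b :: "'a::cstar_1"
 shows "pos (star b * b)"
proof -
 define c where "c = star b * b"
 have c: "star c = c" by (simp add: c_def star_mult star_star)
 have co: "continuous_on UNIV (%t::real. max t 0)" "continuous_on UNIV (%t::real. max (-t) 0)"
  by (intro continuous_intros)+
 define d where "d = cfc (%t. max (-t) 0) c"
 have d: "star d = d" unfolding d_def by (rule star_cfc[OF c co(2)])
 have "c * d = cfc (%t. t * max (-t) 0) c"
  using cfc_mult[OF c continuous_on_id co(2)] cfc_id[OF c] by (simp add: d_def)
 also have "... = cfc (%t. -1 * (max (-t) 0 * max (-t) 0)) c"
 proof (rule cfc_cong[OF c order_refl])
  show "t * max (-t) 0 = -1 * (max (-t) 0 * max (-t) 0)" for t :: real by (simp add: max_def)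
 qed (intro continuous_intros)+
 also have "... = - (d * d)"
  by (subst cfc_cmult[OF c]) (auto intro!: continuous_intros simp: cfc_mult[OF c co(2) co(2)] d_def)
 finally have cd: "c * d = - (d * d)" .
 define w where "w = b * d"
 define e where "e = d * d * d"
 have ww: "star w * w = - e"
 proof -
  have "star w * w = d * (c * d)" by (simp add: w_def star_mult d c_def mult.assoc)
  thus ?thesis unfolding cd by (simp add: e_def mult.assoc)
 qed
 have "e = cfc (%t. max (-t) 0 * max (-t) 0 * max (-t) 0) c"
  using cfc_mult[OF c continuous_on_mult[OF co(2) co(2)] co(2)] cfc_mult[OF c co(2) co(2)]
  by (simp add: e_def d_def)
 hence e: "pos e" by (simp only:) (rule pos_cfc[OF c], auto intro!: continuous_intros)
 define h where "h = (1/2) *R (w + star w)"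
 define k' where "k' = (1/2) *R (w - star w)"
 define k where "k = \<i> *C k'"
 have h: "star h = h" by (simp add: h_def star_scaleR star_add star_star add.commute)
 have k: "star k = k" by (simp add: k_def k'_def star_scaleR star_scaleC star_diff star_star scaleC_diff_right scaleC_scaleR_commute)
 \<comment> \<open>h and k are the real part and, up to sign, the imaginary part of w. Hence w w* is
   a sum of squares plus e.\<close>
 have hk: "h * h + k * k = (1/2) *R (star w * w + w * star w)"
 proof -
  have kk: "k * k = - (k' * k')" by (simp add: k_def mult_scaleC_left mult_scaleC_right)
  have half: "(1/2) *R x = (1/4) *R x + (1/4) *R x" for x :: 'a
   by (simp flip: scaleR_add_left)
  show ?thesis unfolding kk
   by (simp add: h_def k'_def algebra_simps) (simp add: half[of "w * star w"] half[of "star w * w"])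
 qed
 have "w * star w = (h * h + k * k) + ((h * h + k * k) + e)"
  unfolding hk ww by (simp add: algebra_simps flip: scaleR_add_left)
 moreover have "pos (h * h)" "pos (k * k)" using h k by (auto simp: pos_def)
 ultimately have p: "pos (w * star w)" using e by (metis pos_add)
 \<comment> \<open>The positive part function leaves e unchanged and sends the negative element - w
   w* to 0, so w e = 0.\<close>
 have "w * e = (- (w * star w)) * w" by (simp add: mult.assoc ww)
 from cfc_intertwine[OF pos_selfadj[OF e] _ co(1) this] pos_selfadj[OF p]
 have "w * e = 0" by (simp add: star_minus cfc_pos_part_pos[OF e] cfc_pos_part_pos[OF p])
 hence "star w * (w * e) = 0" by simp
 hence "e * e = 0" by (simp add: ww flip: mult.assoc)
 hence "e = 0" using pos_selfadj[OF e] star_mult_eq_0_iff by metis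
 hence "d * (d * d) = 0" by (simp add: e_def mult.assoc)
 hence "star (d * d) * (d * d) = 0" by (simp add: star_mult d mult.assoc)
 hence "d * d = 0" by (simp only: star_mult_eq_0_iff)
 hence d0: "d = 0" using star_mult_eq_0_iff d by metis
 have "c + d = cfc (%t. max t 0) c"
 proof -
  have "c + d = cfc (%t. t + max (-t) 0) c"
   using cfc_add[OF c continuous_on_id co(2)] cfc_id[OF c] by (simp add: d_def)
  also have "... = cfc (%t. max t 0) c"
   by (rule cfc_cong[OF c order_refl]) (auto intro!: continuous_intros)
  finally show ?thesis .
 qed
 moreover have "pos (cfc (%t. max t 0) c)" by (rule pos_cfc[OF c co(1)]) simp
 ultimately show ?thesis using d0 by (simp add: c_def)
qed

subsection \<open>The unitization\<close>

datatype 'a unitz = Unitz (el: 'a) (sc: complex)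

lemma unitz_eq_iff: "u = v <-> el u = el v & sc u = sc v"
 by (auto intro: unitz.expand)

definition uact :: "'a::cstar_algebra unitz => 'a => 'a"
 where "uact u x = el u * x + sc u *C x"

lemma lin_uact: "bounded_linear (uact u)"
 unfolding uact_def
 by (intro bounded_linear_add bounded_linear_mult_right bounded_linear_scaleC)

text \<open>If the algebra has a unit e, the operator norm alone vanishes at
  \<open>Unitz (- e) 1\<close>. The character \<open>sc\<close> supplies the missing part, and a
  maximum of two C*-seminorms again satisfies the C*-identity.\<close>

definition unorm :: "'a::cstar_algebra unitz => real"
 where "unorm u = max (cmod (sc u)) (onorm (uact u))"

instantiation unitz :: (cstar_algebra) "{zero, one, plus, minus, uminus, times, scaleC, scaleR}"
begin

definition "0 = Unitz 0 0"
definition "1 = Unitz 0 1"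
definition "u + v = Unitz (el u + el v) (sc u + sc v)"
definition "u - v = Unitz (el u - el v) (sc u - sc v)"
definition "- u = Unitz (- el u) (- sc u)"
definition "u * v = Unitz (el u * el v + sc u *C el v + sc v *C el u) (sc u * sc v)"
definition "c *C u = Unitz (c *C el u) (c * sc u)"
definition "r *R u = Unitz (r *R el u) (r *R sc u)"
instance ..

end

definition ustar :: "'a::cstar_algebra unitz => 'a unitz"
 where "ustar u = Unitz (star (el u)) (cnj (sc u))"

lemma unitz_sel [simp]:
 "el 0 = 0" "sc 0 = 0" "el 1 = 0" "sc 1 = 1"
 "el (u + v) = el u + el v" "sc (u + v) = sc u + sc v"
 "el (u - v) = el u - el v" "sc (u - v) = sc u - sc v"
 "el (- u) = - el u" "sc (- u) = - sc u"
 "el (u * v) = el u * el v + sc u *C el v + sc v *C el u" "sc (u * v) = sc u * sc v"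
 "el (c *C u) = c *C el u" "sc (c *C u) = c * sc u"
 "el (r *R u) = r *R el u" "sc (r *R u) = r *R sc u"
 "el (ustar u) = star (el u)" "sc (ustar u) = cnj (sc u)"
 for u v :: "'a::cstar_algebra unitz"
 by (simp_all add: zero_unitz_def one_unitz_def plus_unitz_def minus_unitz_def uminus_unitz_def
   times_unitz_def scaleC_unitz_def scaleR_unitz_def ustar_def)

lemma scaleR_scaleC_assoc: "(r *R c) *C x = r *R (c *C (x::'a::cstar_algebra))"
 by (simp add: scaleR_conv_scaleC scaleR_conv_of_real)

lemma uact_simps:
 "uact (u + v) x = uact u x + uact v x" "uact (u * v) x = uact u (uact v x)" "uact 1 x = x"
 "uact (c *C u) x = c *C uact u x" "uact (r *R u) x = r *R uact u x" "uact 0 x = 0"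
 by (simp_all add: uact_def algebra_simps mult_scaleC_left mult_scaleC_right scaleC_add_right scaleC_add_left
   scaleR_scaleC_assoc)

lemma uact_star: "star (uact u x) * y = star x * uact (ustar u) y"
 by (simp add: uact_def star_add star_mult star_scaleC algebra_simps mult_scaleC_left mult_scaleC_right mult.assoc)

text \<open>The C*-identity of the algebra, applied to u x, gives norm (u x)^2 = norm (x* ((u* u)
  x)) for every x.\<close>

lemma onorm_uact_star_le: "(onorm (uact u))^2 <= onorm (uact (ustar u * u))"
proof -
 define M where "M = onorm (uact (ustar u * u))"
 have M0: "0 <= M" unfolding M_def by (rule onorm_pos_le[OF lin_uact])
 have "norm (uact u x) <= sqrt M * norm x" for x
 proof -
  have "(norm (uact u x))^2 = norm (star x * uact (ustar u * u) x)"
   unfolding cstar_identity[symmetric] uact_star uact_simps ..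
  also have "... <= norm (star x) * norm (uact (ustar u * u) x)" by (rule norm_mult_ineq)
  also have "... <= norm x * (M * norm x)"
   unfolding norm_star M_def by (intro mult_left_mono onorm lin_uact norm_ge_zero)
  also have "... = (sqrt M * norm x)^2" using M0 by (simp add: power_mult_distrib power2_eq_square)
  finally have "(norm (uact u x))^2 <= (sqrt M * norm x)^2" .
  thus ?thesis by (rule power2_le_imp_le) (use M0 in simp)
 qed
 hence "onorm (uact u) <= sqrt M" using M0 by (intro onorm_bound) simp_all
 hence "(onorm (uact u))^2 <= (sqrt M)^2"
  by (intro power_mono onorm_pos_le lin_uact)
 thus ?thesis using M0 by (simp add: M_def)
qed

lemma onorm_uact_mult: "onorm (uact (u * v)) <= onorm (uact u) * onorm (uact v)"
proof -
 have "uact (u * v) = uact u \<circ> uact v" by (simp add: fun_eq_iff uact_simps)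
 thus ?thesis by (simp add: onorm_compose lin_uact)
qed

lemma onorm_uact_star: "onorm (uact (ustar u)) = onorm (uact u)"
proof -
 have le: "onorm (uact u) <= onorm (uact (ustar u))" for u :: "'a unitz"
 proof (cases "onorm (uact u) = 0")
  case True
  thus ?thesis by (simp add: onorm_pos_le[OF lin_uact])
 next
  case False
  hence "0 < onorm (uact u)" using onorm_pos_le[OF lin_uact, of u] by simp
  moreover have "onorm (uact u) * onorm (uact u) <= onorm (uact (ustar u)) * onorm (uact u)"
   using onorm_uact_star_le[of u] onorm_uact_mult[of "ustar u" u] by (simp add: power2_eq_square)
  ultimately show ?thesis by simp
 qed
 have "ustar (ustar u) = u" by (simp add: unitz_eq_iff star_star)
 thus ?thesis using le[of u] le[of "ustar u"] by simp
qed

lemma onorm_uact_scaleC: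
 fixes u :: "'a::cstar_algebra unitz"
 shows "onorm (uact (c *C u)) = cmod c * onorm (uact u)"
proof -
 have le: "onorm (uact (c *C u)) <= cmod c * onorm (uact u)" for c and u :: "'a unitz"
 proof (rule onorm_bound)
  show "0 <= cmod c * onorm (uact u)" by (simp add: onorm_pos_le[OF lin_uact])
  show "norm (uact (c *C u) x) <= cmod c * onorm (uact u) * norm x" for x
   unfolding uact_simps norm_scaleC mult.assoc
   by (intro mult_left_mono onorm lin_uact norm_ge_zero)
 qed
 show ?thesis
 proof (cases "c = 0")
  case True
  thus ?thesis using le[of c u] onorm_pos_le[OF lin_uact, of "c *C u"] by auto
 next
  case False
  have "inverse c *C (c *C u) = u" using False by (simp add: unitz_eq_iff)
  hence "onorm (uact u) <= inverse (cmod c) * onorm (uact (c *C u))"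
   using le[of "inverse c" "c *C u"] by (simp add: norm_inverse)
  hence "cmod c * onorm (uact u) <= cmod c * (inverse (cmod c) * onorm (uact (c *C u)))"
   by (rule mult_left_mono) simp
  moreover have "cmod c * (inverse (cmod c) * y) = y" for y using False by simp
  ultimately have "cmod c * onorm (uact u) <= onorm (uact (c *C u))" by (simp only:)
  thus ?thesis using le[of c u] by simp
 qed
qed

lemma onorm_uact_triangle: "onorm (uact (u + v)) <= onorm (uact u) + onorm (uact v)"
 using onorm_triangle[OF lin_uact lin_uact, of u v]
 by (simp add: uact_simps[abs_def])

lemma onorm_uact_el: "onorm (uact (Unitz a 0)) = norm a"
proof (rule antisym)
 show "onorm (uact (Unitz a 0)) <= norm a"
  by (intro onorm_bound) (simp_all add: uact_def norm_mult_ineq)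
 have "norm (a * star a) <= onorm (uact (Unitz a 0)) * norm (star a)"
  using onorm[OF lin_uact, of "Unitz a 0" "star a"] by (simp add: uact_def)
 hence "norm a * norm a <= onorm (uact (Unitz a 0)) * norm a"
  by (simp add: cstar_identity' power2_eq_square)
 thus "norm a <= onorm (uact (Unitz a 0))"
  using onorm_pos_le[OF lin_uact, of "Unitz a 0"] by (cases "a = 0") auto
qed

lemma unitz_norm_triangle: "unorm (u + v) <= unorm u + unorm (v::'a::cstar_algebra unitz)"
 using onorm_uact_triangle[of u v] norm_triangle_ineq[of "sc u" "sc v"] by (auto simp: unorm_def)

lemma unitz_norm_scaleC: "unorm (c *C u) = cmod c * unorm (u::'a::cstar_algebra unitz)"
 by (auto simp: unorm_def onorm_uact_scaleC norm_mult max_mult_distrib_left)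

lemma unitz_scaleR: "r *R u = cor r *C (u::'a::cstar_algebra unitz)"
 by (simp add: unitz_eq_iff scaleR_conv_scaleC scaleR_conv_of_real)

text \<open>The norm is equivalent to the sum of the norms of both components; completeness and
  continuity of \<open>el\<close> and \<open>sc\<close> follow.\<close>

lemma unitz_norm_bounds:
 fixes u :: "'a::cstar_algebra unitz"
 shows "cmod (sc u) <= unorm u" "norm (el u) <= 2 * unorm u" "unorm u <= norm (el u) + cmod (sc u)"
proof -
 have e: "Unitz (el u) 0 = u + (- sc u) *C 1" "u = Unitz (el u) 0 + sc u *C 1"
  by (simp_all add: unitz_eq_iff)
 have one: "unorm (1::'a unitz) <= 1"
 proof -
  have "onorm (uact (1::'a unitz)) <= 1" by (intro onorm_bound) (simp_all add: uact_simps)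
  thus ?thesis by (simp add: unorm_def)
 qed
 hence s: "unorm (c *C (1::'a unitz)) <= cmod c" for c
  by (simp add: unitz_norm_scaleC mult_left_le)
 have n: "unorm (Unitz (el u) 0) = norm (el u)" by (simp add: unorm_def onorm_uact_el)
 show sc: "cmod (sc u) <= unorm u" by (simp add: unorm_def)
 have "norm (el u) <= unorm u + unorm ((- sc u) *C (1::'a unitz))"
  using unitz_norm_triangle[of u "(- sc u) *C 1"] unfolding e(1)[symmetric] n .
 thus "norm (el u) <= 2 * unorm u" using s[of "- sc u"] sc by simp
 show "unorm u <= norm (el u) + cmod (sc u)"
  using unitz_norm_triangle[of "Unitz (el u) 0" "sc u *C 1"] s[of "sc u"] unfolding e(2)[symmetric] n by linarith
qed

instantiation unitz :: (cstar_algebra) real_normed_algebra_1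
begin

definition "norm = (unorm :: 'a unitz => real)"
definition "dist u v = norm (u - v :: 'a unitz)"
definition "sgn u = inverse (norm u) *R (u :: 'a unitz)"
definition [code del]: "(uniformity :: ('a unitz \<times> 'a unitz) filter) = (INF e\<in>{0 <..}. principal {(x, y). dist x y < e})"
definition [code del]: "open (S :: 'a unitz set) <-> (ALL x:S. eventually (%(x', y). x' = x --> y : S) uniformity)"

instance
proof
 fix u v w :: "'a unitz" and a b :: real
 show "u + v + w = u + (v + w)" "u + v = v + u" "0 + u = u" "- u + u = 0" "u - v = u + - v"
  "u * v * w = u * (v * w)" "(u + v) * w = u * w + v * w" "u * (v + w) = u * v + u * w"
  "1 * u = u" "u * 1 = u" "(0::'a unitz) ~= 1"
  "a *R (u + v) = a *R u + a *R v" "(a + b) *R u = a *R u + b *R u" "a *R b *R u = (a * b) *R u" "1 *R u = u"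
  "a *R u * v = a *R (u * v)" "u * a *R v = a *R (u * v)"
  by (simp_all add: unitz_eq_iff algebra_simps scaleC_add_right scaleC_add_left mult_scaleC_left mult_scaleC_right
    scaleC_scaleR_commute scaleR_scaleC_assoc)
 show "dist u v = norm (u - v)" "sgn u = u /\<^sub>R norm u"
  "(uniformity :: ('a unitz \<times> 'a unitz) filter) = (INF e\<in>{0 <..}. principal {(x, y). dist x y < e})"
  by (fact dist_unitz_def sgn_unitz_def uniformity_unitz_def)+
 show "open S <-> (ALL x:S. eventually (%(x', y). x' = x --> y : S) uniformity)" for S :: "'a unitz set"
  by (fact open_unitz_def)
 show "norm u = 0 <-> u = 0"
  unfolding norm_unitz_def using unitz_norm_bounds[of u] by (auto simp: unitz_eq_iff)
 show "norm (u + v) <= norm u + norm v" unfolding norm_unitz_def by (rule unitz_norm_triangle)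
 show "norm (a *R u) = \<bar>a\<bar> * norm u" by (simp add: norm_unitz_def unitz_scaleR unitz_norm_scaleC)
 show "norm (u * v) <= norm u * norm v"
 proof -
  have "onorm (uact (u * v)) <= onorm (uact u) * onorm (uact v)" by (rule onorm_uact_mult)
  also have "... <= norm u * norm v" unfolding norm_unitz_def unorm_def
   by (intro mult_mono) (simp_all add: onorm_pos_le[OF lin_uact] le_max_iff_disj)
  finally have "onorm (uact (u * v)) <= norm u * norm v" .
  moreover have "cmod (sc (u * v)) <= norm u * norm v"
   by (simp add: norm_mult mult_mono norm_unitz_def unorm_def le_max_iff_disj)
  ultimately show ?thesis unfolding norm_unitz_def unorm_def[of "u * v"] by simp
 qed
 have "onorm (uact (1::'a unitz)) <= 1" by (intro onorm_bound) (simp_all add: uact_simps)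
 thus "norm (1::'a unitz) = 1" by (simp add: norm_unitz_def unorm_def)
qed

end

instance unitz :: (cstar_algebra) complete_space
proof
 fix X :: "nat => 'a unitz"
 assume C: "Cauchy X"
 have d: "dist (u::'a unitz) v = unorm (u - v)" for u v by (simp add: dist_unitz_def norm_unitz_def)
 have "Cauchy (%n. sc (X n))"
 proof (rule metric_CauchyI)
  fix e :: real assume "0 < e"
  then obtain M where M: "!!m n. m >= M ==> n >= M ==> unorm (X m - X n) < e"
   using C unfolding Cauchy_def d by meson
  have "dist (sc (X m)) (sc (X n)) < e" if "m >= M" "n >= M" for m n
   using M[OF that] unitz_norm_bounds(1)[of "X m - X n"] by (simp add: dist_norm)
  thus "EX M. ALL m>=M. ALL n>=M. dist (sc (X m)) (sc (X n)) < e" by blast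
 qed
 moreover have "Cauchy (%n. el (X n))"
 proof (rule metric_CauchyI)
  fix e :: real assume "0 < e"
  then obtain M where M: "!!m n. m >= M ==> n >= M ==> unorm (X m - X n) < e / 2"
   using C half_gt_zero unfolding Cauchy_def d by meson
  have "dist (el (X m)) (el (X n)) < e" if "m >= M" "n >= M" for m n
   using M[OF that] unitz_norm_bounds(2)[of "X m - X n"] by (simp add: dist_norm)
  thus "EX M. ALL m>=M. ALL n>=M. dist (el (X m)) (el (X n)) < e" by blast
 qed
 ultimately obtain l a where l: "(%n. sc (X n)) ----> l" "(%n. el (X n)) ----> a"
  using Cauchy_convergent convergent_def by metis
 have "X ----> Unitz a l"
 proof (rule metric_LIMSEQ_I)
  fix e :: real assume "0 < e"
  hence e2: "0 < e / 2" by simp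
  obtain N1 where N1: "!!n. n >= N1 ==> dist (sc (X n)) l < e/2"
   using metric_LIMSEQ_D[OF l(1) e2] by blast
  obtain N2 where N2: "!!n. n >= N2 ==> dist (el (X n)) a < e/2"
   using metric_LIMSEQ_D[OF l(2) e2] by blast
  define N where "N = max N1 N2"
  have N: "!!n. n >= N ==> dist (sc (X n)) l < e/2" "!!n. n >= N ==> dist (el (X n)) a < e/2"
   using N1 N2 by (auto simp: N_def)
  have "dist (X n) (Unitz a l) < e" if "n >= N" for n
   using N(1)[OF that] N(2)[OF that] unitz_norm_bounds(3)[of "X n - Unitz a l"] by (simp add: d dist_norm)
  thus "EX N. ALL n>=N. dist (X n) (Unitz a l) < e" by blast
 qed
 thus "convergent X" by (auto simp: convergent_def)
qed

instantiation unitz :: (cstar_algebra) cstar_1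
begin

definition "star = (ustar :: 'a unitz => 'a unitz)"

instance
proof
 fix u v :: "'a unitz" and a :: real and c d :: complex
 show "c *C (u + v) = c *C u + c *C v" "(c + d) *C u = c *C u + d *C u" "c *C d *C u = (c * d) *C u" "1 *C u = u"
  "c *C u * v = c *C (u * v)" "u * c *C v = c *C (u * v)"
  by (simp_all add: unitz_eq_iff algebra_simps scaleC_add_right scaleC_add_left mult_scaleC_left mult_scaleC_right)
 show "cor a *C u = a *R u" by (simp add: unitz_scaleR)
 show "norm (c *C u) = cmod c * norm u" unfolding norm_unitz_def by (rule unitz_norm_scaleC)
 show "star (u + v) = star u + star v" "star (c *C u) = cnj c *C star u" "star (u * v) = star v * star u" "star (star u) = u"
  by (simp_all add: unitz_eq_iff star_unitz_def star_add star_scaleC star_mult star_star add_ac)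
 show "norm (star u * u) = (norm u)^2"
 proof -
  have "onorm (uact (ustar u * u)) = (onorm (uact u))^2"
   using onorm_uact_star_le[of u] onorm_uact_mult[of "ustar u" u] by (simp add: onorm_uact_star power2_eq_square)
  moreover have "max (x^2) (y^2) = (max x y)^2" if "0 <= x" "0 <= y" for x y :: real
   using that by (auto simp: max_def power2_le_iff_abs_le abs_le_square_iff[symmetric])
  ultimately show ?thesis
   by (simp add: star_unitz_def norm_unitz_def unorm_def norm_mult power2_eq_square onorm_pos_le[OF lin_uact])
 qed
qed

end

abbreviation emb :: "'a => 'a unitz" where "emb a \<equiv> Unitz a 0"

lemma unitz_norm_le:
 fixes u :: "'a::cstar_algebra unitz"
 shows "cmod (sc u) <= norm u" "norm (el u) <= 2 * norm u"
 using unitz_norm_bounds[of u] by (simp_all add: norm_unitz_def)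

lemma unitz_star_sel [simp]: "el (star u) = star (el u)" "sc (star u) = cnj (sc u)"
 by (simp_all add: star_unitz_def)

lemma norm_emb [simp]: "norm (emb a) = norm (a::'a::cstar_algebra)"
 by (simp add: norm_unitz_def unorm_def onorm_uact_el)

lemma star_emb: "star (emb a) = emb (star a)" by (simp add: unitz_eq_iff)
lemma emb_mult: "emb (a * b) = emb a * emb (b::'a::cstar_algebra)" by (simp add: unitz_eq_iff)
lemma emb_add: "emb (a + b) = emb a + emb (b::'a::cstar_algebra)" by (simp add: unitz_eq_iff)
lemma emb_scaleC: "emb (c *C a) = c *C emb (a::'a::cstar_algebra)" by (simp add: unitz_eq_iff)
lemma emb_scaleR: "emb (c *R a) = c *R emb (a::'a::cstar_algebra)" by (simp add: unitz_eq_iff)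
lemma emb_0: "emb 0 = (0::'a::cstar_algebra unitz)" by (simp add: unitz_eq_iff)

lemma unitz_decomp: "u = emb (el u) + sc u *C (1::'a::cstar_algebra unitz)"
 by (simp add: unitz_eq_iff)

lemma bounded_linear_el: "bounded_linear (el :: 'a::cstar_algebra unitz => 'a)"
 by (rule bounded_linear_intro[where K = 2]) (simp_all add: unitz_norm_le(2) mult.commute[of _ 2])

lemma bounded_linear_sc: "bounded_linear (sc :: 'a::cstar_algebra unitz => complex)"
 by (rule bounded_linear_intro[where K = 1]) (simp_all add: unitz_norm_le(1))

subsection \<open>Ideals and functional calculus\<close>

lemma csub:
 assumes "csubspace V"
 shows "0 : V" "x : V ==> y : V ==> x + y : V" "x : V ==> y : V ==> x - y : V" "x : V ==> c *C x : V" "x : V ==> - x : V"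
 using complex_vector.subspace_0[OF assms] complex_vector.subspace_add[OF assms] complex_vector.subspace_diff[OF assms]
  complex_vector.subspace_scale[OF assms] complex_vector.subspace_neg[OF assms] by blast+

lemma csubspaceI:
 "0 : V ==> (!!x y. x : V ==> y : V ==> x + y : V) ==> (!!c x. x : V ==> c *C x : V) ==> csubspace V"
 by (simp add: complex_vector.subspace_def)

lemma cidealD:
 assumes "cstar_ideal J"
 shows "csubspace J" "closed J" "j : J ==> a * j : J" "j : J ==> j * a : J"
 using assms by (auto simp: cstar_ideal_def)

text \<open>The unitization adds only scalars, so an ideal remains one there. This brings functional
  calculus to ideals of nonunital algebras.\<close>

lemma cstar_ideal_emb:
 assumes J: "cstar_ideal (J :: 'a::cstar_algebra set)"
 shows "cstar_ideal (emb ` J)"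
 unfolding cstar_ideal_def
proof (intro conjI allI ballI)
 note s = csub[OF cidealD(1)[OF J]]
 show "csubspace (emb ` J)"
  by (rule csubspaceI) (use s in "auto simp: emb_0[symmetric] emb_add[symmetric] emb_scaleC[symmetric]")
 have "emb ` J = sc -` {0} \<inter> el -` J"
  by (auto simp: image_iff unitz_eq_iff)
 thus "closed (emb ` J)"
  using continuous_closed_vimage[OF closed_singleton[of 0] linear_continuous_at[OF bounded_linear_sc]]
   continuous_closed_vimage[OF cidealD(2)[OF J] linear_continuous_at[OF bounded_linear_el]]
  by (auto intro!: closed_Int)
 fix u j assume "j : emb ` J"
 then obtain i where i: "i : J" "j = emb i" by blast
 have "u * j = emb (el u * i + sc u *C i)" "j * u = emb (i * el u + sc u *C i)"
  by (simp_all add: unitz_eq_iff i)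
 thus "u * j : emb ` J" "j * u : emb ` J"
  using i cidealD[OF J] s by auto
qed

lemma cstar_ideal_UNIV: "cstar_ideal UNIV"
 by (simp add: cstar_ideal_def complex_vector.subspace_UNIV)

lemma cstar_ideal_zero: "cstar_ideal {0}"
 by (simp add: cstar_ideal_def complex_vector.subspace_single_0)

text \<open>Telescoping settles polynomials, closedness of J the limit. Congruence modulo J takes
  the part of functional calculus in the quotient.\<close>

lemma cfc_diff_in_ideal:
 fixes a b :: "'a::cstar_1"
 assumes J: "cstar_ideal J" and a: "star a = a" "star b = b" "a - b : J" and c: "continuous_on UNIV \<phi>"
 shows "cfc \<phi> a - cfc \<phi> b : J"
proof -
 note s = csub[OF cidealD(1)[OF J]]
 have r: "reval p a - reval p b : J" for p
 proof (induction p)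
  case (pCons c p)
  have "reval (pCons c p) a - reval (pCons c p) b = a * (reval p a - reval p b) + (a - b) * reval p b"
   by (simp add: algebra_simps)
  thus ?case using pCons.IH a(3) s cidealD[OF J] by simp
 qed (simp add: s)
 obtain p where p: "!!c::'a. star c = c ==> norm c <= max (norm a) (norm b) ==> (%n. reval (p n) c) ----> cfc \<phi> c"
  using uniform_poly_approx[OF c, of "max (norm a) (norm b)"] by metis
 have "(%n. reval (p n) a - reval (p n) b) ----> cfc \<phi> a - cfc \<phi> b"
  by (intro tendsto_diff p a) auto
 thus ?thesis by (rule closed_sequentially[OF cidealD(2)[OF J], rotated]) (rule r)
qed

lemma cfc_zero: "cfc \<phi> (0::'a::cstar_1) = of_real (\<phi> 0)" if "continuous_on UNIV \<phi>"
proof -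
 have "cfc \<phi> (0::'a) = cfc (%t. \<phi> 0) 0"
  by (rule cfc_cong[of _ 0]) (auto intro: that)
 thus ?thesis by (simp add: cfc_const)
qed

lemma cfc_in_ideal:
 fixes a :: "'a::cstar_1"
 assumes J: "cstar_ideal J" and a: "star a = a" "a : J" and c: "continuous_on UNIV \<phi>" "\<phi> 0 = 0"
 shows "cfc \<phi> a : J"
 using cfc_diff_in_ideal[OF J a(1) _ _ c(1), of 0] a c by (simp add: cfc_zero)

lemma cfc_hom:
 fixes F :: "'a::cstar_1 => 'b::cstar_1"
 assumes F: "bounded_linear F" "!!x y. F (x * y) = F x * F y" "F 1 = 1"
  and a: "star a = a" "star (F a) = F a" and c: "continuous_on UNIV \<phi>"
 shows "F (cfc \<phi> a) = cfc \<phi> (F a)"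
proof -
 interpret F: bounded_linear F by fact
 have r: "F (reval p a) = reval p (F a)" for p
  by (induction p) (auto simp: F.add F.zero F(2,3) of_real_def F.scaleR)
 obtain p where p: "!!x::'a. star x = x ==> norm x <= max (norm a) (norm (F a)) ==> (%n. reval (p n) x) ----> cfc \<phi> x"
   "!!x::'b. star x = x ==> norm x <= max (norm a) (norm (F a)) ==> (%n. reval (p n) x) ----> cfc \<phi> x"
 proof (rule uniform_poly_approx[where 'a = 'a and 'b = 'b, OF c, of "max (norm a) (norm (F a))"])
  fix p
  assume 1: "!!x::'a. star x = x ==> norm x <= max (norm a) (norm (F a)) ==> (%n. reval (p n) x) ----> cfc \<phi> x"
   and 2: "!!x::'b. star x = x ==> norm x <= max (norm a) (norm (F a)) ==> (%n. reval (p n) x) ----> cfc \<phi> x"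
  show thesis by (rule that[of p]) (fact 1, fact 2)
 qed
 have "(%n. F (reval (p n) a)) ----> F (cfc \<phi> a)" by (intro F.tendsto p a) auto
 moreover have "(%n. reval (p n) (F a)) ----> cfc \<phi> (F a)" by (intro p a) auto
 ultimately show ?thesis by (simp add: r LIMSEQ_unique)
qed

text \<open>\<open>1 - s\<close> is the square root of \<open>1 - b\<close>.\<close>

lemma sqrt_complement:
 fixes b :: "'a::cstar_algebra"
 assumes "star b = b" "norm b <= 1"
 obtains s where "star s = s" "s + s - s * s = b"
proof -
 define f :: "real => real" where "f = (%t. 1 - sqrt (max (1 - t) 0))"
 have c: "continuous_on UNIV f" unfolding f_def by (intro continuous_intros)
 have c': "continuous_on UNIV (%t. f t + f t)" "continuous_on UNIV (%t. f t * f t)"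
  "continuous_on UNIV (%t. (-1) * (f t * f t))" by (intro continuous_intros c)+
 have b: "star (emb b) = emb b" by (simp add: star_emb assms)
 have "cfc f (emb b) : range emb"
  by (rule cfc_in_ideal[OF cstar_ideal_emb[OF cstar_ideal_UNIV] b _ c]) (auto simp: f_def)
 then obtain s where s: "cfc f (emb b) = emb s" by blast
 have "star (emb s) = emb s" using star_cfc[OF b c] s by simp
 hence "star s = s" by (simp add: unitz_eq_iff)
 have "cfc (%t. t) (emb b) = cfc (%t. (f t + f t) + (-1) * (f t * f t)) (emb b)"
 proof (rule cfc_cong[OF b])
  show "norm (emb b) <= 1" by (simp add: assms)
  fix t :: real assume "\<bar>t\<bar> <= 1"
  hence "sqrt (max (1 - t) 0) * sqrt (max (1 - t) 0) = 1 - t" by simp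
  thus "t = (f t + f t) + (-1) * (f t * f t)" unfolding f_def by (simp only: algebra_simps)
 qed (intro continuous_intros c)+
 also have "... = emb s + emb s - emb s * emb s"
  by (simp only: cfc_add[OF b c'(1,3)] cfc_add[OF b c c] cfc_cmult[OF b c'(2)] cfc_mult[OF b c c] s) simp
 finally have "emb b = emb s + emb s - emb s * emb s" unfolding cfc_id[OF b] .
 hence "el (emb b) = el (emb s + emb s - emb s * emb s)" by (rule arg_cong)
 hence "s + s - s * s = b" by simp
 with `star s = s` show thesis by (rule that)
qed

text \<open>With x = c* c and f_n(t) = min 1 (n |t|), the elements c f_n(x) lie in J and approximate
  c: the square of norm (c (1 - f_n(x))) is the norm of t (1 - f_n(t))^2 at x, at most 1/n. Closure
  of ideals under \<open>star\<close>, which \<open>cstar_ideal\<close> does not include,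
  follows.\<close>

lemma ideal_square:
 fixes c :: "'a::cstar_algebra"
 assumes J: "cstar_ideal J" and "star c * c : J"
 shows "c : J"
proof -
 define x where "x = emb (star c * c)"
 have x: "star x = x" by (simp add: x_def star_emb star_mult star_star)
 have xJ: "x : emb ` J" using assms by (simp add: x_def)
 define f where "f n t = min 1 (real n * \<bar>t\<bar>)" for n t
 have f: "continuous_on UNIV (f n)" "f n 0 = 0" for n
  unfolding f_def by (intro continuous_intros) simp
 define g where "g n t = 1 + (-1) * f n t" for n t
 have g: "continuous_on UNIV (g n)" for n
  unfolding g_def by (intro continuous_intros f)
 define y where "y n = cfc (g n) x" for n
 have y: "star (y n) = y n" for n unfolding y_def by (rule star_cfc[OF x g])
 have yf: "y n = 1 - cfc (f n) x" for n
  unfolding y_def g_def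
  using cfc_add[OF x continuous_on_const[of UNIV 1] continuous_on_mult[OF continuous_on_const f(1)], of "-1" n]
  by (simp only: cfc_const[OF x] cfc_cmult[OF x f(1)]) simp
 have J': "cstar_ideal (emb ` J)" by (rule cstar_ideal_emb[OF J])
 have in_J: "emb c * cfc (f n) x : emb ` J" for n
  by (intro cidealD(3)[OF J'] cfc_in_ideal[OF J' x xJ] f)
 have "(norm (emb c * y n))^2 <= 1 / real n" if "n > 0" for n
 proof -
  have "(norm (emb c * y n))^2 = norm (y n * x * y n)"
   unfolding cstar_identity[symmetric]
   by (simp add: star_mult y x_def emb_mult star_emb mult.assoc)
  also have "y n * x * y n = cfc (%t. g n t * t * g n t) x"
   unfolding y_def using cfc_mult[OF x g continuous_on_id, of n] cfc_mult[OF x continuous_on_mult[OF g continuous_on_id] g, of n n]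
   by (simp add: cfc_id[OF x])
  also have "norm ... <= 1 / real n"
  proof (rule norm_cfc_le[OF x order_refl])
   show "continuous_on UNIV (%t. g n t * t * g n t)" by (intro continuous_intros g)
   fix t :: real
   have g1: "0 <= g n t" "g n t <= 1" by (auto simp: g_def f_def)
   show "\<bar>g n t * t * g n t\<bar> <= 1 / real n"
   proof (cases "real n * \<bar>t\<bar> <= 1")
    case True
    have "g n t * \<bar>t\<bar> * g n t <= 1 * \<bar>t\<bar> * 1"
     using g1 by (intro mult_mono) auto
    also have "... <= 1 / real n" using True that by (simp add: field_simps)
    finally show ?thesis using g1 by (simp add: abs_mult)
   next
    case False
    hence "g n t = 0" by (simp add: g_def f_def)
    thus ?thesis by simp
   qed
  qed
  finally show ?thesis .
 qed
 hence bound: "norm (emb c * y n) <= sqrt (1 / real n)" if "n > 0" for n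
  using that by (simp add: real_le_rsqrt)
 have "(%n. emb c * y n) ----> 0"
 proof (rule Lim_null_comparison)
  show "\<forall>\<^sub>F n in sequentially. norm (emb c * y n) <= sqrt (1 / real n)"
   using eventually_gt_at_top[of 0] by eventually_elim (rule bound)
  show "(%n. sqrt (1 / real n)) ----> 0" by real_asymp
 qed
 from tendsto_diff[OF tendsto_const[of "emb c"] this]
 have "(%n. emb c - emb c * y n) ----> emb c" by simp
 moreover have "emb c - emb c * y n = emb c * cfc (f n) x" for n
  unfolding yf by (simp only: right_diff_distrib mult_1_right diff_diff_eq2 add_diff_cancel_left')
 ultimately have "(%n. emb c * cfc (f n) x) ----> emb c" by (simp only:)
 hence "emb c : emb ` J"
  by (rule closed_sequentially[OF cidealD(2)[OF J'], rotated]) (rule in_J)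
 thus ?thesis by auto
qed

lemma ideal_star:
 assumes "cstar_ideal J" "j : J" shows "star j : J"
proof (rule ideal_square[OF assms(1)])
 show "star (star j) * star j : J" unfolding star_star by (rule cidealD(4)[OF assms])
qed

text \<open>The elements \<open>g = (x - d)\<^sub>+\<close>, \<open>k = g\<^sup>1\<^sup>/\<^sup>2\<close> and \<open>m = d\<^sup>1\<^sup>/\<^sup>2 - (d - x)\<^sub>+\<^sup>1\<^sup>/\<^sup>2\<close> for
 \<open>d = e\<^sup>2\<close>; the last one certifies \<open>x - g \<le> d\<close>.\<close>

lemma threshold_elements:
 fixes x :: "'a::cstar_algebra"
 assumes x: "star x = x" and e: "0 < e"
 obtains g k m where "star g = g" "star k = k" "star m = m" "k * k = g"
  "x * g = (e^2) *R g + g * g" "x = g + (2 * e) *R m - m * m"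
proof -
 let ?x = "emb x"
 have sx: "star ?x = ?x" by (simp add: star_emb x)
 define G K M :: "real => real"
  where "G = (%t. max (t - e^2) 0)" and "K = (%t. sqrt (max (t - e^2) 0))"
   and "M = (%t. e - sqrt (max (e^2 - t) 0))"
 have c: "continuous_on UNIV G" "continuous_on UNIV K" "continuous_on UNIV M"
  unfolding G_def K_def M_def by (intro continuous_intros)+
 have c': "continuous_on UNIV (%t. e^2 * G t)" "continuous_on UNIV (%t. G t * G t)"
  "continuous_on UNIV (%t. (2 * e) * M t)" "continuous_on UNIV (%t. G t + (2 * e) * M t)"
  "continuous_on UNIV (%t. M t * M t)" "continuous_on UNIV (%t. (-1) * (M t * M t))"
  by (intro continuous_intros c)+
 have z: "G 0 = 0" "K 0 = 0" "M 0 = 0" using e by (simp_all add: G_def K_def M_def)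
 note ci = cfc_in_ideal[OF cstar_ideal_emb[OF cstar_ideal_UNIV] sx rangeI]
 have "cfc G ?x : range emb" "cfc K ?x : range emb" "cfc M ?x : range emb"
  by (rule ci[OF c(1) z(1)], rule ci[OF c(2) z(2)], rule ci[OF c(3) z(3)])
 then obtain g k m where d: "cfc G ?x = emb g" "cfc K ?x = emb k" "cfc M ?x = emb m" by blast
 have "emb k * emb k = cfc (%t. K t * K t) ?x"
  by (simp only: cfc_mult[OF sx c(2) c(2)] d)
 also have "(%t. K t * K t) = G" by (rule ext) (simp add: K_def G_def)
 finally have "emb k * emb k = emb g" unfolding d .
 moreover have "emb x * emb g = (e^2) *R emb g + emb g * emb g"
 proof -
  have "emb x * emb g = cfc (%t. t * G t) ?x"
   by (simp only: cfc_mult[OF sx continuous_on_id c(1)] d cfc_id[OF sx])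
  also have "(%t. t * G t) = (%t. e^2 * G t + G t * G t)"
   by (rule ext) (simp add: max_def G_def algebra_simps)
  also have "cfc ... ?x = (e^2) *R emb g + emb g * emb g"
   by (simp only: cfc_add[OF sx c'(1,2)] cfc_mult[OF sx c(1) c(1)] cfc_cmult[OF sx c(1)] d)
  finally show ?thesis .
 qed
 moreover have "emb x = emb g + (2 * e) *R emb m - emb m * emb m"
 proof -
  have "(%t. t) = (%t. (G t + (2 * e) * M t) + (-1) * (M t * M t))"
  proof
   fix t :: real
   have "M t * M t = e^2 - 2 * e * sqrt (max (e^2 - t) 0) + max (e^2 - t) 0"
    by (simp add: M_def algebra_simps power2_eq_square)
   hence "(G t + (2 * e) * M t) + (-1) * (M t * M t) = G t + e^2 - max (e^2 - t) 0"
    by (simp add: M_def algebra_simps power2_eq_square)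
   moreover have "G t + e^2 - max (e^2 - t) 0 = t" by (simp add: max_def G_def)
   ultimately show "t = (G t + (2 * e) * M t) + (-1) * (M t * M t)" by (simp only:)
  qed
  hence "emb x = cfc (%t. (G t + (2 * e) * M t) + (-1) * (M t * M t)) ?x"
   using cfc_id[OF sx] by (simp only:)
  also have "... = emb g + (2 * e) *R emb m - emb m * emb m"
   by (simp only: cfc_add[OF sx c'(4,6)] cfc_add[OF sx c(1) c'(3)] cfc_cmult[OF sx c(3)] cfc_cmult[OF sx c'(5)]
     cfc_mult[OF sx c(3) c(3)] d) simp
  finally show ?thesis .
 qed
 moreover have "star (emb g) = emb g" "star (emb k) = emb k" "star (emb m) = emb m"
  unfolding d[symmetric] by (intro star_cfc[OF sx] c)+
 ultimately show thesis
  by (intro that[of g k m]) (simp_all add: unitz_eq_iff)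
qed

subsection \<open>Hilbert spaces\<close>

lemma scaleR_conv_scaleC_h: "r *R x = cor r *C (x::'h::chilbert_space)"
 by (simp add: scaleC_of_real)

lemma cinner_add_left: "cinner (x + y) z = cinner x z + cinner y (z::'h::chilbert_space)"
 by (metis cinner_add_right cinner_commute complex_cnj_add)

lemma cinner_scaleC_left: "cinner (c *C x) y = cnj c * cinner x (y::'h::chilbert_space)"
 by (metis cinner_commute cinner_scaleC_right complex_cnj_mult)

lemma cinner_0_right [simp]: "cinner x 0 = (0::complex)" for x :: "'h::chilbert_space"
 using cinner_scaleC_right[of x 0 0] by simp

lemma cinner_0_left [simp]: "cinner 0 x = (0::complex)" for x :: "'h::chilbert_space"
 using cinner_scaleC_left[of 0 0 x] by simp

lemma cinner_minus_right: "cinner x (- y) = - cinner x (y::'h::chilbert_space)"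
 using cinner_scaleC_right[of x "-1" y] by simp

lemma cinner_minus_left: "cinner (- x) y = - cinner x (y::'h::chilbert_space)"
 using cinner_scaleC_left[of "-1" x y] by simp

lemma cinner_diff_right: "cinner x (y - z) = cinner x y - cinner x (z::'h::chilbert_space)"
 using cinner_add_right[of x y "- z"] by (simp add: cinner_minus_right)

lemma cinner_diff_left: "cinner (x - y) z = cinner x z - cinner y (z::'h::chilbert_space)"
 using cinner_add_left[of x "- y" z] by (simp add: cinner_minus_left)

lemma cinner_self: "cinner x x = cor ((norm x)^2)" for x :: "'h::chilbert_space"
proof -
 have "cinner x x = cnj (cinner x x)" by (rule cinner_commute)
 hence "Im (cinner x x) = 0" by (metis complex_cnj complex.sel(2) equal_neg_zero complex.collapse)
 thus ?thesis by (simp add: complex_eq_iff Re_cinner power2_norm_eq_inner)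
qed

lemma norm_scaleC_h: "norm (c *C x) = cmod c * norm (x::'h::chilbert_space)"
proof -
 have "cor ((norm (c *C x))^2) = cnj c * c * cor ((norm x)^2)"
  unfolding cinner_self[symmetric] by (simp add: cinner_scaleC_left cinner_scaleC_right)
 also have "cnj c * c = cor ((cmod c)^2)" by (metis complex_norm_square mult.commute)
 also have "cor ((cmod c)^2) * cor ((norm x)^2) = cor ((cmod c * norm x)^2)"
  by (simp only: power_mult_distrib of_real_mult)
 finally have "(norm (c *C x))^2 = (cmod c * norm x)^2" by (simp only: of_real_eq_iff)
 thus ?thesis by (rule power2_eq_imp_eq) simp_all
qed

lemma cauchy_schwarz: "cmod (cinner x y) <= norm x * norm (y::'h::chilbert_space)"
proof (cases "cinner x y = 0")
 case False
 define c where "c = cnj (cinner x y) / cmod (cinner x y)"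
 have c: "cmod c = 1" using False by (simp add: c_def norm_divide)
 have "cinner x (c *C y) = cor (cmod (cinner x y))"
 proof -
  have "cnj (cinner x y) * cinner x y = cor (cmod (cinner x y)) * cor (cmod (cinner x y))"
   by (metis complex_norm_square mult.commute of_real_mult of_real_power power2_eq_square)
  thus ?thesis using False by (simp add: cinner_scaleC_right c_def)
 qed
 hence "cmod (cinner x y) = inner x (c *C y)" by (metis Re_cinner Re_complex_of_real)
 also have "... <= norm x * norm (c *C y)" by (rule norm_cauchy_schwarz)
 finally show ?thesis by (simp add: norm_scaleC_h c)
qed simp

lemma scaleC_scaleR_commute_h: "c *C (r *R x) = r *R (c *C (x::'h::chilbert_space))"
 by (simp add: scaleR_conv_scaleC_h mult.commute)

lemma bounded_linear_scaleC_h: "bounded_linear (%x::'h::chilbert_space. c *C x)"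
 by (rule bounded_linear_intro[where K = "cmod c"])
   (simp_all add: scaleC_add_right scaleC_scaleR_commute_h norm_scaleC_h)

lemma bounded_bilinear_cinner: "bounded_bilinear (cinner :: 'h::chilbert_space => 'h => complex)"
proof
 fix x y z :: 'h and r :: real
 show "cinner (x + y) z = cinner x z + cinner y z" by (rule cinner_add_left)
 show "cinner x (y + z) = cinner x y + cinner x z" by (rule cinner_add_right)
 show "cinner (r *R x) y = r *R cinner x y"
  by (simp add: scaleR_conv_scaleC_h cinner_scaleC_left scaleR_conv_of_real)
 show "cinner x (r *R y) = r *R cinner x y"
  by (simp add: scaleR_conv_scaleC_h cinner_scaleC_right scaleR_conv_of_real)
 have "ALL a b::'h. cmod (cinner a b) <= norm a * norm b * 1" by (simp add: cauchy_schwarz)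
 thus "EX K. ALL a b::'h. cmod (cinner a b) <= norm a * norm b * K" ..
qed

lemmas tendsto_scaleC_h = bounded_linear.tendsto[OF bounded_linear_scaleC_h]
lemmas tendsto_cinner = bounded_bilinear.tendsto[OF bounded_bilinear_cinner]

lemma csub_real: "csubspace V ==> subspace (V::'h::chilbert_space set)"
 by (auto simp: subspace_def csub scaleR_conv_scaleC_h)

lemma closure_seqI: "(!!n. f n : Y) ==> f ----> x ==> x : closure (Y::'h::metric_space set)"
 by (auto simp: closure_sequential)

lemma csubspace_closure:
 assumes "csubspace (Y::'h::chilbert_space set)" shows "csubspace (closure Y)"
proof (rule csubspaceI)
 show "0 : closure Y" using csub(1)[OF assms] closure_subset by blast
 fix x y assume "x : closure Y" "y : closure Y"
 then obtain f g where f: "!!n. f n : Y" "f ----> x" and g: "!!n. g n : Y" "g ----> y"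
  unfolding closure_sequential by blast
 have "(%n. f n + g n) ----> x + y" by (intro tendsto_add f g)
 thus "x + y : closure Y" by (rule closure_seqI[rotated]) (intro csub(2)[OF assms] f g)
next
 fix c x assume "x : closure Y"
 then obtain f where f: "!!n. f n : Y" "f ----> x" unfolding closure_sequential by blast
 have "(%n. c *C f n) ----> c *C x" by (intro tendsto_scaleC_h f)
 thus "c *C x : closure Y" by (rule closure_seqI[rotated]) (intro csub(4)[OF assms] f)
qed

lemma hsub_closure: "csubspace Y ==> hilbert_subspace (closure Y)"
 by (simp add: hilbert_subspace_def csubspace_closure)

lemma hsubD:
 assumes "hilbert_subspace H"
 shows "csubspace H" "closed H" "0 : H" "x : H ==> y : H ==> x + y : H" "x : H ==> y : H ==> x - y : H"
  "x : H ==> c *C x : H"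
 using assms unfolding hilbert_subspace_def by (blast intro: csub)+

definition clin_on :: "'h::complex_vector set => ('h => 'k::complex_vector) => bool"
 where "clin_on H T <-> (ALL h:H. ALL k:H. T (h + k) = T h + T k) & (ALL c. ALL h:H. T (c *C h) = c *C T h)"

lemma clin_onI:
 "(!!h k. h : H ==> k : H ==> T (h + k) = T h + T k) ==> (!!c h. h : H ==> T (c *C h) = c *C T h) ==> clin_on H T"
 by (simp add: clin_on_def)

lemma clin_onD:
 assumes "clin_on H T"
 shows "h : H ==> k : H ==> T (h + k) = T h + T k" "h : H ==> T (c *C h) = c *C T h"
 using assms by (simp_all add: clin_on_def)

lemma clin_on_diff:
 assumes "clin_on H T" "csubspace H" "h : H" "k : H" shows "T (h - k) = T h - T k"
proof -
 have "T (h + (-1) *C k) = T h + (-1) *C T k"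
  using clin_onD[OF assms(1)] assms csub(4)[OF assms(2)] by metis
 thus ?thesis by simp
qed

lemma clin_on_0:
 assumes "clin_on H T" "csubspace H" shows "T 0 = 0"
 using clin_onD(2)[OF assms(1) csub(1)[OF assms(2)], of 0] by simp

text \<open>The minimizer of \<open>\<parallel>y\<parallel>\<^sup>2 - 2 Re \<phi>(y)\<close> represents \<open>\<phi>\<close>.\<close>

lemma riesz_dense:
 fixes Y :: "'h::chilbert_space set" and \<phi> :: "'h => complex"
 assumes Y: "csubspace Y"
  and add: "!!x y. x : Y ==> y : Y ==> \<phi> (x + y) = \<phi> x + \<phi> y"
  and scale: "!!c x. x : Y ==> \<phi> (c *C x) = c * \<phi> x"
  and bound: "!!x. x : Y ==> cmod (\<phi> x) <= M * norm x"
 obtains k where "k : closure Y" "!!y. y : Y ==> cinner k y = \<phi> y"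
proof -
 note sY = csub[OF Y]
 have scR: "\<phi> (r *R x) = of_real r * \<phi> x" "r *R x : Y" if "x : Y" for r x
  using that sY(4) scale by (simp_all add: scaleR_conv_scaleC_h)
 define J where "J y = (norm y)^2 - 2 * Re (\<phi> y)" for y
 have Jlow: "- (M^2) <= J y" if "y : Y" for y
 proof -
  have "Re (\<phi> y) <= M * norm y" using bound[OF that] complex_Re_le_cmod[of "\<phi> y"] by linarith
  moreover have "0 <= (norm y - M)^2" by simp
  ultimately show ?thesis unfolding J_def power2_diff by (simp add: mult.commute)
 qed
 define m where "m = Inf (J ` Y)"
 have bdd: "bdd_below (J ` Y)" using Jlow by (auto intro!: bdd_belowI)
 have mle: "m <= J y" if "y : Y" for y
  unfolding m_def using bdd that by (simp add: cInf_lower)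
 have "EX y:Y. J y < m + 1 / real (Suc n)" for n
 proof -
  have "Inf (J ` Y) < m + 1 / real (Suc n)" unfolding m_def by simp
  thus ?thesis using cInf_lessD[of "J ` Y"] sY(1) by blast
 qed
 then obtain y where y: "!!n. y n : Y" "!!n. J (y n) < m + 1 / real (Suc n)" by metis
 \<comment> \<open>The parallelogram law for J: its linear part cancels at the midpoint.\<close>
 have par: "(norm (u - v))^2 = 2 * (J u + J v - 2 * J ((1/2) *R (u + v)))" if "u : Y" "v : Y" for u v
 proof -
  have "\<phi> ((1/2) *R (u + v)) = of_real (1/2) * (\<phi> u + \<phi> v)"
   by (simp only: scR(1)[OF sY(2)[OF that]] add[OF that])
  hence "Re (\<phi> ((1/2) *R (u + v))) = Re (of_real (1/2) * (\<phi> u + \<phi> v))" by (rule arg_cong)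
  hence "Re (\<phi> ((1/2) *R (u + v))) = (Re (\<phi> u) + Re (\<phi> v)) / 2" by simp
  moreover have "(norm ((1/2) *R (u + v)))^2 = (norm (u + v))^2 / 4"
   by (simp add: power_mult_distrib power2_eq_square)
  moreover have "(norm (u + v))^2 + (norm (u - v))^2 = 2 * (norm u)^2 + 2 * (norm v)^2"
   by (simp add: power2_norm_eq_inner inner_add_left inner_add_right inner_diff_left inner_diff_right inner_commute)
  ultimately show ?thesis unfolding J_def by simp
 qed
 have close: "(norm (y n - y p))^2 <= 2 * (1 / real (Suc n)) + 2 * (1 / real (Suc p))" for n p
 proof -
  have "m <= J ((1/2) *R (y n + y p))" by (intro mle scR(2) sY(2) y(1))
  moreover have "d <= 2 * a + 2 * b" if "m <= c" "d = 2 * (u + v - 2 * c)" "u < m + a" "v < m + b" for a b c d u v :: real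
   using that by simp
  ultimately show ?thesis using par[OF y(1)[of n] y(1)[of p]] y(2)[of n] y(2)[of p] by blast
 qed
 have "Cauchy y"
 proof (rule metric_CauchyI)
  fix e :: real assume "0 < e"
  have "(%n. 1 / real (Suc n)) ----> 0" by real_asymp
  hence "eventually (%n. 1 / real (Suc n) < e^2 / 4) sequentially"
   using `0 < e` by (intro order_tendstoD) auto
  then obtain N where N: "!!n. n >= N ==> 1 / real (Suc n) < e^2 / 4" by (auto simp: eventually_sequentially)
  have "dist (y n) (y p) < e" if "n >= N" "p >= N" for n p
  proof -
   have "(norm (y n - y p))^2 < e^2" using close[of n p] N[OF that(1)] N[OF that(2)] by linarith
   thus ?thesis using `0 < e` unfolding dist_norm by (rule power2_less_imp_less[OF _ less_imp_le])
  qed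
  thus "EX N. ALL n>=N. ALL p>=N. dist (y n) (y p) < e" by blast
 qed
 then obtain k where k: "y ----> k" using Cauchy_convergent convergent_def by blast
 have kY: "k : closure Y" by (rule closure_seqI[OF y(1) k])
 have Jm: "(%n. J (y n)) ----> m"
 proof (rule tendsto_sandwich)
  show "\<forall>\<^sub>F n in sequentially. m <= J (y n)" using mle y(1) by (intro always_eventually) blast
  show "\<forall>\<^sub>F n in sequentially. J (y n) <= m + 1 / real (Suc n)"
   using y(2) less_imp_le by (intro always_eventually) blast
  show "(%n. m + 1 / real (Suc n)) ----> m" by real_asymp
 qed simp
 have Re_eq: "inner k z = Re (\<phi> z)" if z: "z : Y" for z
 proof -
  define D where "D = inner k z - Re (\<phi> z)"
  have quad: "0 <= 2 * t * D + t^2 * (norm z)^2" for t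
  proof -
   have exp: "J (y n + t *R z) = J (y n) + (2 * t * (inner (y n) z - Re (\<phi> z)) + t^2 * (norm z)^2)" for n
   proof -
    have "Re (\<phi> (y n + t *R z)) = Re (\<phi> (y n)) + t * Re (\<phi> z)"
     using add[OF y(1) scR(2)[OF z]] scR(1)[OF z] by simp
    moreover have "(norm (y n + t *R z))^2 = (norm (y n))^2 + 2 * t * inner (y n) z + t^2 * (norm z)^2"
     unfolding power2_norm_eq_inner
     by (simp add: inner_add_left inner_add_right inner_commute[of z "y n"] power2_eq_square algebra_simps)
    ultimately show ?thesis unfolding J_def by (simp add: algebra_simps)
   qed
   have a: "(%n. J (y n) + (2 * t * (inner (y n) z - Re (\<phi> z)) + t^2 * (norm z)^2)) ----> m + (2 * t * D + t^2 * (norm z)^2)"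
    unfolding D_def by (intro tendsto_intros Jm k)
   have b: "m <= J (y n) + (2 * t * (inner (y n) z - Re (\<phi> z)) + t^2 * (norm z)^2)" for n
    unfolding exp[symmetric] by (intro mle sY(2) y(1) scR(2) z)
   have "m <= m + (2 * t * D + t^2 * (norm z)^2)"
    by (rule LIMSEQ_le_const[OF a]) (intro exI allI impI b)
   thus ?thesis by simp
  qed
  \<comment> \<open>The minimizing t would be - D / (norm z)^2; the added 1 covers z = 0.\<close>
  define c where "c = (norm z)^2 + 1"
  have c: "0 < c" unfolding c_def by (simp add: add_nonneg_pos)
  have "0 <= 2 * (- D / c) * D + (- D / c)^2 * (norm z)^2" by (rule quad)
  also have "... <= 2 * (- D / c) * D + (- D / c)^2 * c" unfolding c_def by (intro add_left_mono mult_left_mono) simp_all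
  also have "... = - (D^2 / c)" using c by (simp add: power2_eq_square field_simps)
  finally have "D^2 / c <= 0" by simp
  hence "D^2 <= 0" using c by (simp add: divide_le_0_iff)
  thus ?thesis by (simp add: D_def)
 qed
 have "cinner k z = \<phi> z" if z: "z : Y" for z
 proof (rule complex_eqI)
  show "Re (cinner k z) = Re (\<phi> z)" by (simp add: Re_cinner Re_eq[OF z])
  have "Re (cinner k (\<i> *C z)) = Re (\<phi> (\<i> *C z))" unfolding Re_cinner by (rule Re_eq[OF sY(4)[OF z]])
  thus "Im (cinner k z) = Im (\<phi> z)" by (simp add: cinner_scaleC_right scale[OF z])
 qed
 thus thesis using that kY by blast
qed

lemma riesz_projection:
 assumes "hilbert_subspace (H::'h::chilbert_space set)"
 obtains p where "p : H" "!!g. g : H ==> cinner p g = cinner x g"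
proof -
 obtain p where "p : closure H" "!!g. g : H ==> cinner p g = cinner x g"
  by (rule riesz_dense[OF hsubD(1)[OF assms], of "cinner x" "norm x"])
    (auto simp: cinner_add_right cinner_scaleC_right cauchy_schwarz)
 thus thesis using that hsubD(2)[OF assms] closure_closed by metis
qed

lemma cinner_ext:
 assumes "hilbert_subspace (H::'h::chilbert_space set)" "x : H" "y : H" "!!g. g : H ==> cinner x g = cinner y g"
 shows "x = y"
proof -
 have "cinner (x - y) (x - y) = 0"
  using assms(4)[OF hsubD(5)[OF assms(1-3)]] by (simp add: cinner_diff_left)
 thus ?thesis by (simp add: cinner_self)
qed

lemma adjoint_exists:
 fixes H :: "'h::chilbert_space set" and K :: "'k::chilbert_space set"
 assumes H: "hilbert_subspace H" and K: "hilbert_subspace K"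
  and T: "clin_on H T" "!!h. h : H ==> T h : K" "!!h. h : H ==> norm (T h) <= M * norm h" and M: "0 <= M"
 obtains S where "clin_on K S" "!!k. k : K ==> S k : H" "!!k. k : K ==> norm (S k) <= M * norm k"
  "!!h k. h : H ==> k : K ==> cinner (S k) h = cinner k (T h)"
proof -
 have "EX s. s : H & (ALL h:H. cinner s h = cinner k (T h))" for k
 proof -
  obtain s where "s : closure H" "!!h. h : H ==> cinner s h = cinner k (T h)"
  proof (rule riesz_dense[OF hsubD(1)[OF H], of "%h. cinner k (T h)" "norm k * M"])
   fix h assume h: "h : H"
   have "cmod (cinner k (T h)) <= norm k * norm (T h)" by (rule cauchy_schwarz)
   also have "... <= norm k * (M * norm h)" by (intro mult_left_mono T h norm_ge_zero)
   finally show "cmod (cinner k (T h)) <= norm k * M * norm h" by (simp add: mult.assoc)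
  qed (use clin_onD[OF T(1)] in "simp_all add: cinner_add_right cinner_scaleC_right")
  thus ?thesis using hsubD(2)[OF H] closure_closed by metis
 qed
 then obtain S where S: "!!k. S k : H" "!!h k. h : H ==> cinner (S k) h = cinner k (T h)" by metis
 have lin: "clin_on K S"
 proof (rule clin_onI)
  show "S (h + k) = S h + S k" for h k
   by (rule cinner_ext[OF H]) (auto simp: S hsubD[OF H] cinner_add_left)
  show "S (c *C h) = c *C S h" for h c
   by (rule cinner_ext[OF H]) (auto simp: S hsubD[OF H] cinner_scaleC_left)
 qed
 have bd: "norm (S k) <= M * norm k" for k
 proof (cases "S k = 0")
  case True
  thus ?thesis using M by simp
 next
  case False
  have "(norm (S k))^2 = cmod (cinner (S k) (S k))" by (simp add: cinner_self norm_power)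
  also have "... = cmod (cinner k (T (S k)))" by (simp add: S)
  also have "... <= norm k * norm (T (S k))" by (rule cauchy_schwarz)
  also have "... <= norm k * (M * norm (S k))" by (intro mult_left_mono T S norm_ge_zero)
  finally show ?thesis using False by (simp add: power2_eq_square mult_ac)
 qed
 show thesis using that[of S] lin S bd by blast
qed

lemma adjoint_on_props:
 assumes H: "hilbert_subspace (H::'h::chilbert_space set)" and T: "bounded_operator H T" and h: "h : H"
 shows "adjoint_on H T h : H" "g : H ==> cinner (adjoint_on H T h) g = cinner h (T g)"
proof -
 from T obtain M where lin: "linear_into H H T" and M: "!!h. h : H ==> norm (T h) <= M * norm h"
  unfolding bounded_operator_def by blast
 have M': "norm (T h) <= \<bar>M\<bar> * norm h" if "h : H" for h
  using M[OF that] mult_right_mono[OF abs_ge_self, of "norm h" M] by simp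
 have c: "clin_on H T" "!!h. h : H ==> T h : H" using lin by (auto simp: linear_into_def clin_on_def)
 obtain S where S: "!!k. k : H ==> S k : H" "!!h k. h : H ==> k : H ==> cinner (S k) h = cinner k (T h)"
  using adjoint_exists[OF H H c M' abs_ge_zero] by metis
 have "EX! k. k : H & (ALL g:H. cinner k g = cinner h (T g))"
 proof (rule ex1I[of _ "S h"])
  show "S h : H & (ALL g:H. cinner (S h) g = cinner h (T g))" using S h by blast
  show "k = S h" if "k : H & (ALL g:H. cinner k g = cinner h (T g))" for k
   by (rule cinner_ext[OF H]) (use that S h in auto)
 qed
 from theI'[OF this] show "adjoint_on H T h : H" "g : H ==> cinner (adjoint_on H T h) g = cinner h (T g)"
  unfolding adjoint_on_def by blast+
qed

lemma adjoint_on_eqI: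
 assumes H: "hilbert_subspace (H::'h::chilbert_space set)" and T: "bounded_operator H T" and h: "h : H"
  and k: "k : H" "!!g. g : H ==> cinner k g = cinner h (T g)"
 shows "adjoint_on H T h = k"
 by (rule cinner_ext[OF H]) (use adjoint_on_props[OF H T h] k in auto)

subsection \<open>Extending bounded operators by continuity\<close>

lemma clin_on_lipschitz:
 assumes "clin_on H T" "csubspace H" "!!h. h : H ==> norm (T h) <= M * norm h" "x : H" "y : H"
 shows "norm (T x - T y) <= M * norm (x - y)"
 using clin_on_diff[OF assms(1,2,4,5)] assms(3)[OF csub(3)[OF assms(2,4,5)]] by metis

lemma extend_operator:
 fixes T :: "'h::chilbert_space => 'k::chilbert_space"
 assumes Y: "csubspace Y" and T: "clin_on Y T" "!!y. y : Y ==> norm (T y) <= M * norm y"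
 obtains S where "clin_on (closure Y) S" "!!y. y : Y ==> S y = T y"
  "!!x. x : closure Y ==> norm (S x) <= M * norm x" "!!x. x : closure Y ==> S x : closure (T ` Y)"
proof -
 have lip: "norm (T x - T y) <= M * norm (x - y)" if "x : Y" "y : Y" for x y
  by (rule clin_on_lipschitz[OF T(1) Y T(2) that])
 have uc: "uniformly_continuous_on Y T"
  unfolding uniformly_continuous_on_def
 proof (intro allI impI)
  fix e :: real assume "0 < e"
  let ?d = "e / (\<bar>M\<bar> + 1)"
  have "dist (T y) (T x) < e" if "x : Y" "y : Y" "dist y x < ?d" for x y
  proof -
   have "norm (T y - T x) <= M * norm (y - x)" by (rule lip[OF that(2,1)])
   also have "... <= (\<bar>M\<bar> + 1) * norm (y - x)" by (intro mult_right_mono) auto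
   also have "... < e" using that(3) by (simp add: dist_norm pos_less_divide_eq mult.commute add_nonneg_pos)
   finally show ?thesis by (simp add: dist_norm)
  qed
  moreover have "0 < ?d" using `0 < e` by (simp add: add_nonneg_pos)
  ultimately show "EX d>0. ALL x:Y. ALL x':Y. dist x' x < d --> dist (T x') (T x) < e" by blast
 qed
 obtain S where S: "uniformly_continuous_on (closure Y) S" "!!y. y : Y ==> T y = S y"
 proof (rule uniformly_continuous_on_extension_on_closure[OF uc])
  fix g assume g: "uniformly_continuous_on (closure Y) g" "!!x. x : Y ==> T x = g x"
  show thesis by (rule that[of g]) (rule g(1), rule g(2))
 qed
 have lim: "(%n. T (f n)) ----> S x" if "!!n. f n : Y" "f ----> x" for f x
 proof -
  have "x : closure Y" using that by (rule closure_seqI)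
  hence "(%n. S (f n)) ----> S x"
   using uniformly_continuous_imp_continuous[OF S(1)] that closure_subset[of Y]
   unfolding continuous_on_sequentially comp_def by blast
  thus ?thesis using S(2) that(1) by simp
 qed
 note sY = csub[OF Y]
 show thesis
 proof
  show "S y = T y" if "y : Y" for y using S(2)[OF that] by simp
  show "clin_on (closure Y) S"
  proof (rule clin_onI)
   fix x y assume "x : closure Y" "y : closure Y"
   then obtain f g where f: "!!n. f n : Y" "f ----> x" and g: "!!n. g n : Y" "g ----> y"
  unfolding closure_sequential by blast
   have "(%n. T (f n + g n)) ----> S (x + y)" by (rule lim) (intro sY tendsto_add f g)+
   moreover have "(%n. T (f n + g n)) ----> S x + S y"
    using tendsto_add[OF lim[OF f] lim[OF g]] clin_onD(1)[OF T(1)] f g by simp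
   ultimately show "S (x + y) = S x + S y" by (rule LIMSEQ_unique)
  next
   fix c x assume "x : closure Y"
   then obtain f where f: "!!n. f n : Y" "f ----> x" unfolding closure_sequential by blast
   have "(%n. T (c *C f n)) ----> S (c *C x)" by (rule lim) (intro sY tendsto_scaleC_h f)+
   moreover have "(%n. T (c *C f n)) ----> c *C S x"
    using tendsto_scaleC_h[OF lim[OF f], of c] clin_onD(2)[OF T(1)] f by simp
   ultimately show "S (c *C x) = c *C S x" by (rule LIMSEQ_unique)
  qed
  fix x assume "x : closure Y"
  then obtain f where f: "!!n. f n : Y" "f ----> x" unfolding closure_sequential by blast
  show "norm (S x) <= M * norm x"
  proof (rule LIMSEQ_le)
   show "(%n. norm (T (f n))) ----> norm (S x)" by (intro tendsto_norm lim f)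
   show "(%n. M * norm (f n)) ----> M * norm x" by (intro tendsto_intros f)
   show "EX N. ALL n>=N. norm (T (f n)) <= M * norm (f n)" using T(2) f(1) by blast
  qed
  show "S x : closure (T ` Y)" using lim[OF f] by (rule closure_seqI[rotated]) (use f(1) in blast)
 qed
qed

subsection \<open>Gram matrices\<close>

text \<open>The span of the pairs (d j, f j): v and y are the same combination of the d j and of the
  f j. The relation is symmetric in both families, and single-valuedness becomes a question about
  pairs with one entry 0.\<close>

inductive colink :: "('i => 'v::complex_vector) => ('i => 'h::complex_vector) => 'i set => 'v => 'h => bool"
 for d f D where
  colink_0: "colink d f D 0 0"
 | colink_step: "colink d f D v y ==> j : D ==> colink d f D (v + c *C d j) (y + c *C f j)"

lemma colink_add: "colink d f D v y ==> colink d f D v' y' ==> colink d f D (v' + v) (y' + y)"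
proof (induction rule: colink.induct)
 case (colink_step v y j c)
 thus ?case using colink.colink_step[of d f D "v' + v" "y' + y" j c] by (simp add: add.assoc)
qed simp

lemma colink_scale: "colink d f D v y ==> colink d f D (c *C v) (c *C y)"
proof (induction rule: colink.induct)
 case (colink_step v y j e)
 thus ?case using colink.colink_step[of d f D "c *C v" "c *C y" j "c * e"] by (simp add: scaleC_add_right)
qed (simp add: colink_0)

lemma colink_base: "j : D ==> colink d f D (d j) (f j)"
 using colink_step[OF colink_0, of j D d f 1] by simp

lemma colink_diff: "colink d f D v y ==> colink d f D v' y' ==> colink d f D (v' - v) (y' - y)"
 using colink_add[OF colink_scale[of d f D v y "-1"]] by simp

lemma colink_span: "(EX y. colink d f D v y) <-> v : cspan (d ` D)"
proof
 assume "EX y. colink d f D v y"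
 then obtain y where "colink d f D v y" by blast
 thus "v : cspan (d ` D)"
  by (induction rule: colink.induct)
    (auto intro: complex_vector.span_zero complex_vector.span_add complex_vector.span_scale complex_vector.span_base)
next
 assume "v : cspan (d ` D)"
 thus "EX y. colink d f D v y"
 proof (induction rule: complex_vector.span_induct_alt)
  case base
  show ?case using colink_0 by blast
 next
  case (step c x y)
  then obtain j z where "j : D" "x = d j" "colink d f D y z" by blast
  thus ?case using colink_add[OF colink_scale[OF colink_base]] colink_step by (metis add.commute)
 qed
qed

lemma colink_sym: "colink d f D v y <-> colink f d D y v"
proof
 show "colink d f D v y ==> colink f d D y v"
  by (induction rule: colink.induct) (auto intro: colink.intros)
 show "colink f d D y v ==> colink d f D v y"
  by (induction rule: colink.induct) (auto intro: colink.intros)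
qed

locale semi_inner =
 fixes s :: "'v::complex_vector => 'v => complex"
 assumes add_right: "s x (y + z) = s x y + s x z"
  and scale_right: "s x (c *C y) = c * s x y"
  and herm: "s x y = cnj (s y x)"
  and nonneg: "0 <= Re (s x x)"
begin

lemma add_left: "s (x + y) z = s x z + s y z"
 by (metis add_right herm complex_cnj_add)

lemma scale_left: "s (c *C x) y = cnj c * s x y"
 by (metis scale_right herm complex_cnj_mult)

lemma zero_right: "s x 0 = 0" using scale_right[of x 0 0] by simp

lemma zero_left: "s 0 x = 0" using scale_left[of 0 0 x] by simp

lemma real: "s x x = cor (Re (s x x))"
proof -
 have "Im (s x x) = - Im (s x x)" using arg_cong[OF herm[of x x], of Im] by simp
 thus ?thesis by (simp add: complex_eq_iff)
qed

lemma cauchy_schwarz: "(cmod (s x y))^2 <= Re (s x x) * Re (s y y)"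
proof -
 let ?z = "s x y"
 have exp: "Re (s (x + c *C y) (x + c *C y)) = Re (s x x) + 2 * Re (c * ?z) + (cmod c)^2 * Re (s y y)" for c
 proof -
  have "s (x + c *C y) (x + c *C y) = s x x + c * ?z + cnj (c * ?z) + (cnj c * c) * s y y"
   using herm[of y x] by (simp add: add_left add_right scale_left scale_right algebra_simps)
  moreover have "cnj c * c = cor ((cmod c)^2)" by (metis complex_norm_square mult.commute)
  ultimately show ?thesis by simp
 qed
 show ?thesis
 proof (cases "Re (s y y) = 0")
  case True
  have "?z = 0"
  proof (rule ccontr)
   assume z: "?z ~= 0"
   \<comment> \<open>This size of c gives the expanded form the value -1, against
     positivity.\<close>
   define t where "t = (Re (s x x) + 1) / (2 * (cmod ?z)^2)"
   define c where "c = - cor t * cnj ?z"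
   have "cnj ?z * ?z = cor ((cmod ?z)^2)" by (metis complex_norm_square mult.commute)
   hence "Re (c * ?z) = - t * (cmod ?z)^2" by (simp add: c_def mult.assoc)
   also have "... = - (Re (s x x) + 1) / 2" using z by (simp add: t_def field_simps)
   finally have "Re (s (x + c *C y) (x + c *C y)) = - 1" using exp[of c] True by simp
   thus False using nonneg[of "x + c *C y"] by simp
  qed
  thus ?thesis using True by simp
 next
  case False
  hence y: "0 < Re (s y y)" using nonneg[of y] by simp
  define c where "c = - cnj ?z / cor (Re (s y y))"
  have zz: "cnj ?z * ?z = cor ((cmod ?z)^2)" by (metis complex_norm_square mult.commute)
  have "c * ?z = - (cnj ?z * ?z) / cor (Re (s y y))" by (simp add: c_def)
  also have "... = - cor ((cmod ?z)^2 / Re (s y y))" unfolding zz by simp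
  finally have "c * ?z = - cor ((cmod ?z)^2 / Re (s y y))" .
  hence 1: "Re (c * ?z) = - ((cmod ?z)^2 / Re (s y y))" by simp
  have "cmod c = cmod ?z / Re (s y y)" using y by (simp add: c_def norm_divide)
  hence 2: "(cmod c)^2 * Re (s y y) = (cmod ?z)^2 / Re (s y y)"
   using y by (simp add: power_divide power2_eq_square)
  have "0 <= Re (s x x) - (cmod ?z)^2 / Re (s y y)"
   using exp[of c] nonneg[of "x + c *C y"] unfolding 1 2 by simp
  thus ?thesis using y by (simp add: field_simps)
 qed
qed

lemma colink_gram:
 fixes f :: "'i => 'h::chilbert_space"
 assumes g: "!!i j. i : D ==> j : D ==> cinner (f i) (f j) = s (d i) (d j)"
 shows "colink d f D v y ==> colink d f D w z ==> cinner y z = s v w"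
proof (induction rule: colink.induct)
 case colink_0
 show ?case by (simp add: zero_left)
next
 case (colink_step v y j c)
 from colink_step.prems have "cinner (f j) z = s (d j) w"
  by (induction rule: colink.induct)
    (simp_all add: zero_right cinner_add_right add_right cinner_scaleC_right scale_right g colink_step.hyps)
 thus ?case using colink_step by (simp add: cinner_add_left add_left cinner_scaleC_left scale_left)
qed

text \<open>Gram--Schmidt along a well-order of the index set: the new vector is the representative of the
 functional given by the old ones, plus a multiple of a fresh basis vector.\<close>

lemma gram_step:
 fixes f :: "'i => 'i ell2"
 assumes g: "!!i j. i : D ==> j : D ==> cinner (f i) (f j) = s (d i) (d j)"
  and supp: "!!j k. j : D ==> k ~: D ==> Rep_ell2 (f j) k = 0" and i: "i ~: D"
 obtains x where "!!j. j : D ==> cinner (f j) x = s (d j) v" "cinner x x = s v v"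
  "!!k. k ~: D ==> k ~= i ==> Rep_ell2 x k = 0"
proof -
 define Y where "Y = cspan (f ` D)"
 have Y: "csubspace Y" unfolding Y_def by (rule complex_vector.subspace_span)
 have "EX w. colink d f D w y" if "y : Y" for y
  using that colink_span[of f d D y] colink_sym[of d f D] unfolding Y_def by blast
 then obtain w where w: "!!y. y : Y ==> colink d f D (w y) y" by metis
 \<comment> \<open>Two preimages of y differ by a null vector, and by Cauchy-Schwarz null vectors
   are orthogonal to v.\<close>
 have wd: "s v a = s v b" if "colink d f D a y" "colink d f D b y" for a b y
 proof -
  have "colink d f D (a - b) 0" using colink_diff[OF that(2,1)] by simp
  from colink_gram[OF g this this] have "s (a - b) (a - b) = 0" by simp
  hence "s v (a - b) = 0" using cauchy_schwarz[of v "a - b"] by simp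
  hence "s v (a + (-1) *C b) = 0" by simp
  thus ?thesis unfolding add_right scale_right by simp
 qed
 define \<phi> where "\<phi> y = s v (w y)" for y
 define S where "S = Re (s v v)"
 have S0: "0 <= S" using nonneg by (simp add: S_def)
 have \<phi>: "\<phi> y = s v a" if "colink d f D a y" "y : Y" for a y
  unfolding \<phi>_def by (rule wd[OF w[OF that(2)] that(1)])
 have bd: "cmod (\<phi> y) <= sqrt S * norm y" if "y : Y" for y
 proof -
  have "Re (s (w y) (w y)) = (norm y)^2"
   using arg_cong[OF colink_gram[OF g w[OF that] w[OF that]], of Re] unfolding cinner_self by (simp only: Re_complex_of_real)
  hence "(cmod (\<phi> y))^2 <= S * (norm y)^2"
   using cauchy_schwarz[of v "w y"] by (simp add: \<phi>_def S_def)
  also have "... = (sqrt S * norm y)^2" using S0 by (simp add: power_mult_distrib)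
  finally show ?thesis by (rule power2_le_imp_le) (use S0 in simp)
 qed
 obtain k where k: "k : closure Y" "!!y. y : Y ==> cinner k y = \<phi> y"
 proof (rule riesz_dense[OF Y, of \<phi> "sqrt S"])
  fix x y assume xy: "x : Y" "y : Y"
  show "\<phi> (x + y) = \<phi> x + \<phi> y"
   using \<phi>[OF colink_add[OF w[OF xy(2)] w[OF xy(1)]] csub(2)[OF Y xy]]
   by (simp add: add_right \<phi>_def)
 next
  fix c x assume x: "x : Y"
  show "\<phi> (c *C x) = c * \<phi> x"
   using \<phi>[OF colink_scale[OF w[OF x]] csub(4)[OF Y x]] by (simp add: scale_right \<phi>_def)
 qed (use bd in auto)
 have kj: "cinner (f j) k = s (d j) v" if "j : D" for j
 proof -
  have "f j : Y" unfolding Y_def using that by (intro complex_vector.span_base) blast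
  hence "cinner k (f j) = s v (d j)" using k(2) \<phi>[OF colink_base[OF that]] by simp
  thus ?thesis using cinner_commute[of "f j" k] herm[of "d j" v] by simp
 qed
 have supY: "Rep_ell2 y k = 0" if "y : Y" "k ~: D" for y k
  using that(1) unfolding Y_def
 proof (induction rule: complex_vector.span_induct_alt)
  case base
  show ?case by (simp add: zero_ell2.rep_eq)
 next
  case (step c x y)
  thus ?case using supp that(2) by (auto simp: plus_ell2.rep_eq scaleC_ell2.rep_eq)
 qed
 obtain y where y: "!!n. y n : Y" "y ----> k" using k(1) unfolding closure_sequential by blast
 have supk: "Rep_ell2 k l = 0" if "l ~: D" for l
 proof -
  from tendsto_diff[OF tendsto_const[of k] y(2)]
  have "(%n. norm (k - y n)) ----> 0" by (intro tendsto_norm_zero) simp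
  moreover have "cmod (Rep_ell2 k l) <= norm (k - y n)" for n
   using ell2_coordinate_bound[of "k - y n" l] supY[OF y(1) that] by (simp add: minus_ell2.rep_eq)
  ultimately have "cmod (Rep_ell2 k l) <= 0" by (intro LIMSEQ_le_const) auto
  thus ?thesis by simp
 qed
 have normk: "(norm k)^2 <= S"
 proof -
  have "(%n. cmod (cinner k (y n))) ----> cmod (cinner k k)"
   by (intro tendsto_norm tendsto_cinner tendsto_const y)
  moreover have "(%n. sqrt S * norm (y n)) ----> sqrt S * norm k" by (intro tendsto_intros y)
  moreover have "cmod (cinner k (y n)) <= sqrt S * norm (y n)" for n using bd[OF y(1)] k(2)[OF y(1)] by simp
  ultimately have "cmod (cinner k k) <= sqrt S * norm k" by (intro LIMSEQ_le) auto
  moreover have "cmod (cinner k k) = norm k * norm k" unfolding cinner_self norm_of_real by (simp add: power2_eq_square)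
  ultimately have "norm k * norm k <= sqrt S * norm k" by simp
  hence "norm k <= sqrt S" using S0 by (cases "k = 0") auto
  hence "(norm k)^2 <= (sqrt S)^2" by (intro power_mono) auto
  thus ?thesis using S0 by simp
 qed
 define \<delta> :: "'i ell2" where "\<delta> = Abs_ell2 (%j. if j = i then 1 else 0)"
 have "square_summable (%j. if j = i then 1 else 0)"
 proof -
  have "(%j. (cmod (if j = i then 1 else 0))^2) summable_on {i}" by (rule summable_on_finite) simp
  thus ?thesis unfolding square_summable_def
   by (rule summable_on_cong_neutral[THEN iffD1, rotated -1]) auto
 qed
 hence \<delta>: "Rep_ell2 \<delta> = (%j. if j = i then 1 else 0)" unfolding \<delta>_def by (simp add: Abs_ell2_inverse)
 have cd: "cinner y \<delta> = cnj (Rep_ell2 y i)" for y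
 proof -
  have "cinner y \<delta> = (\<Sum>\<^sub>\<infinity>j\<in>{i}. cnj (Rep_ell2 y j) * Rep_ell2 \<delta> j)"
   unfolding cinner_ell2.rep_eq by (rule infsum_cong_neutral) (auto simp: \<delta>)
  thus ?thesis by (simp add: \<delta>)
 qed
 \<comment> \<open>The length of v that k does not reach; \<open>normk\<close> makes the radicand
   nonnegative.\<close>
 define t where "t = cor (sqrt (S - (norm k)^2))"
 have t: "cnj t * t = cor (S - (norm k)^2)"
  using normk by (simp add: t_def flip: of_real_mult)
 have ck: "cinner k \<delta> = 0" "cinner \<delta> k = 0"
  using cd[of k] supk[OF i] cinner_commute[of \<delta> k] by simp_all
 show thesis
 proof (rule that[of "k + t *C \<delta>"])
  show "cinner (f j) (k + t *C \<delta>) = s (d j) v" if "j : D" for j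
   using kj[OF that] cd[of "f j"] supp[OF that i] by (simp add: cinner_add_right cinner_scaleC_right)
  have "cinner (k + t *C \<delta>) (k + t *C \<delta>) = cinner k k + (cnj t * t) * cinner \<delta> \<delta>"
   using ck by (simp add: cinner_add_right cinner_add_left cinner_scaleC_right cinner_scaleC_left)
  also have "cinner \<delta> \<delta> = 1" using cd[of \<delta>] by (simp add: \<delta>)
  finally show "cinner (k + t *C \<delta>) (k + t *C \<delta>) = s v v"
   unfolding t cinner_self using real[of v] by (simp add: S_def)
  show "Rep_ell2 (k + t *C \<delta>) l = 0" if "l ~: D" "l ~= i" for l
   using supk[OF that(1)] that(2) by (simp add: plus_ell2.rep_eq scaleC_ell2.rep_eq \<delta>)
 qed
qed

text \<open>The index type bounds the dimension, so spaces built from forms stay in the types over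
  which spectrum and crossed product quantify. The construction is a recursion along a well-order;
  the support clause of P keeps the i-th basis vector fresh at stage i.\<close>

lemma gram_realization:
 fixes d :: "'i => 'v"
 obtains g :: "'i => 'i ell2" where "!!i j. cinner (g i) (g j) = s (d i) (d j)"
proof -
 obtain r :: "'i rel" where r: "well_order_on UNIV r" using well_order_on by blast
 define R where "R = r - Id"
 have wf: "wf R" using r by (simp add: well_order_on_def R_def)
 have lin: "linear_order_on UNIV r" using r by (simp add: well_order_on_def)
 have tr: "(a, c) : R" if "(a, b) : R" "(b, c) : R" for a b c
  using that lin unfolding R_def linear_order_on_def partial_order_on_def preorder_on_def trans_def antisym_def by blast
 have tot: "(a, b) : R \<or> a = b \<or> (b, a) : R" for a b
  using lin unfolding R_def linear_order_on_def total_on_def by blast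
 have irr: "(a, a) ~: R" for a by (simp add: R_def)
 define P where "P f i x <-> (ALL k. (k, i) ~: R --> k ~= i --> Rep_ell2 x k = 0) &
  (ALL j. (j, i) : R --> cinner (f j) x = s (d j) (d i)) & cinner x x = s (d i) (d i)"
  for f :: "'i => 'i ell2" and i x
 have "EX g. ALL i. P g i (g i)"
 proof (rule dependent_wf_choice[OF wf])
  fix f g :: "'i => 'i ell2" and i x
  assume "!!z. (z, i) : R ==> f z = g z"
  thus "P f i x = P g i x" by (simp add: P_def)
 next
  fix i and f :: "'i => 'i ell2"
  assume IH: "!!j. (j, i) : R ==> P f j (f j)"
  let ?D = "{j. (j, i) : R}"
  have gD: "cinner (f a) (f b) = s (d a) (d b)" if "(a, b) : R" "b : ?D" for a b
   using IH[of b] that by (simp add: P_def)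
  have "EX x. (ALL j:?D. cinner (f j) x = s (d j) (d i)) & cinner x x = s (d i) (d i) &
   (ALL k. k ~: ?D --> k ~= i --> Rep_ell2 x k = 0)"
  proof (rule gram_step[of ?D f d i "d i"])
   fix a b assume ab: "a : ?D" "b : ?D"
   show "cinner (f a) (f b) = s (d a) (d b)"
    using tot[of a b] gD[OF _ ab(2)] gD[OF _ ab(1), of b] IH[of a] ab cinner_commute[of "f a" "f b"] herm[of "d a" "d b"]
    by (auto simp: P_def)
  next
   fix j k assume jk: "j : ?D" "k ~: ?D"
   hence "(k, j) ~: R" "k ~= j" using tr[of k j i] by auto
   thus "Rep_ell2 (f j) k = 0" using IH[of j] jk(1) by (simp add: P_def)
  next
   show "i ~: ?D" using irr by simp
  next
   fix x assume "!!j. j : ?D ==> cinner (f j) x = s (d j) (d i)" "cinner x x = s (d i) (d i)"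
    "!!k. k ~: ?D ==> k ~= i ==> Rep_ell2 x k = 0"
   thus ?thesis by blast
  qed
  thus "EX x. P f i x" by (auto simp: P_def)
 qed
 then obtain g where g: "!!i. P g i (g i)" by blast
 have 1: "cinner (g a) (g b) = s (d a) (d b)" if "(a, b) : R" for a b
  using g[of b] that by (simp add: P_def)
 have 2: "cinner (g a) (g a) = s (d a) (d a)" for a using g[of a] by (simp add: P_def)
 have "cinner (g i) (g j) = s (d i) (d j)" for i j
  using tot[of i j] 1[of i j] 1[of j i] 2[of i] cinner_commute[of "g i" "g j"] herm[of "d i" "d j"] by auto
 thus thesis by (rule that)
qed

end

lemma semi_inner_cinner: "semi_inner (cinner :: 'h::chilbert_space => 'h => complex)"
proof
 show "cinner x y = cnj (cinner y x)" for x y :: 'h by (rule cinner_commute)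
 show "0 <= Re (cinner x x)" for x :: 'h by (simp add: cinner_self)
qed (simp_all add: cinner_add_right cinner_scaleC_right)

text \<open>Equal Gram matrices make the relation \<open>colink\<close> isometric, hence
  single-valued, and an isometry extends to closures.\<close>

lemma gram_isometry:
 fixes d :: "'i => 'h::chilbert_space" and f :: "'i => 'k::chilbert_space"
 assumes g: "!!i j. i : D ==> j : D ==> cinner (f i) (f j) = cinner (d i) (d j)"
 obtains U where "clin_on (closure (cspan (d ` D))) U" "U ` closure (cspan (d ` D)) = closure (cspan (f ` D))"
  "!!x y. x : closure (cspan (d ` D)) ==> y : closure (cspan (d ` D)) ==> cinner (U x) (U y) = cinner x y"
  "!!i. i : D ==> U (d i) = f i"
proof -
 interpret semi_inner "cinner :: 'h => 'h => complex" by (rule semi_inner_cinner)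
 let ?Y = "cspan (d ` D)" and ?Z = "cspan (f ` D)"
 have Y: "csubspace ?Y" by (rule complex_vector.subspace_span)
 have "EX z. colink d f D y z" if "y : ?Y" for y using that colink_span[of d f D y] by blast
 then obtain T where T: "!!y. y : ?Y ==> colink d f D y (T y)" by metis
 have un: "a = b" if "colink d f D y a" "colink d f D y b" for y a b
 proof -
  have "colink d f D 0 (a - b)" using colink_diff[OF that(2,1)] by simp
  from colink_gram[OF g this this] have "cinner (a - b) (a - b) = 0" by simp
  thus ?thesis by (simp add: cinner_self)
 qed
 have lin: "clin_on ?Y T"
 proof (rule clin_onI)
  fix h k assume hk: "h : ?Y" "k : ?Y"
  show "T (h + k) = T h + T k"
   by (rule un[OF T[OF csub(2)[OF Y hk]] colink_add[OF T[OF hk(2)] T[OF hk(1)]]])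
 next
  fix c h assume h: "h : ?Y"
  show "T (c *C h) = c *C T h"
   by (rule un[OF T[OF csub(4)[OF Y h]] colink_scale[OF T[OF h]]])
 qed
 have iso: "cinner (T x) (T y) = cinner x y" if "x : ?Y" "y : ?Y" for x y
  by (rule colink_gram[OF g T[OF that(1)] T[OF that(2)]])
 have nrm: "norm (T y) = norm y" if "y : ?Y" for y
 proof -
  have "(norm (T y))^2 = (norm y)^2"
   using iso[OF that that] unfolding cinner_self of_real_eq_iff .
  thus ?thesis by (rule power2_eq_imp_eq) simp_all
 qed
 obtain U where U: "clin_on (closure ?Y) U" "!!y. y : ?Y ==> U y = T y"
  "!!x. x : closure ?Y ==> norm (U x) <= 1 * norm x" "!!x. x : closure ?Y ==> U x : closure (T ` ?Y)"
  by (rule extend_operator[OF Y lin, of 1]) (auto simp: nrm)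
 have clY: "csubspace (closure ?Y)" by (rule csubspace_closure[OF Y])
 have lim: "(%n. U (h n)) ----> U x" if "!!n. h n : closure ?Y" "h ----> x" "x : closure ?Y" for h x
 proof (rule LIM_zero_cancel, rule Lim_null_comparison)
  show "\<forall>\<^sub>F n in sequentially. norm (U (h n) - U x) <= 1 * norm (h n - x)"
   using clin_on_lipschitz[OF U(1) clY U(3)] that by (intro always_eventually) blast
  show "(%n. 1 * norm (h n - x)) ----> 0"
   using that(2) by (simp add: LIM_zero tendsto_norm_zero)
 qed
 have isoU: "cinner (U x) (U y) = cinner x y" if xy: "x : closure ?Y" "y : closure ?Y" for x y
 proof -
  obtain p q where p: "!!n. p n : ?Y" "p ----> x" and q: "!!n. q n : ?Y" "q ----> y"
   using xy unfolding closure_sequential by blast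
  have pc: "p n : closure ?Y" "q n : closure ?Y" for n using p(1) q(1) closure_subset by blast+
  have "(%n. cinner (U (p n)) (U (q n))) ----> cinner (U x) (U y)"
   by (intro tendsto_cinner lim pc p q xy)
  moreover have "(%n. cinner (p n) (q n)) ----> cinner x y" by (intro tendsto_cinner p q)
  moreover have "cinner (U (p n)) (U (q n)) = cinner (p n) (q n)" for n
   using iso[OF p(1) q(1)] U(2) p(1) q(1) by simp
  ultimately show ?thesis by (simp add: LIMSEQ_unique)
 qed
 have Uf: "U (d i) = f i" if "i : D" for i
 proof -
  have "d i : ?Y" using that by (intro complex_vector.span_base) blast
  thus ?thesis using U(2) un[OF T colink_base[OF that]] by simp
 qed
 have TY: "T ` ?Y = ?Z"
 proof
  show "T ` ?Y <= ?Z" using T colink_sym[of d f D] colink_span[of f d D] by blast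
  show "?Z <= T ` ?Y"
  proof
   fix z assume "z : ?Z"
   then obtain y where y: "colink d f D y z" using colink_span[of f d D z] colink_sym[of d f D] by blast
   hence "y : ?Y" using colink_span[of d f D y] by blast
   thus "z : T ` ?Y" using un[OF T y] by blast
  qed
 qed
 have "U ` closure ?Y = closure ?Z"
 proof
  show "U ` closure ?Y <= closure ?Z" using U(4) unfolding TY by blast
  show "closure ?Z <= U ` closure ?Y"
  proof
   fix z assume "z : closure ?Z"
   then obtain q where q: "!!n. q n : ?Z" "q ----> z" unfolding closure_sequential by blast
   have "EX y. y : ?Y & q n = T y" for n using q(1)[of n] unfolding TY[symmetric] by blast
   then obtain p where p: "!!n. p n : ?Y" "!!n. q n = T (p n)" by metis
   have "Cauchy p"
   proof (rule metric_CauchyI)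
    fix e :: real assume "0 < e"
    then obtain M where M: "!!m n. m >= M ==> n >= M ==> dist (q m) (q n) < e"
     using LIMSEQ_imp_Cauchy[OF q(2)] metric_CauchyD by meson
    have "dist (p m) (p n) = dist (q m) (q n)" for m n
     unfolding dist_norm p(2) clin_on_diff[OF lin Y p(1) p(1), symmetric]
     by (rule nrm[OF csub(3)[OF Y p(1) p(1)], symmetric])
    hence "dist (p m) (p n) < e" if "m >= M" "n >= M" for m n using M[OF that] by simp
    thus "EX M. ALL m>=M. ALL n>=M. dist (p m) (p n) < e" by blast
   qed
   then obtain x where x: "p ----> x" using Cauchy_convergent convergent_def by blast
   hence xc: "x : closure ?Y" using p(1) by (intro closure_seqI)
   have "(%n. U (p n)) ----> U x" by (rule lim[OF _ x xc]) (rule subsetD[OF closure_subset p(1)])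
   moreover have "U (p n) = q n" for n using U(2) p by simp
   ultimately have "U x = z" using q(2) LIMSEQ_unique by simp
   thus "z : U ` closure ?Y" using xc by blast
  qed
 qed
 from that[OF U(1) this isoU Uf] show thesis .
qed

subsection \<open>Representations\<close>

text \<open>With \<open>1 - b = (1 - t)\<^sup>2\<close> for \<open>b = a\<^sup>* a / \<parallel>a\<parallel>\<^sup>2\<close>, the vector \<open>x - t x\<close> has norm square
 \<open>\<parallel>x\<parallel>\<^sup>2 - \<parallel>a x\<parallel>\<^sup>2 / \<parallel>a\<parallel>\<^sup>2\<close>.\<close>

lemma star_act_bound:
 fixes s :: "'v::complex_vector => 'v => complex" and act :: "'a::cstar_algebra => 'v => 'v"
 assumes V: "csubspace V" and act_in: "!!a x. x : V ==> act a x : V"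
  and addr: "!!x y z. x : V ==> y : V ==> z : V ==> s x (y + z) = s x y + s x z"
  and scr: "!!x y c. x : V ==> y : V ==> s x (c *C y) = c * s x y"
  and herm: "!!x y. x : V ==> y : V ==> s x y = cnj (s y x)"
  and pos: "!!x. x : V ==> 0 <= Re (s x x)"
  and act_add: "!!a b x. x : V ==> act (a + b) x = act a x + act b x"
  and act_scale: "!!c a x. x : V ==> act (c *C a) x = c *C act a x"
  and act_mult: "!!a b x. x : V ==> act (a * b) x = act a (act b x)"
  and act_star: "!!a x y. x : V ==> y : V ==> s (act a x) y = s x (act (star a) y)"
  and x: "x : V"
 shows "Re (s (act a x) (act a x)) <= (norm a)^2 * Re (s x x)"
proof (cases "a = 0")
 case True
 have "act 0 x = 0" using act_scale[OF x, of 0 0] by simp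
 moreover have "s 0 0 = 0" using scr[OF csub(1)[OF V] x, of 0] by simp
 ultimately show ?thesis using True by simp
next
 case False
 define b where "b = cor (1 / (norm a)^2) *C (star a * a)"
 have sb: "star b = b" by (simp add: b_def star_scaleC star_mult star_star)
 have nb: "norm b <= 1" using False by (simp add: b_def norm_scaleC cstar_identity norm_power norm_divide)
 obtain t where t: "star t = t" "t + t - t * t = b" by (rule sqrt_complement[OF sb nb])
 have tb: "b + t * t = t + t" using t(2) by (simp add: algebra_simps)
 define u where "u = act t x"
 have u: "u : V" unfolding u_def by (rule act_in[OF x])
 have xu: "x + (-1) *C u : V" by (intro csub[OF V] x u)
 have uV: "(-1) *C u : V" by (intro csub[OF V] u)
 have addl: "s (p + q) r = s p r + s q r" if "p : V" "q : V" "r : V" for p q r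
 proof -
  have "s (p + q) r = cnj (s r p + s r q)"
   unfolding herm[OF csub(2)[OF V that(1,2)] that(3)] addr[OF that(3,1,2)] ..
  also have "... = cnj (s r p) + cnj (s r q)" by (rule complex_cnj_add)
  also have "... = s p r + s q r" unfolding herm[OF that(1,3), symmetric] herm[OF that(2,3), symmetric] ..
  finally show ?thesis .
 qed
 have scl: "s ((-1) *C p) r = - s p r" if "p : V" "r : V" for p r
 proof -
  have "s ((-1) *C p) r = cnj (-1 * s r p)"
   unfolding herm[OF csub(4)[OF V that(1)] that(2)] scr[OF that(2,1)] ..
  also have "... = - cnj (s r p)" by simp
  also have "... = - s p r" unfolding herm[OF that, symmetric] ..
  finally show ?thesis .
 qed
 have "s (x + (-1) *C u) (x + (-1) *C u) = (s x x + (-1) * s x u) - (s u x + (-1) * s u u)"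
  unfolding addl[OF x uV xu] addr[OF x x uV] scl[OF u xu] addr[OF u x uV] scr[OF x u] scr[OF u u] by simp
 hence e1: "s (x + (-1) *C u) (x + (-1) *C u) = s x x - s x u - s u x + s u u" by simp
 have e2: "s u x = s x u" unfolding u_def using act_star[OF x x, of t] t by simp
 have e3: "s u u = s x (act (t * t) x)"
  unfolding u_def using act_star[OF x act_in[OF x], of t t] t act_mult[OF x, of t t] by simp
 have "s x (act b x) + s x (act (t * t) x) = s x u + s x u"
 proof -
  have "act b x + act (t * t) x = u + u"
   using act_add[OF x, of b "t * t"] act_add[OF x, of t t] tb by (simp add: u_def)
  thus ?thesis using addr[OF x act_in[OF x] act_in[OF x], of b "t * t"] addr[OF x u u] by simp
 qed
 hence e4: "s x (act (t * t) x) = s x u + s x u - s x (act b x)" by (simp only: eq_diff_eq add.commute)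
 have e5: "s x (act b x) = cor (1 / (norm a)^2) * s (act a x) (act a x)"
 proof -
  have "s x (act b x) = cor (1 / (norm a)^2) * s x (act (star a * a) x)"
   unfolding b_def act_scale[OF x] by (rule scr[OF x act_in[OF x]])
  also have "s x (act (star a * a) x) = s (act a x) (act a x)"
   unfolding act_mult[OF x] by (rule act_star[OF x act_in[OF x], symmetric])
  finally show ?thesis .
 qed
 have "s (x + (-1) *C u) (x + (-1) *C u) = s x x - cor (1 / (norm a)^2) * s (act a x) (act a x)"
  unfolding e1 e2 e3 e4 e5 by simp
 hence "0 <= Re (s x x) - 1 / (norm a)^2 * Re (s (act a x) (act a x))"
  using pos[OF xu] by simp
 thus ?thesis using False by (simp add: field_simps)
qed

lemma representationI:
 fixes H :: "'h::chilbert_space set" and \<pi> :: "'a::cstar_algebra => 'h => 'h"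
 assumes H: "hilbert_subspace H" and maps: "!!a h. h : H ==> \<pi> a h : H"
  and lin: "!!a. clin_on H (\<pi> a)"
  and bound: "!!a. EX M. ALL h:H. norm (\<pi> a h) <= M * norm h"
  and add: "!!a b h. h : H ==> \<pi> (a + b) h = \<pi> a h + \<pi> b h"
  and scale: "!!c a h. h : H ==> \<pi> (c *C a) h = c *C \<pi> a h"
  and mult: "!!a b h. h : H ==> \<pi> (a * b) h = \<pi> a (\<pi> b h)"
  and star: "!!a h g. h : H ==> g : H ==> cinner (\<pi> (star a) h) g = cinner h (\<pi> a g)"
 shows "representation H \<pi>"
proof -
 have bo: "bounded_operator H (\<pi> a)" for a
  unfolding bounded_operator_def linear_into_def using maps clin_onD[OF lin] bound by blast
 have "\<pi> (star a) h = adjoint_on H (\<pi> a) h" if "h : H" for a h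
  by (rule adjoint_on_eqI[OF H bo that, symmetric]) (use maps star that in auto)
 thus ?thesis unfolding representation_def using H bo add scale mult by blast
qed

lemma repD:
 assumes "representation H \<pi>"
 shows rep_hilbert: "hilbert_subspace H" and rep_in: "h : H ==> \<pi> a h : H"
  and rep_clin: "clin_on H (\<pi> a)"
  and rep_add: "h : H ==> \<pi> (a + b) h = \<pi> a h + \<pi> b h"
  and rep_scale: "h : H ==> \<pi> (c *C a) h = c *C \<pi> a h"
  and rep_mult: "h : H ==> \<pi> (a * b) h = \<pi> a (\<pi> b h)"
 using assms unfolding representation_def bounded_operator_def linear_into_def clin_on_def by blast+

lemma rep_vadd: "representation H \<pi> ==> h : H ==> k : H ==> \<pi> a (h + k) = \<pi> a h + \<pi> a k"
 using clin_onD(1)[OF rep_clin] by blast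

lemma rep_vscale: "representation H \<pi> ==> h : H ==> \<pi> a (c *C h) = c *C \<pi> a h"
 using clin_onD(2)[OF rep_clin] by blast

lemma rep_vdiff: "representation H \<pi> ==> h : H ==> k : H ==> \<pi> a (h - k) = \<pi> a h - \<pi> a k"
 using clin_on_diff[OF rep_clin hsubD(1)[OF rep_hilbert]] by blast

lemma rep_vzero: "representation H \<pi> ==> \<pi> a 0 = 0"
 using clin_on_0[OF rep_clin hsubD(1)[OF rep_hilbert]] by blast

lemma rep_star:
 assumes "representation H \<pi>" "h : H" "g : H"
 shows "cinner (\<pi> (star a) h) g = cinner h (\<pi> a g)" "cinner (\<pi> a h) g = cinner h (\<pi> (star a) g)"
proof -
 have 1: "cinner (\<pi> (star a) h) g = cinner h (\<pi> a g)" for a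
 proof -
  have bo: "bounded_operator H (\<pi> a)" and st: "\<pi> (star a) h = adjoint_on H (\<pi> a) h"
   using assms unfolding representation_def by blast+
  show ?thesis unfolding st by (rule adjoint_on_props(2)[OF rep_hilbert[OF assms(1)] bo assms(2,3)])
 qed
 show "cinner (\<pi> (star a) h) g = cinner h (\<pi> a g)" by (rule 1)
 show "cinner (\<pi> a h) g = cinner h (\<pi> (star a) g)" using 1[of "star a"] by (simp add: star_star)
qed

lemma rep_norm:
 fixes H :: "'h::chilbert_space set"
 assumes r: "representation H \<pi>" and h: "h : H"
 shows "norm (\<pi> a h) <= norm a * norm h"
proof -
 have "Re (cinner (\<pi> a h) (\<pi> a h)) <= (norm a)^2 * Re (cinner h h)"
 proof (rule star_act_bound[where V = H and act = \<pi> and s = cinner and x = h and a = a])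
  show "csubspace H" by (rule hsubD(1)[OF rep_hilbert[OF r]])
  show "x : H ==> y : H ==> cinner x y = cnj (cinner y x)" for x y by (rule cinner_commute)
  show "0 <= Re (cinner x x)" for x :: 'h by (simp add: cinner_self)
 qed (use h in "simp_all add: rep_in[OF r] cinner_add_right cinner_scaleC_right rep_add[OF r] rep_scale[OF r] rep_mult[OF r] rep_star(2)[OF r]")
 hence "(norm (\<pi> a h))^2 <= (norm a * norm h)^2"
  unfolding cinner_self Re_complex_of_real power_mult_distrib .
 thus ?thesis by (rule power2_le_imp_le) simp
qed

lemma rep_zero: "representation H \<pi> ==> h : H ==> \<pi> 0 h = 0"
 using rep_norm[of H \<pi> h 0] by simp

lemma rep_diff: "representation H \<pi> ==> h : H ==> \<pi> (a - b) h = \<pi> a h - \<pi> b h"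
 using rep_add[of H \<pi> h "a - b" b] by (simp add: algebra_simps)

lemma rep_vlipschitz:
 assumes "representation H \<pi>" "x : H" "y : H" shows "norm (\<pi> a x - \<pi> a y) <= norm a * norm (x - y)"
 by (rule clin_on_lipschitz[OF rep_clin[OF assms(1)] hsubD(1)[OF rep_hilbert[OF assms(1)]] rep_norm[OF assms(1)] assms(2,3)])

lemma rep_tendsto_vec:
 assumes r: "representation H \<pi>" and f: "!!n. f n : H" "f ----> x"
 shows "(%n. \<pi> a (f n)) ----> \<pi> a x"
proof (rule LIM_zero_cancel, rule Lim_null_comparison)
 have x: "x : H" using closed_sequentially[OF hsubD(2)[OF rep_hilbert[OF r]]] f by blast
 show "\<forall>\<^sub>F n in sequentially. norm (\<pi> a (f n) - \<pi> a x) <= norm a * norm (f n - x)"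
  by (intro always_eventually allI rep_vlipschitz[OF r] f x)
 show "(%n. norm a * norm (f n - x)) ----> 0"
  using f(2) by (intro tendsto_mult_right_zero) (simp add: LIM_zero tendsto_norm_zero)
qed

lemma rep_tendsto_alg:
 assumes r: "representation H \<pi>" and x: "x : H" and f: "f ----> a"
 shows "(%n. \<pi> (f n) x) ----> \<pi> a x"
proof (rule LIM_zero_cancel, rule Lim_null_comparison)
 show "\<forall>\<^sub>F n in sequentially. norm (\<pi> (f n) x - \<pi> a x) <= norm (f n - a) * norm x"
  unfolding rep_diff[OF r x, symmetric] by (intro always_eventually allI rep_norm[OF r x])
 show "(%n. norm (f n - a) * norm x) ----> 0"
  using f by (intro tendsto_mult_left_zero) (simp add: LIM_zero tendsto_norm_zero)
qed

lemma rep_from_dense: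
 fixes Y :: "'h::chilbert_space set" and T :: "'a::cstar_algebra => 'h => 'h"
 assumes Y: "csubspace Y" and maps: "!!a y. y : Y ==> T a y : Y" and lin: "!!a. clin_on Y (T a)"
  and bound: "!!a y. y : Y ==> norm (T a y) <= M a * norm y"
  and add: "!!a b y. y : Y ==> T (a + b) y = T a y + T b y"
  and scale: "!!c a y. y : Y ==> T (c *C a) y = c *C T a y"
  and mult: "!!a b y. y : Y ==> T (a * b) y = T a (T b y)"
  and star: "!!a y z. y : Y ==> z : Y ==> cinner (T (star a) y) z = cinner y (T a z)"
 obtains \<Phi> where "representation (closure Y) \<Phi>" "!!a y. y : Y ==> \<Phi> a y = T a y"
proof -
 have "EX S. clin_on (closure Y) S & (ALL y:Y. S y = T a y) & (ALL x:closure Y. norm (S x) <= M a * norm x) &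
  (ALL x:closure Y. S x : closure (T a ` Y))" for a
  by (rule extend_operator[OF Y lin[where a = a] bound[where a = a]]) blast+
 then obtain \<Phi> where \<Phi>: "!!a. clin_on (closure Y) (\<Phi> a)" "!!a y. y : Y ==> \<Phi> a y = T a y"
  "!!a x. x : closure Y ==> norm (\<Phi> a x) <= M a * norm x" "!!a x. x : closure Y ==> \<Phi> a x : closure (T a ` Y)"
  by metis
 have H: "hilbert_subspace (closure Y)" by (rule hsub_closure[OF Y])
 have cY: "csubspace (closure Y)" by (rule csubspace_closure[OF Y])
 have sub: "y : closure Y" if "y : Y" for y using that closure_subset by blast
 have maps': "\<Phi> a x : closure Y" if "x : closure Y" for a x
 proof -
  have "T a ` Y <= Y" using maps by blast
  from closure_mono[OF this] show ?thesis using \<Phi>(4)[OF that, of a] by blast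
 qed
 have tend: "(%n. T a (f n)) ----> \<Phi> a x" if "!!n. f n : Y" "f ----> x" for f a x
 proof -
  have x: "x : closure Y" by (rule closure_seqI[OF that])
  have "(%n. \<Phi> a (f n)) ----> \<Phi> a x"
  proof (rule LIM_zero_cancel, rule Lim_null_comparison)
   have "norm (\<Phi> a (f n) - \<Phi> a x) <= M a * norm (f n - x)" for n
    by (rule clin_on_lipschitz[OF \<Phi>(1) cY \<Phi>(3) sub[OF that(1)] x])
   thus "\<forall>\<^sub>F n in sequentially. norm (\<Phi> a (f n) - \<Phi> a x) <= M a * norm (f n - x)"
    by (intro always_eventually allI)
   show "(%n. M a * norm (f n - x)) ----> 0"
    using that(2) by (intro tendsto_mult_right_zero) (simp add: LIM_zero tendsto_norm_zero)
  qed
  thus ?thesis using \<Phi>(2) that(1) by simp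
 qed
 have "representation (closure Y) \<Phi>"
 proof (rule representationI[OF H])
  show "\<Phi> a x : closure Y" if "x : closure Y" for a x by (rule maps'[OF that])
  show "clin_on (closure Y) (\<Phi> a)" for a by (rule \<Phi>(1))
  show "EX M. ALL h:closure Y. norm (\<Phi> a h) <= M * norm h" for a using \<Phi>(3) by blast
 next
  fix a b h assume "h : closure Y"
  then obtain f where f: "!!n. f n : Y" "f ----> h" unfolding closure_sequential by blast
  have "(%n. T a (f n) + T b (f n)) ----> \<Phi> a h + \<Phi> b h" by (intro tendsto_add tend f)
  moreover have "(%n. T (a + b) (f n)) ----> \<Phi> (a + b) h" by (intro tend f)
  ultimately show "\<Phi> (a + b) h = \<Phi> a h + \<Phi> b h" using add[OF f(1)] by (simp add: LIMSEQ_unique)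
  have "(%n. T a (T b (f n))) ----> \<Phi> a (\<Phi> b h)" by (intro tend maps f)
  moreover have "(%n. T (a * b) (f n)) ----> \<Phi> (a * b) h" by (intro tend f)
  ultimately show "\<Phi> (a * b) h = \<Phi> a (\<Phi> b h)" using mult[OF f(1)] by (simp add: LIMSEQ_unique)
 next
  fix c a h assume "h : closure Y"
  then obtain f where f: "!!n. f n : Y" "f ----> h" unfolding closure_sequential by blast
  have "(%n. c *C T a (f n)) ----> c *C \<Phi> a h" by (intro tendsto_scaleC_h tend f)
  moreover have "(%n. T (c *C a) (f n)) ----> \<Phi> (c *C a) h" by (intro tend f)
  ultimately show "\<Phi> (c *C a) h = c *C \<Phi> a h" using scale[OF f(1)] by (simp add: LIMSEQ_unique)
 next
  fix a h k assume "h : closure Y" "k : closure Y"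
  then obtain f g where f: "!!n. f n : Y" "f ----> h" and g: "!!n. g n : Y" "g ----> k"
   unfolding closure_sequential by blast
  have "(%n. cinner (T (star a) (f n)) (g n)) ----> cinner (\<Phi> (star a) h) k" by (intro tendsto_cinner tend f g)
  moreover have "(%n. cinner (f n) (T a (g n))) ----> cinner h (\<Phi> a k)" by (intro tendsto_cinner tend f g)
  ultimately show "cinner (\<Phi> (star a) h) k = cinner h (\<Phi> a k)" using star[OF f(1) g(1)] by (simp add: LIMSEQ_unique)
 qed
 thus thesis using that \<Phi>(2) by blast
qed

text \<open>The common core of the GNS construction and of Rieffel induction.\<close>

lemma (in semi_inner) gns:
 fixes act :: "'a::cstar_algebra => 'v => 'v"
 assumes act_vadd: "!!a x y. act a (x + y) = act a x + act a y"
  and act_vscale: "!!a c x. act a (c *C x) = c *C act a x"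
  and act_add: "!!a b x. act (a + b) x = act a x + act b x"
  and act_scale: "!!c a x. act (c *C a) x = c *C act a x"
  and act_mult: "!!a b x. act (a * b) x = act a (act b x)"
  and act_star: "!!a x y. s (act a x) y = s x (act (star a) y)"
 obtains g :: "'v => 'v ell2" and \<Phi> where "!!x y. g (x + y) = g x + g y" "!!c x. g (c *C x) = c *C g x"
  "!!x y. cinner (g x) (g y) = s x y" "csubspace (range g)" "representation (closure (range g)) \<Phi>"
  "!!a x. \<Phi> a (g x) = g (act a x)"
proof -
 obtain g :: "'v => 'v ell2" where g: "!!x y. cinner (g x) (g y) = s x y"
  using gram_realization[where d = "%x::'v. x"] by metis
 have eqI: "a = b" if "cinner (a - b) (a - b) = 0" for a b :: "'v ell2"
  using that by (simp add: cinner_self)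
 have gadd: "g (x + y) = g x + g y" for x y
  by (rule eqI) (simp add: cinner_diff_left cinner_diff_right cinner_add_left cinner_add_right g add_left add_right)
 have gsc: "g (c *C x) = c *C g x" for c x
  by (rule eqI) (simp add: cinner_diff_left cinner_diff_right cinner_scaleC_left cinner_scaleC_right g scale_left scale_right)
 have g0: "g 0 = 0" using gsc[of 0 0] by simp
 have Y: "csubspace (range g)"
 proof (rule csubspaceI)
  show "0 : range g" using rangeI[of g 0] g0 by simp
  show "x + y : range g" if "x : range g" "y : range g" for x y using that by (auto simp flip: gadd)
  show "c *C x : range g" if "x : range g" for c x using that by (auto simp flip: gsc)
 qed
 have b: "Re (s (act a x) (act a x)) <= (norm a)^2 * Re (s x x)" for a x
  by (rule star_act_bound[where V = UNIV and act = act])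
    (simp_all add: complex_vector.subspace_UNIV add_right scale_right nonneg act_add act_scale act_mult act_star herm[symmetric])
 have ng: "(norm (g x))^2 = Re (s x x)" for x
  unfolding g[symmetric] cinner_self Re_complex_of_real ..
 have bd: "norm (g (act a x)) <= norm a * norm (g x)" for a x
 proof (rule power2_le_imp_le)
  show "(norm (g (act a x)))^2 <= (norm a * norm (g x))^2" unfolding power_mult_distrib ng by (rule b)
 qed simp
 \<comment> \<open>\<open>inv g\<close> picks some preimage of y. By \<open>bd\<close> null vectors
   stay null under the action, so the choice does not matter.\<close>
 define T where "T a y = g (act a (inv g y))" for a y
 have T: "T a (g x) = g (act a x)" for a x
 proof -
  let ?y = "inv g (g x)"
  have y: "g ?y = g x" by (rule f_inv_into_f[OF rangeI])
  have "g (?y + (-1) *C x) = 0" unfolding gadd gsc y by simp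
  hence "norm (g (act a (?y + (-1) *C x))) <= 0" using bd[of a "?y + (-1) *C x"] by simp
  hence "g (act a ?y) + (-1) *C g (act a x) = 0" unfolding act_vadd act_vscale gadd gsc by simp
  thus ?thesis by (simp add: T_def)
 qed
 obtain \<Phi> where \<Phi>: "representation (closure (range g)) \<Phi>" "!!a y. y : range g ==> \<Phi> a y = T a y"
 proof (rule rep_from_dense[OF Y, of T norm])
  show "T a y : range g" for a y by (simp add: T_def)
  show "clin_on (range g) (T a)" for a
  proof (rule clin_onI)
   fix h k assume "h : range g" "k : range g"
   then obtain x y where "h = g x" "k = g y" by blast
   thus "T a (h + k) = T a h + T a k" by (simp add: gadd[symmetric] T act_vadd)
  next
   fix c h assume "h : range g"
   then obtain x where "h = g x" by blast
   thus "T a (c *C h) = c *C T a h" by (simp add: gsc[symmetric] T act_vscale)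
  qed
  fix \<Phi> assume "representation (closure (range g)) \<Phi>" "!!a y. y : range g ==> \<Phi> a y = T a y"
  thus thesis by (rule that)
 qed (auto simp: T bd act_add act_scale act_mult gadd gsc g act_star star_star)
 thus thesis using that[OF gadd gsc g Y \<Phi>(1)] T by simp
qed

subsection \<open>Unitary equivalence and irreducibility\<close>

text \<open>Unitary equivalence across two Hilbert space types; \<open>unitarily_equivalent\<close>
  compares representations within one.\<close>

definition rep_iso :: "'h::chilbert_space set => ('a => 'h => 'h) => 'k::chilbert_space set => ('a => 'k => 'k) => ('h => 'k) => bool"
 where "rep_iso H \<pi> K \<rho> U <-> clin_on H U & U ` H = K & (ALL h:H. ALL k:H. cinner (U h) (U k) = cinner h k) &
  (ALL a. ALL h:H. U (\<pi> a h) = \<rho> a (U h))"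

lemma rep_isoD:
 assumes "rep_iso H \<pi> K \<rho> U"
 shows "clin_on H U" "U ` H = K" "h : H ==> k : H ==> cinner (U h) (U k) = cinner h k" "h : H ==> U (\<pi> a h) = \<rho> a (U h)"
  "h : H ==> U h : K"
 using assms by (auto simp: rep_iso_def)

lemma unitarily_equivalent_iff: "unitarily_equivalent (H, \<pi>) (K, \<rho>) <-> (EX U. rep_iso H \<pi> K \<rho> U)"
 unfolding unitarily_equivalent_def rep_iso_def linear_into_def clin_on_def by auto

lemma isometry_norm:
 assumes "!!h k. h : H ==> k : H ==> cinner (U h) (U k) = cinner h k" "h : H"
 shows "norm (U h :: 'k::chilbert_space) = norm (h :: 'h::chilbert_space)"
proof -
 have "(norm (U h))^2 = (norm h)^2" using assms(1)[OF assms(2,2)] unfolding cinner_self of_real_eq_iff .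
 thus ?thesis by (rule power2_eq_imp_eq) simp_all
qed

lemma isometry_inj:
 assumes U: "clin_on H U" "!!h k. h : H ==> k : H ==> cinner (U h) (U k) = cinner h k" and H: "csubspace H"
 shows "inj_on (U :: 'h::chilbert_space => 'k::chilbert_space) H"
proof (rule inj_onI)
 fix x y assume xy: "x : H" "y : H" "U x = U y"
 hence "U (x - y) = 0" using clin_on_diff[OF U(1) H xy(1,2)] by simp
 thus "x = y" using isometry_norm[of H U "x - y"] U(2) csub(3)[OF H xy(1,2)] by simp
qed

lemma isometry_image_hilbert:
 fixes U :: "'h::chilbert_space => 'k::chilbert_space"
 assumes U: "clin_on H U" "!!h k. h : H ==> k : H ==> cinner (U h) (U k) = cinner h k" and H: "hilbert_subspace H"
 shows "hilbert_subspace (U ` H)"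
 unfolding hilbert_subspace_def
proof
 note HD = hsubD[OF H]
 show "csubspace (U ` H)"
 proof (rule csubspaceI)
  show "0 : U ` H" using clin_on_0[OF U(1) HD(1)] HD(3) by (metis imageI)
  show "x + y : U ` H" if "x : U ` H" "y : U ` H" for x y
  proof -
   obtain h k where "h : H" "k : H" "x = U h" "y = U k" using `x : _` `y : _` by blast
   thus ?thesis using clin_onD(1)[OF U(1), of h k] HD(4) by (metis imageI)
  qed
  show "c *C x : U ` H" if "x : U ` H" for c x
  proof -
   obtain h where "h : H" "x = U h" using `x : _` by blast
   thus ?thesis using clin_onD(2)[OF U(1), of h c] HD(6) by (metis imageI)
  qed
 qed
 have "complete (U ` H)"
 proof (rule completeI)
  fix f assume f: "ALL n. f n : U ` H" "Cauchy f"
  hence "EX h. h : H & f n = U h" for n by blast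
  then obtain h where h: "!!n. h n : H" "!!n. f n = U (h n)" by metis
  have d: "dist (h m) (h n) = dist (f m) (f n)" for m n
   unfolding dist_norm h(2) clin_on_diff[OF U(1) HD(1) h(1) h(1), symmetric]
   by (rule isometry_norm[OF U(2) HD(5)[OF h(1) h(1)], symmetric])
  have "Cauchy h" using f(2) unfolding Cauchy_def d .
  then obtain x where x: "h ----> x" using Cauchy_convergent convergent_def by blast
  have xH: "x : H" by (rule closed_sequentially[OF HD(2) h(1) x])
  have "f ----> U x"
  proof (rule LIM_zero_cancel, rule Lim_null_comparison)
   have "norm (f n - U x) <= norm (h n - x)" for n
    unfolding h(2) clin_on_diff[OF U(1) HD(1) h(1) xH, symmetric]
    by (rule eq_refl[OF isometry_norm[OF U(2) HD(5)[OF h(1) xH]]])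
   thus "\<forall>\<^sub>F n in sequentially. norm (f n - U x) <= norm (h n - x)"
    by (intro always_eventually allI)
   show "(%n. norm (h n - x)) ----> 0" using x by (simp add: LIM_zero tendsto_norm_zero)
  qed
  thus "EX l:U ` H. f ----> l" using xH by blast
 qed
 thus "closed (U ` H)" by (rule complete_imp_closed)
qed

lemma rep_iso_refl: "rep_iso H \<pi> H \<pi> (%x. x)"
 by (simp add: rep_iso_def clin_on_def)

lemma rep_iso_trans:
 assumes "rep_iso H \<pi> K \<rho> U" "rep_iso K \<rho> L \<sigma> V" shows "rep_iso H \<pi> L \<sigma> (V \<circ> U)"
 unfolding rep_iso_def
proof (intro conjI ballI allI)
 note u = rep_isoD[OF assms(1)] and v = rep_isoD[OF assms(2)]
 show "clin_on H (V \<circ> U)"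
  by (rule clin_onI) (simp_all add: clin_onD[OF u(1)] clin_onD[OF v(1)] u(5))
 show "(V \<circ> U) ` H = L" unfolding image_comp[symmetric] u(2) v(2) ..
 show "cinner ((V \<circ> U) h) ((V \<circ> U) k) = cinner h k" if "h : H" "k : H" for h k
  using that by (simp add: u v)
 show "(V \<circ> U) (\<pi> a h) = \<sigma> a ((V \<circ> U) h)" if "h : H" for a h
  using that by (simp add: u v)
qed

lemma rep_iso_inverse:
 assumes r: "representation H \<pi>" and iso: "rep_iso H \<pi> K \<rho> U"
 obtains V where "rep_iso K \<rho> H \<pi> V" "!!h. h : H ==> V (U h) = h" "!!k. k : K ==> U (V k) = k"
proof -
 note u = rep_isoD[OF iso] and HD = hsubD[OF rep_hilbert[OF r]]
 have inj: "inj_on U H" by (rule isometry_inj[OF u(1) u(3) HD(1)])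
 define V where "V = inv_into H U"
 have VU: "V (U h) = h" if "h : H" for h unfolding V_def using inj that by (rule inv_into_f_f)
 have UV: "U (V k) = k" and VH: "V k : H" if "k : K" for k
  using that unfolding V_def u(2)[symmetric] by (auto intro: f_inv_into_f inv_into_into)
 have "rep_iso K \<rho> H \<pi> V"
  unfolding rep_iso_def
 proof (intro conjI ballI allI)
  show "clin_on K V"
  proof (rule clin_onI)
   show "V (h + k) = V h + V k" if "h : K" "k : K" for h k
    using VU[OF HD(4)[OF VH[OF that(1)] VH[OF that(2)]]] clin_onD(1)[OF u(1) VH[OF that(1)] VH[OF that(2)]] UV that by simp
   show "V (c *C h) = c *C V h" if "h : K" for c h
    using VU[OF HD(6)[OF VH[OF that]]] clin_onD(2)[OF u(1) VH[OF that]] UV that by simp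
  qed
  show "V ` K = H" using VU VH u(5) by force
  show "cinner (V h) (V k) = cinner h k" if "h : K" "k : K" for h k
   using u(3)[OF VH[OF that(1)] VH[OF that(2)]] UV that by simp
  show "V (\<rho> a h) = \<pi> a (V h)" if "h : K" for a h
   using VU[OF rep_in[OF r VH[OF that], of a]] u(4)[OF VH[OF that], of a] UV[OF that] by simp
 qed
 thus thesis using that VU UV by blast
qed

lemma rep_transport:
 fixes U :: "'h::chilbert_space => 'k::chilbert_space"
 assumes r: "representation H (\<pi> :: 'a::cstar_algebra => 'h => 'h)" and U: "clin_on H U" "!!h k. h : H ==> k : H ==> cinner (U h) (U k) = cinner h k"
 obtains \<rho> where "representation (U ` H) \<rho>" "rep_iso H \<pi> (U ` H) \<rho> U"
proof -
 note HD = hsubD[OF rep_hilbert[OF r]]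
 have inj: "inj_on U H" by (rule isometry_inj[OF U HD(1)])
 define \<rho> where "\<rho> a k = U (\<pi> a (inv_into H U k))" for a k
 have \<rho>: "\<rho> a (U h) = U (\<pi> a h)" if "h : H" for a h
  unfolding \<rho>_def using inj that by simp
 have iso: "rep_iso H \<pi> (U ` H) \<rho> U"
  unfolding rep_iso_def using U \<rho> by simp
 have "representation (U ` H) \<rho>"
 proof (rule representationI)
  show "hilbert_subspace (U ` H)" by (rule isometry_image_hilbert[OF U rep_hilbert[OF r]])
  show "clin_on (U ` H) (\<rho> a)" for a
  proof (rule clin_onI)
   fix x y assume "x : U ` H" "y : U ` H"
   then obtain h k where hk: "h : H" "k : H" "x = U h" "y = U k" by blast
   hence "\<rho> a (x + y) = U (\<pi> a (h + k))" using \<rho>[OF HD(4)] clin_onD(1)[OF U(1)] by simp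
   thus "\<rho> a (x + y) = \<rho> a x + \<rho> a y"
    using hk rep_vadd[OF r hk(1,2)] clin_onD(1)[OF U(1) rep_in[OF r hk(1)] rep_in[OF r hk(2)]] \<rho> by simp
  next
   fix c x assume "x : U ` H"
   then obtain h where h: "h : H" "x = U h" by blast
   hence "\<rho> a (c *C x) = U (\<pi> a (c *C h))" using \<rho>[OF HD(6)] clin_onD(2)[OF U(1)] by simp
   thus "\<rho> a (c *C x) = c *C \<rho> a x"
    using h rep_vscale[OF r h(1)] clin_onD(2)[OF U(1) rep_in[OF r h(1)]] \<rho> by simp
  qed
  show "EX M. ALL h:U ` H. norm (\<rho> a h) <= M * norm h" for a
  proof (intro exI[of _ "norm a"] ballI)
   fix x assume "x : U ` H"
   then obtain h where h: "h : H" "x = U h" by blast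
   show "norm (\<rho> a x) <= norm a * norm x"
    unfolding h(2) \<rho>[OF h(1)] using rep_norm[OF r h(1), of a] isometry_norm[OF U(2)] h(1) rep_in[OF r h(1)] by simp
  qed
 qed (auto simp: \<rho> rep_in[OF r] rep_add[OF r] rep_scale[OF r] rep_mult[OF r] U(2) clin_onD[OF U(1)] rep_star(1)[OF r])
 thus thesis using that iso by blast
qed

lemma irrepD:
 assumes "irrep H \<pi>"
 shows "representation H \<pi>" "EX a. EX h:H. \<pi> a h ~= 0"
  "hilbert_subspace L ==> L <= H ==> (!!a h. h : L ==> \<pi> a h : L) ==> L = {0} \<or> L = H"
 using assms unfolding irreducible_rep_def by auto

lemma irreducible_repI:
 assumes "representation H \<pi>" "h : H" "\<pi> a h ~= 0"
  "!!L. hilbert_subspace L ==> L <= H ==> (!!a h. h : L ==> \<pi> a h : L) ==> L = {0} \<or> L = H"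
 shows "irrep H \<pi>"
 unfolding irreducible_rep_def using assms by blast

lemma irreducible_iso:
 assumes irr: "irrep H \<pi>" and K: "representation K \<rho>" and iso: "rep_iso H \<pi> K \<rho> U"
 shows "irrep K \<rho>"
proof -
 have r: "representation H \<pi>" by (rule irrepD(1)[OF irr])
 obtain V where V: "rep_iso K \<rho> H \<pi> V" "!!h. h : H ==> V (U h) = h" "!!k. k : K ==> U (V k) = k"
  using rep_iso_inverse[OF r iso] by blast
 note u = rep_isoD[OF iso] and v = rep_isoD[OF V(1)]
 obtain a h where ah: "h : H" "\<pi> a h ~= 0" using irrepD(2)[OF irr] by blast
 have "\<rho> a (U h) ~= 0"
 proof -
  have "norm (U (\<pi> a h)) = norm (\<pi> a h)" by (rule isometry_norm[OF u(3) rep_in[OF r ah(1)]])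
  thus ?thesis using ah(2) u(4)[OF ah(1), of a] by auto
 qed
 with K u(5)[OF ah(1)] show ?thesis
 proof (rule irreducible_repI)
  fix L assume L: "hilbert_subspace L" "L <= K" "!!a h. h : L ==> \<rho> a h : L"
  have cl: "clin_on L V" using clin_onD[OF v(1)] L(2) unfolding clin_on_def by blast
  have iL: "cinner (V h) (V k) = cinner h k" if "h : L" "k : L" for h k using v(3) that L(2) by blast
  have "V ` L = {0} \<or> V ` L = H"
  proof (rule irrepD(3)[OF irr])
   show "hilbert_subspace (V ` L)" by (rule isometry_image_hilbert[OF cl iL L(1)])
   show "V ` L <= H" using v(5) L(2) by blast
   show "\<pi> a h : V ` L" if "h : V ` L" for a h
   proof -
    obtain k where k: "k : L" "h = V k" using `h : _` by blast
    have "V (\<rho> a k) = \<pi> a (V k)" by (rule v(4)) (use k(1) L(2) in blast)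
    thus ?thesis using imageI[OF L(3)[OF k(1), of a], of V] k(2) by simp
   qed
  qed
  thus "L = {0} \<or> L = K"
  proof
   assume 0: "V ` L = {0}"
   have "k = 0" if "k : L" for k
   proof -
    have "V k = 0" using 0 that by blast
    moreover have "norm (V k) = norm k" by (rule isometry_norm[OF iL that])
    ultimately show ?thesis by simp
   qed
   thus ?thesis using hsubD(3)[OF L(1)] by blast
  next
   assume 1: "V ` L = H"
   have "K <= L"
   proof
    fix k assume k: "k : K"
    then obtain l where l: "l : L" "V k = V l" using v(5)[OF k] 1 by blast
    hence "k = l" using V(3)[OF k] V(3)[of l] L(2) by auto
    thus "k : L" using l by simp
   qed
   thus ?thesis using L(2) by blast
  qed
 qed
qed

lemma hilbert_subspace_null:
 assumes r: "representation H \<pi>" shows "hilbert_subspace {h : H. ALL a:S. \<pi> a h = 0}"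
 unfolding hilbert_subspace_def
proof
 note HD = hsubD[OF rep_hilbert[OF r]]
 show "csubspace {h : H. ALL a:S. \<pi> a h = 0}"
  by (rule csubspaceI) (auto simp: HD rep_vzero[OF r] rep_vadd[OF r] rep_vscale[OF r])
 show "closed {h : H. ALL a:S. \<pi> a h = 0}"
  unfolding closed_sequential_limits
 proof (intro allI impI, elim conjE)
  fix f l assume f: "ALL n. f n : {h : H. ALL a:S. \<pi> a h = 0}" "f ----> l"
  have "l : H" by (rule closed_sequentially[OF HD(2) _ f(2)]) (use f(1) in blast)
  moreover have "\<pi> a l = 0" if "a : S" for a
  proof -
   have "(%n. \<pi> a (f n)) ----> \<pi> a l" by (rule rep_tendsto_vec[OF r _ f(2)]) (use f(1) in blast)
   moreover have "\<pi> a (f n) = 0" for n using f(1) that by blast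
   ultimately show ?thesis by (simp add: LIMSEQ_const_iff)
  qed
  ultimately show "l : {h : H. ALL a:S. \<pi> a h = 0}" by blast
 qed
qed

text \<open>The vectors killed by a right ideal form a closed invariant subspace, and one vector
  that survives makes it proper.\<close>

lemma irreducible_nondegenerate:
 assumes irr: "irrep H \<pi>" and I: "!!a i. i : I ==> i * a : I"
  and nz: "i : I" "k : H" "\<pi> i k ~= 0" and h: "h : H" "!!i. i : I ==> \<pi> i h = 0"
 shows "h = 0"
proof -
 have r: "representation H \<pi>" by (rule irrepD(1)[OF irr])
 let ?L = "{h : H. ALL a:I. \<pi> a h = 0}"
 have "?L = {0} \<or> ?L = H"
 proof (rule irrepD(3)[OF irr hilbert_subspace_null[OF r]])
  fix a h assume h: "h : ?L"
  have "\<pi> i (\<pi> a h) = 0" if "i : I" for i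
   using rep_mult[OF r, of h i a] I[OF that, of a] h by auto
  thus "\<pi> a h : ?L" using h rep_in[OF r] by blast
 qed blast
 moreover have "?L ~= H" using nz by blast
 ultimately show ?thesis using h by blast
qed

lemma csubspace_orbit:
 assumes r: "representation H \<pi>" and h: "h : H" and I: "csubspace I"
 shows "csubspace ((%a. \<pi> a h) ` I)"
proof (rule csubspaceI)
 note sI = csub[OF I]
 show "0 : (%a. \<pi> a h) ` I" using rep_zero[OF r h] sI(1) by (metis imageI)
 show "x + y : (%a. \<pi> a h) ` I" if "x : (%a. \<pi> a h) ` I" "y : (%a. \<pi> a h) ` I" for x y
 proof -
  obtain a b where "a : I" "b : I" "x = \<pi> a h" "y = \<pi> b h" using `x : _` `y : _` by blast
  thus ?thesis using rep_add[OF r h, of a b] sI(2) by (metis imageI)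
 qed
 show "c *C x : (%a. \<pi> a h) ` I" if "x : (%a. \<pi> a h) ` I" for c x
 proof -
  obtain a where "a : I" "x = \<pi> a h" using `x : _` by blast
  thus ?thesis using rep_scale[OF r h, of c a] sI(4) by (metis imageI)
 qed
qed

text \<open>The orbit of h under I is invariant, and by \<open>irreducible_nondegenerate\<close> it
  is not zero.\<close>

lemma irreducible_cyclic:
 assumes irr: "irrep H \<pi>" and I: "csubspace I" "!!a i. i : I ==> i * a : I" "!!a i. i : I ==> a * i : I"
  and nz: "i : I" "k : H" "\<pi> i k ~= 0" and h: "h : H" "h ~= 0"
 shows "closure ((%a. \<pi> a h) ` I) = H"
proof -
 have r: "representation H \<pi>" by (rule irrepD(1)[OF irr])
 let ?Y = "(%a. \<pi> a h) ` I"
 have Y: "csubspace ?Y" by (rule csubspace_orbit[OF r h(1) I(1)])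
 have "closure ?Y = {0} \<or> closure ?Y = H"
 proof (rule irrepD(3)[OF irr hsub_closure[OF Y]])
  show "closure ?Y <= H" using hsubD(2)[OF rep_hilbert[OF r]] rep_in[OF r h(1)] by (intro closure_minimal) auto
  hence YH: "x : H" if "x : closure ?Y" for x using that by blast
  fix a x assume "x : closure ?Y"
  then obtain f where f: "!!n. f n : ?Y" "f ----> x" unfolding closure_sequential by blast
  have "f n : H" for n using f(1) YH closure_subset by blast
  hence "(%n. \<pi> a (f n)) ----> \<pi> a x" by (rule rep_tendsto_vec[OF r _ f(2)])
  moreover have "\<pi> a (f n) : ?Y" for n
  proof -
   obtain b where b: "b : I" "f n = \<pi> b h" using f(1) by blast
   hence "\<pi> a (f n) = \<pi> (a * b) h" using rep_mult[OF r h(1), of a b] by simp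
   thus ?thesis using I(3)[OF b(1)] by blast
  qed
  ultimately show "\<pi> a x : closure ?Y" by (rule closure_seqI[rotated])
 qed
 moreover have "closure ?Y ~= {0}"
 proof
  assume "closure ?Y = {0}"
  hence "\<pi> i h = 0" if "i : I" for i using that closure_subset[of ?Y] by blast
  hence "h = 0" using irreducible_nondegenerate[OF irr I(2) nz h(1)] by blast
  thus False using h by simp
 qed
 ultimately show ?thesis by blast
qed

section \<open>Moving irreducible representations to \<open>'a ell2\<close>\<close>

lemma compress:
 fixes d :: "'i => 'h::chilbert_space"
 assumes "closure (cspan (range d)) = H"
 shows "EX U :: 'h => 'i ell2. clin_on H U & (ALL h:H. ALL k:H. cinner (U h) (U k) = cinner h k)"
proof -
 interpret semi_inner "cinner :: 'h => 'h => complex" by (rule semi_inner_cinner)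
 obtain g :: "'i => 'i ell2" where g: "!!i j. cinner (g i) (g j) = cinner (d i) (d j)"
  using gram_realization[of d] by blast
 show ?thesis
 proof (rule gram_isometry[of UNIV g d])
  show "cinner (g i) (g j) = cinner (d i) (d j)" for i j by (rule g)
  fix U :: "'h => 'i ell2"
  assume 1: "clin_on (closure (cspan (range d))) U"
   and 2: "!!x y. x : closure (cspan (range d)) ==> y : closure (cspan (range d)) ==> cinner (U x) (U y) = cinner x y"
  show ?thesis using 1 2 unfolding assms by (intro exI[of _ U] conjI ballI)
 qed
qed

lemma irreducible_compress:
 fixes H :: "'h::chilbert_space set" and \<pi> :: "'a::cstar_algebra => 'h => 'h" and d :: "'i => 'h"
 assumes irr: "irrep H \<pi>" and h: "h : H" "h ~= 0" and d: "!!a. \<pi> a h : closure (cspan (range d))"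
  and dH: "range d <= H"
 obtains K :: "'i ell2 set" and \<rho> U where "irrep K \<rho>" "rep_iso H \<pi> K \<rho> U"
proof -
 have r: "representation H \<pi>" by (rule irrepD(1)[OF irr])
 note HD = hsubD[OF rep_hilbert[OF r]]
 obtain a k where ak: "k : H" "\<pi> a k ~= 0" using irrepD(2)[OF irr] by blast
 have "closure (range (%a. \<pi> a h)) = H"
  by (rule irreducible_cyclic[OF irr _ _ _ _ ak h]) (auto simp: complex_vector.subspace_UNIV)
 hence "H <= closure (cspan (range d))" using d by (metis closure_minimal closed_closure image_subset_iff)
 moreover have "closure (cspan (range d)) <= H"
  using dH HD by (intro closure_minimal complex_vector.span_minimal) auto
 ultimately have eqH: "closure (cspan (range d)) = H" by blast
 obtain U :: "'h => 'i ell2" where U: "clin_on H U" "!!h k. h : H ==> k : H ==> cinner (U h) (U k) = cinner h k"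
  using compress[OF eqH] by blast
 obtain \<rho> where \<rho>: "representation (U ` H) \<rho>" "rep_iso H \<pi> (U ` H) \<rho> U" by (rule rep_transport[OF r U])
 show thesis by (rule that[OF irreducible_iso[OF irr \<rho>] \<rho>(2)])
qed

text \<open>The orbit of one vector is dense and indexed by the algebra. So every irreducible
  representation, on whatever type, has a copy among those from which \<open>spectrum\<close> is
  formed.\<close>

lemma irreducible_compress':
 fixes H :: "'h::chilbert_space set" and \<pi> :: "'a::cstar_algebra => 'h => 'h"
 assumes irr: "irrep H \<pi>"
 obtains K :: "'a ell2 set" and \<rho> U where "irrep K \<rho>" "rep_iso H \<pi> K \<rho> U"
proof -
 have r: "representation H \<pi>" by (rule irrepD(1)[OF irr])
 obtain a h where ah: "h : H" "\<pi> a h ~= 0" using irrepD(2)[OF irr] by blast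
 have h0: "h ~= 0" using ah rep_vzero[OF r] by auto
 have d1: "\<pi> b h : closure (cspan (range (%a. \<pi> a h)))" for b
  by (rule subsetD[OF closure_subset complex_vector.span_base[OF rangeI]])
 have d2: "range (%a. \<pi> a h) <= H" using rep_in[OF r ah(1)] by blast
 show thesis by (rule irreducible_compress[OF irr ah(1) h0 d1 d2]) (rule that)
qed

subsection \<open>Sublinear functionals and extreme points\<close>

definition sublinear :: "('v::real_vector => real) => bool"
 where "sublinear q <-> (ALL x y. q (x + y) <= q x + q y) & (ALL r>0. ALL x. q (r *R x) <= r * q x)"

lemma sublinearD:
 assumes "sublinear q"
 shows "q (x + y) <= q x + q y" "0 < r ==> q (r *R x) <= r * q x"
 using assms by (auto simp: sublinear_def)

lemma sublinear_scale:
 assumes "sublinear q" "0 < r" shows "q (r *R x) = r * q x"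
proof (rule antisym)
 show "q (r *R x) <= r * q x" by (rule sublinearD(2)[OF assms])
 have "q ((1/r) *R (r *R x)) <= (1/r) * q (r *R x)" using assms by (intro sublinearD(2)) simp_all
 hence "q x <= (1/r) * q (r *R x)" using assms(2) by simp
 hence "r * q x <= r * ((1/r) * q (r *R x))" using assms(2) by (intro mult_left_mono) simp_all
 thus "r * q x <= q (r *R x)" using assms(2) by simp
qed

lemma sublinear_0: "sublinear q ==> q 0 = 0"
 using sublinear_scale[of q 2 0] by simp

lemma sublinear_scale0: "sublinear q ==> 0 <= r ==> q (r *R x) = r * q x"
 using sublinear_scale[of q r x] sublinear_0[of q] by (cases "r = 0") auto

lemma sublinear_neg: "sublinear q ==> - q (- x) <= q x"
 using sublinearD(1)[of q x "- x"] sublinear_0[of q] by simp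

text \<open>A sublinear q stands for the set of linear functionals below it; the last clause says
  that this set is a face of the one belonging to p. Infima of chains of sublinear functions then do
  the work of weak-* compactness.\<close>

definition dom_face :: "('v::real_vector => real) => ('v => real) => bool"
 where "dom_face q p <-> sublinear q & (ALL x. q x <= p x) &
  (ALL f1 f2 l. linear f1 --> linear f2 --> (ALL x. f1 x <= p x) --> (ALL x. f2 x <= p x) --> 0 < l --> l < 1 -->
   (ALL x. l * f1 x + (1 - l) * f2 x <= q x) --> (ALL x. f1 x <= q x))"

lemma dom_faceD:
 assumes "dom_face q p"
 shows "sublinear q" "q x <= p x"
  "linear f1 ==> linear f2 ==> (!!x. f1 x <= p x) ==> (!!x. f2 x <= p x) ==> 0 < l ==> l < 1 ==>
   (!!x. l * f1 x + (1 - l) * f2 x <= q x) ==> f1 x <= q x"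
 using assms unfolding dom_face_def by blast+

lemma dom_face_refl: "sublinear p ==> dom_face p p"
 by (simp add: dom_face_def)

lemma dom_face_trans:
 assumes "dom_face q p" "dom_face r q" shows "dom_face r p"
 unfolding dom_face_def
proof (intro conjI allI impI)
 show "sublinear r" by (rule dom_faceD(1)[OF assms(2)])
 show "r x <= p x" for x using dom_faceD(2)[OF assms(2), of x] dom_faceD(2)[OF assms(1), of x] by linarith
 fix f1 f2 l x
 assume f: "linear f1" "linear f2" "ALL x. f1 x <= p x" "ALL x. f2 x <= p x" and l: "0 < l" "l < (1::real)"
  and c: "ALL x. l * f1 x + (1 - l) * f2 x <= r x"
 have cq: "l * f1 x + (1 - l) * f2 x <= q x" for x
  using c dom_faceD(2)[OF assms(2), of x] order_trans by blast
 have cq': "(1 - l) * f2 x + (1 - (1 - l)) * f1 x <= q x" for x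
  using cq[of x] by (simp add: add.commute)
 have 1: "f1 x <= q x" for x
  using dom_faceD(3)[OF assms(1) f(1,2) _ _ l cq] f(3,4) by blast
 have "0 < 1 - l" "1 - l < 1" using l by auto
 hence 2: "f2 x <= q x" for x
  using dom_faceD(3)[OF assms(1) f(2,1) _ _ _ _ cq'] f(3,4) by blast
 show "f1 x <= r x" using dom_faceD(3)[OF assms(2) f(1,2) 1 2 l] c by blast
qed

text \<open>A linear f below q with f b = q b satisfies f x = f (x + t b) - t q b <= q (x + t b) - t
  q b for all t >= 0. The infimum over t describes the face on which the value at b is
  maximal.\<close>

definition face_at :: "('v::real_vector => real) => 'v => 'v => real"
 where "face_at q b x = (INF t\<in>{0..}. q (x + t *R b) - t * q b)"

lemma face_at_bdd:
 assumes "sublinear q" shows "bdd_below ((%t. q (x + t *R b) - t * q b) ` {0..})"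
proof (rule bdd_belowI2[where m = "- q (- x)"])
 fix t :: real assume "t : {0..}"
 hence "t * q b = q ((x + t *R b) + - x)" using sublinear_scale0[OF assms, of t b] by simp
 also have "... <= q (x + t *R b) + q (- x)" by (rule sublinearD(1)[OF assms])
 finally show "- q (- x) <= q (x + t *R b) - t * q b" by simp
qed

lemma face_at_le: "sublinear q ==> 0 <= t ==> face_at q b x <= q (x + t *R b) - t * q b"
 unfolding face_at_def by (rule cINF_lower[OF face_at_bdd]) simp_all

lemma face_at_greatest: "(!!t. 0 <= t ==> m <= q (x + t *R b) - t * q b) ==> m <= face_at q b x"
 unfolding face_at_def by (rule cINF_greatest) auto

lemma face_at_neg: "sublinear q ==> face_at q b (- b) <= - q b"
 using face_at_le[of q 1 b "- b"] sublinear_0[of q] by simp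

text \<open>If a proper convex combination of functionals below q takes the value q b at b, then so
  does each of them.\<close>

lemma face_at_face:
 assumes q: "sublinear q" shows "dom_face (face_at q b) q"
 unfolding dom_face_def
proof (intro conjI allI impI)
 show le: "face_at q b x <= q x" for x using face_at_le[OF q, of 0 b x] by simp
 show "sublinear (face_at q b)"
  unfolding sublinear_def
 proof (intro conjI allI impI)
  fix x y
  have "face_at q b (x + y) - (q (y + t' *R b) - t' * q b) <= face_at q b x" if t': "0 <= t'" for t'
  proof (rule face_at_greatest)
   fix t :: real assume t: "0 <= t"
   have "face_at q b (x + y) <= q ((x + y) + (t + t') *R b) - (t + t') * q b"
    using t t' by (intro face_at_le[OF q]) simp
   also have "(x + y) + (t + t') *R b = (x + t *R b) + (y + t' *R b)" by (simp add: algebra_simps)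
   also have "q ... <= q (x + t *R b) + q (y + t' *R b)" by (rule sublinearD(1)[OF q])
   finally show "face_at q b (x + y) - (q (y + t' *R b) - t' * q b) <= q (x + t *R b) - t * q b"
    by (simp add: algebra_simps)
  qed
  hence "face_at q b (x + y) - face_at q b x <= face_at q b y"
   by (intro face_at_greatest) (simp add: algebra_simps)
  thus "face_at q b (x + y) <= face_at q b x + face_at q b y" by simp
 next
  fix r :: real and x assume r: "0 < r"
  have "face_at q b (r *R x) / r <= face_at q b x"
  proof (rule face_at_greatest)
   fix t :: real assume t: "0 <= t"
   have "face_at q b (r *R x) <= q (r *R x + (r * t) *R b) - (r * t) * q b"
    using r t by (intro face_at_le[OF q]) simp
   also have "r *R x + (r * t) *R b = r *R (x + t *R b)" by (simp add: algebra_simps)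
   also have "q ... = r * q (x + t *R b)" by (rule sublinear_scale[OF q r])
   also have "r * q (x + t *R b) - (r * t) * q b = (q (x + t *R b) - t * q b) * r" by (simp add: algebra_simps)
   finally show "face_at q b (r *R x) / r <= q (x + t *R b) - t * q b"
    using r by (simp only: pos_divide_le_eq)
  qed
  thus "face_at q b (r *R x) <= r * face_at q b x" using r by (simp add: divide_le_eq mult.commute)
 qed
 fix f1 f2 :: "'a => real" and l x
 assume f: "linear f1" "linear f2" "ALL x. f1 x <= q x" "ALL x. f2 x <= q x" and l: "0 < l" "l < (1::real)"
  and c: "ALL x. l * f1 x + (1 - l) * f2 x <= face_at q b x"
 have "l * f1 (- b) + (1 - l) * f2 (- b) <= - q b" using c face_at_neg[OF q, of b] order_trans by blast
 hence 1: "q b <= l * f1 b + (1 - l) * f2 b" using linear_neg[OF f(1)] linear_neg[OF f(2)] by simp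
 have "(1 - l) * f2 b <= (1 - l) * q b" using l f(4) by (intro mult_left_mono) simp_all
 hence "l * q b <= l * f1 b" using 1 by (simp add: algebra_simps)
 hence "q b <= f1 b" using l by simp
 hence e: "f1 b = q b" using f(3) antisym by blast
 show "f1 x <= face_at q b x"
 proof (rule face_at_greatest)
  fix t :: real
  have "f1 (x + t *R b) = f1 x + t * f1 b" using linear_add[OF f(1)] linear_scale[OF f(1)] by simp
  thus "f1 x <= q (x + t *R b) - t * q b" using f(3)[rule_format, of "x + t *R b"] e by simp
 qed
qed

text \<open>Subadditivity of the infimum is where the chain matters: q x + r y is compared with the
  smaller of q and r.\<close>

lemma chain_face:
 assumes C: "C ~= {}" "!!q. q : C ==> dom_face q p" and p: "sublinear p"
  and chain: "!!q r. q : C ==> r : C ==> (ALL x. q x <= r x) \<or> (ALL x. r x <= q x)"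
 shows "dom_face (%x. INF q\<in>C. q x) p" "q : C ==> (INF q\<in>C. q x) <= q x"
proof -
 let ?u = "%x. INF q\<in>C. q x"
 have bdd: "bdd_below ((%q. q x) ` C)" for x
 proof (rule bdd_belowI2[where m = "- p (- x)"])
  fix q assume "q : C"
  thus "- p (- x) <= q x"
   using sublinear_neg[OF dom_faceD(1)[OF C(2)], of q x] dom_faceD(2)[OF C(2), of q "- x"] by linarith
 qed
 show le: "?u x <= q x" if "q : C" for q x by (rule cINF_lower[OF bdd that])
 obtain q0 where q0: "q0 : C" using C(1) by blast
 show "dom_face ?u p"
  unfolding dom_face_def
 proof (intro conjI allI impI)
  show "?u x <= p x" for x using le[OF q0, of x] dom_faceD(2)[OF C(2)[OF q0], of x] by linarith
  show "sublinear ?u"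
   unfolding sublinear_def
  proof (intro conjI allI impI)
   fix x y
   have *: "?u (x + y) <= q x + r y" if qr: "q : C" "r : C" for q r
   proof -
    obtain m where m: "m : C" "m x <= q x" "m y <= r y" using chain[OF qr] qr by blast
    have "?u (x + y) <= m (x + y)" by (rule le[OF m(1)])
    also have "... <= m x + m y" by (rule sublinearD(1)[OF dom_faceD(1)[OF C(2)[OF m(1)]]])
    finally show ?thesis using m(2,3) by linarith
   qed
   have "?u (x + y) - q x <= ?u y" if "q : C" for q
    using *[OF that] by (intro cINF_greatest C(1)) (simp add: algebra_simps)
   hence "?u (x + y) - ?u y <= ?u x"
    by (intro cINF_greatest C(1)) (simp add: algebra_simps)
   thus "?u (x + y) <= ?u x + ?u y" by simp
  next
   fix r :: real and x assume r: "0 < r"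
   have "?u (r *R x) / r <= ?u x"
   proof (rule cINF_greatest[OF C(1)])
    fix q assume q: "q : C"
    have "?u (r *R x) <= q (r *R x)" by (rule le[OF q])
    also have "... <= r * q x" by (rule sublinearD(2)[OF dom_faceD(1)[OF C(2)[OF q]] r])
    finally show "?u (r *R x) / r <= q x" using r by (simp add: divide_le_eq mult.commute)
   qed
   thus "?u (r *R x) <= r * ?u x" using r by (simp add: divide_le_eq mult.commute)
  qed
  fix f1 f2 l x
  assume f: "linear f1" "linear f2" "ALL x. f1 x <= p x" "ALL x. f2 x <= p x" and l: "0 < l" "l < (1::real)"
   and c: "ALL x. l * f1 x + (1 - l) * f2 x <= ?u x"
  show "f1 x <= ?u x"
  proof (rule cINF_greatest[OF C(1)])
   fix q assume q: "q : C"
   have "l * f1 y + (1 - l) * f2 y <= q y" for y using c[rule_format, of y] le[OF q, of y] by linarith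
   thus "f1 x <= q x" using dom_faceD(3)[OF C(2)[OF q] f(1,2) _ _ l] f(3,4) by blast
  qed
 qed
qed

text \<open>A minimal face coincides with all the faces exposed inside it, and q =
  \<open>face_at q b\<close> forces q (x + b) = q x + q b.\<close>

lemma minimal_face_linear:
 assumes q: "sublinear q" and m: "!!r. dom_face r q ==> r = q" shows "linear q"
proof -
 have eq: "face_at q b = q" for b by (rule m[OF face_at_face[OF q]])
 have add: "q (x + b) = q x + q b" for x b
 proof (rule antisym)
  show "q (x + b) <= q x + q b" by (rule sublinearD(1)[OF q])
  show "q x + q b <= q (x + b)" using face_at_le[OF q, of 1 b x] unfolding eq by simp
 qed
 have neg: "q (- x) = - q x" for x using add[of x "- x"] sublinear_0[OF q] by simp
 have "q (r *R x) = r * q x" for r x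
 proof (cases "0 <= r")
  case True
  thus ?thesis by (rule sublinear_scale0[OF q])
 next
  case False
  hence "q ((- r) *R x) = (- r) * q x" by (intro sublinear_scale0[OF q]) simp
  thus ?thesis using neg[of "r *R x"] by simp
 qed
 thus ?thesis using add by (intro linearI) simp_all
qed

text \<open>Zorn's lemma runs below the face exposed by b, so the value at b stays maximal. This
  serves both as Krein-Milman and as Hahn-Banach.\<close>

lemma extreme_functional:
 assumes p: "sublinear p"
 obtains f where "linear f" "dom_face f p" "f b = p b"
proof -
 define p' where "p' = face_at p b"
 have p': "dom_face p' p" unfolding p'_def by (rule face_at_face[OF p])
 define F where "F = {q. dom_face q p'}"
 define P where "P q r <-> (ALL x. r x <= q x)" for q r :: "'a => real"
 have "EX m:F. ALL a:F. P m a --> a = m"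
 proof (rule predicate_Zorn)
  show "partial_order_on F (relation_of P F)"
   by (rule partial_order_on_relation_ofI) (auto simp: P_def fun_eq_iff intro: order_trans antisym)
  fix C assume C: "C : Chains (relation_of P F)"
  hence CF: "q : F" if "q : C" for q using that unfolding Chains_def relation_of_def by blast
  show "EX u:F. ALL a:C. P a u"
  proof (cases "C = {}")
   case True
   have "p' : F" unfolding F_def using dom_face_refl[OF dom_faceD(1)[OF p']] by simp
   thus ?thesis using True by blast
  next
   case False
   have 1: "dom_face q p'" if "q : C" for q using CF[OF that] by (simp add: F_def)
   have 2: "(ALL x. q x <= r x) \<or> (ALL x. r x <= q x)" if "q : C" "r : C" for q r
   proof -
    have "(q, r) : relation_of P F \<or> (r, q) : relation_of P F" using C that unfolding Chains_def by blast
    hence "P q r \<or> P r q" unfolding relation_of_def by blast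
    thus ?thesis
    proof
     assume "P q r"
     thus ?thesis unfolding P_def by (rule disjI2)
    next
     assume "P r q"
     thus ?thesis unfolding P_def by (rule disjI1)
    qed
   qed
   have cf1: "dom_face (%x. INF q\<in>C. q x) p'"
    by (rule chain_face(1)[of C p']) (erule 1 | rule False dom_faceD(1)[OF p'] | erule (1) 2)+
   have cf2: "(INF q\<in>C. q x) <= q x" if "q : C" for q x
    by (rule chain_face(2)[of C p']) (rule that | erule 1 | rule False dom_faceD(1)[OF p'] | erule (1) 2)+
   show ?thesis
   proof (rule bexI[of _ "%x. INF q\<in>C. q x"])
    show "(%x. INF q\<in>C. q x) : F" unfolding F_def using cf1 by simp
    show "ALL a:C. P a (%x. INF q\<in>C. q x)" unfolding P_def by (intro ballI allI cf2)
   qed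
  qed
 qed
 then obtain f where f: "dom_face f p'" and fm: "!!r. dom_face r p' ==> ALL x. r x <= f x ==> r = f"
  unfolding F_def P_def by blast
 have "linear f"
 proof (rule minimal_face_linear[OF dom_faceD(1)[OF f]])
  fix r assume r: "dom_face r f"
  show "r = f" by (rule fm[OF dom_face_trans[OF f r]]) (use dom_faceD(2)[OF r] in blast)
 qed
 moreover have "dom_face f p" by (rule dom_face_trans[OF p' f])
 moreover have "f b = p b"
 proof (rule antisym)
  show "f b <= p b" by (rule dom_faceD(2)[OF `dom_face f p`])
  have "f (- b) <= - p b" using dom_faceD(2)[OF f, of "- b"] face_at_neg[OF p, of b] unfolding p'_def by linarith
  thus "p b <= f b" using linear_neg[OF `linear f`, of b] by simp
 qed
 ultimately show thesis by (rule that)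
qed

lemma dom_face_extreme:
 assumes f: "linear f" "dom_face f p" and "linear f1" "linear f2" "!!x. f1 x <= p x" "!!x. f2 x <= p x" "0 < l" "l < 1"
  "!!x. l * f1 x + (1 - l) * f2 x = f x"
 shows "f1 x = f x"
proof -
 have le: "f1 x <= f x" for x by (rule dom_faceD(3)[OF assms(2-8)]) (simp add: assms(9))
 from le[of "- x"] have "f x <= f1 x" using linear_neg[OF f(1)] linear_neg[OF assms(3)] by simp
 thus ?thesis using le[of x] by simp
qed

subsection \<open>States and the GNS construction\<close>

text \<open>These are the real parts of states; \<open>complexify\<close> recovers the complex
  functional.\<close>

definition state :: "('a::cstar_1 => real) => bool"
 where "state f <-> linear f & (ALL x. f x <= norm x) & f 1 = 1"

lemma state_of_real: "state f ==> f (of_real r) = r"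
 using linear_scale[of f r 1] by (simp add: state_def of_real_def)

lemma state_pos:
 assumes f: "state f" and x: "pos x" shows "0 <= f x"
proof -
 have "f (of_real (norm x) - x) <= norm (of_real (norm x) - x)" using f by (simp add: state_def)
 also have "... <= norm x" by (rule pos_norm[OF x order_refl])
 finally show ?thesis using f state_of_real[OF f, of "norm x"] by (simp add: state_def linear_diff)
qed

text \<open>For real s, (s + f x)^2 <= norm (s + x)^2 = norm (s^2 - x^2) <= s^2 + (norm x)^2, which
  fails for large s if f x > 0.\<close>

lemma state_skew:
 assumes f: "state f" and x: "star x = - x" shows "f x = 0"
proof -
 have lin: "linear f" using f by (simp add: state_def)
 have le: "f x <= 0" if x: "star x = - x" for x
 proof (rule ccontr)
  assume "\<not> f x <= 0"
  hence p: "0 < f x" by simp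
  define s where "s = (norm x)^2 / f x"
  have s0: "0 <= s" using p by (simp add: s_def)
  have "s + f x = f (of_real s + x)" using linear_add[OF lin] state_of_real[OF f] by simp
  also have "... <= norm (of_real s + x)" using f by (simp add: state_def)
  finally have "(s + f x)^2 <= (norm (of_real s + x))^2" using s0 p by (intro power_mono) auto
  also have "(norm (of_real s + x))^2 = norm (of_real (s * s) - x * x)"
  proof -
  have "star (of_real s + x) * (of_real s + x) = of_real (s * s) - x * x"
  proof -
   have "of_real s * x = x * of_real s" by (simp add: of_real_def)
   thus ?thesis by (simp add: star_add star_of_real x algebra_simps)
  qed
  thus ?thesis unfolding cstar_identity[symmetric] by (simp only:)
  qed
  also have "... <= s * s + norm x * norm x"
  proof -
   have "norm (of_real (s * s) - x * x) <= norm (of_real (s * s) :: 'a) + norm (x * x)" by (rule norm_triangle_ineq4)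
   moreover have "norm (of_real (s * s) :: 'a) = s * s" unfolding norm_of_real by simp
   ultimately show ?thesis using norm_mult_ineq[of x x] by linarith
  qed
  finally have "2 * (s * f x) + (f x)^2 <= (norm x)^2" by (simp add: power2_eq_square algebra_simps)
  moreover have "s * f x = (norm x)^2" using p by (simp add: s_def)
  ultimately have "(norm x)^2 + (f x)^2 <= 0" by simp
  moreover have "0 < (f x)^2" using p by simp
  ultimately show False using zero_le_power2[of "norm x"] by linarith
 qed
 have "star (- x) = - (- x)" by (simp add: star_minus x)
 from le[OF this] le[OF x] show ?thesis using linear_neg[OF lin] by simp
qed

definition complexify :: "('a::cstar_algebra => real) => 'a => complex"
 where "complexify f x = Complex (f x) (- f (\<i> *C x))"

lemma complexify_linear:
 assumes "linear f"
 shows "complexify f (x + y) = complexify f x + complexify f y" "complexify f (c *C x) = c * complexify f x"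
proof -
 show "complexify f (x + y) = complexify f x + complexify f y"
  by (simp add: complexify_def linear_add[OF assms] scaleC_add_right complex_eq_iff)
 have c: "c *C x = Re c *R x + Im c *R (\<i> *C x)"
  by (simp add: scaleR_conv_scaleC complex_eq[of c, symmetric] mult.commute flip: scaleC_add_left)
 have ic: "\<i> *C (c *C x) = Re c *R (\<i> *C x) + (- Im c) *R x"
  unfolding c scaleC_add_right scaleC_scaleR_commute by simp
 show "complexify f (c *C x) = c * complexify f x"
  unfolding complexify_def ic unfolding c
  by (simp add: linear_add[OF assms] linear_scale[OF assms] linear_diff[OF assms] complex_eq_iff)
qed

lemma complexify_star:
 assumes "state f" shows "complexify f (star x) = cnj (complexify f x)"
proof -
 have lin: "linear f" using assms by (simp add: state_def)
 have s: "f (star x) = f x" for x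
 proof -
  have "f (star x - x) = 0" by (rule state_skew[OF assms]) (simp add: star_diff star_star)
  thus ?thesis using linear_diff[OF lin] by simp
 qed
 have "\<i> *C star x = star (- (\<i> *C x))" by (simp add: star_minus star_scaleC)
 hence "f (\<i> *C star x) = - f (\<i> *C x)" using s[of "- (\<i> *C x)"] linear_neg[OF lin] by simp
 thus ?thesis by (simp add: complexify_def s complex_eq_iff)
qed

lemma state_gns:
 fixes f :: "'u::cstar_1 => real"
 assumes f: "state f"
 obtains g :: "'u => 'u ell2" and \<Phi> where "csubspace (range g)" "representation (closure (range g)) \<Phi>"
  "!!a x. \<Phi> a (g x) = g (a * x)" "!!x y. cinner (g x) (g y) = complexify f (star x * y)"
  "!!h. h : closure (range g) ==> \<Phi> 1 h = h"
proof -
 have lin: "linear f" using f by (simp add: state_def)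
 interpret semi_inner "%x y. complexify f (star x * y)"
 proof
  fix x y z :: 'u and c
  show "complexify f (star x * (y + z)) = complexify f (star x * y) + complexify f (star x * z)"
   by (simp add: distrib_left complexify_linear[OF lin])
  show "complexify f (star x * c *C y) = c * complexify f (star x * y)"
   by (simp add: mult_scaleC_right complexify_linear[OF lin])
  show "complexify f (star x * y) = cnj (complexify f (star y * x))"
   using complexify_star[OF f, of "star y * x"] by (simp add: star_mult star_star)
  show "0 <= Re (complexify f (star x * x))"
   using state_pos[OF f pos_star_mult] by (simp add: complexify_def)
 qed
 obtain g :: "'u => 'u ell2" and \<Phi> where g: "!!x y. cinner (g x) (g y) = complexify f (star x * y)" "csubspace (range g)"
  "representation (closure (range g)) \<Phi>" "!!a x. \<Phi> a (g x) = g (a * x)"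
 proof (rule gns[where act = "%a b :: 'u. a * b"])
  fix g :: "'u => 'u ell2" and \<Phi> :: "'u => 'u ell2 => 'u ell2"
  assume 1: "!!x y. cinner (g x) (g y) = complexify f (star x * y)" "csubspace (range g)"
   "representation (closure (range g)) \<Phi>" "!!a x. \<Phi> a (g x) = g (a * x)"
  show thesis by (rule that[OF 1(1) 1(2) 1(3) 1(4)])
 next
  show "a * (x + y) = a * x + a * y" for a x y :: 'u by (rule distrib_left)
  show "a * c *C x = c *C (a * x)" for a x :: 'u and c by (rule mult_scaleC_right)
  show "(a + b) * x = a * x + b * x" for a b x :: 'u by (rule distrib_right)
  show "c *C a * x = c *C (a * x)" for a x :: 'u and c by (rule mult_scaleC_left)
  show "a * b * x = a * (b * x)" for a b x :: 'u by (rule mult.assoc)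
  show "complexify f (star (a * x) * y) = complexify f (star x * (star a * y))" for a x y :: 'u
   by (simp only: star_mult mult.assoc)
 qed
 have one: "\<Phi> 1 h = h" if h: "h : closure (range g)" for h
 proof -
  obtain y where y: "!!n. y n : range g" "y ----> h" using h unfolding closure_sequential by blast
  have "(%n. \<Phi> 1 (y n)) ----> \<Phi> 1 h"
   by (rule rep_tendsto_vec[OF g(3) _ y(2)]) (rule subsetD[OF closure_subset y(1)])
  moreover have "\<Phi> 1 (y n) = y n" for n
  proof -
   obtain x where "y n = g x" using y(1)[of n] by blast
   thus ?thesis using g(4)[of 1 x] by simp
  qed
  ultimately show ?thesis using y(2) by (simp add: LIMSEQ_unique)
 qed
 show thesis by (rule that[OF g(2) g(3) g(4) g(1) one])
qed

lemma rep_restrict: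
 assumes r: "representation H \<Phi>" and f: "star_hom f" shows "representation H (%a. \<Phi> (f a))"
proof (rule representationI)
 have f: "f (a + b) = f a + f b" "f (c *C a) = c *C f a" "f (a * b) = f a * f b" "f (star a) = star (f a)" for a b c
  using f unfolding star_hom_def by (auto simp: linear_iff Vector_Spaces.linear_iff)
 show "hilbert_subspace H" by (rule rep_hilbert[OF r])
 show "EX M. ALL h:H. norm (\<Phi> (f a) h) <= M * norm h" for a using rep_norm[OF r] by blast
qed (use assms in "simp_all add: star_hom_def rep_in rep_clin rep_add rep_scale rep_mult rep_star Vector_Spaces.linear_iff")

lemma star_hom_emb: "star_hom (emb :: 'a::cstar_algebra => 'a unitz)"
 unfolding star_hom_def Vector_Spaces.linear_iff
 by (simp add: emb_add emb_scaleC emb_mult star_emb complex_vector.vector_space_axioms)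

text \<open>(j x)* (j x) lies in J, so f vanishes on it and j annihilates the dense set of vectors g
  x.\<close>

lemma gns_kills:
 fixes g :: "'a::cstar_algebra unitz => 'h::chilbert_space"
 assumes r: "representation (closure (range g)) \<Phi>" and \<Phi>: "!!a x. \<Phi> a (g x) = g (a * x)"
  and ip: "!!x y. cinner (g x) (g y) = complexify f (star x * y)"
  and J: "cstar_ideal J" "!!j. j : J ==> f (emb j) = 0" and j: "j : J" and h: "h : closure (range g)"
 shows "\<Phi> (emb j) h = 0"
proof -
 have 0: "\<Phi> (emb j) (g x) = 0" for x
 proof -
  have J': "cstar_ideal (emb ` J)" by (rule cstar_ideal_emb[OF J(1)])
  have "star (emb j * x) * (emb j * x) : emb ` J"
   using j by (intro cidealD(3)[OF J'] cidealD(4)[OF J']) blast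
  then obtain k where k: "k : J" "star (emb j * x) * (emb j * x) = emb k" by blast
  have "\<i> *C k : J" by (rule csub(4)[OF cidealD(1)[OF J(1)] k(1)])
  hence "complexify f (emb k) = 0" using J(2)[OF k(1)] J(2)[of "\<i> *C k"]
   by (simp add: complexify_def emb_scaleC complex_eq_iff)
  hence "cinner (g (emb j * x)) (g (emb j * x)) = 0" unfolding ip k(2) .
  thus ?thesis unfolding \<Phi> by (simp add: cinner_self)
 qed
 obtain y where y: "!!n. y n : range g" "y ----> h" using h unfolding closure_sequential by blast
 have "(%n. \<Phi> (emb j) (y n)) ----> \<Phi> (emb j) h"
  by (rule rep_tendsto_vec[OF r _ y(2)]) (rule subsetD[OF closure_subset y(1)])
 moreover have "\<Phi> (emb j) (y n) = 0" for n using y(1)[of n] 0 by auto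
 ultimately show ?thesis by (simp add: LIMSEQ_const_iff)
qed

subsection \<open>Separating ideals by irreducible representations\<close>

lemma orth_dense:
 fixes Y :: "'h::chilbert_space set"
 assumes "l : closure Y" "!!y. y : Y ==> cinner y l = 0" shows "l = 0"
proof -
 obtain y where y: "!!n. y n : Y" "y ----> l" using assms(1) unfolding closure_sequential by blast
 have "(%n. cinner (y n) l) ----> cinner l l" by (intro tendsto_cinner tendsto_const y)
 hence "cinner l l = 0" using assms(2)[OF y(1)] by (simp add: LIMSEQ_const_iff)
 thus ?thesis by (simp add: cinner_self)
qed

text \<open>The quotient norm modulo I, evaluated on representatives.\<close>

definition quot_norm :: "'u::real_normed_vector set => 'u => real"
 where "quot_norm I u = (INF i\<in>I. norm (u + i))"

lemma quot_norm_le: "i : I ==> quot_norm I u <= norm (u + i)"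
 unfolding quot_norm_def by (rule cINF_lower) (auto intro!: bdd_belowI2[where m = 0])

lemma quot_norm_greatest: "I ~= {} ==> (!!i. i : I ==> m <= norm (u + i)) ==> m <= quot_norm I u"
 unfolding quot_norm_def by (rule cINF_greatest)

lemma quot_norm_sublinear:
 fixes I :: "'u::cstar_algebra set"
 assumes I: "csubspace I" shows "sublinear (quot_norm I)"
 unfolding sublinear_def
proof (intro conjI allI impI)
 note s = csub[OF I]
 have ne: "I ~= {}" using s(1) by blast
 fix x y
 have "quot_norm I (x + y) - norm (x + i) <= quot_norm I y" if "i : I" for i
 proof (rule quot_norm_greatest[OF ne])
  fix j assume "j : I"
  hence "quot_norm I (x + y) <= norm ((x + y) + (i + j))" using that s(2) by (intro quot_norm_le) blast
  also have "(x + y) + (i + j) = (x + i) + (y + j)" by simp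
  also have "norm ... <= norm (x + i) + norm (y + j)" by (rule norm_triangle_ineq)
  finally show "quot_norm I (x + y) - norm (x + i) <= norm (y + j)" by simp
 qed
 hence "quot_norm I (x + y) - quot_norm I y <= quot_norm I x"
  by (intro quot_norm_greatest[OF ne]) (simp add: algebra_simps)
 thus "quot_norm I (x + y) <= quot_norm I x + quot_norm I y" by simp
next
 note s = csub[OF I]
 have ne: "I ~= {}" using s(1) by blast
 fix r :: real and x assume r: "0 < r"
 have "quot_norm I (r *R x) / r <= quot_norm I x"
 proof (rule quot_norm_greatest[OF ne])
  fix i assume "i : I"
  hence "quot_norm I (r *R x) <= norm (r *R x + r *R i)" using s(4) by (intro quot_norm_le) (simp add: scaleR_conv_scaleC)
  also have "... = norm (x + i) * r" using r by (simp flip: scaleR_add_right)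
  finally show "quot_norm I (r *R x) / r <= norm (x + i)" using r by (simp only: pos_divide_le_eq)
 qed
 thus "quot_norm I (r *R x) <= r * quot_norm I x" using r by (simp add: pos_divide_le_eq mult.commute)
qed

text \<open>For an invariant L, split the cyclic vector xi into its projection p to L and the rest
  p'. If both are nonzero, f is a convex combination of the normalized vector functionals of p and
  p', which respect the quotient norm. Extremality makes p equal to l xi with l = (norm p)^2, whence
  l = l^2, absurd. The cases p = 0 and p' = 0 give L = 0 and L = H.\<close>

lemma extreme_state_irreducible:
 fixes I :: "'a::cstar_algebra set" and f :: "'a unitz => real"
 assumes I: "cstar_ideal I" and lin: "linear f" and face: "dom_face f (quot_norm (emb ` I))" and f1: "f 1 = 1"
  and nz: "f (emb (star a * a)) ~= 0"
 obtains K :: "'a ell2 set" and \<pi> h where "irrep K \<pi>" "ALL i:I. ALL k:K. \<pi> i k = 0"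
  "h : K" "norm h = 1" "(norm (\<pi> a h))^2 = f (emb (star a * a))"
proof -
 have I': "cstar_ideal (emb ` I)" by (rule cstar_ideal_emb[OF I])
 have zI: "0 : emb ` I" by (rule csub(1)[OF cidealD(1)[OF I']])
 have fq: "f u <= norm (u + emb i)" if "i : I" for u i
  using dom_faceD(2)[OF face, of u] quot_norm_le[of "emb i" "emb ` I" u] that by simp
 have st: "state f" unfolding state_def
 proof (intro conjI allI lin f1)
  fix x show "f x <= norm x" using dom_faceD(2)[OF face, of x] quot_norm_le[OF zI, of x] by simp
 qed
 have fI: "f (emb j) = 0" if j: "j : I" for j
 proof -
  have mj: "- j : I" by (rule csub(5)[OF cidealD(1)[OF I] j])
  have "emb j + emb (- j) = 0" "emb (- j) + emb j = 0" by (simp_all add: emb_add[symmetric] emb_0)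
  hence "f (emb j) <= 0" "f (emb (- j)) <= 0" using fq[OF mj, of "emb j"] fq[OF j, of "emb (- j)"] by simp_all
  moreover have "emb (- j) = - emb j" by (simp add: unitz_eq_iff)
  ultimately show ?thesis using linear_neg[OF lin, of "emb j"] by simp
 qed
 obtain g :: "'a unitz => 'a unitz ell2" and \<Phi> where g: "csubspace (range g)" "representation (closure (range g)) \<Phi>"
  "!!a x. \<Phi> a (g x) = g (a * x)" "!!x y. cinner (g x) (g y) = complexify f (star x * y)"
  "!!h. h : closure (range g) ==> \<Phi> 1 h = h"
  using state_gns[OF st] by metis
 define H where "H = closure (range g)"
 note r = g(2)[folded H_def] and one = g(5)[folded H_def]
 note HD = hsubD[OF rep_hilbert[OF r]]
 have gH: "g x : H" for x unfolding H_def by (rule subsetD[OF closure_subset rangeI])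
 define \<xi> where "\<xi> = g 1"
 have \<xi>: "\<xi> : H" by (simp add: \<xi>_def gH)
 have gu: "g u = \<Phi> u \<xi>" for u by (simp add: \<xi>_def g(3))
 have sq: "(norm (g u))^2 = f (star u * u)" for u
  using arg_cong[OF g(4)[of u u], of Re] unfolding cinner_self Re_complex_of_real by (simp add: complexify_def)
 have n\<xi>: "norm \<xi> = 1"
 proof -
  have "(norm \<xi>)^2 = 1" unfolding \<xi>_def sq by (simp add: f1)
  thus ?thesis by (simp add: power2_eq_1_iff) (metis norm_ge_zero not_one_le_zero neg_0_le_iff_le)
 qed
 have f\<xi>: "f u = Re (cinner \<xi> (\<Phi> u \<xi>))" for u
  unfolding gu[symmetric] unfolding \<xi>_def g(4) by (simp add: complexify_def)
 define \<rho> where "\<rho> = (%a. \<Phi> (emb a))"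
 have r\<rho>: "representation H \<rho>" unfolding \<rho>_def by (rule rep_restrict[OF r star_hom_emb])
 have kill: "\<Phi> (emb i) h = 0" if "i : I" "h : H" for i h
  by (rule gns_kills[OF g(2) g(3) g(4) I fI that(1) that(2)[unfolded H_def]])
 have vf: "linear (%u. Re (cinner w (\<Phi> u w)) / (norm w)^2)"
  "Re (cinner w (\<Phi> u w)) / (norm w)^2 <= quot_norm (emb ` I) u" if w: "w : H" "w ~= 0" for w u
 proof -
  show "linear (%u. Re (cinner w (\<Phi> u w)) / (norm w)^2)"
   by (rule linearI) (simp_all add: rep_add[OF r w(1)] scaleR_conv_scaleC rep_scale[OF r w(1)] cinner_add_right cinner_scaleC_right add_divide_distrib)
  show "Re (cinner w (\<Phi> u w)) / (norm w)^2 <= quot_norm (emb ` I) u"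
  proof (rule quot_norm_greatest)
   show "emb ` I ~= {}" using zI by blast
   fix i assume "i : emb ` I"
   then obtain j where j: "j : I" "i = emb j" by blast
   have "\<Phi> u w = \<Phi> (u + i) w" using rep_add[OF r w(1), of u i] kill[OF j(1) w(1)] j(2) by simp
   hence "Re (cinner w (\<Phi> u w)) <= cmod (cinner w (\<Phi> (u + i) w))" using complex_Re_le_cmod by simp
   also have "... <= norm w * norm (\<Phi> (u + i) w)" by (rule cauchy_schwarz)
   also have "... <= norm w * (norm (u + i) * norm w)" by (intro mult_left_mono rep_norm[OF r w(1)] norm_ge_zero)
   also have "... = norm (u + i) * (norm w)^2" by (simp add: power2_eq_square)
   finally show "Re (cinner w (\<Phi> u w)) / (norm w)^2 <= norm (u + i)"
    using w(2) by (simp add: pos_divide_le_eq)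
  qed
 qed
 have irr: "irrep H \<rho>"
 proof (rule irreducible_repI[OF r\<rho> \<xi>])
  have "(norm (\<rho> a \<xi>))^2 ~= 0" unfolding \<rho>_def gu[symmetric] sq using nz by (simp add: star_emb emb_mult)
  thus "\<rho> a \<xi> ~= 0" by auto
  fix L assume L: "hilbert_subspace L" "L <= H" and inv: "!!a h. h : L ==> \<rho> a h : L"
  note LD = hsubD[OF L(1)]
  have invU: "\<Phi> u l : L" if l: "l : L" for u l
  proof -
   have lH: "l : H" using l L(2) by blast
   have "\<Phi> u l = \<Phi> (emb (el u) + sc u *C 1) l" by (simp add: unitz_decomp[symmetric])
   also have "... = \<rho> (el u) l + sc u *C l"
    unfolding rep_add[OF r lH] rep_scale[OF r lH] one[OF lH] \<rho>_def ..
   finally show ?thesis using LD(4)[OF inv[OF l] LD(6)[OF l]] by simp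
  qed
  obtain p where p: "p : L" "!!l. l : L ==> cinner p l = cinner \<xi> l"
   using riesz_projection[OF L(1)] by metis
  have pH: "p : H" using p(1) L(2) by blast
  define p' where "p' = \<xi> - p"
  have p'H: "p' : H" unfolding p'_def by (rule HD(5)[OF \<xi> pH])
  have o1: "cinner p' l = 0" "cinner l p' = 0" if l: "l : L" for l
  proof -
   show "cinner p' l = 0" using p(2)[OF l] by (simp add: p'_def cinner_diff_left)
   thus "cinner l p' = 0" using cinner_commute[of l p'] by simp
  qed
  have o2: "cinner l (\<Phi> u p') = 0" if l: "l : L" for l u
  proof -
   have lH: "l : H" using l L(2) by blast
   have "cinner l (\<Phi> u p') = cinner (\<Phi> (star u) l) p'" by (rule rep_star(1)[OF r lH p'H, symmetric])
   thus ?thesis using o1(2)[OF invU[OF l]] by simp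
  qed
  have \<xi>pp: "\<xi> = p + p'" by (simp add: p'_def)
  have \<Phi>\<xi>: "\<Phi> u \<xi> = \<Phi> u p + \<Phi> u p'" for u unfolding \<xi>pp by (rule rep_vadd[OF r pH p'H])
  have split: "cinner \<xi> (\<Phi> u \<xi>) = cinner p (\<Phi> u p) + cinner p' (\<Phi> u p')" for u
   unfolding \<Phi>\<xi> by (simp add: \<xi>pp cinner_add_left cinner_add_right o2[OF p(1)] o1(1)[OF invU[OF p(1)]])
  have pyth: "(norm p)^2 + (norm p')^2 = 1"
  proof -
   have "cinner \<xi> \<xi> = cinner p p + cinner p' p'"
    using split[of 1] one[OF \<xi>] one[OF pH] one[OF p'H] by simp
   hence "cor ((norm p)^2 + (norm p')^2) = cor ((norm \<xi>)^2)"
    unfolding cinner_self by simp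
   thus ?thesis unfolding of_real_eq_iff n\<xi> by simp
  qed
  show "L = {0} \<or> L = H"
  proof (cases "p = 0")
   case True
   have "l = 0" if l: "l : L" for l
   proof (rule orth_dense)
    show "l : closure (range g)" using l L(2) unfolding H_def by blast
    fix y assume "y : range g"
    then obtain u where u: "y = \<Phi> u \<xi>" using gu by blast
    have lH: "l : H" using l L(2) by blast
    have "cinner y l = cinner \<xi> (\<Phi> (star u) l)" unfolding u by (rule rep_star(2)[OF r \<xi> lH])
    also have "... = cinner p (\<Phi> (star u) l)" by (rule p(2)[OF invU[OF l], symmetric])
    finally show "cinner y l = 0" using True by simp
   qed
   thus ?thesis using LD(3) by blast
  next
   case pnz: False
   show ?thesis
   proof (cases "p' = 0")
    case True
    hence "\<xi> : L" using p(1) by (simp add: p'_def)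
    hence "g u : L" for u unfolding gu by (rule invU)
    hence "H <= L" unfolding H_def by (intro closure_minimal LD(2)) blast
    thus ?thesis using L(2) by blast
   next
    case p'nz: False
    define l where "l = (norm p)^2"
    have l: "0 < l" "l < 1" using pyth pnz p'nz by (simp_all add: l_def) (smt (verit) zero_less_power2 norm_eq_zero)
    have l': "1 - l = (norm p')^2" using pyth by (simp add: l_def)
    have cv: "l * (Re (cinner p (\<Phi> u p)) / (norm p)^2) + (1 - l) * (Re (cinner p' (\<Phi> u p')) / (norm p')^2) = f u" for u
     unfolding l' f\<xi> split using pnz p'nz by (simp add: l_def)
    have ext: "Re (cinner p (\<Phi> u p)) / (norm p)^2 = f u" for u
     by (rule dom_face_extreme[OF lin face vf(1)[OF pH pnz] vf(1)[OF p'H p'nz] vf(2)[OF pH pnz] vf(2)[OF p'H p'nz] l cv])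
    \<comment> \<open>Extremality compares real parts only; replacing u by i u below supplies the
      imaginary parts.\<close>
    have re: "Re (cinner (p - cor l *C \<xi>) (\<Phi> u \<xi>)) = 0" for u
    proof -
     have "cinner p (\<Phi> u \<xi>) = cinner p (\<Phi> u p)" unfolding \<Phi>\<xi> cinner_add_right o2[OF p(1)] by simp
     moreover have "Re (cinner p (\<Phi> u p)) = l * Re (cinner \<xi> (\<Phi> u \<xi>))"
      using ext[of u] pnz unfolding f\<xi>[symmetric] l_def by (simp add: field_simps)
     ultimately show ?thesis by (simp add: cinner_diff_left cinner_scaleC_left)
    qed
    have vH: "p - cor l *C \<xi> : H" by (intro HD pH \<xi>)
    have "p - cor l *C \<xi> = 0"
    proof (rule orth_dense[OF vH[unfolded H_def]])
     fix y assume "y : range g"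
     then obtain u where u: "y = \<Phi> u \<xi>" using gu by blast
     have "Re (cinner (p - cor l *C \<xi>) (\<i> *C y)) = 0"
      using re[of "\<i> *C u"] unfolding u rep_scale[OF r \<xi>] .
     hence "cinner (p - cor l *C \<xi>) y = 0"
      using re[of u] u by (simp add: cinner_scaleC_right complex_eq_iff)
     thus "cinner y (p - cor l *C \<xi>) = 0" by (subst cinner_commute) simp
    qed
    hence "p = cor l *C \<xi>" by simp
    hence "norm p = l" using l n\<xi> by (simp add: norm_scaleC_h)
    hence "(norm p)^2 = l^2" by simp
    hence "l = l^2" unfolding l_def[symmetric] .
    hence "l = l * l" by (simp add: power2_eq_square)
    thus ?thesis using l by simp
   qed
  qed
 qed
 obtain K :: "'a ell2 set" and \<pi> U where K: "irrep K \<pi>" "rep_iso H \<rho> K \<pi> U"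
  by (rule irreducible_compress'[OF irr])
 note u = rep_isoD[OF K(2)]
 show thesis
 proof (rule that[OF K(1)])
  show "ALL i:I. ALL k:K. \<pi> i k = 0"
  proof (intro ballI)
   fix i k assume i: "i : I" and "k : K"
   then obtain x where x: "x : H" "k = U x" using u(2) by blast
   have "\<rho> i x = 0" unfolding \<rho>_def by (rule kill[OF i x(1)])
   thus "\<pi> i k = 0" using u(4)[OF x(1), of i] clin_on_0[OF u(1) HD(1)] x(2) by simp
  qed
  show "U \<xi> : K" by (rule u(5)[OF \<xi>])
  show "norm (U \<xi>) = 1" using isometry_norm[OF u(3) \<xi>] n\<xi> by simp
  have "norm (\<pi> a (U \<xi>)) = norm (\<rho> a \<xi>)"
   unfolding u(4)[OF \<xi>, symmetric] by (rule isometry_norm[OF u(3) rep_in[OF r\<rho> \<xi>]])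
  thus "(norm (\<pi> a (U \<xi>)))^2 = f (emb (star a * a))"
   using sq[of "emb a"] by (simp add: \<rho>_def gu star_emb emb_mult)
 qed
qed

text \<open>Adding \<open>t \<ge> 0\<close> to a positive element increases its quotient norm by \<open>t\<close>: the positive part of
 \<open>b + i\<close> is a perturbation of \<open>b\<close> by an element of the ideal.\<close>

lemma quot_norm_shift:
 fixes I :: "'a::cstar_algebra set"
 assumes I: "cstar_ideal I" and t: "0 <= t"
 shows "t + quot_norm (emb ` I) (emb (star a * a)) <= quot_norm (emb ` I) (emb (star a * a) + of_real t)"
proof (rule quot_norm_greatest)
 have I': "cstar_ideal (emb ` I)" by (rule cstar_ideal_emb[OF I])
 note sI = csub[OF cidealD(1)[OF I]]
 show "emb ` I ~= {}" using sI(1) by blast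
 define b where "b = emb (star a * a)"
 have b: "pos b" unfolding b_def emb_mult star_emb[symmetric] by (rule pos_star_mult)
 have sb: "star b = b" by (rule pos_selfadj[OF b])
 fix i assume "i : emb ` I"
 then obtain k where k: "k : I" "i = emb k" by blast
 define j where "j = emb ((1/2) *R (k + star k))"
 have jI: "j : emb ` I" unfolding j_def using sI ideal_star[OF I k(1)] k(1) by (simp add: scaleR_conv_scaleC)
 have sj: "star j = j" by (simp add: j_def star_emb star_scaleR star_add star_star add.commute)
 define r where "r = norm (b + of_real t + i)"
 define z where "z = b + of_real t + j"
 have z: "star z = z" by (simp add: z_def star_add sb sj star_of_real)
 have "z = (1/2) *R ((b + of_real t + i) + star (b + of_real t + i))"
  by (simp add: z_def j_def k(2) star_add sb star_of_real star_emb emb_scaleR emb_add algebra_simps flip: scaleR_add_left)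
 also have "norm ... <= r"
  using norm_triangle_ineq[of "b + of_real t + i" "star (b + of_real t + i)"] by (simp add: r_def)
 finally have zr: "norm z <= r" .
 have "pos (of_real r - z)" by (rule pos_shift[OF z zr])
 then obtain y where y: "star y = y" "of_real r - z = y * y" by (auto simp: pos_def)
 define c where "c = b + j"
 define \<kappa> where "\<kappa> = r - t"
 have c: "star c = c" by (simp add: c_def star_add sb sj)
 have cz: "z = c + of_real t" by (simp add: z_def c_def)
 have cy: "c = of_real \<kappa> - y * y" unfolding y(2)[symmetric] cz \<kappa>_def by simp
 have cont: "continuous_on UNIV (%t::real. max t 0)" "continuous_on UNIV (%t::real. max (- t) 0)"
  by (intro continuous_intros)+
 define cp where "cp = cfc (%t. max t 0) c"
 define cn where "cn = cfc (%t. max (- t) 0) c"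
 have neg_b: "cfc (%t. max (- t) 0) b = 0"
 proof -
  obtain w where w: "star w = w" "b = w * w" using b by (auto simp: pos_def)
  have cq: "continuous_on UNIV (poly [:0, 0, 1::real:])" by (intro continuous_intros)
  have "b = cfc (poly [:0, 0, 1:]) w" by (simp add: cfc_poly[OF w(1)] w(2))
  hence "cfc (%t. max (- t) 0) b = cfc (%t. max (- poly [:0, 0, 1:] t) 0) w"
   by (simp only: cfc_compose[OF w(1) cont(2) cq])
  also have "(%t. max (- poly [:0, 0, 1:] t) 0) = (%t::real. 0)" by (rule ext) simp
  finally show ?thesis by (simp add: cfc_const[OF w(1)])
 qed
 have "c - b : emb ` I" using jI by (simp add: c_def)
 from cfc_diff_in_ideal[OF I' c sb this cont(2)] have cnI: "cn : emb ` I" by (simp add: cn_def neg_b)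
 have "cp - cn = c"
 proof -
  have cm: "continuous_on UNIV (%t::real. (-1) * max (- t) 0)" by (intro continuous_intros)
  have "(%t::real. max t 0 + (-1) * max (- t) 0) = (%t. t)" by (rule ext) simp
  hence "c = cfc (%t. max t 0 + (-1) * max (- t) 0) c" using cfc_id[OF c] by simp
  also have "... = cp + (-1) *R cn"
   unfolding cfc_add[OF c cont(1) cm] cfc_cmult[OF c cont(2)] cp_def cn_def ..
  finally show ?thesis by simp
 qed
 hence cpb: "cp = b + (j + cn)" by (simp add: c_def algebra_simps)
 have "j + cn : emb ` I" by (rule csub(2)[OF cidealD(1)[OF I'] jI cnI])
 hence q: "quot_norm (emb ` I) b <= norm cp" unfolding cpb by (rule quot_norm_le)
 have "norm cp <= max \<kappa> 0"
 proof -
  have cq: "continuous_on UNIV (poly [:\<kappa>, 0, - 1::real:])" by (intro continuous_intros)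
  have "c = cfc (poly [:\<kappa>, 0, - 1:]) y" by (simp add: cfc_poly[OF y(1)] cy)
  hence "cp = cfc (%t. max (poly [:\<kappa>, 0, - 1:] t) 0) y"
   unfolding cp_def by (simp only: cfc_compose[OF y(1) cont(1) cq])
  also have "norm ... <= max \<kappa> 0"
  proof (rule norm_cfc_le[OF y(1) order_refl])
   show "continuous_on UNIV (%t. max (poly [:\<kappa>, 0, - 1:] t) 0)" by (intro continuous_intros)
   fix s :: real
   have "poly [:\<kappa>, 0, - 1:] s <= \<kappa>" by simp
   thus "\<bar>max (poly [:\<kappa>, 0, - 1:] s) 0\<bar> <= max \<kappa> 0" by linarith
  qed
  finally show ?thesis .
 qed
 hence 1: "quot_norm (emb ` I) b <= max \<kappa> 0" using q by simp
 \<comment> \<open>The scalar component gives t <= r, so that the maximum of r - t and 0 is r -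
   t.\<close>
 have "sc (b + of_real t + i) = cor t" by (simp add: b_def k(2) of_real_def)
 hence 2: "t <= r" using unitz_norm_le(1)[of "b + of_real t + i"] t by (simp add: r_def)
 have "t + quot_norm (emb ` I) b <= r" using 1 2 by (simp add: \<kappa>_def max_def split: if_splits)
 thus "t + quot_norm (emb ` I) (emb (star a * a)) <= norm (emb (star a * a) + of_real t + i)"
  by (simp add: r_def b_def)
qed

text \<open>Extreme functionals are sought below the quotient norm, so that the representation kills
  I. The face at 1 singles out the states among them, and by \<open>quot_norm_shift\<close> this
  restriction does not lower the maximum at a* a.\<close>

lemma irreducible_quot_norm:
 fixes I :: "'a::cstar_algebra set"
 assumes I: "cstar_ideal I" and nz: "0 < quot_norm (emb ` I) (emb (star a * a))"
 obtains K :: "'a ell2 set" and \<pi> h where "irrep K \<pi>" "ALL i:I. ALL k:K. \<pi> i k = 0"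
  "h : K" "norm h = 1" "quot_norm (emb ` I) (emb (star a * a)) <= (norm (\<pi> a h))^2"
proof -
 let ?q = "quot_norm (emb ` I)" and ?b = "emb (star a * a)"
 have I': "cstar_ideal (emb ` I)" by (rule cstar_ideal_emb[OF I])
 have q: "sublinear ?q" by (rule quot_norm_sublinear[OF cidealD(1)[OF I']])
 have zI: "0 : emb ` I" by (rule csub(1)[OF cidealD(1)[OF I']])
 have q1: "?q 1 = 1"
 proof (rule antisym)
  show "?q 1 <= 1" using quot_norm_le[OF zI, of 1] by simp
  show "1 <= ?q 1"
  proof (rule quot_norm_greatest)
   fix i assume "i : emb ` I"
   hence "sc (1 + i) = 1" by auto
   thus "1 <= norm (1 + i)" using unitz_norm_le(1)[of "1 + i"] by simp
  qed (use zI in blast)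
 qed
 define p where "p = face_at ?q 1"
 have pf: "dom_face p ?q" unfolding p_def by (rule face_at_face[OF q])
 obtain f where f: "linear f" "dom_face f p" "f ?b = p ?b"
  by (rule extreme_functional[OF dom_faceD(1)[OF pf]])
 have face: "dom_face f ?q" by (rule dom_face_trans[OF pf f(2)])
 have f1: "f 1 = 1"
 proof (rule antisym)
  show "f 1 <= 1" using dom_faceD(2)[OF face, of 1] q1 by simp
  have "f (- 1) <= - 1" using dom_faceD(2)[OF f(2), of "- 1"] face_at_neg[OF q, of 1] q1 by (simp add: p_def)
  thus "1 <= f 1" using linear_neg[OF f(1), of 1] by simp
 qed
 have fb: "?q ?b <= f ?b"
  unfolding f(3) p_def
 proof (rule face_at_greatest)
  fix t :: real assume "0 <= t"
  from quot_norm_shift[OF I this, of a] show "?q ?b <= ?q (?b + t *R 1) - t * ?q 1"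
   unfolding q1 by (simp add: of_real_def)
 qed
 hence "f ?b ~= 0" using nz by linarith
 then obtain K :: "'a ell2 set" and \<pi> h where K: "irrep K \<pi>" "ALL i:I. ALL k:K. \<pi> i k = 0"
  "h : K" "norm h = 1" "(norm (\<pi> a h))^2 = f ?b"
  by (rule extreme_state_irreducible[OF I f(1) face f1])
 show thesis by (rule that[OF K(1-4)]) (unfold K(5), rule fb)
qed

text \<open>By \<open>ideal_square\<close> also a* a lies outside the closed set I, hence has
  positive quotient norm.\<close>

theorem irreducible_separation:
 fixes I :: "'a::cstar_algebra set"
 assumes I: "cstar_ideal I" and a: "a ~: I"
 obtains K :: "'a ell2 set" and \<pi> h where "irrep K \<pi>" "ALL i:I. ALL k:K. \<pi> i k = 0"
  "h : K" "\<pi> a h ~= 0"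
proof -
 let ?q = "quot_norm (emb ` I)" and ?b = "emb (star a * a)"
 have I': "cstar_ideal (emb ` I)" by (rule cstar_ideal_emb[OF I])
 have ne: "emb ` I ~= {}" using csub(1)[OF cidealD(1)[OF I]] by blast
 have "?b ~: emb ` I" using a ideal_square[OF I, of a] by auto
 hence "?b : - emb ` I" by simp
 then obtain e where e0: "0 < e" "ball ?b e <= - emb ` I"
  using open_Compl[OF cidealD(2)[OF I']] open_contains_ball by metis
 have e: "e <= dist ?b x" if "x : emb ` I" for x
  using e0(2) that by (meson ComplD in_mono mem_ball not_le)
 have "e <= ?q ?b"
 proof (rule quot_norm_greatest[OF ne])
  fix i assume "i : emb ` I"
  hence "- i : emb ` I" by (rule csub(5)[OF cidealD(1)[OF I']])
  from e[OF this] show "e <= norm (?b + i)" by (simp add: dist_norm)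
 qed
 hence pos: "0 < ?q ?b" using e0(1) by linarith
 obtain K :: "'a ell2 set" and \<pi> h where K: "irrep K \<pi>" "ALL i:I. ALL k:K. \<pi> i k = 0"
  "h : K" "norm h = 1" "?q ?b <= (norm (\<pi> a h))^2"
  by (rule irreducible_quot_norm[OF I pos])
 have "\<pi> a h ~= 0" using K(5) pos by auto
 thus thesis by (rule that[OF K(1-3)])
qed

theorem irreducible_norming:
 fixes a :: "'a::cstar_algebra"
 assumes "a ~= 0"
 obtains K :: "'a ell2 set" and \<pi> h where "irrep K \<pi>" "h : K" "norm h = 1" "norm a <= norm (\<pi> a h)"
proof -
 let ?q = "quot_norm (emb ` {0::'a})" and ?b = "emb (star a * a)"
 have "(norm a)^2 <= ?q ?b"
 proof (rule quot_norm_greatest)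
  fix i :: "'a unitz" assume "i : emb ` {0}"
  hence "?b + i = ?b" by (simp add: emb_0)
  thus "(norm a)^2 <= norm (?b + i)" by (simp add: cstar_identity)
 qed simp
 moreover from this have pos: "0 < ?q ?b" using assms by (smt (verit) zero_less_power2 norm_eq_zero)
 obtain K :: "'a ell2 set" and \<pi> h where K: "irrep K \<pi>" "ALL i:{0}. ALL k:K. \<pi> i k = 0"
  "h : K" "norm h = 1" "?q ?b <= (norm (\<pi> a h))^2"
  by (rule irreducible_quot_norm[OF cstar_ideal_zero pos])
 ultimately have "(norm a)^2 <= (norm (\<pi> a h))^2" by linarith
 hence "norm a <= norm (\<pi> a h)" by (rule power2_le_imp_le) simp
 thus thesis by (rule that[OF K(1,3,4)])
qed

subsection \<open>Homomorphisms and extension of representations\<close>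

lemma star_homD:
 assumes "star_hom f"
 shows "f (a + b) = f a + f b" "f (c *C a) = c *C f a" "f (a * b) = f a * f b" "f (star a) = star (f a)"
 using assms unfolding star_hom_def Vector_Spaces.linear_iff by auto

lemma hom_more:
 assumes "star_hom f"
 shows "f 0 = 0" "f (- a) = - f a" "f (a - b) = f a - f b" "f (r *R a) = r *R f a"
proof -
 note s = star_homD[OF assms]
 show 0: "f 0 = 0" using s(2)[of 0 0] by simp
 show m: "f (- a) = - f a" for a using s(2)[of "-1" a] by simp
 show "f (a - b) = f a - f b" using s(1)[of a "- b"] m by simp
 show "f (r *R a) = r *R f a" by (simp add: scaleR_conv_scaleC s(2))
qed

text \<open>Some irreducible representation of the target attains norm (f a), and composed with f it
  is a representation of the source, hence contractive.\<close>

lemma star_hom_norm: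
 assumes f: "star_hom (f :: 'a::cstar_algebra => 'b::cstar_algebra)" shows "norm (f a) <= norm a"
proof (cases "f a = 0")
 case False
 obtain K :: "'b ell2 set" and \<pi> h where K: "irrep K \<pi>" "h : K" "norm h = 1" "norm (f a) <= norm (\<pi> (f a) h)"
  by (rule irreducible_norming[OF False])
 have "norm (\<pi> (f a) h) <= norm a * norm h" by (rule rep_norm[OF rep_restrict[OF irrepD(1)[OF K(1)] f] K(2)])
 thus ?thesis using K(3,4) by simp
qed simp

definition uext :: "('a => 'b) => 'a unitz => 'b unitz"
 where "uext f u = Unitz (f (el u)) (sc u)"

lemma uext_sel [simp]: "el (uext f u) = f (el u)" "sc (uext f u) = sc u"
 by (simp_all add: uext_def)

lemma uext_hom:
 assumes f: "star_hom (f :: 'a::cstar_algebra => 'b::cstar_algebra)"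
 shows "uext f (u + v) = uext f u + uext f v" "uext f (c *C u) = c *C uext f u" "uext f (r *R u) = r *R uext f u"
  "uext f (u * v) = uext f u * uext f v" "uext f (star u) = star (uext f u)" "uext f 1 = 1" "uext f (emb a) = emb (f a)"
 by (simp_all add: unitz_eq_iff star_homD[OF f] hom_more[OF f])

lemma bounded_linear_uext:
 assumes f: "star_hom (f :: 'a::cstar_algebra => 'b::cstar_algebra)" shows "bounded_linear (uext f)"
proof (rule bounded_linear_intro[where K = 3])
 show "uext f (x + y) = uext f x + uext f y" for x y by (rule uext_hom(1)[OF f])
 show "uext f (r *R x) = r *R uext f x" for r x by (rule uext_hom(3)[OF f])
 fix u :: "'a unitz"
 have "norm (uext f u) <= norm (f (el u)) + cmod (sc u)" using unitz_norm_bounds(3)[of "uext f u"] by (simp add: norm_unitz_def)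
 also have "... <= norm u * 3" using star_hom_norm[OF f, of "el u"] unitz_norm_le[of u] by simp
 finally show "norm (uext f u) <= norm u * 3" .
qed

text \<open>q b is the best upper bound for f b that f <= p and f (F u) = f0 u force. A linear
  functional below q is at most f0 along F, and applying this to u and - u gives equality.\<close>

lemma dominated_extension:
 fixes p :: "'v::real_vector => real" and F :: "'u::real_vector => 'v"
 assumes p: "sublinear p" and F: "linear F" and f0: "linear f0" and le: "!!u. f0 u <= p (F u)"
 obtains f where "linear f" "!!x. f x <= p x" "!!u. f (F u) = f0 u"
proof -
 define q where "q b = (INF u. p (b + F u) - f0 u)" for b
 have bd: "- p (- b) <= p (b + F u) - f0 u" for b u
  using le[of u] sublinearD(1)[OF p, of "b + F u" "- b"] by simp
 have qle: "q b <= p (b + F u) - f0 u" for b u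
  unfolding q_def by (rule cINF_lower) (auto intro!: bdd_belowI2[where m = "- p (- b)"] bd)
 have qge: "m <= q b" if "!!u. m <= p (b + F u) - f0 u" for m b
  unfolding q_def by (rule cINF_greatest) (use that in auto)
 have "sublinear q"
  unfolding sublinear_def
 proof (intro conjI allI impI)
  fix x y
  have "q (x + y) - (p (x + F u) - f0 u) <= q y" for u
  proof (rule qge)
   fix v
   have "q (x + y) <= p ((x + F u) + (y + F v)) - (f0 u + f0 v)"
    using qle[of "x + y" "u + v"] by (simp add: linear_add[OF F] linear_add[OF f0] algebra_simps)
   thus "q (x + y) - (p (x + F u) - f0 u) <= p (y + F v) - f0 v"
    using sublinearD(1)[OF p, of "x + F u" "y + F v"] by linarith
  qed
  hence "q (x + y) - q y <= q x" by (intro qge) (simp add: algebra_simps)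
  thus "q (x + y) <= q x + q y" by simp
 next
  fix r :: real and x assume r: "0 < r"
  have "q (r *R x) / r <= q x"
  proof (rule qge)
   fix u
   have "q (r *R x) <= p (r *R (x + F u)) - r * f0 u"
    using qle[of "r *R x" "r *R u"] by (simp add: linear_scale[OF F] linear_scale[OF f0] scaleR_add_right)
   also have "... = (p (x + F u) - f0 u) * r" unfolding sublinear_scale[OF p r] by (simp add: algebra_simps)
   finally show "q (r *R x) / r <= p (x + F u) - f0 u" using r by (simp only: pos_divide_le_eq)
  qed
  thus "q (r *R x) <= r * q x" using r by (simp add: pos_divide_le_eq mult.commute)
 qed
 then obtain f where f: "linear f" "dom_face f q" by (rule extreme_functional)
 have fq: "f x <= q x" for x by (rule dom_faceD(2)[OF f(2)])
 have fF: "f (F u) <= f0 u" for u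
  using fq[of "F u"] qle[of "F u" "- u"] by (simp add: linear_neg[OF F] linear_neg[OF f0] sublinear_0[OF p])
 show thesis
 proof (rule that[OF f(1)])
  show "f x <= p x" for x using fq[of x] qle[of x 0] by (simp add: linear_0[OF F] linear_0[OF f0])
  show "f (F u) = f0 u" for u
   using fF[of u] fF[of "- u"] by (simp add: linear_neg[OF F] linear_neg[OF f0] linear_neg[OF f(1)])
 qed
qed

text \<open>The quotient norm of a* a dominates the square of any representation that kills I, and
  by \<open>irreducible_quot_norm\<close> it is reached at an irreducible one.\<close>

lemma rep_bound:
 fixes a :: "'a::cstar_algebra" and H :: "'h::chilbert_space set"
 assumes I: "cstar_ideal I" and r: "representation H \<rho>" and kill: "!!i h. i : I ==> h : H ==> \<rho> i h = 0" and C: "0 <= C"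
  and le: "!!(K::'a ell2 set) \<pi> h. irrep K \<pi> ==> ALL i:I. ALL k:K. \<pi> i k = 0 ==> h : K ==> norm h = 1 ==> norm (\<pi> a h) <= C"
  and h: "h : H"
 shows "norm (\<rho> a h) <= C * norm h"
proof -
 let ?q = "quot_norm (emb ` I) (emb (star a * a))"
 have ne: "emb ` I ~= {}" using csub(1)[OF cidealD(1)[OF I]] by blast
 have "?q <= C^2"
 proof (cases "0 < ?q")
  case True
  obtain K :: "'a ell2 set" and \<pi> h where K: "irrep K \<pi>" "ALL i:I. ALL k:K. \<pi> i k = 0"
   "h : K" "norm h = 1" "?q <= (norm (\<pi> a h))^2" by (rule irreducible_quot_norm[OF I True])
  show ?thesis using K(5) power_mono[OF le[OF K(1-4)], of 2] by simp
 qed (use zero_le_power2[of C] in linarith)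
 have *: "(norm (\<rho> a h))^2 <= norm (emb (star a * a) + i) * (norm h)^2" if "i : emb ` I" for i
 proof -
  obtain k where k: "i = emb k" "k : I" using \<open>i \<in> emb ` I\<close> by blast
  have "cor ((norm (\<rho> a h))^2) = cinner h (\<rho> (star a * a + k) h)"
   unfolding cinner_self[symmetric] rep_star(2)[OF r h rep_in[OF r h]]
   by (simp add: rep_add[OF r h] rep_mult[OF r h] kill[OF k(2) h])
  hence "(norm (\<rho> a h))^2 = cmod (cinner h (\<rho> (star a * a + k) h))" by (metis norm_of_real abs_power2)
  also have "... <= norm h * (norm (star a * a + k) * norm h)"
   using cauchy_schwarz[of h "\<rho> (star a * a + k) h"] mult_left_mono[OF rep_norm[OF r h, of "star a * a + k"], of "norm h"] by simp
  finally show ?thesis by (simp add: k(1) emb_add[symmetric] power2_eq_square ac_simps)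
 qed
 have "(norm (\<rho> a h))^2 <= (C * norm h)^2"
 proof (cases "h = 0")
  case False
  have "(norm (\<rho> a h))^2 / (norm h)^2 <= ?q"
   by (rule quot_norm_greatest[OF ne]) (use * False in "simp add: divide_le_eq")
  thus ?thesis using `?q <= C^2` False by (simp add: divide_le_eq power_mult_distrib) (meson mult_right_mono order_trans zero_le_power2)
 qed (simp add: rep_vzero[OF r])
 thus ?thesis by (rule power2_le_imp_le) (simp add: C)
qed

text \<open>Hahn-Banach carries the vector state of xi along psi to a state that vanishes on J, and
  GNS does the rest. The point is the domination f0 u <= rho = norm (psi(u) + i): with s the real
  part of u, psi sends the positive part of s - rho into J, so f0 kills it, and adding it to rho - s
  gives a positive element.\<close>

lemma state_extension:
 fixes \<psi> :: "'a::cstar_algebra => 'b::cstar_algebra" and H :: "'h::chilbert_space set"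
 assumes hom: "star_hom \<psi>" and J: "cstar_ideal J" and r: "representation H \<pi>"
  and kill: "!!a h. \<psi> a : J ==> h : H ==> \<pi> a h = 0" and \<xi>: "\<xi> : H" "norm \<xi> = 1"
 obtains K :: "'b unitz ell2 set" and \<Phi> \<eta> where "representation K \<Phi>" "\<eta> : K" "!!j k. j : J ==> k : K ==> \<Phi> j k = 0"
  "!!a. cinner \<eta> (\<Phi> (\<psi> a) \<eta>) = cinner \<xi> (\<pi> a \<xi>)"
proof -
 note ux = uext_hom[OF hom]
 have J': "cstar_ideal (emb ` J)" by (rule cstar_ideal_emb[OF J])
 let ?F = "uext \<psi>" and ?p = "quot_norm (emb ` J)"
 \<comment> \<open>The real part of the vector state on the unitization; the unit contributes
   \<open>Re (sc u)\<close> because norm xi = 1.\<close>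
 define f0 where "f0 u = Re (cinner \<xi> (\<pi> (el u) \<xi>)) + Re (sc u)" for u
 have lf0: "linear f0" by (rule linearI) (simp_all add: f0_def rep_add[OF r \<xi>(1)] cinner_add_right scaleR_conv_scaleC rep_scale[OF r \<xi>(1)] cinner_scaleC_right algebra_simps)
 have lF: "linear ?F" by (rule bounded_linear.linear[OF bounded_linear_uext[OF hom]])
 have f0pos: "0 <= f0 x" if x: "pos x" for x
 proof -
  obtain y where y: "star y = y" "x = y * y" using x by (auto simp: pos_def)
  define v where "v = \<pi> (el y) \<xi> + sc y *C \<xi>"
  have sy: "star (el y) = el y" "cnj (sc y) = sc y" using y(1) by (simp_all add: unitz_eq_iff)
  have 1: "cinner (\<pi> (el y) \<xi>) k = cinner \<xi> (\<pi> (el y) k)" if "k : H" for k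
   using rep_star(2)[OF r \<xi>(1) that, of "el y"] sy by simp
  have \<xi>\<xi>: "cinner \<xi> \<xi> = 1" by (simp add: cinner_self \<xi>(2))
  have "cor ((norm v)^2) = cinner \<xi> (\<pi> (el x) \<xi>) + sc x"
   unfolding cinner_self[symmetric] v_def y(2)
   by (simp add: cinner_add_left cinner_add_right cinner_scaleC_left cinner_scaleC_right sy(2) 1 rep_in[OF r] \<xi>
     rep_add[OF r \<xi>(1)] rep_scale[OF r \<xi>(1)] rep_mult[OF r \<xi>(1)] \<xi>\<xi> algebra_simps)
  hence "(norm v)^2 = f0 x" unfolding f0_def plus_complex.sel[symmetric] by (metis Re_complex_of_real)
  thus ?thesis by (metis zero_le_power2)
 qed
 have f0star: "f0 (star u) = f0 u" for u
 proof -
  have "cinner \<xi> (\<pi> (star (el u)) \<xi>) = cnj (cinner \<xi> (\<pi> (el u) \<xi>))"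
   unfolding rep_star(2)[OF r \<xi>(1) \<xi>(1), symmetric] by (rule cinner_commute)
  thus ?thesis by (simp add: f0_def)
 qed
 have le: "f0 u <= ?p (?F u)" for u
 proof (rule quot_norm_greatest)
  show "emb ` J ~= {}" using csub(1)[OF cidealD(1)[OF J]] by blast
  fix i assume i: "i : emb ` J"
  \<comment> \<open>f0 and the norm bound pass to self-adjoint parts, where functional calculus is
    available.\<close>
  define s where "s = (1/2) *R (u + star u)"
  define k where "k = (1/2) *R (i + star i)"
  define \<rho> where "\<rho> = norm (?F u + i)"
  have ss: "star s = s" "star k = k" by (simp_all add: s_def k_def star_scaleR star_add star_star add.commute)
  have kJ: "k : emb ` J" unfolding k_def scaleR_conv_scaleC
   by (intro csub(2,4)[OF cidealD(1)[OF J']] i ideal_star[OF J'])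
  have sF: "star (?F s) = ?F s" unfolding ux(5)[symmetric] ss ..
  have "?F s + k = (1/2) *R ((?F u + i) + star (?F u + i))"
   unfolding s_def k_def ux(1,3,5) star_add by (simp add: algebra_simps)
  also have "norm ... <= \<rho>"
   using norm_triangle_ineq[of "?F u + i" "star (?F u + i)"] by (simp add: \<rho>_def)
  finally have n: "norm (?F s + k) <= \<rho>" .
  have c: "continuous_on UNIV (%t. max (t - \<rho>) 0)" "continuous_on UNIV (%t. max (\<rho> - t) 0)" "continuous_on UNIV (%t. \<rho>)"
   "continuous_on UNIV (%t::real. t)" "continuous_on UNIV (%t::real. (- 1) * t)" "continuous_on UNIV (%t. \<rho> + (- 1) * t)"
   by (intro continuous_intros)+
  \<comment> \<open>psi(s) + k has norm at most rho, so the positive part of it minus rho is 0;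
    psi(s) itself is congruent to it modulo J.\<close>
  have "norm (cfc (%t. max (t - \<rho>) 0) (?F s + k)) <= 0"
  proof (rule norm_cfc_le[OF _ n c(1)])
   show "star (?F s + k) = ?F s + k" unfolding star_add sF ss ..
   fix t assume "\<bar>t\<bar> <= \<rho>"
   thus "\<bar>max (t - \<rho>) 0\<bar> <= 0" by linarith
  qed
  moreover have "cfc (%t. max (t - \<rho>) 0) (?F s + k) - cfc (%t. max (t - \<rho>) 0) (?F s) : emb ` J"
  proof (rule cfc_diff_in_ideal)
   show "cstar_ideal (emb ` J)" by (rule J')
   show "star (?F s + k) = ?F s + k" unfolding star_add sF ss ..
   show "star (?F s) = ?F s" by (rule sF)
   show "?F s + k - ?F s : emb ` J" using kJ unfolding add_diff_cancel_left' .
   show "continuous_on UNIV (%t. max (t - \<rho>) 0)" by (rule c(1))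
  qed
  ultimately have "- cfc (%t. max (t - \<rho>) 0) (?F s) : emb ` J"
   unfolding norm_le_zero_iff by (simp only: diff_0)
  hence "cfc (%t. max (t - \<rho>) 0) (?F s) : emb ` J"
   using csub(5)[OF cidealD(1)[OF J']] by (metis minus_minus)
  hence "?F (cfc (%t. max (t - \<rho>) 0) s) : emb ` J"
   unfolding cfc_hom[OF bounded_linear_uext[OF hom] ux(4) ux(6) ss(1) sF c(1)] .
  hence "f0 (cfc (%t. max (t - \<rho>) 0) s) = 0"
   using kill[OF _ \<xi>(1)] by (auto simp: f0_def unitz_eq_iff)
  moreover have "0 <= f0 (cfc (%t. max (\<rho> - t) 0) s)" by (rule f0pos[OF pos_cfc[OF ss(1) c(2)]]) simp
  moreover have "of_real \<rho> - s + cfc (%t. max (t - \<rho>) 0) s = cfc (%t. max (\<rho> - t) 0) s"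
  proof -
   have "(%t. max (\<rho> - t) 0) = (%t. \<rho> + (- 1) * t + max (t - \<rho>) 0)" by (rule ext) (simp add: max_def)
   thus ?thesis
    by (simp only: cfc_add[OF ss(1) c(6) c(1)] cfc_add[OF ss(1) c(3) c(5)] cfc_cmult[OF ss(1) c(4)] cfc_const[OF ss(1)] cfc_id[OF ss(1)]) simp
  qed
  ultimately have "0 <= f0 (of_real \<rho>) - f0 s" by (metis (no_types) linear_add[OF lf0] linear_diff[OF lf0] add.right_neutral)
  moreover have "f0 (of_real \<rho>) = \<rho>" by (simp add: f0_def of_real_def rep_zero[OF r \<xi>(1)])
  moreover have "f0 s = f0 u" by (simp add: s_def linear_scale[OF lf0] linear_add[OF lf0] f0star)
  ultimately show "f0 u <= norm (?F u + i)" by (simp add: \<rho>_def)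
 qed
 obtain f where f: "linear f" "!!x. f x <= ?p x" "!!u. f (?F u) = f0 u"
  using dominated_extension[OF quot_norm_sublinear[OF cidealD(1)[OF J']] lF lf0 le] by metis
 have fn: "f x <= norm x" for x
  using f(2)[of x] quot_norm_le[of 0 "emb ` J" x] csub(1)[OF cidealD(1)[OF J']] by simp
 have "f 1 = 1" using f(3)[of 1] by (simp add: ux(6) f0_def rep_zero[OF r \<xi>(1)])
 hence st: "state f" using f(1) fn by (simp add: state_def)
 have fJ: "f (emb j) = 0" if j: "j : J" for j
 proof -
  note sJ = csub(5)[OF cidealD(1)[OF J']]
  have le0: "f i <= 0" if "i : emb ` J" for i using f(2)[of i] quot_norm_le[OF sJ[OF that], of i] by simp
  show ?thesis using le0[of "emb j"] le0[OF sJ, of "emb j"] j by (simp add: linear_neg[OF f(1)])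
 qed
 show thesis
 proof (rule state_gns[OF st])
  fix g :: "'b unitz => 'b unitz ell2" and \<Phi>
  assume g: "csubspace (range g)" "representation (closure (range g)) \<Phi>"
   "!!a x. \<Phi> a (g x) = g (a * x)" "!!x y. cinner (g x) (g y) = complexify f (star x * y)"
  show thesis
 proof (rule that[of "closure (range g)" "%b. \<Phi> (emb b)" "g 1"])
  show "representation (closure (range g)) (%b. \<Phi> (emb b))" by (rule rep_restrict[OF g(2) star_hom_emb])
  show "g 1 : closure (range g)" by (rule subsetD[OF closure_subset rangeI])
  show "\<Phi> (emb j) k = 0" if "j : J" "k : closure (range g)" for j k
   by (rule gns_kills[OF g(2,3,4) J fJ that])
  fix a
  have e: "f (emb (\<psi> c)) = Re (cinner \<xi> (\<pi> c \<xi>))" for c using f(3)[of "emb c"] by (simp add: ux(7) f0_def)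
  have "\<i> *C emb (\<psi> a) = emb (\<psi> (\<i> *C a))" by (simp add: star_homD[OF hom] emb_scaleC)
  thus "cinner (g 1) (\<Phi> (emb (\<psi> a)) (g 1)) = cinner \<xi> (\<pi> a \<xi>)"
   by (simp add: g(3,4) star_1 complexify_def e rep_scale[OF r \<xi>(1)] cinner_scaleC_right complex_eq_iff)
 qed
 qed
qed

subsection \<open>Schur's lemma\<close>

lemma kernel_hilbert:
 assumes H: "hilbert_subspace (H :: 'h::chilbert_space set)" and T: "clin_on H (T :: 'h => 'k::chilbert_space)" "!!h. h : H ==> norm (T h) <= M * norm h"
 shows "hilbert_subspace {h : H. T h = 0}"
 unfolding hilbert_subspace_def
proof (intro conjI csubspaceI)
 note HD = hsubD[OF H]
 show "closed {h : H. T h = 0}"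
  unfolding closed_sequential_limits
 proof (intro allI impI)
  fix f x assume f: "(ALL n. f n : {h : H. T h = 0}) & f ----> x"
  hence x: "x : H" using closed_sequentially[OF HD(2)] by blast
  have "norm (T x) <= M * norm (x - f n)" for n
   using clin_on_lipschitz[OF T(1) HD(1) T(2) x, of "f n"] f by simp
  moreover have "(%n. M * norm (x - f n)) ----> M * norm (x - x)" using f by (intro tendsto_intros) simp
  ultimately have "norm (T x) <= M * norm (x - x)" by (intro LIMSEQ_le_const) auto
  thus "x : {h : H. T h = 0}" using x by simp
 qed
qed (use hsubD[OF H] clin_on_0[OF T(1)] clin_onD[OF T(1)] in auto)

text \<open>D is Q minus its expectation l at a unit vector x, scaled to a contraction, and A = |D|
  comes from the square root iteration for 1 - D D. The kernel of the intertwiner A + D is 0 or H,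
  so A h is D h or - D h. As D has expectation 0 at x, so has A, which forces A x = 0 and D x = 0;
  the kernel of D is then H.\<close>

lemma irreducible_selfadj_scalar:
 fixes H :: "'h::chilbert_space set" and \<pi> :: "'a::cstar_algebra => 'h => 'h"
 assumes irr: "irrep H \<pi>" and Q: "clin_on H Q" "!!h. h : H ==> Q h : H" "!!h. h : H ==> norm (Q h) <= M * norm h"
  and sa: "!!h k. h : H ==> k : H ==> cinner (Q h) k = cinner h (Q k)" and comm: "!!a h. h : H ==> \<pi> a (Q h) = Q (\<pi> a h)"
 shows "EX l::real. ALL h:H. Q h = cor l *C h"
proof -
 note r = irrepD(1)[OF irr]
 note H = rep_hilbert[OF r]
 note HD = hsubD[OF H]
 obtain x0 where x0: "x0 : H" "x0 ~= 0" using irrepD(2)[OF irr] rep_vzero[OF r] by metis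
 define x where "x = cor (1 / norm x0) *C x0"
 have x: "x : H" "norm x = 1" using x0 HD(6) by (simp_all add: x_def norm_scaleC_h norm_divide)
 define l where "l = Re (cinner x (Q x))"
 define N where "N = \<bar>M\<bar> + \<bar>l\<bar> + 1"
 have N: "0 < N" by (simp add: N_def)
 define D where "D h = cor (1 / N) *C (Q h - cor l *C h)" for h
 have DH: "D h : H" if "h : H" for h unfolding D_def by (intro HD(5,6) Q(2) that)
 have Dlin: "clin_on H D" by (rule clin_onI) (simp_all add: D_def clin_onD[OF Q(1)] scaleC_add_right scaleC_diff_right scaleC_scaleC ac_simps)
 have Dnorm: "norm (D h) <= norm h" if h: "h : H" for h
 proof -
  have "norm (Q h - cor l *C h) <= norm (Q h) + \<bar>l\<bar> * norm h"
   using norm_triangle_ineq4[of "Q h" "cor l *C h"] by (simp add: norm_scaleC_h)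
  also have "... <= N * norm h"
   using Q(3)[OF h] mult_right_mono[OF abs_ge_self[of M] norm_ge_zero[of h]] norm_ge_zero[of h]
   unfolding N_def distrib_right by linarith
  finally show ?thesis using N by (simp add: D_def norm_scaleC_h norm_divide divide_le_eq mult.commute)
 qed
 have Dsa: "cinner (D h) k = cinner h (D k)" if "h : H" "k : H" for h k
  by (simp add: D_def cinner_scaleC_left cinner_scaleC_right cinner_diff_left cinner_diff_right sa[OF that])
 have Dpi: "\<pi> a (D h) = D (\<pi> a h)" if "h : H" for a h
  by (simp add: D_def that rep_vscale[OF r] rep_vdiff[OF r] HD Q(2) comm)
 \<comment> \<open>R = 1 - D D, so the iteration yields s with (1 - s)^2 = D D and the operator A =
   1 - s below.\<close>
 define R where "R h = h - D (D h)" for h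
 have RH: "R h : H" if "h : H" for h unfolding R_def by (intro HD(5) DH that)
 have Radd: "R (h + k) = R h + R k" "R (c *C h) = c *C R h" if "h : H" "k : H" for h k c
  using that by (simp_all add: R_def clin_onD[OF Dlin] DH scaleC_diff_right)
 have Rnorm: "norm (R h) <= norm h" if h: "h : H" for h
 proof (rule power2_le_imp_le)
  have "cinner (R h) (R h) = cinner h h - cinner (D h) (D h) - cinner (D h) (D h) + cinner (D (D h)) (D (D h))"
   using Dsa[OF h DH[OF h]] Dsa[OF DH[OF h] h]
   by (simp add: R_def cinner_diff_left cinner_diff_right)
  hence "cor ((norm (R h))^2) = cor ((norm h)^2 - (norm (D h))^2 - (norm (D h))^2 + (norm (D (D h)))^2)"
   unfolding cinner_self by simp
  hence "(norm (R h))^2 = (norm h)^2 - (norm (D h))^2 - (norm (D h))^2 + (norm (D (D h)))^2" unfolding of_real_eq_iff .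
  moreover have "(norm (D (D h)))^2 <= (norm (D h))^2" by (rule power_mono[OF Dnorm[OF DH[OF h]]]) simp
  ultimately show "(norm (R h))^2 <= (norm h)^2" using zero_le_power2[of "norm (D h)"] by linarith
 qed simp
 interpret c: contraction_on H R
  by unfold_locales (use csub_real[OF HD(1)] HD(2) RH Radd Rnorm in "simp_all add: scaleR_conv_scaleC_h")
 define s where "s = sqrt_lim R"
 have int: "C (s h) = s (C h)" if "!!y. y : H ==> C y : H" "!!y. y : H ==> C (D y) = D (C y)" "clin_on H C" "!!y. y : H ==> norm (C y) <= m * norm y" "h : H" for C m h
  unfolding s_def
 proof (rule c.lim_intertwine[OF that(1) _ _ _ that(4) that(5)])
  show "C (R y) = R (C y)" if y: "y : H" for y
   unfolding R_def clin_on_diff[OF `clin_on H C` HD(1) y DH[OF DH[OF y]]]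
   by (simp add: `!!y. y : H ==> C (D y) = D (C y)` DH y)
 qed (use clin_onD[OF that(3)] in "simp_all add: scaleR_conv_scaleC_h")
 have sC: "s (c *C h) = c *C s h" if "h : H" for c h
  by (rule int[OF _ _ _ _ that, of "%h. c *C h" "cmod c", symmetric])
   (auto simp: HD(6) clin_onD[OF Dlin] norm_scaleC_h clin_on_def scaleC_add_right scaleC_scaleC mult.commute)
 have sD: "D (s h) = s (D h)" if "h : H" for h by (rule int[OF DH _ Dlin _ that, of 1]) (use Dnorm in auto)
 have spi: "\<pi> a (s h) = s (\<pi> a h)" if "h : H" for a h
  by (rule int[OF _ _ rep_clin[OF r] rep_norm[OF r] that]) (simp_all add: rep_in[OF r] Dpi)
 have sH: "s h : H" if "h : H" for h unfolding s_def by (rule c.lim_in[OF that])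
 have slin: "clin_on H s" by (rule clin_onI) (use c.lim_add sC in "auto simp: s_def")
 have snorm: "norm (s h) <= norm h" if "h : H" for h unfolding s_def by (rule c.lim_norm[OF that])
 define A where "A h = h - s h" for h
 have AH: "A h : H" if "h : H" for h unfolding A_def by (intro HD(5) sH that)
 have AA: "A (A h) = D (D h)" if h: "h : H" for h
 proof -
  have "A (A h) = h - (2 *R s h - s (s h))" by (simp add: A_def clin_on_diff[OF slin HD(1) h sH[OF h]] scaleR_2)
  also have "2 *R s h - s (s h) = R h" unfolding s_def by (rule c.lim_square[OF h])
  finally show ?thesis by (simp add: R_def)
 qed
 have AD: "A (D h) = D (A h)" if h: "h : H" for h
  by (simp add: A_def clin_on_diff[OF Dlin HD(1) h sH[OF h]] sD[OF h])
 define P where "P h = A h + D h" for h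
 have Plin: "clin_on H P" by (rule clin_onI) (simp_all add: P_def A_def clin_onD[OF Dlin] clin_onD[OF slin] scaleC_add_right scaleC_diff_right)
 have Pnorm: "norm (P h) <= 3 * norm h" if h: "h : H" for h
  using norm_triangle_ineq[of "A h" "D h"] norm_triangle_ineq4[of h "s h"] snorm[OF h] Dnorm[OF h] by (simp add: P_def A_def)
 have inv: "{h : H. T h = 0} = {0} \<or> {h : H. T h = 0} = H"
  if T: "clin_on H T" "!!h. h : H ==> norm (T h) <= m * norm h" "!!a h. h : H ==> T (\<pi> a h) = \<pi> a (T h)" for T m
  by (rule irrepD(3)[OF irr kernel_hilbert[OF H T(1,2)]]) (auto simp: T(3) rep_in[OF r] rep_vzero[OF r])
 have Ppi: "P (\<pi> a h) = \<pi> a (P h)" if h: "h : H" for a h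
  by (simp add: P_def A_def rep_vadd[OF r] rep_vdiff[OF r] HD sH DH h spi Dpi)
 \<comment> \<open>If A + D is injective, then (A + D)(A - D) = A A - D D = 0 gives A = D.\<close>
 have pm: "A h = D h \<or> A h = - D h" if h: "h : H" for h
  using inv[OF Plin Pnorm Ppi]
 proof
  assume e: "{h : H. P h = 0} = {0}"
  have "P (A h - D h) = 0"
   by (simp add: P_def clin_on_diff[OF Dlin HD(1)] A_def clin_on_diff[OF slin HD(1)] h DH sH HD sD)
     (use AA[OF h] in "simp add: A_def clin_on_diff[OF slin HD(1) h sH[OF h]]")
  hence "A h - D h : {0}" unfolding e[symmetric] using HD(5)[OF AH[OF h] DH[OF h]] by blast
  thus ?thesis by simp
 next
  assume "{h : H. P h = 0} = H"
  hence "P h = 0" using h by blast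
  thus ?thesis by (simp add: P_def eq_neg_iff_add_eq_0)
 qed
 have "cinner x (Q x) = cor l"
  using sa[OF x(1) x(1)] cinner_commute[of x "Q x"] by (simp add: l_def complex_eq_iff)
 hence xD: "cinner x (D x) = 0"
  by (simp add: D_def cinner_scaleC_right cinner_diff_right cinner_self x(2))
 hence "cinner x (A x) = 0" using pm[OF x(1)] by (auto simp: cinner_minus_right)
 \<comment> \<open>s is contractive, so expectation 1 at the unit vector x forces s x = x.\<close>
 hence xs: "cinner x (s x) = 1" by (simp add: A_def cinner_diff_right cinner_self x(2))
 hence sx: "cinner (s x) x = 1" by (metis cinner_commute complex_cnj_one)
 have "cinner (x - s x) (x - s x) = cor ((norm (s x))^2 - 1)"
  by (simp add: cinner_diff_left cinner_diff_right xs sx cinner_self[of x] cinner_self[of "s x"] x(2))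
 hence "(norm (x - s x))^2 = (norm (s x))^2 - 1" unfolding cinner_self of_real_eq_iff .
 moreover have "(norm (s x))^2 <= 1^2" by (rule power_mono) (use snorm[OF x(1)] x(2) in auto)
 ultimately have "(norm (x - s x))^2 <= 0" by simp
 hence "A x = 0" by (simp add: A_def)
 hence "D x = 0" using pm[OF x(1)] by auto
 moreover have "x ~= 0" using x(2) by auto
 ultimately have "{h : H. D h = 0} = H"
  using inv[OF Dlin, of 1] Dnorm Dpi x(1) by fastforce
 hence "Q h = cor l *C h" if "h : H" for h
 proof -
  have "cor N *C D h = 0" using that `{h : H. D h = 0} = H` by auto
  thus ?thesis using N by (simp add: D_def scaleC_scaleC)
 qed
 thus ?thesis by blast
qed

text \<open>The orthogonal projections between L and M intertwine, and their composite on L is a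
  scalar l by Schur's lemma. Two vectors that are not orthogonal make l > 0, and the projection
  divided by sqrt l is unitary.\<close>

lemma irreducible_orthogonal:
 assumes r: "representation K (\<rho> :: 'a::cstar_algebra => 'h::chilbert_space => 'h)" and L: "irrep L \<rho>" "L <= K" and M: "irrep M \<rho>" "M <= K"
  and x: "x : L" "y : M" "cinner x y ~= 0"
 shows "EX U. rep_iso L \<rho> M \<rho> U"
proof -
 have proj: "EX p. clin_on L p & (ALL h:L. p h : M & norm (p h) <= norm h & (ALL g:M. cinner (p h) g = cinner h g) & (ALL a. \<rho> a (p h) = p (\<rho> a h)))"
  if L: "irrep L \<rho>" "L <= K" and M: "irrep M \<rho>" "M <= K" for L M
 proof -
  note rL = irrepD(1)[OF L(1)] and rM = irrepD(1)[OF M(1)]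
  note LD = hsubD[OF rep_hilbert[OF rL]] and MD = hsubD[OF rep_hilbert[OF rM]]
  have "EX p. p : M & (ALL g:M. cinner p g = cinner h g)" for h
   using riesz_projection[OF rep_hilbert[OF rM], of h] by metis
  then obtain p where p: "p h : M" "!!g. g : M ==> cinner (p h) g = cinner h g" for h by metis
  have e: "p h = k" if "k : M" "!!g. g : M ==> cinner h g = cinner k g" for h k
   by (rule cinner_ext[OF rep_hilbert[OF rM] p(1) that(1)]) (simp add: p(2) that(2))
  have "norm (p h) <= norm h" for h
  proof (cases "p h = 0")
   case False
   have "norm (p h) * norm (p h) = cmod (cinner (p h) (p h))" by (simp add: cinner_self power2_eq_square norm_mult)
   also have "... <= norm h * norm (p h)" unfolding p(2)[OF p(1)] by (rule cauchy_schwarz)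
   finally show ?thesis using False by simp
  qed simp
  moreover have "clin_on L p"
   by (intro clin_onI e MD p(1)) (simp_all add: cinner_add_left cinner_scaleC_left p(2))
  moreover have "\<rho> a (p h) = p (\<rho> a h)" if "h : L" for a h
  proof (rule e[symmetric])
   show "\<rho> a (p h) : M" by (rule rep_in[OF rM p(1)])
   fix g assume g: "g : M"
   have "cinner (\<rho> a h) g = cinner h (\<rho> (star a) g)" using rep_star(2)[OF r] that g L(2) M(2) by blast
   also have "... = cinner (p h) (\<rho> (star a) g)" by (rule p(2)[OF rep_in[OF rM g], symmetric])
   also have "... = cinner (\<rho> a (p h)) g" by (rule rep_star(2)[OF rM p(1) g, symmetric])
   finally show "cinner (\<rho> a h) g = cinner (\<rho> a (p h)) g" .
  qed
  ultimately show ?thesis using p by blast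
 qed
 obtain p where p: "clin_on L p" "!!h. h : L ==> p h : M" "!!h. h : L ==> norm (p h) <= norm h"
  "!!h g. h : L ==> g : M ==> cinner (p h) g = cinner h g" "!!a h. h : L ==> \<rho> a (p h) = p (\<rho> a h)" using proj[OF L M] by blast
 obtain q where q: "clin_on M q" "!!h. h : M ==> q h : L" "!!h. h : M ==> norm (q h) <= norm h"
  "!!h g. h : M ==> g : L ==> cinner (q h) g = cinner h g" "!!a h. h : M ==> \<rho> a (q h) = q (\<rho> a h)" using proj[OF M L] by blast
 note rL = irrepD(1)[OF L(1)] and rM = irrepD(1)[OF M(1)]
 note LD = hsubD[OF rep_hilbert[OF rL]] and MD = hsubD[OF rep_hilbert[OF rM]]
 have qp: "cinner (q (p h)) k = cinner (p h) (p k)" if "h : L" "k : L" for h k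
  using q(4)[OF p(2)[OF that(1)] that(2)] p(4)[OF that(2) p(2)[OF that(1)]] by (metis cinner_commute)
 have "EX l::real. ALL h:L. q (p h) = cor l *C h"
 proof (rule irreducible_selfadj_scalar[OF L(1), where M = 1])
  show "clin_on L (%h. q (p h))" by (rule clin_onI) (simp_all add: clin_onD[OF p(1)] clin_onD[OF q(1)] p(2))
  show "norm (q (p h)) <= 1 * norm h" if "h : L" for h using q(3)[OF p(2)] p(3) that by force
  show "cinner (q (p h)) k = cinner h (q (p k))" if "h : L" "k : L" for h k
   using qp[OF that] qp[OF that(2,1)] by (metis cinner_commute)
 qed (simp_all add: p q)
 then obtain l where l: "!!h. h : L ==> q (p h) = cor l *C h" by blast
 have pp: "cinner (p h) (p k) = cor l * cinner h k" if "h : L" "k : L" for h k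
  unfolding qp[OF that, symmetric] l[OF that(1)] by (simp add: cinner_scaleC_left)
 have px: "p x ~= 0" using p(4)[OF x(1,2)] x(3) by auto
 have "cor ((norm (p x))^2) = cor (l * (norm x)^2)"
  using pp[OF x(1) x(1)] by (simp add: cinner_self)
 hence "(norm (p x))^2 = l * (norm x)^2" unfolding of_real_eq_iff .
 hence l0: "0 < l" using px by (metis zero_less_norm_iff zero_less_power zero_le_power2 zero_less_mult_pos2 mult_eq_0_iff less_eq_real_def)
 define U where "U h = cor (1 / sqrt l) *C p h" for h
 have U: "clin_on L U" by (rule clin_onI) (simp_all add: U_def clin_onD[OF p(1)] scaleC_add_right scaleC_scaleC mult.commute)
 have Ui: "cinner (U h) (U k) = cinner h k" if "h : L" "k : L" for h k
 proof -
  have "cor (sqrt l) * cor (sqrt l) = cor l" using l0 by (simp flip: of_real_mult)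
  thus ?thesis using l0 by (simp add: U_def cinner_scaleC_left cinner_scaleC_right pp[OF that] field_simps)
 qed
 have Upi: "U (\<rho> a h) = \<rho> a (U h)" if "h : L" for a h
  by (simp add: U_def p(5)[OF that, symmetric] rep_vscale[OF rM p(2)[OF that]])
 have UM: "U h : M" if "h : L" for h unfolding U_def by (intro MD(6) p(2) that)
 have "U ` L = {0} \<or> U ` L = M"
 proof (rule irrepD(3)[OF M(1) isometry_image_hilbert[OF U Ui rep_hilbert[OF rL]]])
  show "\<rho> a h : U ` L" if "h : U ` L" for a h using that by (auto simp: Upi[symmetric] rep_in[OF rL])
 qed (use UM in auto)
 moreover have "U x ~= 0" using px l0 by (simp add: U_def)
 ultimately have "U ` L = M" using x(1) by blast
 hence "rep_iso L \<rho> M \<rho> U" using U Ui Upi by (simp add: rep_iso_def)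
 thus ?thesis by blast
qed

subsection \<open>The spectrum\<close>

text \<open>The point of the spectrum given by a representation on an arbitrary Hilbert space
  type.\<close>

definition cls :: "'h::chilbert_space set => ('a::cstar_algebra => 'h => 'h) => ('a, 'a ell2) rep set"
 where "cls H \<pi> = {(K, \<rho>). irrep K \<rho> & (EX U. rep_iso H \<pi> K \<rho> U)}"

lemma rep_iso_sym: "representation H (\<pi> :: 'a::cstar_algebra => 'h::chilbert_space => 'h) ==> rep_iso H \<pi> K \<rho> U ==> EX V. rep_iso K \<rho> H \<pi> V"
 using rep_iso_inverse by metis

lemma cls_ex:
 fixes \<pi> :: "'a::cstar_algebra => 'h::chilbert_space => 'h"
 assumes "irrep H \<pi>"
 obtains K :: "'a ell2 set" and \<rho> U where "irrep K \<rho>" "rep_iso H \<pi> K \<rho> U" "(K, \<rho>) : cls H \<pi>"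
proof -
 obtain K :: "'a ell2 set" and \<rho> U where "irrep K \<rho>" "rep_iso H \<pi> K \<rho> U"
  by (rule irreducible_compress'[OF assms])
 thus thesis using that by (auto simp: cls_def)
qed

lemma cls_eq:
 assumes p: "irreducible_rep (H, \<pi> :: 'a::cstar_algebra => 'h::chilbert_space => 'h)" and q: "irreducible_rep (K, \<rho> :: 'a => 'k::chilbert_space => 'k)"
 shows "cls H \<pi> = cls K \<rho> <-> (EX U. rep_iso H \<pi> K \<rho> U)"
proof
 note r = irrepD(1)[OF p] irrepD(1)[OF q]
 obtain L :: "'a ell2 set" and \<sigma> U where L: "rep_iso H \<pi> L \<sigma> U" "(L, \<sigma>) : cls H \<pi>" by (rule cls_ex[OF p])
 assume "cls H \<pi> = cls K \<rho>"
 then obtain V where "rep_iso K \<rho> L \<sigma> V" using L(2) by (auto simp: cls_def)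
 from rep_iso_sym[OF r(2) this] show "EX U. rep_iso H \<pi> K \<rho> U" using rep_iso_trans[OF L(1)] by blast
next
 note r = irrepD(1)[OF p] irrepD(1)[OF q]
 assume "EX U. rep_iso H \<pi> K \<rho> U"
 then obtain U where U: "rep_iso H \<pi> K \<rho> U" ..
 obtain V where V: "rep_iso K \<rho> H \<pi> V" using rep_iso_sym[OF r(1) U] by blast
 show "cls H \<pi> = cls K \<rho>" using rep_iso_trans[OF U] rep_iso_trans[OF V] by (fastforce simp: cls_def)
qed

lemma cls_self:
 assumes "(H, \<pi>) : cls K \<rho>" shows "irrep H \<pi>" "EX U. rep_iso K \<rho> H \<pi> U"
 using assms by (auto simp: cls_def)

lemma cls_class:
 fixes \<pi> :: "'a::cstar_algebra => 'a ell2 => 'a ell2"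
 assumes "irrep H \<pi>"
 shows "{(p, q). irreducible_rep p & irreducible_rep q & unitarily_equivalent p q} `` {(H, \<pi>)} = cls H \<pi>"
 using assms by (auto simp: cls_def unitarily_equivalent_iff)

lemma cls_spectrum:
 fixes \<pi> :: "'a::cstar_algebra => 'h::chilbert_space => 'h"
 assumes "irrep H \<pi>" shows "cls H \<pi> : spectrum"
proof -
 obtain K :: "'a ell2 set" and \<rho> U where K: "irrep K \<rho>" "rep_iso H \<pi> K \<rho> U" by (rule irreducible_compress'[OF assms])
 have "cls H \<pi> = cls K \<rho>" using cls_eq[OF assms K(1)] K(2) by blast
 also have "... : spectrum" unfolding spectrum_def cls_class[OF K(1), symmetric] using K(1) by (blast intro: quotientI)
 finally show ?thesis .
qed

lemma spectrum_cls:
 fixes c :: "('a::cstar_algebra, 'a ell2) rep set"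
 assumes "c : spectrum"
 obtains H and \<pi> :: "'a action" where "irrep H \<pi>" "c = cls H \<pi>"
proof -
 obtain p where p: "irreducible_rep p" "c = {(p, q). irreducible_rep p & irreducible_rep q & unitarily_equivalent p q} `` {p}"
  using assms unfolding spectrum_def quotient_def by blast
 obtain H \<pi> where "p = (H, \<pi>)" by (cases p)
 thus thesis using that[of H \<pi>] p cls_class[of H \<pi>] by simp
qed

lemma cls_hat:
 assumes p: "irreducible_rep (H, \<pi> :: 'a::cstar_algebra => 'h::chilbert_space => 'h)"
 shows "cls H \<pi> : hat I <-> (EX a:I. EX h:H. \<pi> a h ~= 0)"
proof -
 have *: "(EX a:I. EX h:K. \<rho> a h ~= 0) <-> (EX a:I. EX h:H. \<pi> a h ~= 0)" if q: "(K, \<rho>) : cls H \<pi>" for K \<rho>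
 proof -
  obtain U where U: "rep_iso H \<pi> K \<rho> U" using cls_self[OF q] by blast
  note u = rep_isoD[OF U]
  have "\<rho> a (U h) = 0 <-> \<pi> a h = 0" if h: "h : H" for a h
  proof -
   have "norm (\<rho> a (U h)) = norm (\<pi> a h)" unfolding u(4)[OF h, symmetric]
    by (rule isometry_norm[OF u(3) rep_in[OF irrepD(1)[OF p] h]])
   thus ?thesis by (metis norm_eq_zero)
  qed
  thus ?thesis unfolding u(2)[symmetric] by blast
 qed
 obtain K :: "'a ell2 set" and \<rho> U where K: "(K, \<rho>) : cls H \<pi>" by (rule cls_ex[OF p])
 show ?thesis
 proof
  assume "cls H \<pi> : hat I"
  then obtain K \<rho> where "(K, \<rho>) : cls H \<pi>" "EX a:I. EX h:K. \<rho> a h ~= 0" unfolding hat_def by blast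
  thus "EX a:I. EX h:H. \<pi> a h ~= 0" using * by simp
 next
  assume "EX a:I. EX h:H. \<pi> a h ~= 0"
  hence "EX a:I. EX h:K. \<rho> a h ~= 0" unfolding *[OF K] .
  thus "cls H \<pi> : hat I" unfolding hat_def using cls_spectrum[OF p] K by blast
 qed
qed

lemma hat_spectrum: "hat I <= spectrum" by (auto simp: hat_def)

lemma hat_mono: "I <= I' ==> hat I <= hat I'" unfolding hat_def by blast

lemma hat_subset_iff:
 fixes I' :: "'a::cstar_algebra set"
 assumes "cstar_ideal I'" shows "hat I <= hat I' <-> I <= I'"
proof (rule iffI[OF subsetI hat_mono])
 fix a assume s: "hat I <= hat I'" and a: "a : I"
 show "a : I'"
 proof (rule ccontr)
  assume "a ~: I'"
  then obtain K :: "'a ell2 set" and \<pi> h where K: "irrep K \<pi>" "ALL i:I'. ALL k:K. \<pi> i k = 0" "h : K" "\<pi> a h ~= 0"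
   by (rule irreducible_separation[OF assms])
  thus False using s a cls_hat[OF K(1)] by blast
 qed
qed

lemma hat_UNIV: "hat UNIV = (spectrum :: ('a::cstar_algebra, 'a ell2) rep set set)"
proof
 show "spectrum <= (hat UNIV :: ('a, 'a ell2) rep set set)"
 proof
  fix c :: "('a, 'a ell2) rep set" assume "c : spectrum"
  then obtain H and \<pi> :: "'a action" where p: "irrep H \<pi>" "c = cls H \<pi>" by (rule spectrum_cls)
  show "c : hat UNIV" unfolding p(2) cls_hat[OF p(1)] using irrepD(2)[OF p(1)] by blast
 qed
qed (rule hat_spectrum)

text \<open>The common kernel of the representations outside U, the largest ideal whose hat lies in
  U.\<close>

definition hull_ideal :: "('a::cstar_algebra, 'a ell2) rep set set => 'a set"
 where "hull_ideal U = {a. ALL H (\<pi> :: 'a action). irrep H \<pi> --> cls H \<pi> ~: U --> (ALL h:H. \<pi> a h = 0)}"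

lemma rep_kernel_ideal:
 assumes r: "representation H (\<pi> :: 'a::cstar_algebra => 'h::chilbert_space => 'h)"
 shows "cstar_ideal {a. ALL h:H. \<pi> a h = 0}"
 unfolding cstar_ideal_def
proof (intro conjI csubspaceI)
 show "closed {a. ALL h:H. \<pi> a h = 0}"
  unfolding closed_sequential_limits
 proof (intro allI impI, elim conjE)
  fix f a assume f: "ALL n. f n : {a. ALL h:H. \<pi> a h = 0}" "f ----> a"
  have "\<pi> a h = 0" if "h : H" for h using rep_tendsto_alg[OF r that f(2)] f(1) that by (simp add: LIMSEQ_const_iff)
  thus "a : {a. ALL h:H. \<pi> a h = 0}" by blast
 qed
qed (use r in "auto simp: rep_zero rep_add rep_scale rep_mult rep_in rep_vzero")

lemma cstar_ideal_Inter:
 assumes "!!J. J : C ==> cstar_ideal J" shows "cstar_ideal (\<Inter>C)"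
 using assms unfolding cstar_ideal_def by (auto intro!: complex_vector.subspace_Inter)

lemma hull_ideal_ideal:
 fixes U :: "('a::cstar_algebra, 'a ell2) rep set set"
 shows "cstar_ideal (hull_ideal U)"
proof -
 let ?P = "{p :: ('a, 'a ell2) rep. irreducible_rep p & cls (fst p) (snd p) ~: U}" and ?k = "%p. {a. ALL h:fst p. snd p a h = 0}"
 have "hull_ideal U = \<Inter>(?k ` ?P)"
 proof (intro equalityI subsetI)
  fix a assume a: "a : \<Inter>(?k ` ?P)"
  have "ALL h:H. \<pi> a h = 0" if "irrep H \<pi>" "cls H \<pi> ~: U" for H and \<pi> :: "'a action"
   using INT_D[OF a, of "(H, \<pi>)"] that by simp
  thus "a : hull_ideal U" by (simp add: hull_ideal_def)
 qed (auto simp: hull_ideal_def)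
 also have "cstar_ideal ..."
 proof (rule cstar_ideal_Inter)
  fix J assume "J : ?k ` ?P"
  then obtain p where p: "p : ?P" "J = ?k p" by blast
  show "cstar_ideal J" unfolding p(2) by (rule rep_kernel_ideal, rule irrepD(1)) (use p(1) in simp)
 qed
 finally show ?thesis .
qed

lemma hat_hull_subset:
 fixes U :: "('a::cstar_algebra, 'a ell2) rep set set"
 shows "hat (hull_ideal U) <= U"
proof
 fix c :: "('a, 'a ell2) rep set" assume c: "c : hat (hull_ideal U)"
 then obtain H and \<pi> :: "'a action" where p: "irrep H \<pi>" "c = cls H \<pi>"
  using hat_spectrum by (meson spectrum_cls subsetD)
 thus "c : U" using c cls_hat[OF p(1)] by (auto simp: hull_ideal_def)
qed

text \<open>Induction over the generation of the topology. Finite intersections rest on primeness of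
  kernels: if a and b act nontrivially in an irreducible representation, so does a x b for some
  x.\<close>

lemma openin_hull:
 fixes U :: "('a::cstar_algebra, 'a ell2) rep set set"
 assumes "openin spectrum_topology U" shows "U = hat (hull_ideal U)"
proof -
 have "c : hat (hull_ideal U)" if "c : U" for c
  using assms[unfolded spectrum_topology_def openin_topology_generated_by_iff] that
 proof (induction arbitrary: c rule: generate_topology_on.induct)
  case (Int U V)
  have "c : spectrum" using Int hat_spectrum by blast
  then obtain H and \<pi> :: "'a action" where p: "irrep H \<pi>" "c = cls H \<pi>" by (rule spectrum_cls)
  note r = irrepD(1)[OF p(1)]
  have cU: "cls H \<pi> : hat (hull_ideal U)" "cls H \<pi> : hat (hull_ideal V)" using Int p(2) by auto
  obtain a h where a: "a : hull_ideal U" "h : H" "\<pi> a h ~= 0" using cU(1) cls_hat[OF p(1)] by blast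
  obtain b k where b: "b : hull_ideal V" "k : H" "\<pi> b k ~= 0" using cU(2) cls_hat[OF p(1)] by blast
  have "EX x. \<pi> (a * x * b) k ~= 0"
  proof (rule ccontr)
   assume "\<nexists>x. \<pi> (a * x * b) k ~= 0"
   hence 0: "\<pi> i (\<pi> b k) = 0" if "i : {a * x |x. True}" for i
    using that by (auto simp: rep_mult[OF r] b(2) rep_in[OF r])
   have sub: "!!y i. i : {a * x |x. True} ==> i * y : {a * x |x. True}" by (auto simp: mult.assoc)
   have z: "\<pi> (a * x) y = 0" if "y : H" for x y
    using irreducible_nondegenerate[OF p(1) sub _ _ _ rep_in[OF r b(2)] 0] b(3) that by blast
   have z': "\<pi> (star a) y = 0" if y: "y : H" for y
   proof -
    have "cinner (\<pi> (star a) y) (\<pi> (star a) y) = cinner y (\<pi> (a * star a) y)"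
     by (simp add: rep_star(1)[OF r y rep_in[OF r y]] rep_mult[OF r y])
    thus ?thesis by (simp add: z[OF y] cinner_self)
   qed
   have "cinner (\<pi> a h) (\<pi> a h) = cinner h (\<pi> (star a) (\<pi> a h))" by (rule rep_star(2)[OF r a(2) rep_in[OF r a(2)]])
   thus False using a(3) by (simp add: z'[OF rep_in[OF r a(2)]] cinner_self)
  qed
  then obtain x where x: "\<pi> (a * x * b) k ~= 0" ..
  have "a * x * b : hull_ideal U" by (intro cidealD(4)[OF hull_ideal_ideal] a(1))
  moreover have "a * x * b : hull_ideal V" by (rule cidealD(3)[OF hull_ideal_ideal b(1)])
  ultimately have "a * x * b : hull_ideal (U \<inter> V)" by (auto simp: hull_ideal_def)
  thus ?case unfolding p(2) cls_hat[OF p(1)] using x b(2) by blast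
 next
  case (UN K)
  then obtain k where k: "k : K" "c : hat (hull_ideal k)" by blast
  have "hull_ideal k <= hull_ideal (\<Union>K)" using k(1) by (auto simp: hull_ideal_def)
  from hat_mono[OF this] show ?case using k(2) by blast
 next
  case (Basis s)
  then obtain I where I: "s = hat I" by blast
  have "I <= hull_ideal (hat I)"
   unfolding hull_ideal_def
  proof (intro subsetI CollectI allI impI ballI)
   fix a H \<pi> h assume a: "a : I" and p: "irrep H \<pi>" "cls H \<pi> ~: hat I" and h: "h : H"
   show "\<pi> a h = 0" using p(2) a h unfolding cls_hat[OF p(1)] by blast
  qed
  from hat_mono[OF this] show ?case using Basis(2) unfolding I by blast
 qed simp
 thus ?thesis using hat_hull_subset by blast
qed

lemma openin_hat: "cstar_ideal I ==> openin spectrum_topology (hat I)"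
 unfolding spectrum_topology_def by (rule topology_generated_by_Basis) blast

lemma topspace_spectrum [simp]: "topspace spectrum_topology = spectrum"
proof
 show "topspace spectrum_topology <= spectrum"
  unfolding spectrum_topology_def topology_generated_by_topspace using hat_spectrum by blast
 show "spectrum <= topspace spectrum_topology"
  using openin_subset[OF openin_hat[OF cstar_ideal_UNIV]] unfolding hat_UNIV .
qed

subsection \<open>Induced representations\<close>

lemma span_closure_eq:
 fixes A B :: "'h::chilbert_space => 'k::chilbert_space"
 assumes A: "clin_on K A" "!!h. h : K ==> norm (A h) <= M * norm h" and B: "clin_on K B" "!!h. h : K ==> norm (B h) <= N * norm h"
  and K: "hilbert_subspace K" "K = closure (cspan S)" and e: "!!h. h : S ==> A h = B h" and h: "h : K"
 shows "A h = B h"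
proof -
 have "hilbert_subspace {h : K. A h - B h = 0}"
 proof (rule kernel_hilbert[OF K(1)])
  show "clin_on K (%h. A h - B h)" by (rule clin_onI) (simp_all add: clin_onD[OF A(1)] clin_onD[OF B(1)] scaleC_diff_right)
  show "norm (A h - B h) <= (M + N) * norm h" if "h : K" for h
   using norm_triangle_ineq4[of "A h" "B h"] A(2)[OF that] B(2)[OF that] by (simp add: distrib_right)
 qed
 note V = hsubD[OF this]
 have "S <= K" unfolding K(2) using complex_vector.span_superset[of S] closure_subset[of "cspan S"] by blast
 hence "cspan S <= {h : K. A h - B h = 0}" using e by (intro complex_vector.span_minimal V(1)) auto
 from closure_minimal[OF this V(2)] show ?thesis using h K(2) by auto
qed

lemma riesz_range:
 fixes g :: "'v::complex_vector => 'h::chilbert_space" and F :: "'v => complex"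
 assumes g: "!!x y. g (x + y) = g x + g y" "!!c x. g (c *C x) = c *C g x" "csubspace (range g)"
  and F: "!!x y. F (x + y) = F x + F y" "!!c x. F (c *C x) = c * F x" and b: "!!x. cmod (F x) <= M * norm (g x)" and M: "0 <= M"
 shows "EX k. k : closure (range g) & (ALL y. cinner k (g y) = F y) & norm k <= M"
proof -
 define \<phi> where "\<phi> v = F (inv g v)" for v
 have \<phi>g: "\<phi> (g y) = F y" for y
 proof -
  let ?w = "inv g (g y) + (-1) *C y"
  have "g ?w = 0" unfolding g(1,2) by (simp add: f_inv_into_f)
  hence "F ?w = 0" using b[of ?w] by simp
  thus ?thesis unfolding F \<phi>_def by simp
 qed
 obtain k where k: "k : closure (range g)" "!!v. v : range g ==> cinner k v = \<phi> v"
 proof (rule riesz_dense[OF g(3), of \<phi> M])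
  show "\<phi> (x + y) = \<phi> x + \<phi> y" if "x : range g" "y : range g" for x y
   using that by (auto simp: g(1)[symmetric] \<phi>g F(1))
  show "\<phi> (c *C x) = c * \<phi> x" if "x : range g" for c x using that by (auto simp: g(2)[symmetric] \<phi>g F(2))
  show "cmod (\<phi> x) <= M * norm x" if "x : range g" for x using that b by (auto simp: \<phi>g)
 qed auto
 have kg: "cinner k (g y) = F y" for y using k(2)[of "g y"] \<phi>g by simp
 obtain f where f: "!!n. f n : range g" "f ----> k" using k(1) unfolding closure_sequential by blast
 have "cmod (cinner k (f n)) <= M * norm (f n)" for n using f(1)[of n] b kg by auto
 moreover have "(%n. cmod (cinner k (f n))) ----> cmod (cinner k k)" by (intro tendsto_norm tendsto_cinner tendsto_const f(2))
 moreover have "(%n. M * norm (f n)) ----> M * norm k" by (intro tendsto_intros f(2))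
 ultimately have "cmod (cinner k k) <= M * norm k" by (meson LIMSEQ_le)
 hence n: "norm k * norm k <= M * norm k" by (simp add: cinner_self power2_eq_square norm_mult)
 have "norm k <= M"
 proof (cases "k = 0")
  case True
  thus ?thesis using M by simp
 next
  case False
  thus ?thesis using n by simp
 qed
 thus ?thesis using k(1) kg by blast
qed

text \<open>The relations of a covariant pair, with X acting from H to K by T and back by the
  adjoints S. A link takes the place of K = X tensor H and, unlike the tensor product, is symmetric
  under exchanging H and K together with the two sides of X.\<close>

definition link :: "('a::cstar_algebra => 'x::complex_vector => 'x) => ('x => 'a => 'x) => ('x => 'x => 'a) => ('x => 'x => 'a) =>
  'h::chilbert_space set => ('a => 'h => 'h) => 'k::chilbert_space set => ('a => 'k => 'k) => ('x => 'h => 'k) => ('x => 'k => 'h) => bool"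
 where "link lact ract innerL innerR H \<pi> K \<rho> T S <->
  (ALL x. clin_on H (T x) & clin_on K (S x)) & (ALL x. ALL h:H. T x h : K) & (ALL x. ALL k:K. S x k : H) &
  (ALL x. ALL h:H. ALL k:K. cinner (T x h) k = cinner h (S x k)) &
  (ALL x y. ALL h:H. T (x + y) h = T x h + T y h) & (ALL c x. ALL h:H. T (c *C x) h = c *C T x h) &
  (ALL a x. ALL h:H. T (lact a x) h = \<rho> a (T x h)) & (ALL a x. ALL h:H. T (ract x a) h = T x (\<pi> a h)) &
  (ALL x y. ALL h:H. S x (T y h) = \<pi> (innerR x y) h) & (ALL x y. ALL k:K. T x (S y k) = \<rho> (innerL x y) k)"

lemma linkD:
 assumes "link lact ract innerL innerR H \<pi> K \<rho> T S"
 shows "clin_on H (T x)" "clin_on K (S x)" "h : H ==> T x h : K" "k : K ==> S x k : H"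
  "h : H ==> k : K ==> cinner (T x h) k = cinner h (S x k)" "h : H ==> T (x + y) h = T x h + T y h" "h : H ==> T (c *C x) h = c *C T x h"
  "h : H ==> T (lact a x) h = \<rho> a (T x h)" "h : H ==> T (ract x a) h = T x (\<pi> a h)"
  "h : H ==> S x (T y h) = \<pi> (innerR x y) h" "k : K ==> T x (S y k) = \<rho> (innerL x y) k"
 using assms unfolding link_def by simp_all

definition good :: "'h::chilbert_space set => ('a::cstar_algebra => 'h => 'h) => bool"
 where "good H \<pi> <-> representation H \<pi> & (H = {0} \<or> irrep H \<pi>)"

context hilbert_bimodule
begin

abbreviation (input) "xlink == link lact ract innerL innerR"

lemma innerR_left:
 "innerR (x + y) z = innerR x z + innerR y z" "innerR (c *C x) z = cnj c *C innerR x z" "innerR (ract x a) z = star a * innerR x z"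
 by (subst (1 2 3) innerR_star[symmetric], simp only: innerR_add star_add)
  (subst (1 2) innerR_star[symmetric], simp only: innerR_scaleC star_scaleC innerR_ract star_mult)+

lemma innerL_right:
 "innerL x (y + z) = innerL x y + innerL x z" "innerL x (c *C z) = cnj c *C innerL x z" "innerL x (lact a z) = innerL x z * star a"
 by (subst (1 2 3) innerL_star[symmetric], simp only: innerL_add star_add)
  (subst (1 2) innerL_star[symmetric], simp only: innerL_scaleC star_scaleC innerL_lact star_mult)+

lemma inner_0: "innerR x 0 = 0" "innerR 0 x = 0"
 using innerR_scaleC[of x 0 0] innerR_left(2)[of 0 0 x] by simp_all

text \<open>The difference of both sides annihilates \<open>X\<close> from the right and is a combination of inner products.\<close>

lemma innerR_lact: "innerR (lact a x) y = innerR x (lact (star a) y)"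
proof -
 define d where "d = innerR (lact a x) y - innerR x (lact (star a) y)"
 have "ract z (innerR (lact a x) y) = ract z (innerR x (lact (star a) y))" for z
  by (simp add: compatible innerL_right(3) lact_mult)
 hence "ract z d + ract z (innerR x (lact (star a) y)) = ract z (innerR x (lact (star a) y))" for z
  unfolding ract_add_right[symmetric] by (simp add: d_def)
 hence 0: "ract z d = 0" for z by simp
 have "innerR u v * d = 0" for u v using innerR_ract[of u v d] by (simp add: 0 inner_0)
 moreover have "star d = innerR y (lact a x) - innerR (lact (star a) y) x" by (simp add: d_def star_diff innerR_star)
 ultimately have "star d * d = 0" by (simp add: left_diff_distrib)
 hence "d = 0" unfolding star_mult_eq_0_iff .
 thus ?thesis by (simp add: d_def)
qed

lemma link_norm:
 assumes l: "xlink H \<pi> K \<rho> T S" and r: "representation H \<pi>" "representation K \<rho>" and h: "h : H"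
 shows "norm (T x h) <= sqrt (norm (innerR x x)) * norm h"
proof -
 note L = linkD[OF l]
 have "(norm (T x h))^2 = cmod (cinner (T x h) (T x h))" by (simp add: cinner_self norm_power)
 also have "... = cmod (cinner h (\<pi> (innerR x x) h))" by (simp add: L(5,10) h L(3)[OF h])
 also have "... <= norm h * (norm (innerR x x) * norm h)"
  by (rule order_trans[OF cauchy_schwarz mult_left_mono[OF rep_norm[OF r(1) h]]]) simp
 also have "... = (sqrt (norm (innerR x x)) * norm h)^2" by (simp add: power_mult_distrib power2_eq_square)
 finally show ?thesis by (rule power2_le_imp_le) simp
qed

text \<open>An invariant M in K pulls back to the invariant M' of all h with every T x h in M. If M'
  = H, then M contains all T x h. If M' = 0, then S x m, which lies in M', vanishes, so M is
  orthogonal to all T x h.\<close>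

lemma link_good:
 assumes l: "xlink H \<pi> K \<rho> T S" and g: "good H \<pi>" and r: "representation K \<rho>"
  and d: "closure (cspan {T x h |x h. h : H}) = K"
 shows "good K \<rho>"
proof (cases "K = {0}")
 case False
 note L = linkD[OF l]
 have rH: "representation H \<pi>" using g by (simp add: good_def)
 note HD = hsubD[OF rep_hilbert[OF rH]] and KD = hsubD[OF rep_hilbert[OF r]]
 have T0: "EX x. EX h:H. T x h ~= 0"
 proof (rule ccontr)
  assume "\<not> ?thesis"
  hence "{T x h |x h. h : H} <= {0}" by blast
  hence "cspan {T x h |x h. h : H} <= {0}" by (rule complex_vector.span_minimal) simp
  hence "K <= {0}" unfolding d[symmetric] by (rule closure_minimal) simp
  thus False using False KD(3) by blast
 qed
 hence "H ~= {0}" using clin_on_0[OF L(1) HD(1)] by blast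
 hence irr: "irrep H \<pi>" using g by (simp add: good_def)
 obtain x0 h0 where "h0 : H" "T x0 h0 ~= 0" using T0 by blast
 hence "cinner (T x0 h0) (T x0 h0) ~= 0" by (simp add: cinner_self)
 hence \<pi>0: "\<pi> (innerR x0 x0) h0 ~= 0" using L(5)[OF `h0 : H` L(3)[OF `h0 : H`]] L(10)[OF `h0 : H`] by auto
 have "T x0 (S x0 (T x0 h0)) ~= 0"
 proof
  assume "T x0 (S x0 (T x0 h0)) = 0"
  moreover have "S x0 (T x0 h0) = \<pi> (innerR x0 x0) h0" by (rule L(10)[OF `h0 : H`])
  moreover have "cinner (T x0 (\<pi> (innerR x0 x0) h0)) (T x0 h0) = cinner (\<pi> (innerR x0 x0) h0) (\<pi> (innerR x0 x0) h0)"
   by (simp add: L(5) L(3) L(10) rep_in[OF rH] `h0 : H`)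
  ultimately show False using \<pi>0 by (simp add: cinner_self)
 qed
 hence \<rho>0: "\<rho> (innerL x0 x0) (T x0 h0) ~= 0" using L(11)[OF L(3)[OF `h0 : H`]] by simp
 have "irrep K \<rho>"
 proof (rule irreducible_repI[OF r L(3)[OF `h0 : H`] \<rho>0])
  fix M assume M: "hilbert_subspace M" "M <= K" "!!a h. h : M ==> \<rho> a h : M"
  note MD = hsubD[OF M(1)]
  define M' where "M' = {h : H. ALL x. T x h : M}"
  have hM': "hilbert_subspace M'"
   unfolding hilbert_subspace_def
  proof (intro conjI csubspaceI)
   show "closed M'"
    unfolding closed_sequential_limits
   proof (intro allI impI, elim conjE)
    fix f h assume f: "ALL n. f n : M'" "f ----> h"
    have fH: "f n : H" for n using f(1) by (simp add: M'_def)
    have h: "h : H" by (rule closed_sequentially[OF HD(2) fH f(2)])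
    have "T x h : M" for x
    proof (rule closed_sequentially[OF MD(2)])
     show "T x (f n) : M" for n using f(1) by (simp add: M'_def)
     show "(%n. T x (f n)) ----> T x h"
     proof (rule Lim_transform_bound[where g = "%n. sqrt (norm (innerR x x)) *R (f n - h)", THEN LIM_zero_cancel])
      show "\<forall>\<^sub>F n in sequentially. norm (T x (f n) - T x h) <= norm (sqrt (norm (innerR x x)) *R (f n - h))"
       using link_norm[OF l rH r HD(5)[OF fH h], of x] by (simp add: clin_on_diff[OF L(1) HD(1) fH h])
      show "(%n. sqrt (norm (innerR x x)) *R (f n - h)) ----> 0"
       using tendsto_scaleR[OF tendsto_const LIM_zero[OF f(2)]] by simp
     qed
    qed
    thus "h : M'" using h by (simp add: M'_def)
   qed
  qed (use HD MD clin_onD[OF L(1)] clin_on_0[OF L(1) HD(1)] in "auto simp: M'_def")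
  have "M' = {0} \<or> M' = H"
   by (rule irrepD(3)[OF irr hM']) (auto simp: M'_def rep_in[OF rH] L(9)[symmetric])
  thus "M = {0} \<or> M = K"
  proof
   assume "M' = H"
   hence "{T x h |x h. h : H} <= M" by (auto simp: M'_def)
   hence "K <= M" unfolding d[symmetric] by (intro closure_minimal complex_vector.span_minimal MD)
   thus ?thesis using M(2) by blast
  next
   assume e: "M' = {0}"
   have Sm: "S x m = 0" if m: "m : M" for x m
   proof -
    have "S x m : M'" using m M(2,3) L(4,11) by (auto simp: M'_def)
    thus ?thesis using e by blast
   qed
   have "m = 0" if m: "m : M" for m
   proof -
    have mK: "m : K" using m M(2) by blast
    have z: "cinner y m = 0" if "y : cspan {T x h |x h. h : H}" for y
     using that by (induction rule: complex_vector.span_induct_alt) (auto simp: cinner_add_left cinner_scaleC_left L(5)[OF _ mK] Sm[OF m])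
    show ?thesis by (rule orth_dense[of m "cspan {T x h |x h. h : H}"]) (simp_all only: d mK z)
   qed
   thus ?thesis using MD(3) by blast
  qed
 qed
 thus ?thesis using r by (simp add: good_def)
qed (use r in "simp add: good_def")

text \<open>The induced space is built from X alone: for a cyclic vector xi, x stands for x tensor
  xi and s is the resulting form. For general h the vector T x h is the Riesz vector of y |-> <h,
  pi(<x, y>_R) xi>. The space thus fits into \<open>'x ell2\<close>.\<close>

lemma link_exists:
 fixes \<pi> :: "'a => 'h::chilbert_space => 'h"
 assumes irr: "irrep H \<pi>"
 shows "EX (K :: 'x ell2 set) \<rho> T S. xlink H \<pi> K \<rho> T S & good K \<rho> & (K = {0} \<or> (EX x. EX h:H. T x h ~= 0))"
proof -
 note r = irrepD(1)[OF irr]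
 note HD = hsubD[OF rep_hilbert[OF r]]
 obtain i \<xi> where \<xi>: "\<xi> : H" "\<pi> i \<xi> ~= 0" using irrepD(2)[OF irr] by blast
 have \<xi>0: "\<xi> ~= 0" using \<xi>(2) rep_vzero[OF r] by auto
 have cyc: "closure (range (%a. \<pi> a \<xi>)) = H"
  by (rule irreducible_cyclic[OF irr _ _ _ _ \<xi> \<xi>(1) \<xi>0]) (auto simp: complex_vector.subspace_UNIV)
 have cyc': "H = closure (cspan (range (%a. \<pi> a \<xi>)))"
  using cyc csubspace_orbit[OF r \<xi>(1), of UNIV] by (simp add: complex_vector.subspace_UNIV complex_vector.span_eq_iff[THEN iffD2])
 define s where "s x y = cinner \<xi> (\<pi> (innerR x y) \<xi>)" for x y
 interpret si: semi_inner s
 proof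
  show "s x (y + z) = s x y + s x z" for x y z by (simp add: s_def innerR_add rep_add[OF r \<xi>(1)] cinner_add_right)
  show "s x (c *C y) = c * s x y" for x c y by (simp add: s_def innerR_scaleC rep_scale[OF r \<xi>(1)] cinner_scaleC_right)
  show "s x y = cnj (s y x)" for x y
   using rep_star(1)[OF r \<xi>(1) \<xi>(1), of "innerR x y"] cinner_commute[of "\<pi> (innerR y x) \<xi>" \<xi>] by (simp add: s_def innerR_star)
  fix x
  obtain b where b: "innerR x x = star b * b" using innerR_positive by (auto simp: positive_elem_def)
  have "s x x = cinner (\<pi> b \<xi>) (\<pi> b \<xi>)"
   by (simp add: s_def b rep_mult[OF r \<xi>(1)] rep_star(2)[OF r \<xi>(1) rep_in[OF r \<xi>(1)]])
  thus "0 <= Re (s x x)" by (simp add: cinner_self)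
 qed
 show ?thesis
 proof (rule si.gns[of lact])
  show "s (lact a x) y = s x (lact (star a) y)" for a x y by (simp add: s_def innerR_lact)
  fix g :: "'x => 'x ell2" and \<rho>
  assume g: "!!x y. g (x + y) = g x + g y" "!!c x. g (c *C x) = c *C g x" "!!x y. cinner (g x) (g y) = s x y"
   "csubspace (range g)" and r\<rho>: "representation (closure (range g)) \<rho>" and \<rho>: "!!a x. \<rho> a (g x) = g (lact a x)"
  let ?K = "closure (range g)"
  note K = rep_hilbert[OF r\<rho>]
  note KD = hsubD[OF K]
  have gK: "g x : ?K" for x by (rule subsetD[OF closure_subset rangeI])
  have ext: "u = v" if "u : ?K" "v : ?K" "!!y. cinner u (g y) = cinner v (g y)" for u v
  proof -
   have "u - v = 0"
   proof (rule orth_dense[OF KD(5)[OF that(1,2)]])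
    fix y assume "y : range g"
    thus "cinner y (u - v) = 0" using that(3) by (subst cinner_commute) (auto simp: cinner_diff_left)
   qed
   thus ?thesis by simp
  qed
  \<comment> \<open>Compatibility of the two inner products turns the square of the left side into
    <g y, rho(<x, x>_L) g y>; the Riesz functional is therefore bounded in g y.\<close>
  have b: "norm (\<pi> (innerR x y) \<xi>) <= sqrt (norm (innerL x x)) * norm (g y)" for x y
  proof (rule power2_le_imp_le)
   have "cinner (\<pi> (innerR x y) \<xi>) (\<pi> (innerR x y) \<xi>) = cinner \<xi> (\<pi> (innerR y x * innerR x y) \<xi>)"
    unfolding rep_star(2)[OF r \<xi>(1) rep_in[OF r \<xi>(1)]] innerR_star rep_mult[OF r \<xi>(1)] ..
   also have "innerR y x * innerR x y = innerR y (lact (innerL x x) y)"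
    unfolding innerR_ract[symmetric] compatible ..
   also have "cinner \<xi> (\<pi> (innerR y (lact (innerL x x) y)) \<xi>) = cinner (g y) (\<rho> (innerL x x) (g y))" by (simp add: \<rho> g(3) s_def)
   finally have "cor ((norm (\<pi> (innerR x y) \<xi>))^2) = cinner (g y) (\<rho> (innerL x x) (g y))" unfolding cinner_self .
   hence "(norm (\<pi> (innerR x y) \<xi>))^2 = cmod (cinner (g y) (\<rho> (innerL x x) (g y)))" by (metis norm_of_real abs_power2)
   also have "... <= norm (g y) * (norm (innerL x x) * norm (g y))"
    by (rule order_trans[OF cauchy_schwarz mult_left_mono[OF rep_norm[OF r\<rho> gK]]]) simp
   also have "... = (sqrt (norm (innerL x x)) * norm (g y))^2" by (simp add: power_mult_distrib power2_eq_square)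
   finally show "(norm (\<pi> (innerR x y) \<xi>))^2 <= (sqrt (norm (innerL x x)) * norm (g y))^2" .
  qed simp
  let ?P = "%x h k. k : ?K & (ALL y. cinner k (g y) = cinner h (\<pi> (innerR x y) \<xi>)) & norm k <= norm h * sqrt (norm (innerL x x))"
  have Pex: "EX k. ?P x h k" for x h
  proof (rule riesz_range[OF g(1,2,4)])
   show "cmod (cinner h (\<pi> (innerR x y) \<xi>)) <= norm h * sqrt (norm (innerL x x)) * norm (g y)" for y
    using order_trans[OF cauchy_schwarz mult_left_mono[OF b norm_ge_zero]] by (simp add: mult.assoc)
  qed (simp_all add: innerR_add rep_add[OF r \<xi>(1)] cinner_add_right innerR_scaleC rep_scale[OF r \<xi>(1)] cinner_scaleC_right)
  define T where "T x h = (SOME k. ?P x h k)" for x h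
  have TP: "?P x h (T x h)" for x h unfolding T_def by (rule someI_ex[OF Pex])
  have T: "T x h : ?K" "cinner (T x h) (g y) = cinner h (\<pi> (innerR x y) \<xi>)" "norm (T x h) <= norm h * sqrt (norm (innerL x x))" for x h y
   using TP[of x h] by blast+
  have Tlin: "clin_on H (T x)" for x
   by (intro clin_onI ext T(1) KD) (simp_all add: cinner_add_left cinner_scaleC_left T(2))
  have Tx: "T (x + y) h = T x h + T y h" "T (c *C x) h = c *C T x h" for x y h c
   by (intro ext T(1) KD; simp add: cinner_add_left cinner_scaleC_left T(2) innerR_left rep_add[OF r \<xi>(1)] rep_scale[OF r \<xi>(1)] cinner_add_right cinner_scaleC_right)+
  have T\<xi>: "T x \<xi> = g x" for x by (rule ext[OF T(1) gK]) (simp add: T(2) g(3) s_def)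
  have TL: "T (lact a x) h = \<rho> a (T x h)" for a x h
   by (rule ext[OF T(1) rep_in[OF r\<rho> T(1)]]) (simp add: rep_star(2)[OF r\<rho> T(1) gK] \<rho> T(2) innerR_lact)
  have TR: "T (ract x a) h = T x (\<pi> a h)" if "h : H" for a x h
   by (rule ext[OF T(1) T(1)]) (simp add: T(2) innerR_left rep_mult[OF r \<xi>(1)] rep_star(2)[OF r that rep_in[OF r \<xi>(1)]])
  have "EX S. clin_on ?K S & (ALL k:?K. S k : H & norm (S k) <= sqrt (norm (innerL x x)) * norm k & (ALL h:H. cinner (S k) h = cinner k (T x h)))" for x
   using adjoint_exists[OF rep_hilbert[OF r] K Tlin, of x "sqrt (norm (innerL x x))"] T(1) T(3)[of x] by (simp add: mult.commute) metis
  then obtain S where S: "!!x. clin_on ?K (S x)" "!!x k. k : ?K ==> S x k : H" "!!x k. k : ?K ==> norm (S x k) <= sqrt (norm (innerL x x)) * norm k"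
   "!!x k h. k : ?K ==> h : H ==> cinner (S x k) h = cinner k (T x h)" by metis
  have Sg: "S x (g y) = \<pi> (innerR x y) \<xi>" for x y
  proof (rule cinner_ext[OF rep_hilbert[OF r] S(2)[OF gK] rep_in[OF r \<xi>(1)]])
   fix h assume h: "h : H"
   show "cinner (S x (g y)) h = cinner (\<pi> (innerR x y) \<xi>) h"
    unfolding S(4)[OF gK h] using T(2)[of x h y] by (metis cinner_commute)
  qed
  have lnk: "xlink H \<pi> ?K \<rho> T S"
   unfolding link_def
  proof (intro conjI allI ballI)
   fix x y h assume h: "h : H"
   show "S x (T y h) = \<pi> (innerR x y) h"
   proof (rule span_closure_eq[OF _ _ rep_clin[OF r] rep_norm[OF r] rep_hilbert[OF r] cyc' _ h])
    show "clin_on H (%h. S x (T y h))" by (rule clin_onI) (simp_all add: clin_onD[OF Tlin] clin_onD[OF S(1)] T(1))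
    show "norm (S x (T y h)) <= sqrt (norm (innerL x x)) * sqrt (norm (innerL y y)) * norm h" for h
     using order_trans[OF S(3)[OF T(1)] mult_left_mono[OF T(3)]] by (simp add: ac_simps)
    fix h assume "h : range (%a. \<pi> a \<xi>)"
    then obtain a where a: "h = \<pi> a \<xi>" by blast
    show "S x (T y h) = \<pi> (innerR x y) h"
     unfolding a TR[OF \<xi>(1), symmetric] T\<xi> Sg innerR_ract rep_mult[OF r \<xi>(1)] ..
   qed
  next
   fix x y k assume k: "k : ?K"
   have K': "?K = closure (cspan (range g))" using g(4) by (simp add: complex_vector.span_eq_iff[THEN iffD2])
   show "T x (S y k) = \<rho> (innerL x y) k"
   proof (rule span_closure_eq[OF _ _ rep_clin[OF r\<rho>] rep_norm[OF r\<rho>] K K' _ k])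
    show "clin_on ?K (%k. T x (S y k))" by (rule clin_onI) (simp_all add: clin_onD[OF Tlin] clin_onD[OF S(1)] S(2))
    show "norm (T x (S y k)) <= sqrt (norm (innerL x x)) * sqrt (norm (innerL y y)) * norm k" if "k : ?K" for k
     using order_trans[OF T(3) mult_right_mono[OF S(3)[OF that]]] by (simp add: ac_simps)
    fix k assume "k : range g"
    then obtain z where z: "k = g z" by blast
    show "T x (S y k) = \<rho> (innerL x y) k"
     unfolding z Sg TR[OF \<xi>(1), symmetric] T\<xi> \<rho> compatible ..
   qed
  next
   show "cinner (T x h) k = cinner h (S x k)" if "h : H" "k : ?K" for x h k
    using S(4)[OF that(2,1)] by (metis cinner_commute)
  qed (use Tlin S(1,2) T(1) Tx TL TR in auto)
  have "range g <= {T x h |x h. h : H}" using T\<xi> \<xi>(1) by (auto simp flip: T\<xi>)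
  hence "?K <= closure (cspan {T x h |x h. h : H})"
   by (intro closure_mono) (use complex_vector.span_superset in blast)
  moreover have "closure (cspan {T x h |x h. h : H}) <= ?K"
   by (intro closure_minimal complex_vector.span_minimal KD) (use T(1) in auto)
  ultimately have d: "closure (cspan {T x h |x h. h : H}) = ?K" by blast
  have "good H \<pi>" using irr r by (simp add: good_def)
  from link_good[OF lnk this r\<rho> d] have gK: "good ?K \<rho>" .
  have nz: "?K = {0} \<or> (EX x. EX h:H. T x h ~= 0)"
  proof (cases "EX x. g x ~= 0")
   case False
   hence "?K <= {0}" by (intro closure_minimal) auto
   thus ?thesis using KD(3) by blast
  next
   case True
   then obtain x where "g x ~= 0" ..
   hence "T x \<xi> ~= 0" unfolding T\<xi> .
   thus ?thesis using \<xi>(1) by blast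
  qed
  show ?thesis by (rule exI[of _ ?K], rule exI[of _ \<rho>], rule exI[of _ T], rule exI[of _ S]) (intro conjI lnk gK nz)
 qed (simp_all add: lact_add_left lact_add_right lact_scaleC_left lact_scaleC_right lact_mult)
qed

end

text \<open>The part of \<open>induced_rep\<close> that determines K up to equivalence, for H and K
  of different types.\<close>

definition indrel :: "('a::cstar_algebra => 'x::complex_vector => 'x) => ('x => 'x => 'a) =>
  'h::chilbert_space set => ('a => 'h => 'h) => 'k::chilbert_space set => ('a => 'k => 'k) => ('x => 'h => 'k) => bool"
 where "indrel lact innerR H \<pi> K \<rho> T <-> (ALL x. ALL h:H. T x h : K) &
  (ALL x y. ALL h:H. ALL k:H. cinner (T x h) (T y k) = cinner h (\<pi> (innerR x y) k)) &
  closure (cspan {T x h |x h. h : H}) = K & (ALL a x. ALL h:H. T (lact a x) h = \<rho> a (T x h))"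

lemma isometry_intertwines:
 assumes r: "representation K \<rho>" "representation K' \<sigma>"
  and V: "clin_on K V" "V ` K <= K'" "!!x y. x : K ==> y : K ==> cinner (V x) (V y) = cinner x y"
  and K: "K = closure (cspan S)" and e: "!!k. k : S ==> V (\<rho> a k) = \<sigma> a (V k)" and k: "k : K"
 shows "V (\<rho> a k) = \<sigma> a (V k)"
proof (rule span_closure_eq[OF _ _ _ _ rep_hilbert[OF r(1)] K e k])
 have nV: "norm (V h) = norm h" if "h : K" for h by (rule isometry_norm[OF _ that]) (rule V(3))
 have VK: "V h : K'" if "h : K" for h using V(2) that by blast
 note KD = hsubD[OF rep_hilbert[OF r(1)]]
 show "clin_on K (%k. V (\<rho> a k))" by (rule clin_onI) (simp_all add: clin_onD[OF V(1)] rep_vadd[OF r(1)] rep_vscale[OF r(1)] rep_in[OF r(1)] KD)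
 show "clin_on K (%k. \<sigma> a (V k))" by (rule clin_onI) (simp_all add: clin_onD[OF V(1)] rep_vadd[OF r(2)] rep_vscale[OF r(2)] VK KD)
 show "norm (V (\<rho> a h)) <= norm a * norm h" if "h : K" for h
  using nV[OF rep_in[OF r(1) that]] rep_norm[OF r(1) that] by simp
 show "norm (\<sigma> a (V h)) <= norm a * norm h" if "h : K" for h
  using rep_norm[OF r(2) VK[OF that]] nV[OF that] by simp
qed

text \<open>The inner products of the elementary tensors depend on the inducing representation only,
  so \<open>gram_isometry\<close> applies.\<close>

lemma indrel_unique:
 assumes 1: "indrel lact innerR H \<pi> K \<rho> T" and 2: "indrel lact innerR H' \<pi>' K' \<rho>' T'"
  and r: "representation H \<pi>" "representation K \<rho>" "representation K' \<rho>'" and U: "rep_iso H \<pi> H' \<pi>' U"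
 shows "EX V. rep_iso K \<rho> K' \<rho>' V"
proof -
 note u = rep_isoD[OF U]
 let ?d = "%(x, h). T x h" and ?f = "%(x, h). T' x (U h)" and ?D = "UNIV \<times> H"
 have sp: "?d ` ?D = {T x h |x h. h : H}" "?f ` ?D = {T' x h |x h. h : H'}" unfolding u(2)[symmetric] by auto
 have K: "closure (cspan (?d ` ?D)) = K" "closure (cspan (?f ` ?D)) = K'"
  using 1 2 unfolding sp by (simp_all add: indrel_def)
 have "cinner (?f i) (?f j) = cinner (?d i) (?d j)" if "i : ?D" "j : ?D" for i j
  using that 1 2 u(5) u(3) by (auto simp: indrel_def u(4)[symmetric] rep_in[OF r(1)])
 then obtain V where V: "clin_on K V" "V ` K = K'" "!!x y. x : K ==> y : K ==> cinner (V x) (V y) = cinner x y"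
  "!!i. i : ?D ==> V (?d i) = ?f i"
  using gram_isometry[of ?D ?f ?d, unfolded K] by metis
 have "V (\<rho> a k) = \<rho>' a (V k)" if k: "k : K" for a k
 proof (rule isometry_intertwines[OF r(2,3) V(1) _ V(3) K(1)[symmetric] _ k])
  show "V ` K <= K'" using V(2) by simp
  fix k assume "k : ?d ` ?D"
  then obtain x h where xh: "h : H" "k = T x h" by auto
  have e: "V (T x h) = T' x (U h)" for x using V(4)[of "(x, h)"] xh(1) by simp
  have "\<rho> a (T x h) = T (lact a x) h" "\<rho>' a (T' x (U h)) = T' (lact a x) (U h)"
   using 1 2 xh(1) u(5)[OF xh(1)] by (simp_all add: indrel_def)
  thus "V (\<rho> a k) = \<rho>' a (V k)" unfolding xh(2) e by (simp add: e)
 qed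
 hence "rep_iso K \<rho> K' \<rho>' V" using V by (simp add: rep_iso_def)
 thus ?thesis by blast
qed

section \<open>The conjugate bimodule and transport of links\<close>

datatype 'x conj = Cj (uncj: 'x)

lemma conj_eq_iff: "u = v <-> uncj u = uncj v" by (cases u; cases v) simp

instantiation conj :: (complex_vector) complex_vector
begin
definition "0 = Cj 0"
definition "u + v = Cj (uncj u + uncj v)"
definition "u - v = Cj (uncj u - uncj v)"
definition "- u = Cj (- uncj u)"
definition "c *C u = Cj (cnj c *C uncj u)"
instance by standard
 (simp_all add: conj_eq_iff zero_conj_def plus_conj_def minus_conj_def uminus_conj_def scaleC_conj_def algebra_simps scaleC_add_right scaleC_add_left)
end

lemma uncj_simps [simp]:
 "uncj (u + v) = uncj u + uncj v" "uncj (u - v) = uncj u - uncj v" "uncj (c *C u) = cnj c *C uncj u" "uncj 0 = 0"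
 by (simp_all add: zero_conj_def plus_conj_def minus_conj_def scaleC_conj_def)

abbreviation "lactC ract \<equiv> %a x. Cj (ract (uncj x) (star a))"
abbreviation "ractC lact \<equiv> %x a. Cj (lact (star a) (uncj x))"
abbreviation "innerC ip \<equiv> %x y. ip (uncj x) (uncj y)"

lemma complete_conj:
 assumes "complete_wrt N" shows "complete_wrt (%x. N (uncj x))"
 unfolding complete_wrt_def
proof (intro allI impI)
 fix s :: "nat => 'a conj" assume "ALL e>0. EX M. ALL m>=M. ALL n>=M. N (uncj (s m - s n)) < e"
 hence "EX x. (%n. N (uncj (s n) - x)) ----> 0"
  using assms[unfolded complete_wrt_def, rule_format, of "%n. uncj (s n)"] by simp
 then obtain x where "(%n. N (uncj (s n) - x)) ----> 0" ..
 thus "EX x. (%n. N (uncj (s n - x))) ----> 0" by (intro exI[of _ "Cj x"]) simp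
qed

lemma link_S:
 assumes l: "link lact ract innerL innerR H \<pi> K \<rho> T S" and r: "representation H \<pi>" "representation K \<rho>" and k: "k : K"
 shows "S (x + y) k = S x k + S y k" "S (c *C x) k = cnj c *C S x k"
  "S (ract x a) k = \<pi> (star a) (S x k)" "S (lact a x) k = S x (\<rho> (star a) k)"
proof -
 note L = linkD[OF l] and HD = hsubD[OF rep_hilbert[OF r(1)]]
 have e: "S x k = v" if v: "v : H" "!!h. h : H ==> cinner (T x h) k = cinner h v" for x v
 proof (rule cinner_ext[OF rep_hilbert[OF r(1)] L(4)[OF k] v(1)])
  fix g assume "g : H"
  thus "cinner (S x k) g = cinner v g" using v(2) L(5)[OF _ k] by (metis cinner_commute)
 qed
 note s = cinner_add_left cinner_add_right cinner_scaleC_left cinner_scaleC_right L(5)[OF _ k] L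
 show "S (x + y) k = S x k + S y k" by (rule e) (simp_all add: s HD k)
 show "S (c *C x) k = cnj c *C S x k" by (rule e) (simp_all add: s HD k)
 show "S (ract x a) k = \<pi> (star a) (S x k)"
  by (rule e[OF rep_in[OF r(1) L(4)[OF k]]]) (simp add: L(9) L(5)[OF rep_in[OF r(1)] k] rep_star(2)[OF r(1) _ L(4)[OF k]])
 show "S (lact a x) k = S x (\<rho> (star a) k)"
  by (rule e[OF L(4)[OF rep_in[OF r(2) k]]]) (simp add: L(8) rep_star(2)[OF r(2) L(3) k] L(5)[OF _ rep_in[OF r(2) k]])
qed

lemma link_conj:
 assumes l: "link lact ract innerL innerR H \<pi> K \<rho> T S" and r: "representation H \<pi>" "representation K \<rho>"
 shows "link (lactC ract) (ractC lact) (innerC innerR) (innerC innerL) K \<rho> H \<pi> (%x. S (uncj x)) (%x. T (uncj x))"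
proof -
 note L = linkD[OF l]
 have c: "cinner (S x k) h = cinner k (T x h)" if "h : H" "k : K" for x h k
  using L(5)[OF that] by (metis cinner_commute)
 show ?thesis unfolding link_def by (simp add: L link_S[OF l r] star_star c)
qed

lemma link_unconj:
 assumes l: "link (lactC ract) (ractC lact) (innerC innerR) (innerC innerL) K \<rho> H \<pi> S T" and r: "representation H \<pi>" "representation K \<rho>"
 shows "link lact ract innerL innerR H \<pi> K \<rho> (%x. T (Cj x)) (%x. S (Cj x))"
proof -
 note L = linkD[OF l] and LS = link_S[OF l r(2,1)]
 have c: "cinner (T x h) k = cinner h (S x k)" if "h : H" "k : K" for x h k
  using L(5)[OF that(2,1)] by (metis cinner_commute)
 have "T (Cj (x + y)) h = T (Cj x) h + T (Cj y) h" "T (Cj (b *C x)) h = b *C T (Cj x) h"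
  "T (Cj (lact a x)) h = \<rho> a (T (Cj x) h)" "T (Cj (ract x a)) h = T (Cj x) (\<pi> a h)" if "h : H" for x y b a h
  using LS(1)[OF that, of "Cj x" "Cj y"] LS(2)[OF that, of "cnj b" "Cj x"] LS(3)[OF that, of "star a" "Cj x"] LS(4)[OF that, of "Cj x" "star a"]
  by (simp_all add: plus_conj_def scaleC_conj_def star_star)
 moreover have "S (Cj x) (T (Cj y) h) = \<pi> (innerR x y) h" if "h : H" for x y h using L(11)[OF that, of "Cj x" "Cj y"] by simp
 moreover have "T (Cj x) (S (Cj y) k) = \<rho> (innerL x y) k" if "k : K" for x y k using L(10)[OF that, of "Cj x" "Cj y"] by simp
 ultimately show ?thesis unfolding link_def using L(1,2,3,4) c by simp
qed

lemma link_iso: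
 assumes l: "link lact ract innerL innerR H \<pi> K \<rho> T S" and r: "representation H \<pi>" "representation K \<rho>"
  and V: "rep_iso H \<pi> H' \<pi>' V" and U: "rep_iso K \<rho> K' \<rho>' U"
 shows "EX T' S'. link lact ract innerL innerR H' \<pi>' K' \<rho>' T' S' & (ALL x. ALL h:H. T' x (V h) = U (T x h))"
proof -
 obtain V' where V': "rep_iso H' \<pi>' H \<pi> V'" "!!h. h : H ==> V' (V h) = h" "!!k. k : H' ==> V (V' k) = k"
  by (rule rep_iso_inverse[OF r(1) V]) blast
 obtain U' where U': "rep_iso K' \<rho>' K \<rho> U'" "!!h. h : K ==> U' (U h) = h" "!!k. k : K' ==> U (U' k) = k"
  by (rule rep_iso_inverse[OF r(2) U]) blast
 note L = linkD[OF l] and u = rep_isoD[OF U] and u' = rep_isoD[OF U'(1)] and v = rep_isoD[OF V] and v' = rep_isoD[OF V'(1)]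
 have "link lact ract innerL innerR H' \<pi>' K' \<rho>' (%x h. U (T x (V' h))) (%x k. V (S x (U' k)))"
  unfolding link_def
 proof (intro conjI allI ballI)
  fix x show "clin_on H' (%h. U (T x (V' h)))" by (rule clin_onI) (simp_all add: clin_onD[OF L(1)] clin_onD[OF u(1)] clin_onD[OF v'(1)] L v'(5))
  show "clin_on K' (%k. V (S x (U' k)))" by (rule clin_onI) (simp_all add: clin_onD[OF L(2)] clin_onD[OF v(1)] clin_onD[OF u'(1)] L u'(5))
 next
  fix x h k assume h: "h : H'" and k: "k : K'"
  have "cinner (U (T x (V' h))) k = cinner (U (T x (V' h))) (U (U' k))" by (simp add: U'(3)[OF k])
  also have "... = cinner (V (V' h)) (V (S x (U' k)))"
   by (simp add: u(3)[OF L(3)[OF v'(5)[OF h]] u'(5)[OF k]] v(3)[OF v'(5)[OF h] L(4)[OF u'(5)[OF k]]] L(5)[OF v'(5)[OF h] u'(5)[OF k]])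
  finally show "cinner (U (T x (V' h))) k = cinner h (V (S x (U' k)))" by (simp add: V'(3)[OF h])
 qed (simp_all add: L u(5) u'(5) v(5) v'(5) clin_onD[OF u(1)] u(4) v(4) v'(4) U'(2,3) V'(2,3))
 thus ?thesis using V'(2) by (intro exI conjI) (assumption, simp)
qed

lemma zero_rep_good: "good {0} (%a h. 0 :: 'h::chilbert_space)"
 unfolding good_def by (intro conjI disjI1 representationI refl) (auto simp: hilbert_subspace_def clin_on_def)

lemma cspan_closure_subset:
 assumes "hilbert_subspace K" "S <= K" shows "closure (cspan S) <= K"
 by (intro closure_minimal complex_vector.span_minimal hsubD[OF assms(1)] assms(2))

lemma clin_on_closure:
 fixes A :: "'h::chilbert_space => 'k::chilbert_space"
 assumes A: "clin_on K A" "!!h. h : K ==> norm (A h) <= M * norm h" and K: "hilbert_subspace K" "S <= K" and L: "hilbert_subspace L"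
  and e: "!!h. h : S ==> A h : L" and h: "h : closure (cspan S)"
 shows "A h : L"
proof -
 note KD = hsubD[OF K(1)] and LD = hsubD[OF L]
 have sK: "cspan S <= K" by (rule complex_vector.span_minimal[OF K(2) KD(1)])
 have c: "y : K & A y : L" if "y : cspan S" for y
  using that by (induction rule: complex_vector.span_induct_alt)
   (use K(2) e in "auto simp: clin_on_0[OF A(1) KD(1)] KD LD clin_onD[OF A(1)] subset_iff")
 obtain f where f: "!!n. f n : cspan S" "f ----> h" using h unfolding closure_sequential by blast
 have hK: "h : K" using cspan_closure_subset[OF K] h by blast
 have "(%n. A (f n)) ----> A h"
 proof (rule Lim_transform_bound[where g = "%n. M *R (f n - h)", THEN LIM_zero_cancel])
  have "norm (A (f n) - A h) <= norm (M *R (f n - h))" for n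
   using clin_on_lipschitz[OF A(1) KD(1) A(2) _ hK, of "f n"] c[OF f(1)] by (simp add: order_trans[OF _ mult_right_mono[OF abs_ge_self]])
  thus "\<forall>\<^sub>F n in sequentially. norm (A (f n) - A h) <= norm (M *R (f n - h))" by simp
  show "(%n. M *R (f n - h)) ----> 0" using tendsto_scaleR[OF tendsto_const LIM_zero[OF f(2)]] by simp
 qed
 thus ?thesis by (rule closed_sequentially[OF LD(2) _, rotated]) (use c f(1) in blast)
qed

text \<open>The closed span of all T x h is invariant and nonzero. So a nonzero link between
  irreducible representations is an induction.\<close>

lemma link_dense:
 assumes l: "link lact ract innerL innerR H \<pi> K \<rho> T S" and irr: "irrep H \<pi>" "irrep K \<rho>"
  and nz: "h0 : H" "T x0 h0 ~= 0"
 shows "indrel lact innerR H \<pi> K \<rho> T"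
proof -
 note L = linkD[OF l] and r = irrepD(1)[OF irr(1)] irrepD(1)[OF irr(2)]
 let ?Y = "cspan {T x h |x h. h : H}"
 have Y: "csubspace ?Y" by (rule complex_vector.subspace_span)
 have S: "{T x h |x h. h : H} <= K" using L(3) by blast
 have inv: "\<rho> a k : closure ?Y" if k: "k : closure ?Y" for a k
 proof (rule clin_on_closure[OF rep_clin[OF r(2)] rep_norm[OF r(2)] rep_hilbert[OF r(2)] S hsub_closure[OF Y] _ k])
  fix k assume "k : {T x h |x h. h : H}"
  then obtain z h where zh: "k = T z h" "h : H" by blast
  hence "\<rho> a k = T (lact a z) h" using L by simp
  moreover have "T (lact a z) h : ?Y" using zh(2) by (blast intro: complex_vector.span_base)
  ultimately show "\<rho> a k : closure ?Y" using closure_subset by auto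
 qed
 have "closure ?Y = {0} \<or> closure ?Y = K"
  by (rule irrepD(3)[OF irr(2) hsub_closure[OF Y] cspan_closure_subset[OF rep_hilbert[OF r(2)] S] inv])
 moreover have "T x0 h0 : closure ?Y" by (rule subsetD[OF closure_subset]) (use nz(1) in "auto intro: complex_vector.span_base")
 ultimately have "closure ?Y = K" using nz(2) by blast
 thus ?thesis using L by (simp add: indrel_def)
qed

context hilbert_bimodule
begin

text \<open>Left and right change places: inducing backwards is inducing forwards for the conjugate
  bimodule.\<close>

lemma conj_bimodule: "hilbert_bimodule (lactC ract) (ractC lact) (innerC innerR) (innerC innerL)"
proof
 show "complete_wrt (%x. sqrt (norm (innerR (uncj x) (uncj x))))" by (rule complete_conj[OF innerR_complete])
 show "complete_wrt (%x. sqrt (norm (innerL (uncj x) (uncj x))))" by (rule complete_conj[OF innerL_complete])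
 show "Cj (lact (star (innerL (uncj y) (uncj z))) (uncj x)) = Cj (ract (uncj z) (star (innerR (uncj x) (uncj y))))" for x y z
  by (simp add: innerL_star innerR_star compatible)
qed (simp_all add: conj_eq_iff star_add star_scaleC star_mult star_star ract_add_left ract_add_right ract_scaleC_left ract_scaleC_right ract_mult
  lact_add_left lact_add_right lact_scaleC_left lact_scaleC_right lact_mult innerR_left innerL_right innerL_add innerL_scaleC innerL_lact
  innerR_add innerR_scaleC innerR_ract innerR_star innerL_star innerR_positive innerL_positive innerR_definite innerL_definite lact_ract)

text \<open>\<open>link_exists\<close> ends in \<open>'x ell2\<close>; irreducibility brings K back
  to \<open>'a ell2\<close>, so the step can be iterated. If nothing is induced, the zero space
  continues the orbit.\<close>

lemma link_forward:
 fixes \<pi> :: "'a => 'h::chilbert_space => 'h"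
 assumes g: "good H \<pi>"
 shows "EX (K :: 'a ell2 set) \<rho> T S. xlink H \<pi> K \<rho> T S & good K \<rho> & (K = {0} \<or> (EX x. EX h:H. T x h ~= 0))"
proof -
 have r: "representation H \<pi>" using g by (simp add: good_def)
 have H0: "0 : H" by (rule hsubD(3)[OF rep_hilbert[OF r]])
 have zero: ?thesis if "!!x y h. h : H ==> \<pi> (innerR x y) h = 0"
 proof (intro exI conjI)
  show "xlink H \<pi> {0 :: 'a ell2} (%a h. 0) (%x h. 0) (%x k. 0)"
   using that H0 by (simp add: link_def clin_on_def)
  show "good {0 :: 'a ell2} (%a h. 0)" by (rule zero_rep_good)
 qed simp
 show ?thesis
 proof (cases "H = {0}")
  case True
  thus ?thesis using zero rep_vzero[OF r] by simp
 next
  case False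
  hence "irrep H \<pi>" using g by (simp add: good_def)
  then obtain K :: "'x ell2 set" and \<rho> T S where l: "xlink H \<pi> K \<rho> T S" and gK: "good K \<rho>" and nz: "K = {0} \<or> (EX x. EX h:H. T x h ~= 0)"
   using link_exists by blast
  note L = linkD[OF l]
  have rK: "representation K \<rho>" using gK by (simp add: good_def)
  show ?thesis
  proof (cases "K = {0}")
   case True
   have "\<pi> (innerR x y) h = 0" if "h : H" for x y h
    using L(3)[OF that, of y] clin_on_0[OF L(2) hsubD(1)[OF rep_hilbert[OF rK]]] True unfolding L(10)[OF that, symmetric] by simp
   thus ?thesis by (rule zero)
  next
   case False
   hence "irrep K \<rho>" using gK by (simp add: good_def)
   then obtain K' :: "'a ell2 set" and \<rho>' U where K': "irrep K' \<rho>'" "rep_iso K \<rho> K' \<rho>' U"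
    by (rule irreducible_compress')
   obtain T' S' where T': "xlink H \<pi> K' \<rho>' T' S'" "!!x h. h : H ==> T' x h = U (T x h)"
    using link_iso[OF l r rK rep_iso_refl K'(2)] by blast
   obtain x h where h: "h : H" "T x h ~= 0" using nz False by blast
   have "norm (T' x h) = norm (T x h)" unfolding T'(2)[OF h(1)] by (rule isometry_norm[OF rep_isoD(3)[OF K'(2)] L(3)[OF h(1)]])
   hence "T' x h ~= 0" using h(2) by (metis norm_eq_zero)
   moreover have "good K' \<rho>'" using K'(1) irrepD(1) by (auto simp: good_def)
   ultimately show ?thesis using T'(1) h(1) by blast
  qed
 qed
qed

lemma link_backward:
 fixes \<rho> :: "'a => 'h::chilbert_space => 'h"
 assumes g: "good K \<rho>"
 shows "EX (H :: 'a ell2 set) \<pi> T S. xlink H \<pi> K \<rho> T S & good H \<pi> & (H = {0} \<or> (EX x. EX h:H. T x h ~= 0))"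
proof -
 obtain H :: "'a ell2 set" and \<pi> S T where l: "link (lactC ract) (ractC lact) (innerC innerR) (innerC innerL) K \<rho> H \<pi> S T" "good H \<pi>"
  and nz: "H = {0} \<or> (EX x. EX k:K. S x k ~= 0)"
  using hilbert_bimodule.link_forward[OF conj_bimodule g] by blast
 have "xlink H \<pi> K \<rho> (%x. T (Cj x)) (%x. S (Cj x))"
  using link_unconj[OF l(1)] l(2) g by (auto simp: good_def)
 moreover have "EX x. EX h:H. T (Cj x) h ~= 0" if k: "k : K" "S x k ~= 0" for x k
 proof -
  have "cinner (S x k) (S x k) = cinner k (T x (S x k))" by (rule linkD(5)[OF l(1) k(1) linkD(3)[OF l(1) k(1)]])
  hence "T (Cj (uncj x)) (S x k) ~= 0" using k(2) by (auto simp: cinner_self)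
  thus ?thesis using linkD(3)[OF l(1) k(1)] by blast
 qed
 ultimately show ?thesis using l(2) nz by blast
qed

text \<open>T vanishes exactly if pi kills the right inner products, since <T x h, T x h> = <h,
  pi(<x, x>_R) h> and S x (T y h) = pi(<x, y>_R) h.\<close>

lemma hat_inner:
 fixes \<pi> :: "'a => 'h::chilbert_space => 'h"
 assumes l: "xlink H \<pi> K \<rho> T S" and irr: "irrep H \<pi>" and r: "representation K \<rho>"
 shows "cls H \<pi> : hat (inner_ideal innerR) <-> (EX x. EX h:H. T x h ~= 0)"
proof -
 note L = linkD[OF l] and rH = irrepD(1)[OF irr]
 have N: "cstar_ideal {a. ALL h:H. \<pi> a h = 0}" by (rule rep_kernel_ideal[OF rH])
 show ?thesis
  unfolding cls_hat[OF irr]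
 proof
  assume a: "EX a:inner_ideal innerR. EX h:H. \<pi> a h ~= 0"
  show "EX x. EX h:H. T x h ~= 0"
  proof (rule ccontr)
   assume "\<nexists>x. EX h:H. T x h ~= 0"
   hence "\<pi> (innerR x y) h = 0" if "h : H" for x y h
    using L(10)[OF that, of x y] that clin_on_0[OF L(2) hsubD(1)[OF rep_hilbert[OF r]]] by simp
   hence "inner_ideal innerR <= {a. ALL h:H. \<pi> a h = 0}"
    unfolding inner_ideal_def by (intro closure_minimal complex_vector.span_minimal cidealD(1,2)[OF N]) auto
   thus False using a by blast
  qed
 next
  assume "EX x. EX h:H. T x h ~= 0"
  then obtain x h where h: "h : H" "T x h ~= 0" by blast
  have "cinner (T x h) (T x h) = cinner h (\<pi> (innerR x x) h)" by (simp add: L(5) L(3) L(10) h(1))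
  hence "\<pi> (innerR x x) h ~= 0" using h(2) by (auto simp: cinner_self)
  moreover have "innerR x x : inner_ideal innerR"
   unfolding inner_ideal_def by (rule subsetD[OF closure_subset]) (auto intro: complex_vector.span_base)
  ultimately show "EX a:inner_ideal innerR. EX h:H. \<pi> a h ~= 0" using h(1) by blast
 qed
qed

text \<open>Uniqueness of induced representations gives one inclusion, transport of the link along
  equivalences the other.\<close>

lemma dual_map_cls:
 fixes \<pi> :: "'a => 'h::chilbert_space => 'h"
 assumes l: "xlink H \<pi> K \<rho> T S" and irr: "irrep H \<pi>" "irrep K \<rho>" and nz: "h0 : H" "T x0 h0 ~= 0"
 shows "dual_map lact innerR (cls H \<pi>) = cls K \<rho>"
proof -
 note L = linkD[OF l] and r = irrepD(1)[OF irr(1)] irrepD(1)[OF irr(2)]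
 have I: "indrel lact innerR H \<pi> K \<rho> T" by (rule link_dense[OF l irr nz])
 show ?thesis
 proof (intro equalityI subsetI)
  fix q assume q: "q : dual_map lact innerR (cls H \<pi>)"
  obtain K' \<rho>' where q': "q = (K', \<rho>')" by (cases q)
  obtain H' \<pi>' where p: "(H', \<pi>') : cls H \<pi>" "induced_rep lact innerR (H', \<pi>') (K', \<rho>')" and iq: "irrep K' \<rho>'"
   using q unfolding q' dual_map_def by auto
  obtain T' where "ALL x. linear_into H' K' (T' x)"
   "ALL x\<^sub>1 x\<^sub>2. ALL h\<^sub>1:H'. ALL h\<^sub>2:H'. cinner (T' x\<^sub>1 h\<^sub>1) (T' x\<^sub>2 h\<^sub>2) = cinner h\<^sub>1 (\<pi>' (innerR x\<^sub>1 x\<^sub>2) h\<^sub>2)"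
   "closure (cspan {T' x h |x h. h : H'}) = K'" "ALL a x. ALL h:H'. \<rho>' a (T' x h) = T' (lact a x) h"
   using p(2) unfolding induced_rep_def prod.case by blast
  hence "indrel lact innerR H' \<pi>' K' \<rho>' T'" by (simp add: indrel_def linear_into_def)
  moreover obtain U where "rep_iso H \<pi> H' \<pi>' U" using cls_self[OF p(1)] by blast
  ultimately have "EX V. rep_iso K \<rho> K' \<rho>' V" using indrel_unique[OF I _ r irrepD(1)[OF iq]] by blast
  thus "q : cls K \<rho>" using iq by (simp add: cls_def q')
 next
  fix q assume q: "q : cls K \<rho>"
  obtain K' \<rho>' where q': "q = (K', \<rho>')" by (cases q)
  obtain U where iq: "irrep K' \<rho>'" and U: "rep_iso K \<rho> K' \<rho>' U" using q cls_self unfolding q' by blast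
  obtain H' :: "'a ell2 set" and \<pi>' W where H': "irrep H' \<pi>'" "rep_iso H \<pi> H' \<pi>' W" "(H', \<pi>') : cls H \<pi>" by (rule cls_ex[OF irr(1)])
  obtain T' S' where T': "xlink H' \<pi>' K' \<rho>' T' S'" "!!x h. h : H ==> T' x (W h) = U (T x h)"
   using link_iso[OF l r H'(2) U] by blast
  note L' = linkD[OF T'(1)]
  have "norm (T' x0 (W h0)) = norm (T x0 h0)"
   unfolding T'(2)[OF nz(1)] by (rule isometry_norm[OF rep_isoD(3)[OF U] L(3)[OF nz(1)]])
  hence "T' x0 (W h0) ~= 0" using nz(2) by (metis norm_eq_zero)
  hence "indrel lact innerR H' \<pi>' K' \<rho>' T'" by (rule link_dense[OF T'(1) H'(1) iq rep_isoD(5)[OF H'(2) nz(1)]])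
  hence "induced_rep lact innerR (H', \<pi>') (K', \<rho>')"
   unfolding induced_rep_def prod.case indrel_def using L'(1,6,7) irrepD(1)[OF iq]
   by (intro conjI exI[of _ T']) (auto simp: linear_into_def clin_on_def Vector_Spaces.linear_iff intro: complex_vector.vector_space_axioms)
  thus "q : dual_map lact innerR (cls H \<pi>)" using iq H'(3) unfolding dual_map_def q' by blast
 qed
qed

lemma dual_ex:
 assumes c: "c : hat (inner_ideal innerR)"
 obtains H K :: "'a ell2 set" and \<pi> \<rho> T S x h where "h : H" "irrep H \<pi>" "c = cls H \<pi>" "xlink H \<pi> K \<rho> T S"
  "irrep K \<rho>" "dual_map lact innerR c = cls K \<rho>" "T x h ~= 0"
proof -
 obtain H and \<pi> :: "'a action" where p: "irrep H \<pi>" "c = cls H \<pi>"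
  using c hat_spectrum by (meson spectrum_cls subsetD)
 have "good H \<pi>" using p(1) irrepD(1) by (auto simp: good_def)
 then obtain K :: "'a ell2 set" and \<rho> T S where l: "xlink H \<pi> K \<rho> T S" "good K \<rho>" using link_forward by blast
 obtain x h where h: "h : H" "T x h ~= 0" using c hat_inner[OF l(1) p(1)] l(2) unfolding p(2) by (auto simp: good_def)
 have "irrep K \<rho>" using l(2) linkD(3)[OF l(1) h(1), of x] h(2) by (auto simp: good_def)
 thus thesis using that[OF h(1) p l(1)] p(2) dual_map_cls[OF l(1) p(1) _ h] h(2) by simp
qed

lemma link_dense_conj:
 assumes l: "xlink H \<pi> K \<rho> T S" and irr: "irrep H \<pi>" "irrep K \<rho>" and nz: "h : H" "T x h ~= 0"
 shows "indrel (lactC ract) (innerC innerL) K \<rho> H \<pi> (%x. S (uncj x))"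
proof -
 note L = linkD[OF l]
 have "cinner (T x h) (T x h) ~= 0" using nz(2) by (simp add: cinner_self)
 hence "cinner h (S x (T x h)) ~= 0" unfolding L(5)[OF nz(1) L(3)[OF nz(1)]] .
 hence "S (uncj (Cj x)) (T x h) ~= 0" by auto
 from link_dense[OF link_conj[OF l irrepD(1)[OF irr(1)] irrepD(1)[OF irr(2)]] irr(2,1) L(3)[OF nz(1)] this]
 show ?thesis .
qed

text \<open>The adjoints S induce back through the conjugate bimodule, and there, too, the result is
  unique up to equivalence.\<close>

lemma dual_map_inj:
 assumes "c : hat (inner_ideal innerR)" "c' : hat (inner_ideal innerR)" "dual_map lact innerR c = dual_map lact innerR c'"
 shows "c = c'"
proof -
 obtain H K :: "'a ell2 set" and \<pi> \<rho> T S x h where 1: "h : H" "irrep H \<pi>" "c = cls H \<pi>" "xlink H \<pi> K \<rho> T S"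
  "irrep K \<rho>" "dual_map lact innerR c = cls K \<rho>" "T x h ~= 0" by (rule dual_ex[OF assms(1)])
 obtain H' K' :: "'a ell2 set" and \<pi>' \<rho>' T' S' x' h' where 2: "h' : H'" "irrep H' \<pi>'" "c' = cls H' \<pi>'" "xlink H' \<pi>' K' \<rho>' T' S'"
  "irrep K' \<rho>'" "dual_map lact innerR c' = cls K' \<rho>'" "T' x' h' ~= 0" by (rule dual_ex[OF assms(2)])
 obtain U where "rep_iso K \<rho> K' \<rho>' U" using assms(3) 1(6) 2(6) cls_eq[OF 1(5) 2(5)] by auto
 from indrel_unique[OF link_dense_conj[OF 1(4,2,5,1,7)] link_dense_conj[OF 2(4,2,5,1,7)] irrepD(1)[OF 1(5)] irrepD(1)[OF 1(2)] irrepD(1)[OF 2(2)] this]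
 show ?thesis unfolding 1(3) 2(3) cls_eq[OF 1(2) 2(2)] .
qed

end

subsection \<open>The covariant representation of an orbit\<close>

text \<open>The vectors of \<open>'i ell2\<close> supported on the range of e form the orthogonal
  sum of copies of \<open>'j ell2\<close> over the integers; \<open>comp\<close> and
  \<open>glue\<close> pass to components and back.\<close>

locale direct_sum =
 fixes e :: "int \<times> 'j => 'i"
 assumes e: "inj e"
begin

definition comp :: "int => 'i ell2 => 'j ell2"
 where "comp n \<psi> = Abs_ell2 (%j. Rep_ell2 \<psi> (e (n, j)))"

definition supp :: "'i ell2 => bool"
 where "supp \<psi> <-> (ALL i. i ~: range e --> Rep_ell2 \<psi> i = 0)"

definition glue :: "(int => 'j ell2) => 'i ell2"
 where "glue v = Abs_ell2 (%i. if i : range e then Rep_ell2 (v (fst (inv e i))) (snd (inv e i)) else 0)"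

lemma Rep_comp: "Rep_ell2 (comp n \<psi>) j = Rep_ell2 \<psi> (e (n, j))"
proof -
 have "(%j. (cmod (Rep_ell2 \<psi> (e (n, j))))^2) = (%i. (cmod (Rep_ell2 \<psi> i))^2) \<circ> (%j. e (n, j))" by (simp add: comp_def fun_eq_iff)
 moreover have "inj (%j. e (n, j))" using e by (auto simp: inj_on_def)
 ultimately have "square_summable (%j. Rep_ell2 \<psi> (e (n, j)))"
  unfolding square_summable_def using summable_on_subset[OF ell2_summable[of \<psi>], of "range (%j. e (n, j))"] by (simp add: summable_on_reindex)
 thus ?thesis by (simp add: comp_def Abs_ell2_inverse)
qed

lemma comp_lin: "comp n (\<psi> + \<phi>) = comp n \<psi> + comp n \<phi>" "comp n (c *C \<psi>) = c *C comp n \<psi>" "comp n 0 = 0"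
 by (simp_all add: Rep_ell2_inject[symmetric] fun_eq_iff Rep_comp plus_ell2.rep_eq scaleC_ell2.rep_eq zero_ell2.rep_eq)

lemma comp_diff: "comp n (\<psi> - \<phi>) = comp n \<psi> - comp n \<phi>"
 by (simp add: Rep_ell2_inject[symmetric] fun_eq_iff Rep_comp minus_ell2.rep_eq)

lemma supp_closed: "supp \<psi> ==> supp \<phi> ==> supp (\<psi> + \<phi>)" "supp \<psi> ==> supp (c *C \<psi>)" "supp 0"
 by (simp_all add: supp_def plus_ell2.rep_eq scaleC_ell2.rep_eq zero_ell2.rep_eq)

lemma comp_ext: "supp \<psi> ==> supp \<phi> ==> (!!n. comp n \<psi> = comp n \<phi>) ==> \<psi> = \<phi>"
 unfolding Rep_ell2_inject[symmetric] supp_def fun_eq_iff Rep_comp by (metis rangeE surj_pair)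

lemma has_sum_cinner_ell2: "((%i. cnj (Rep_ell2 \<psi> i) * Rep_ell2 \<phi> i) has_sum cinner \<psi> \<phi>) UNIV"
 unfolding cinner_ell2.rep_eq using Rep_ell2 by (intro has_sum_infsum square_summable_cinner) auto

lemma has_sum_comp:
 assumes "supp \<psi>"
 shows "((%n. cinner (comp n \<psi>) (comp n \<phi>)) has_sum cinner \<psi> \<phi>) UNIV"
proof (rule has_sum_SigmaD)
 let ?g = "%i. cnj (Rep_ell2 \<psi> i) * Rep_ell2 \<phi> i"
 have "(?g has_sum cinner \<psi> \<phi>) (range e) <-> (?g has_sum cinner \<psi> \<phi>) UNIV"
  by (rule has_sum_cong_neutral) (use assms in "auto simp: supp_def")
 hence "(?g \<circ> e has_sum cinner \<psi> \<phi>) UNIV" using has_sum_cinner_ell2 by (simp add: has_sum_reindex[OF e])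
 thus "(?g \<circ> e has_sum cinner \<psi> \<phi>) (UNIV \<times> UNIV)" by simp
 show "((%y. (?g \<circ> e) (n, y)) has_sum cinner (comp n \<psi>) (comp n \<phi>)) UNIV" for n
  using has_sum_cinner_ell2[of "comp n \<psi>" "comp n \<phi>"] by (simp add: Rep_comp)
qed

lemma has_sum_norm:
 assumes "supp \<psi>" shows "((%n. (norm (comp n \<psi>))^2) has_sum (norm \<psi>)^2) UNIV"
 using has_sum_Re[OF has_sum_comp[OF assms, of \<psi>]] unfolding cinner_self by simp

lemma norm_comp_le: assumes "supp \<psi>" shows "norm (comp n \<psi>) <= norm \<psi>"
proof (rule power2_le_imp_le)
 show "(norm (comp n \<psi>))^2 <= (norm \<psi>)^2"
  using finite_sum_le_infsum[OF has_sum_imp_summable[OF has_sum_norm[OF assms]], of "{n}"] infsumI[OF has_sum_norm[OF assms]] by simp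
qed simp

lemma glue_comp:
 assumes "(%n. (norm (v n))^2) summable_on UNIV"
 shows "supp (glue v)" "comp n (glue v) = v n"
proof -
 let ?g = "%i. if i : range e then Rep_ell2 (v (fst (inv e i))) (snd (inv e i)) else 0"
 have "(%p. (cmod (Rep_ell2 (v (fst p)) (snd p)))^2) summable_on UNIV \<times> UNIV"
  by (rule summable_on_SigmaI[OF _ assms]) (simp_all add: ell2_norm_square has_sum_infsum[OF ell2_summable])
 also have "(%p. (cmod (Rep_ell2 (v (fst p)) (snd p)))^2) = (%i. (cmod (?g i))^2) \<circ> e"
  using e by (simp add: fun_eq_iff)
 finally have "(%i. (cmod (?g i))^2) summable_on range e" unfolding summable_on_reindex[OF e] by (simp add: o_def)
 also have "?this <-> square_summable ?g" unfolding square_summable_def by (rule summable_on_cong_neutral) auto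
 finally have g: "Rep_ell2 (glue v) = ?g" by (simp add: glue_def Abs_ell2_inverse)
 show "supp (glue v)" by (simp add: supp_def g)
 show "comp n (glue v) = v n" using e by (simp add: Rep_ell2_inject[symmetric] fun_eq_iff Rep_comp g)
qed

end

text \<open>The vectors of the direct sum of the spaces \<open>H n\<close>; operators move the component \<open>n - d\<close> to the component \<open>n\<close>.\<close>

locale summed = direct_sum e for e :: "int \<times> 'j => 'i" +
 fixes H :: "int => 'j ell2 set"
 assumes H: "hilbert_subspace (H n)"
begin

definition total :: "'i ell2 set"
 where "total = {\<psi>. supp \<psi> & (ALL n. comp n \<psi> : H n)}"

definition shift :: "int => (int => 'j ell2 => 'j ell2) => 'i ell2 => 'i ell2"
 where "shift d A \<psi> = glue (%n. A n (comp (n - d) \<psi>))"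

lemma totalD: "\<psi> : total ==> supp \<psi>" "\<psi> : total ==> comp n \<psi> : H n"
 by (simp_all add: total_def)

lemma total_ext: "\<psi> : total ==> \<phi> : total ==> (!!n. comp n \<psi> = comp n \<phi>) ==> \<psi> = \<phi>"
 by (rule comp_ext) (simp_all add: total_def)

lemma total_hilbert: "hilbert_subspace total"
 unfolding hilbert_subspace_def
proof (intro conjI csubspaceI)
 note HD = hsubD[OF H]
 show "closed total"
  unfolding closed_sequential_limits
 proof (intro allI impI, elim conjE)
  fix f \<psi> assume f: "ALL n. f n : total" "f ----> \<psi>"
  have d: "(%n. norm (f n - \<psi>)) ----> 0" using f(2) by (simp add: LIM_zero_iff tendsto_norm_zero)
  have c: "(%n. Rep_ell2 (f n) i) ----> Rep_ell2 \<psi> i" for i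
  proof (rule Lim_null_comparison[OF _ d, THEN LIM_zero_cancel])
   show "\<forall>\<^sub>F n in sequentially. norm (Rep_ell2 (f n) i - Rep_ell2 \<psi> i) <= norm (f n - \<psi>)"
    using ell2_coordinate_bound[of "f _ - \<psi>" i] by (simp add: minus_ell2.rep_eq)
  qed
  have "Rep_ell2 \<psi> i = 0" if "i ~: range e" for i
   using c[of i] f(1) that by (simp add: total_def supp_def LIMSEQ_const_iff)
  hence s: "supp \<psi>" by (simp add: supp_def)
  have "comp m \<psi> : H m" for m
  proof (rule closed_sequentially[OF HD(2)])
   show "comp m (f n) : H m" for n using f(1) by (simp add: total_def)
   have "norm (comp m (f n) - comp m \<psi>) <= norm (f n - \<psi>)" for n
    unfolding comp_diff[symmetric] using f(1) s by (intro norm_comp_le) (simp add: total_def supp_def minus_ell2.rep_eq)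
   thus "(%n. comp m (f n)) ----> comp m \<psi>" by (intro Lim_null_comparison[OF _ d, THEN LIM_zero_cancel]) simp
  qed
  thus "\<psi> : total" using s by (simp add: total_def)
 qed
qed (use hsubD[OF H] in "auto simp: total_def supp_closed comp_lin")

definition family :: "int => (int => 'j ell2 => 'j ell2) => real => bool"
 where "family d A M <-> (ALL n. clin_on (H (n - d)) (A n) & (ALL h:H (n - d). A n h : H n & norm (A n h) <= M * norm h))"

lemma family_shift:
 assumes A: "family d A M" and \<psi>: "\<psi> : total"
 shows "shift d A \<psi> : total" "comp n (shift d A \<psi>) = A n (comp (n - d) \<psi>)" "norm (shift d A \<psi>) <= \<bar>M\<bar> * norm \<psi>"
proof -
 let ?v = "%n. A n (comp (n - d) \<psi>)"
 have bij: "bij_betw (%n. n - d) UNIV UNIV" by (rule bij_betw_byWitness[where f' = "%n. n + d"]) auto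
 have "((%n. (norm (comp (n - d) \<psi>))^2) has_sum (norm \<psi>)^2) UNIV"
  using has_sum_norm[OF totalD(1)[OF \<psi>]] by (simp only: has_sum_reindex_bij_betw[OF bij, of "%n. (norm (comp n \<psi>))^2"])
 from has_sum_cmult_right[OF this, of "M^2"] have s: "((%n. M^2 * (norm (comp (n - d) \<psi>))^2) has_sum M^2 * (norm \<psi>)^2) UNIV" .
 have le: "(norm (?v n))^2 <= M^2 * (norm (comp (n - d) \<psi>))^2" for n
  using A totalD(2)[OF \<psi>, of "n - d"] unfolding family_def power_mult_distrib[symmetric] by (intro power_mono) auto
 have sv: "(%n. (norm (?v n))^2) summable_on UNIV"
  by (rule summable_on_comparison_test[OF has_sum_imp_summable[OF s] le]) simp
 note g = glue_comp[OF sv]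
 show c: "comp n (shift d A \<psi>) = A n (comp (n - d) \<psi>)" for n by (simp add: shift_def g)
 show t: "shift d A \<psi> : total" using A totalD(2)[OF \<psi>] by (simp add: total_def c family_def) (simp add: shift_def g)
 have "(norm (shift d A \<psi>))^2 <= M^2 * (norm \<psi>)^2"
  by (rule has_sum_mono[OF has_sum_norm[OF totalD(1)[OF t]] s]) (simp add: c le)
 hence "(norm (shift d A \<psi>))^2 <= (\<bar>M\<bar> * norm \<psi>)^2" by (simp add: power_mult_distrib)
 thus "norm (shift d A \<psi>) <= \<bar>M\<bar> * norm \<psi>" by (rule power2_le_imp_le) simp
qed

lemma shift_clin:
 assumes A: "family d A M" shows "clin_on total (shift d A)"
proof (rule clin_onI)
 note TD = hsubD[OF total_hilbert] and f = family_shift[OF A]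
 have cl: "clin_on (H (n - d)) (A n)" for n using A by (simp add: family_def)
 show "shift d A (\<psi> + \<phi>) = shift d A \<psi> + shift d A \<phi>" if "\<psi> : total" "\<phi> : total" for \<psi> \<phi>
  by (rule total_ext) (simp_all add: that TD f comp_lin clin_onD[OF cl] totalD)
 show "shift d A (c *C \<psi>) = c *C shift d A \<psi>" if "\<psi> : total" for c \<psi>
  by (rule total_ext) (simp_all add: that TD f comp_lin clin_onD[OF cl] totalD)
qed

lemma shift_bounded: "family d A M ==> bounded_operator total (shift d A)"
 using shift_clin[of d A M] family_shift(1,3)[of d A M] unfolding bounded_operator_def linear_into_def clin_on_def by blast

lemma shift_cinner:
 assumes A: "family d A M" and B: "family (- d) B N" and \<psi>: "\<psi> : total" and \<phi>: "\<phi> : total"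
  and adj: "!!n h k. h : H n ==> k : H (n + d) ==> cinner (A (n + d) h) k = cinner h (B n k)"
 shows "cinner (shift d A \<psi>) \<phi> = cinner \<psi> (shift (- d) B \<phi>)"
proof (rule has_sum_unique)
 have bij: "bij_betw (%n. n + d) UNIV UNIV" by (rule bij_betw_byWitness[where f' = "%n. n - d"]) auto
 have "((%n. cinner (comp (n + d) (shift d A \<psi>)) (comp (n + d) \<phi>)) has_sum cinner (shift d A \<psi>) \<phi>) UNIV"
  using has_sum_comp[OF totalD(1)[OF family_shift(1)[OF A \<psi>]], of \<phi>]
  by (simp only: has_sum_reindex_bij_betw[OF bij, of "%n. cinner (comp n (shift d A \<psi>)) (comp n \<phi>)"])
 thus "((%n. cinner (comp n \<psi>) (B n (comp (n + d) \<phi>))) has_sum cinner (shift d A \<psi>) \<phi>) UNIV"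
  by (simp add: family_shift(2)[OF A \<psi>] adj totalD(2)[OF \<psi>] totalD(2)[OF \<phi>])
 show "((%n. cinner (comp n \<psi>) (B n (comp (n + d) \<phi>))) has_sum cinner \<psi> (shift (- d) B \<phi>)) UNIV"
  using has_sum_comp[OF totalD(1)[OF \<psi>], of "shift (- d) B \<phi>"] by (simp add: family_shift(2)[OF B \<phi>])
qed

end

section \<open>Room for an orbit\<close>

lemma infinite_vector_space:
 assumes "(a :: 'a::complex_vector) ~= 0" shows "infinite (UNIV :: 'a set)"
proof
 assume f: "finite (UNIV :: 'a set)"
 have i: "inj (%n::nat. (of_nat n :: complex) *C a)"
 proof (rule injI)
  fix x y :: nat assume "(of_nat x :: complex) *C a = of_nat y *C a"
  hence "(of_nat x :: complex) = of_nat y" by (rule complex_vector.scale_right_imp_eq[OF assms])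
  thus "x = y" by (rule of_nat_eq_iff[THEN iffD1])
 qed
 have "finite (range (%n::nat. (of_nat n :: complex) *C a))" by (rule finite_subset[OF subset_UNIV f])
 from range_inj_infinite[OF i] this show False by (rule notE)
qed

text \<open>An infinite set absorbs a product with the integers, so the sum along an orbit fits into
  a space indexed by the algebra.\<close>

lemma int_times_inj:
 assumes "infinite (UNIV :: 'a set)" obtains f :: "int \<times> 'a => 'a" where "inj f"
proof -
 obtain g :: "nat => 'a" where g: "inj g" using assms[unfolded infinite_iff_countable_subset] by auto
 have "inj_on (g \<circ> (to_nat :: int => nat)) UNIV & (g \<circ> to_nat) ` (UNIV :: int set) <= UNIV"
  using inj_compose[OF g inj_to_nat] by simp
 hence "(card_of (UNIV :: int set), card_of (UNIV :: 'a set)) : ordLeq"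
  unfolding card_of_ordLeq[symmetric] by (intro exI[of _ "g \<circ> (to_nat :: int => nat)"])
 from card_of_Times_infinite[OF assms _ this]
 have "(card_of ((UNIV :: int set) \<times> (UNIV :: 'a set)), card_of (UNIV :: 'a set)) : ordLeq"
  by (simp add: ordIso_iff_ordLeq)
 then obtain f :: "int \<times> 'a => 'a" where "inj_on f ((UNIV :: int set) \<times> (UNIV :: 'a set))" unfolding card_of_ordLeq[symmetric] by (elim exE conjE)
 thus thesis using that by auto
qed

context hilbert_bimodule
begin

definition lnk :: "'h::chilbert_space set => ('a => 'h => 'h) => 'k::chilbert_space set => ('a => 'k => 'k) => bool"
 where "lnk H \<pi> K \<rho> <-> (EX T S. xlink H \<pi> K \<rho> T S)"

text \<open>P is a property constant along nonzero links, later that of avoiding U. The two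
  directions are sequences of dependent choices.\<close>

lemma orbit_exists:
 fixes \<pi>0 :: "'a action"
 assumes g: "good H0 \<pi>0" and P0: "P H0 \<pi>0"
  and P: "!!H \<pi> K \<rho> T S x h. irrep H \<pi> ==> irrep K \<rho> ==> xlink H \<pi> K \<rho> T S ==>
   h : H ==> T x h ~= 0 ==> P H \<pi> <-> P K (\<rho> :: 'a action)" and Pz: "!!\<pi>. P {0} \<pi>"
 shows "EX H \<pi>. H 0 = H0 & \<pi> 0 = \<pi>0 & (ALL n::int. good (H n) (\<pi> n) & P (H n) (\<pi> n) & lnk (H n) (\<pi> n) (H (n + 1)) (\<pi> (n + 1)))"
proof -
 let ?G = "%p :: ('a, 'a ell2) rep. good (fst p) (snd p) & P (fst p) (snd p)"
 let ?L = "%p q :: ('a, 'a ell2) rep. lnk (fst p) (snd p) (fst q) (snd q)"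
 have nzlink: "irrep H \<pi> & irrep K \<rho>"
  if l: "xlink H \<pi> K \<rho> T S" and g: "good H \<pi>" "good K \<rho>" and h: "h : H" "T x h ~= 0"
  for H K :: "'a ell2 set" and \<pi> \<rho> T S x h
 proof -
  have r: "representation H \<pi>" using g by (simp add: good_def)
  have "h ~= 0" using h(2) clin_on_0[OF linkD(1)[OF l] hsubD(1)[OF rep_hilbert[OF r]]] by auto
  thus ?thesis using g h linkD(3)[OF l h(1)] by (auto simp: good_def)
 qed
 have seq: "EX F. F 0 = (H0, \<pi>0) & (ALL n::nat. ?G (F n) & R (F n) (F (Suc n)))"
  if R: "!!p. ?G p ==> EX q. ?G q & R p q" for R
 proof -
  have "EX F. ALL n. (?G (F n) & (n = 0 --> F n = (H0, \<pi>0))) & R (F n) (F (Suc n))"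
  proof (rule dependent_nat_choice)
   show "EX p. ?G p & ((0::nat) = 0 --> p = (H0, \<pi>0))" using g P0 by simp
   show "EX q. (?G q & (Suc n = 0 --> q = (H0, \<pi>0))) & R p q" if "?G p & (n = 0 --> p = (H0, \<pi>0))" for p n
    using R[of p] that by simp
  qed
  thus ?thesis by blast
 qed
 have "EX F. F 0 = (H0, \<pi>0) & (ALL n. ?G (F n) & ?L (F n) (F (Suc n)))"
 proof (rule seq)
  fix p assume p: "?G p"
  then obtain K :: "'a ell2 set" and \<rho> T S where l: "xlink (fst p) (snd p) K \<rho> T S" "good K \<rho>"
   and nz: "K = {0} \<or> (EX x. EX h:fst p. T x h ~= 0)" using link_forward by blast
  have "P K \<rho>" if h: "h : fst p" "T x h ~= 0" for x h
   using nzlink[OF l(1) _ l(2) h] P[OF _ _ l(1) h] p by simp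
  hence "P K \<rho>" using nz Pz by auto
  thus "EX q. ?G q & ?L p q" using l by (intro exI[of _ "(K, \<rho>)"]) (auto simp: lnk_def)
 qed
 then obtain F where F: "F 0 = (H0, \<pi>0)" "!!n. ?G (F n)" "!!n. ?L (F n) (F (Suc n))" by blast
 have "EX F. F 0 = (H0, \<pi>0) & (ALL n. ?G (F n) & ?L (F (Suc n)) (F n))"
 proof (rule seq)
  fix p assume p: "?G p"
  then obtain K :: "'a ell2 set" and \<rho> T S where l: "xlink K \<rho> (fst p) (snd p) T S" "good K \<rho>"
   and nz: "K = {0} \<or> (EX x. EX h:K. T x h ~= 0)" using link_backward by blast
  have "P K \<rho>" if h: "h : K" "T x h ~= 0" for x h
   using nzlink[OF l(1,2) _ h] P[OF _ _ l(1) h] p by simp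
  hence "P K \<rho>" using nz Pz by auto
  thus "EX q. ?G q & ?L q p" using l by (intro exI[of _ "(K, \<rho>)"]) (auto simp: lnk_def)
 qed
 then obtain B where B: "B 0 = (H0, \<pi>0)" "!!n. ?G (B n)" "!!n. ?L (B (Suc n)) (B n)" by blast
 \<comment> \<open>The backward sequence is traversed in reverse; both sequences share the starting
   point at index 0.\<close>
 define G where "G n = (if 0 <= n then F (nat n) else B (nat (- n)))" for n :: int
 have L: "?L (G n) (G (n + 1))" for n
 proof (cases "0 <= n")
  case True
  thus ?thesis using F(3)[of "nat n"] by (simp add: G_def Suc_nat_eq_nat_zadd1 add.commute)
 next
  case False
  hence "G (n + 1) = B (nat (- n - 1))" "nat (- n) = Suc (nat (- n - 1))" using F(1) B(1) by (auto simp: G_def)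
  thus ?thesis using B(3)[of "nat (- n - 1)"] False by (simp add: G_def)
 qed
 have "?G (G n)" for n using F(2) B(2) by (simp add: G_def)
 thus ?thesis using L F(1) by (intro exI[of _ "%n. fst (G n)"] exI[of _ "%n. snd (G n)"]) (simp add: G_def)
qed

text \<open>With A acting diagonally and X moving each space to the next, the link relations become
  covariance. P holds along the whole orbit, so all components kill I, while component 0 remains the
  given representation.\<close>

lemma orbit_covariant:
 fixes \<pi>0 :: "'a action"
 assumes irr: "irrep H0 \<pi>0" and P0: "P H0 \<pi>0"
  and P: "!!H \<pi> K \<rho> T S x h. irrep H \<pi> ==> irrep K \<rho> ==> xlink H \<pi> K \<rho> T S ==>
   h : H ==> T x h ~= 0 ==> P H \<pi> <-> P K (\<rho> :: 'a action)" and Pz: "!!\<pi>. P {0} \<pi>"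
  and kill: "!!H \<pi> a h. good H \<pi> ==> P H \<pi> ==> a : I ==> h : H ==> \<pi> a h = 0"
 shows "EX (K :: ('a + 'x) ell2 set) \<pi>A \<pi>X. covariant_rep lact ract innerL innerR K \<pi>A \<pi>X &
  (ALL a:I. ALL h:K. \<pi>A a h = 0) & (ALL a h. h : H0 --> \<pi>0 a h ~= 0 --> (EX h:K. \<pi>A a h ~= 0))"
proof -
 obtain a0 :: 'a where "a0 ~= 0" using irrepD(2)[OF irr] rep_zero[OF irrepD(1)[OF irr]] by metis
 hence "infinite (UNIV :: 'a set)" by (rule infinite_vector_space)
 then obtain f :: "int \<times> 'a => 'a" where f: "inj f" by (rule int_times_inj)
 \<comment> \<open>The universal property is tested on \<open>('a + 'x) ell2\<close>, whose first
   summand has room enough.\<close>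
 define e :: "int \<times> 'a => 'a + 'x" where "e = Inl \<circ> f"
 have "inj e" unfolding e_def using f by (intro inj_compose) auto
 have "good H0 \<pi>0" using irr irrepD(1) by (auto simp: good_def)
 hence "EX H \<pi>. H 0 = H0 & \<pi> 0 = \<pi>0 & (ALL n::int. good (H n) (\<pi> n) & P (H n) (\<pi> n) & lnk (H n) (\<pi> n) (H (n + 1)) (\<pi> (n + 1)))"
  by (rule orbit_exists[where P = P]) (rule P0, rule P, assumption+, rule Pz)
 then obtain H \<pi> where O': "H 0 = H0 & \<pi> 0 = \<pi>0 & (ALL n::int. good (H n) (\<pi> n) & P (H n) (\<pi> n) & lnk (H n) (\<pi> n) (H (n + 1)) (\<pi> (n + 1)))"
  by (elim exE)
 hence O: "H 0 = H0" "\<pi> 0 = \<pi>0" "good (H n) (\<pi> n)" "P (H n) (\<pi> n)" "lnk (H n) (\<pi> n) (H (n + 1)) (\<pi> (n + 1))" for n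
  by simp_all
 have r: "representation (H n) (\<pi> n)" for n using O(3) by (simp add: good_def)
 interpret summed e H by unfold_locales (rule `inj e`, rule rep_hilbert[OF r])
 have "ALL n. EX p. xlink (H n) (\<pi> n) (H (n + 1)) (\<pi> (n + 1)) (fst p) (snd p)"
  using O(5) by (simp add: lnk_def)
 then obtain p where p: "ALL n. xlink (H n) (\<pi> n) (H (n + 1)) (\<pi> (n + 1)) (fst (p n)) (snd (p n))"
  by (rule exE[OF choice])
 define T S where "T n = fst (p n)" and "S n = snd (p n)" for n
 have l: "xlink (H n) (\<pi> n) (H (n + 1)) (\<pi> (n + 1)) (T n) (S n)" for n using p by (simp add: T_def S_def)
 note L = linkD[OF l]
 have L1: "T (n - 1) x h : H n" if "h : H (n - 1)" for n x h using L(3)[OF that] by simp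
 define A where "A a = shift 0 (%n. \<pi> n a)" for a
 \<comment> \<open>Component n receives from component n - 1, hence the index of T.\<close>
 define X where "X x = shift 1 (%n. T (n - 1) x)" for x
 define Y where "Y x = shift (- 1) (%n. S n x)" for x
 have fA: "family 0 (%n. \<pi> n a) (norm a)" for a by (simp add: family_def rep_clin[OF r] rep_in[OF r] rep_norm[OF r])
 have fX: "family 1 (%n. T (n - 1) x) (sqrt (norm (innerR x x)))" for x
  by (simp add: family_def L(1) L1 link_norm[OF l r r])
 have fY: "family (- 1) (%n. S n x) (sqrt (norm (innerL x x)))" for x
  using hilbert_bimodule.link_norm[OF conj_bimodule link_conj[OF l r r] r r, where x = "Cj x"] by (simp add: family_def L(2,4))
 note a = family_shift[OF fA, folded A_def] and x = family_shift[OF fX, folded X_def] and y = family_shift[OF fY, folded Y_def]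
 note TD = hsubD[OF total_hilbert]
 have c: "comp n (A b \<psi>) = \<pi> n b (comp n \<psi>)" "comp n (X z \<psi>) = T (n - 1) z (comp (n - 1) \<psi>)" "comp n (Y z \<psi>) = S n z (comp (n + 1) \<psi>)"
  if "\<psi> : total" for b z n \<psi> using a(2)[OF that] x(2)[OF that] y(2)[OF that] by simp_all
 have adj: "adjoint_on total (X z) \<psi> = Y z \<psi>" if \<psi>: "\<psi> : total" for z \<psi>
 proof (rule adjoint_on_eqI[OF total_hilbert _ \<psi> y(1)[OF \<psi>]])
  show "bounded_operator total (X z)" unfolding X_def by (rule shift_bounded[OF fX])
  fix \<phi> assume \<phi>: "\<phi> : total"
  have "cinner (X z \<phi>) \<psi> = cinner \<phi> (Y z \<psi>)"
   unfolding X_def Y_def by (rule shift_cinner[OF fX fY \<phi> \<psi>]) (simp add: L(5))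
  thus "cinner (Y z \<psi>) \<phi> = cinner \<psi> (X z \<phi>)" by (metis cinner_commute)
 qed
 have rA: "representation total A"
 proof (rule representationI[OF total_hilbert a(1)])
  show "clin_on total (A b)" for b unfolding A_def by (rule shift_clin[OF fA])
  show "EX M. ALL \<psi>:total. norm (A b \<psi>) <= M * norm \<psi>" for b using a(3) by blast
  show "cinner (A (star b) \<psi>) \<phi> = cinner \<psi> (A b \<phi>)" if "\<psi> : total" "\<phi> : total" for b \<psi> \<phi>
   using shift_cinner[OF fA _ that, of "%n. \<pi> n b" "norm b" "star b"] fA[of b] by (simp add: A_def rep_star(1)[OF r])
 qed (auto intro!: total_ext simp: a(1) TD c comp_lin totalD rep_add[OF r] rep_scale[OF r] rep_mult[OF r])
 have cov: "covariant_rep lact ract innerL innerR total A X"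
  unfolding covariant_rep_def
 proof (intro conjI allI ballI rA)
  show "bounded_operator total (X z)" for z unfolding X_def by (rule shift_bounded[OF fX])
  show "clinear (%z. X z \<psi>)" if "\<psi> : total" for \<psi>
   unfolding Vector_Spaces.linear_iff
   by (intro conjI allI complex_vector.vector_space_axioms total_ext) (simp_all add: that x(1) TD c comp_lin L totalD)
  fix b z w \<psi> assume t: "\<psi> : total"
  have L8: "T (n - 1) (lact b z) h = \<pi> n b (T (n - 1) z h)" if "h : H (n - 1)" for n h using L(8)[OF that] by simp
  have L11: "T (n - 1) z (S (n - 1) w k) = \<pi> n (innerL z w) k" if "k : H n" for n k using L(11)[of k "n - 1"] that by simp
  show "X (lact b z) \<psi> = A b (X z \<psi>)" by (rule total_ext) (simp_all add: t a(1) x(1) c L8 totalD)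
  show "X (ract z b) \<psi> = X z (A b \<psi>)" by (rule total_ext) (simp_all add: t a(1) x(1) c L(9) totalD)
  show "A (innerR z w) \<psi> = adjoint_on total (X z) (X w \<psi>)" by (rule total_ext) (simp_all add: t adj a(1) x(1) y(1) c L(10) totalD)
  show "A (innerL z w) \<psi> = X z (adjoint_on total (X w) \<psi>)" by (rule total_ext) (simp_all add: t adj a(1) x(1) y(1) c L11 totalD)
 qed
 have kill0: "A b \<psi> = 0" if "b : I" "\<psi> : total" for b \<psi>
  by (rule total_ext) (simp_all add: that a(1) TD c comp_lin totalD kill[OF O(3,4)])
 have nz0: "EX \<psi>:total. A b \<psi> ~= 0" if "h : H0" "\<pi>0 b h ~= 0" for b h
 proof -
  define v where "v n = (if n = 0 then h else 0)" for n :: int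
  have "(%n. (norm (v n))^2) summable_on {0}" by simp
  also have "?this <-> (%n. (norm (v n))^2) summable_on UNIV" by (rule summable_on_cong_neutral) (auto simp: v_def)
  finally have s: "(%n. (norm (v n))^2) summable_on UNIV" .
  note g = glue_comp[OF s]
  have t: "glue v : total" using hsubD(3)[OF rep_hilbert[OF r]] that(1) O(1) by (simp add: total_def g v_def)
  have "comp 0 (A b (glue v)) ~= 0" using that(2) by (simp add: c[OF t] g v_def O(2))
  hence "A b (glue v) ~= 0" by (auto simp: comp_lin(3))
  thus ?thesis using t by blast
 qed
 show ?thesis
  by (rule exI[of _ total], rule exI[of _ A], rule exI[of _ X], intro conjI cov ballI allI impI) (erule (1) kill0, erule (1) nz0)
qed

end

subsection \<open>The grading of the crossed product\<close>

locale crossed = hilbert_bimodule lact ract innerL innerR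
 for lact :: "'a::cstar_algebra => 'x::complex_vector => 'x" and ract :: "'x => 'a => 'x" and innerL innerR :: "'x => 'x => 'a" +
 fixes iA :: "'a => 'b::cstar_algebra" and iX :: "'x => 'b"
 assumes cp: "is_crossed_product lact ract innerL innerR iA iX"
begin

lemma hom: "star_hom iA" using cp by (simp add: is_crossed_product_def)

lemma iX: "iX (x + y) = iX x + iX y" "iX (c *C x) = c *C iX x" "iX (lact a x) = iA a * iX x" "iX (ract x a) = iX x * iA a"
 "iA (innerR x y) = star (iX x) * iX y" "iA (innerL x y) = iX x * star (iX y)"
 using cp by (simp_all add: is_crossed_product_def Vector_Spaces.linear_iff)

text \<open>Degree one is listed separately so that it contains each \<open>iX x\<close> and not
  only the products \<open>iX x * iA a\<close>.\<close>

fun word :: "nat => 'b set" where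
 "word 0 = range iA" | "word (Suc 0) = range iX" | "word (Suc (Suc n)) = {iX x * w |x w. w : word (Suc n)}"

lemma word_iX: "w : word n ==> iX x * w : word (Suc n)"
 by (cases n) (auto simp: iX(4)[symmetric])

lemma iA_word: "w : word n ==> iA a * w : word n"
proof (induction n rule: word.induct)
 case (3 n)
 then obtain x v where v: "w = iX x * v" "v : word (Suc n)" by auto
 have "iA a * w = iX (lact a x) * v" by (simp add: v(1) iX(3) mult.assoc)
 thus ?case using v(2) by auto
qed (auto simp: star_homD(3)[OF hom, symmetric] iX(3)[symmetric])

lemma word_iA: "w : word n ==> w * iA a : word n"
proof (induction n arbitrary: w rule: word.induct)
 case (3 n)
 then obtain x v where v: "w = iX x * v" "v : word (Suc n)" by auto
 from word_iX[OF "3.IH"[OF v(2)], of x] show ?case by (simp only: v(1) mult.assoc)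
qed (auto simp: star_homD(3)[OF hom, symmetric] iX(4)[symmetric])

lemma word_snoc: "w : word n ==> w * iX x : word (Suc n)"
proof (induction n arbitrary: w rule: word.induct)
 case (3 n)
 then obtain y v where v: "w = iX y * v" "v : word (Suc n)" by auto
 from "3.IH"[OF v(2)] show ?case using v(1) by (auto simp: mult.assoc)
qed (auto simp: iX(3)[symmetric])

lemma word_last:
 assumes "w : word (Suc (Suc n))" obtains v x where "w = v * iX x" "v : word (Suc n)"
proof -
 have "EX v x. w = v * iX x & v : word (Suc n)"
  using assms
 proof (induction n arbitrary: w)
  case (Suc n)
  then obtain y v where v: "w = iX y * v" "v : word (Suc (Suc n))" by auto
  then obtain u x where u: "v = u * iX x" "u : word (Suc n)" using Suc.IH by blast
  have "iX y * u : word (Suc (Suc n))" by (rule word_iX[OF u(2)])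
  thus ?case using v(1) u(1) by (auto simp: mult.assoc[symmetric])
 qed auto
 thus thesis using that by blast
qed

definition pword :: "int => 'b set"
 where "pword k = (if 0 <= k then word (nat k) else star ` word (nat (- k)))"

lemma pword_nat: "pword (int n) = word n" "pword (- int n) = star ` word n"
proof -
 have "star ` range iA = range iA"
 proof -
  have 1: "star (iA a) : range iA" for a using rangeI[of iA "star a"] unfolding star_homD(4)[OF hom] .
  have 2: "iA a : star ` range iA" for a by (rule image_eqI[of _ _ "iA (star a)"]) (simp add: star_homD(4)[OF hom] star_star, rule rangeI)
  show ?thesis
  proof (intro equalityI subsetI)
   fix b assume "b : star ` range iA"
   then obtain a where "b = star (iA a)" by blast
   thus "b : range iA" using 1 by simp
  next
   fix b assume "b : range iA"
   then obtain a where "b = iA a" by blast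
   thus "b : star ` range iA" using 2[of a] by (simp only:)
  qed
 qed
 thus "pword (- int n) = star ` word n" by (cases n) (simp_all add: pword_def del: of_nat_Suc)
qed (simp add: pword_def)

lemma pword_cases:
 assumes "w : pword k" obtains (pos) n where "k = int n" "w : word n" | (neg) n v where "k = - int (Suc n)" "w = star v" "v : word (Suc n)"
proof (cases "0 <= k")
 case True
 thus thesis using that(1)[of "nat k"] assms by (simp add: pword_def)
next
 case False
 then obtain n where k: "k = - int (Suc n)" by (metis int_cases not_le of_nat_0_le_iff)
 then obtain v where "w = star v" "v : word (Suc n)" using assms unfolding k pword_nat by blast
 thus thesis using that(2)[OF k] by blast
qed

lemma pword_star: assumes "w : pword k" shows "star w : pword (- k)"
 using assms by (cases rule: pword_cases) (auto simp: pword_nat star_star simp del: of_nat_Suc word.simps)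

lemma iA_pword: assumes "w : pword k" shows "iA a * w : pword k"
 using assms
proof (cases rule: pword_cases)
 case (neg n v)
 have "iA a * w = star (v * iA (star a))" by (simp add: neg star_mult star_homD(4)[OF hom] star_star)
 thus ?thesis using word_iA[OF neg(3)] unfolding neg(1) pword_nat by blast
qed (auto simp: pword_nat iA_word)

lemma iX_pword: assumes "w : pword k" shows "iX x * w : pword (k + 1)"
 using assms
proof (cases rule: pword_cases)
 case (pos n)
 thus ?thesis using word_iX[OF pos(2)] pword_nat(1)[of "Suc n"] by (simp add: add.commute)
next
 case (neg n v)
 have k: "k + 1 = - int n" using neg(1) by simp
 show ?thesis
 proof (cases n)
  case 0
  then obtain y where "v = iX y" using neg(3) by auto
  hence "iX x * w = iA (innerL x y)" by (simp add: neg(2) iX(6))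
  thus ?thesis using pword_nat(1)[of 0] 0 k by simp
 next
  case (Suc m)
  then obtain u y where u: "v = u * iX y" "u : word n" using neg(3) word_last by metis
  have "iX x * w = iA (innerL x y) * star u" by (simp add: neg(2) u(1) star_mult iX(6) mult.assoc)
  also have "... = star (u * iA (star (innerL x y)))" by (simp add: star_mult star_homD(4)[OF hom] star_star)
  finally show ?thesis unfolding k pword_nat using word_iA[OF u(2)] by blast
 qed
qed

lemma iX_star_pword: "w : pword k ==> star (iX x) * w : pword (k - 1)"
proof (cases "0 < k")
 case True
 then obtain n where k: "k = int (Suc n)" by (metis zero_less_imp_eq_int Suc_pred)
 moreover assume "w : pword k"
 ultimately have w: "w : word (Suc n)" by (simp only: pword_nat)
 have "star (iX x) * w : word n"
 proof (cases n)
  case 0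
  thus ?thesis using w by (auto simp: iX(5)[symmetric])
 next
  case (Suc m)
  then obtain y v where "w = iX y * v" "v : word n" using w by auto
  thus ?thesis using iA_word[of v n "innerR x y"] by (simp add: iX(5) mult.assoc)
 qed
 thus ?thesis using k pword_nat(1)[of n] by simp
next
 case False
 then obtain n where k: "k = - int n" by (metis minus_minus nonneg_int_cases neg_0_le_iff_le not_less)
 moreover assume "w : pword k"
 ultimately obtain v where v: "w = star v" "v : word n" unfolding k pword_nat by blast
 have "star (iX x) * w = star (v * iX x)" by (simp add: v(1) star_mult)
 moreover have "k - 1 = - int (Suc n)" using k by simp
 ultimately show ?thesis using word_snoc[OF v(2)] by (simp only: pword_nat) blast
qed

text \<open>Products of mixed sign shrink, because the two inner products put
  \<open>iX x * star (iX y)\<close> and \<open>star (iX x) * iX y\<close> into A.\<close>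

lemma pword_mult: assumes "v : pword j" and w: "w : pword k" shows "v * w : pword (j + k)"
 using assms(1)
proof (cases rule: pword_cases)
 case (pos n)
 have "v * w : pword (int n + k)"
  using pos(2)
 proof (induction n arbitrary: v rule: word.induct)
  case (3 n)
  then obtain y u where u: "v = iX y * u" "u : word (Suc n)" by auto
  from iX_pword[OF "3.IH"[OF u(2)], of y] show ?case using u(1) by (simp add: mult.assoc ac_simps)
 qed (use w iA_pword iX_pword[OF w] in "auto simp: add.commute")
 thus ?thesis using pos(1) by simp
next
 case (neg n u)
 have "star u * w : pword (k - int (Suc n))"
  using neg(3) w
 proof (induction n arbitrary: u w k)
  case 0
  thus ?case using iX_star_pword by auto
 next
  case (Suc n)
  then obtain y v where v: "u = iX y * v" "v : word (Suc n)" by auto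
  from Suc.IH[OF v(2) iX_star_pword[OF Suc.prems(2)], of y] show ?case using v(1) by (simp add: star_mult mult.assoc algebra_simps)
 qed
 moreover have "j + k = k - int (Suc n)" using neg(1) by simp
 ultimately show ?thesis unfolding neg(2) by (simp only:)
qed

definition G :: "int => 'b set" where "G k = cspan (pword k)"

lemma G_subspace: "csubspace (G k)" unfolding G_def by (rule complex_vector.subspace_span)

lemma pword_G: "w : pword k ==> w : G k" unfolding G_def by (rule complex_vector.span_base)

lemma G_star: assumes "b : G k" shows "star b : G (- k)"
 using assms unfolding G_def[of k]
proof (induction rule: complex_vector.span_induct_alt)
 case (step c w b)
 thus ?case using csub(2,4)[OF G_subspace] pword_G[OF pword_star] by (simp add: star_add star_scaleC)
qed (simp add: csub(1)[OF G_subspace])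

lemma G_mult:
 assumes "b : G j" "c : G k" shows "b * c : G (j + k)"
proof -
 have 1: "w * c : G (j + k)" if "w : pword j" for w
  using assms(2) unfolding G_def[of k]
 proof (induction rule: complex_vector.span_induct_alt)
  case (step d v c)
  thus ?case using csub(2,4)[OF G_subspace] pword_G[OF pword_mult[OF that]] by (simp add: distrib_left mult_scaleC_right)
 qed (simp add: csub(1)[OF G_subspace])
 show ?thesis using assms(1) unfolding G_def[of j]
 proof (induction rule: complex_vector.span_induct_alt)
  case (step d v b)
  thus ?case using csub(2,4)[OF G_subspace] 1 by (simp add: distrib_right mult_scaleC_left)
 qed (simp add: csub(1)[OF G_subspace])
qed

lemma G_0: "b : G 0 ==> EX a. b = iA a"
proof -
 have "csubspace (range iA)"
 proof (rule csubspaceI)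
  show "0 : range iA" using rangeI[of iA 0] hom_more(1)[OF hom] by simp
 qed (auto simp: star_homD(1,2)[OF hom, symmetric])
 hence "G 0 = range iA" unfolding G_def using pword_nat(1)[of 0] by (simp add: complex_vector.span_eq_iff[THEN iffD2])
 thus "b : G 0 ==> EX a. b = iA a" by blast
qed

text \<open>b is a sum of homogeneous terms of degree at most N in absolute value, and
  \<open>b'\<close> has each term of degree k multiplied by z^k. It is a relation because no
  uniqueness of the decomposition is known yet; under freeness, \<open>gr_contractive\<close> shows
  that \<open>b'\<close> depends on b only.\<close>

inductive gr :: "complex => nat => 'b => 'b => bool" for z where
 base: "b : G k ==> \<bar>k\<bar> <= int N ==> gr z N b (z powi k *C b)"
| add: "gr z N b b' ==> gr z N c c' ==> gr z N (b + c) (b' + c')"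

lemma gr_mono: "gr z N b b' ==> N <= M ==> gr z M b b'"
 by (induction rule: gr.induct) (auto intro: gr.intros)

lemma gr_scale: "gr z N b b' ==> gr z N (c *C b) (c *C b')"
proof (induction rule: gr.induct)
 case (base b k N)
 hence "gr z N (c *C b) (z powi k *C c *C b)" by (intro gr.base csub(4)[OF G_subspace])
 thus ?case by (simp add: mult.commute)
qed (simp add: scaleC_add_right gr.add)

lemma gr_mult:
 assumes z: "z ~= 0" and "gr z N b b'" "gr z M c c'" shows "gr z (N + M) (b * c) (b' * c')"
 using assms(2)
proof (induction rule: gr.induct)
 case (base b k N)
 show ?case using assms(3)
 proof (induction rule: gr.induct)
  case (base c l M)
  have "gr z (N + M) (b * c) (z powi (k + l) *C (b * c))"
   using base.hyps `b : G k` `\<bar>k\<bar> <= int N` by (intro gr.base G_mult) auto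
  thus ?case using z by (simp add: mult_scaleC_left mult_scaleC_right power_int_add mult.commute)
 qed (simp add: distrib_left gr.add)
qed (simp add: distrib_right gr.add)

lemma gr_star: assumes z: "cmod z = 1" and "gr z N b b'" shows "gr z N (star b) (star b')"
 using assms(2)
proof (induction rule: gr.induct)
 case (base b k N)
 have "gr z N (star b) (z powi (- k) *C star b)" using base by (intro gr.base G_star) auto
 moreover have "z powi (- k) = cnj (z powi k)"
 proof -
  have "cmod (z powi k) = 1" by (simp add: norm_power_int z)
  hence "z powi k * cnj (z powi k) = 1" unfolding complex_norm_square[symmetric] by simp
  from inverse_unique[OF this] show ?thesis by (simp only: power_int_minus)
 qed
 ultimately show ?case by (simp add: star_scaleC)
qed (simp add: star_add gr.add)

lemma gr_sum:
 assumes "gr z N b b'"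
 shows "EX w. (ALL k. w k : G k) & b = (\<Sum>k\<in>{- int N..int N}. w k) & b' = (\<Sum>k\<in>{- int N..int N}. z powi k *C w k)"
 using assms
proof (induction rule: gr.induct)
 case (base b k N)
 let ?w = "%l. if l = k then b else 0"
 have "(\<Sum>l\<in>{- int N..int N}. z powi l *C ?w l) = (\<Sum>l\<in>{- int N..int N}. if l = k then z powi k *C b else 0)" by (rule sum.cong) auto
 thus ?case using base csub(1)[OF G_subspace] by (intro exI[of _ ?w]) (auto simp: abs_le_iff)
next
 case (add N b b' c c')
 then obtain w v where "ALL k. w k : G k" "b = (\<Sum>k\<in>{- int N..int N}. w k)" "b' = (\<Sum>k\<in>{- int N..int N}. z powi k *C w k)"
  "ALL k. v k : G k" "c = (\<Sum>k\<in>{- int N..int N}. v k)" "c' = (\<Sum>k\<in>{- int N..int N}. z powi k *C v k)" by blast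
 thus ?case using csub(2)[OF G_subspace]
  by (intro exI[of _ "%k. w k + v k"]) (simp add: sum.distrib scaleC_add_right)
qed

lemma gr_generators: "gr z N (iA a) (iA a)" "gr z 1 (iX x) (z *C iX x)"
 using gr.base[of "iA a" 0 N z] gr.base[of "iX x" 1 1 z] pword_G[of _ 0] pword_G[of _ 1] pword_nat(1)[of 0] pword_nat(1)[of 1] by auto

text \<open>The elements with a decomposition form a self-adjoint algebra containing the generators,
  so its closure is everything.\<close>

lemma graded_dense:
 assumes z: "cmod z = 1" obtains s s' where "!!n. EX N. gr z N (s n) (s' n)" "s ----> b"
proof -
 define S where "S = {b. EX b' N. gr z N b b'}"
 have z0: "z ~= 0" using z by auto
 have sS: "csubspace S"
 proof (rule csubspaceI)
  show "0 : S" using gr_generators(1)[of z 0 0] hom_more(1)[OF hom] by (auto simp: S_def)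
 next
  fix x y assume "x : S" "y : S"
  then obtain N x' M y' where "gr z N x x'" "gr z M y y'" unfolding S_def by blast
  hence "gr z (max N M) (x + y) (x' + y')" by (intro gr.add gr_mono[OF _ max.cobounded1] gr_mono[OF _ max.cobounded2])
  thus "x + y : S" unfolding S_def by blast
 next
  show "c *C x : S" if "x : S" for c x using that gr_scale unfolding S_def by fast
 qed
 have tend: "EX f. (ALL n. f n : S) & f ----> b" if "b : closure S" for b using that unfolding closure_sequential .
 have cl: "b : closure S" if "!!n. f n : S" "f ----> b" for f b by (rule closure_seqI[OF that])
 have "cstar_subalgebra (closure S)"
  unfolding cstar_subalgebra_def
 proof (intro conjI ballI csubspaceI closed_closure)
  show "0 : closure S" using closure_subset csub(1)[OF sS] by blast
 next
  fix x y assume "x : closure S" "y : closure S"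
  with tend obtain f g where fg: "ALL n. f n : S" "f ----> x" "ALL n. g n : S" "g ----> y" by meson
  hence f: "!!n. f n : S" "f ----> x" "!!n. g n : S" "g ----> y" by simp_all
  show "x + y : closure S" by (rule cl[OF csub(2)[OF sS f(1,3)] tendsto_add[OF f(2,4)]])
  have "f n * g n : S" for n using f(1,3)[of n] gr_mult[OF z0] unfolding S_def by blast
  thus "x * y : closure S" by (rule cl[OF _ tendsto_mult[OF f(2,4)]])
 next
  fix x assume "x : closure S"
  with tend obtain f where fx: "ALL n. f n : S" "f ----> x" by meson
  hence f: "!!n. f n : S" "f ----> x" by simp_all
  show "c *C x : closure S" for c by (rule cl[OF csub(4)[OF sS f(1)] tendsto_scaleC_alg[OF f(2)]])
  have "star (f n) : S" for n using f(1)[of n] gr_star[OF z] unfolding S_def by blast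
  thus "star x : closure S" by (rule cl[OF _ tendsto_star[OF f(2)]])
 qed
 moreover have "range iA \<union> range iX <= closure S" using closure_subset[of S] gr_generators[of z] unfolding S_def by blast
 ultimately have "cstar_generated (range iA \<union> range iX) <= closure S" unfolding cstar_generated_def by (intro Inter_lower) simp
 moreover have "cstar_generated (range iA \<union> range iX) = UNIV" using cp by (simp add: is_crossed_product_def)
 ultimately have "b : closure S" by auto
 from tend[OF this] obtain f where f: "ALL n. f n : S" "f ----> b" by (elim exE conjE)
 have "ALL n. EX b'. EX N. gr z N (f n) b'" using f(1) by (simp add: S_def)
 hence "EX s'. ALL n. EX N. gr z N (f n) (s' n)" by (rule choice)
 then obtain s' where s': "ALL n. EX N. gr z N (f n) (s' n)" by (elim exE)
 show thesis by (rule that[of f s', OF spec[OF s'] f(2)])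
qed

end

subsection \<open>Invariance of the spectra of intersections with \<open>A\<close>\<close>

text \<open>rho(a) T x h = T (a x) h has norm square <h, pi(<a x, a x>_R) h>.\<close>

lemma indrel_kill:
 assumes i: "indrel lact innerR H \<pi> K \<rho> T" and r: "representation K \<rho>"
  and z: "!!x h. h : H ==> \<pi> (innerR (lact a x) (lact a x)) h = 0" and k: "k : K"
 shows "\<rho> a k = 0"
proof -
 have K: "K = closure (cspan {T x h |x h. h : H})" using i by (simp add: indrel_def)
 show ?thesis
 proof (rule span_closure_eq[OF rep_clin[OF r] rep_norm[OF r] _ _ rep_hilbert[OF r] K _ k, of "%_. 0" 0])
  fix v assume "v : {T x h |x h. h : H}"
  then obtain x h where h: "v = T x h" "h : H" by blast
  have "cinner (T (lact a x) h) (T (lact a x) h) = cinner h (\<pi> (innerR (lact a x) (lact a x)) h)"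
   using i h(2) unfolding indrel_def by blast
  hence "cinner (T (lact a x) h) (T (lact a x) h) = 0" by (simp add: z h(2))
  hence "T (lact a x) h = 0" by (simp add: cinner_self)
  thus "\<rho> a v = 0" using i h by (simp add: indrel_def)
 qed (simp_all add: clin_on_def)
qed

lemma subrep:
 assumes r: "representation K (\<sigma> :: 'a::cstar_algebra => 'h::chilbert_space => 'h)" and L: "hilbert_subspace L" "L <= K" "!!a h. h : L ==> \<sigma> a h : L"
 shows "representation L \<sigma>"
proof (rule representationI[OF L(1,3)])
 have LK: "h : K" if "h : L" for h using that L(2) by blast
 show "clin_on L (\<sigma> a)" for a using rep_clin[OF r] L(2) unfolding clin_on_def by blast
 show "EX M. ALL h:L. norm (\<sigma> a h) <= M * norm h" for a using rep_norm[OF r] LK by blast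
qed (use L(2) in "auto simp: rep_add[OF r] rep_scale[OF r] rep_mult[OF r] rep_star(1)[OF r] subset_iff")

lemma star_hom_vimage_ideal:
 assumes f: "star_hom f" and J: "cstar_ideal J" shows "cstar_ideal (f -` J)"
 unfolding cstar_ideal_def
proof (intro conjI csubspaceI)
 have "bounded_linear f"
  by (rule bounded_linear_intro[where K = 1]) (simp_all add: star_homD(1)[OF f] hom_more(4)[OF f] star_hom_norm[OF f])
 thus "closed (f -` J)" by (intro continuous_closed_vimage cidealD(2)[OF J] linear_continuous_at)
qed (use csub[OF cidealD(1)[OF J]] cidealD(3,4)[OF J] in "auto simp: star_homD[OF f] hom_more(1)[OF f]")

context crossed
begin

abbreviation "D \<equiv> hat (inner_ideal innerR)"
abbreviation "dual \<equiv> dual_map lact innerR"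

lemma preimage_ideal: "cstar_ideal J ==> cstar_ideal (iA -` J)"
 by (rule star_hom_vimage_ideal[OF hom])

text \<open>If \<open>iA a\<close> lies in J, then so does the image (a x)* (a x) of <a x, a x>_R,
  and likewise on the left. Vanishing on the preimage of J is therefore constant along
  orbits.\<close>

lemma link_kills:
 assumes l: "xlink H \<pi> K \<rho> T S" and irr: "irrep H \<pi>" "irrep K \<rho>" and nz: "h0 : H" "T x0 h0 ~= 0"
  and J: "cstar_ideal J"
 shows "(ALL a:iA -` J. ALL h:H. \<pi> a h = 0) <-> (ALL a:iA -` J. ALL k:K. \<rho> a k = 0)"
proof -
 note r = irrepD(1)[OF irr(1)] irrepD(1)[OF irr(2)]
 have 1: "innerR (lact a x) (lact a x) : iA -` J" if "a : iA -` J" for a x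
  using that by (simp add: iX star_mult mult.assoc cidealD(3,4)[OF J])
 have 2: "innerL (ract x (star a)) (ract x (star a)) : iA -` J" if "a : iA -` J" for a x
  using that by (simp add: iX star_mult mult.assoc cidealD(3,4)[OF J] star_homD(4)[OF hom, symmetric] star_star)
 have "\<rho> a k = 0" if "ALL a:iA -` J. ALL h:H. \<pi> a h = 0" "a : iA -` J" "k : K" for a k
  by (rule indrel_kill[OF link_dense[OF l irr nz] r(2) _ that(3)]) (use that(1) 1[OF that(2)] in blast)
 moreover have "\<pi> a h = 0" if "ALL a:iA -` J. ALL k:K. \<rho> a k = 0" "a : iA -` J" "h : H" for a h
  by (rule indrel_kill[OF link_dense_conj[OF l irr nz] r(1) _ that(3)]) (use that(1) 2[OF that(2)] in simp)
 ultimately show ?thesis by blast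
qed

lemma dual_hat:
 assumes J: "cstar_ideal J" and c: "c : D" shows "c : hat (iA -` J) <-> dual c : hat (iA -` J)" "dual c : spectrum"
proof -
 obtain H K :: "'a ell2 set" and \<pi> \<rho> T S x h where 1: "h : H" "irrep H \<pi>" "c = cls H \<pi>" "xlink H \<pi> K \<rho> T S"
  "irrep K \<rho>" "dual c = cls K \<rho>" "T x h ~= 0" by (rule dual_ex[OF c])
 show "c : hat (iA -` J) <-> dual c : hat (iA -` J)"
  unfolding 1(3)[symmetric] 1(6) unfolding 1(3) cls_hat[OF 1(2)] cls_hat[OF 1(5)] using link_kills[OF 1(4,2,5,1,7) J] by blast
 show "dual c : spectrum" unfolding 1(6) by (rule cls_spectrum[OF 1(5)])
qed

lemma hat_invariant:
 assumes J: "cstar_ideal J"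
 shows "invariant_set D dual (hat (iA -` J))" "invariant_set D dual (spectrum - hat (iA -` J))"
 unfolding invariant_set_def using dual_hat[OF J] hat_spectrum by blast+

text \<open>Freeness provides, in every relatively open subset of the hull of \<open>J\<close>, a point without small periods.\<close>

lemma free_point:
 assumes free: "free_map spectrum_topology D dual" and J: "cstar_ideal J" and irr: "irrep H \<pi>"
  and kill: "ALL a:iA -` J. ALL h:H. \<pi> a h = 0" and g: "h0 : H" "\<pi> g h0 ~= 0"
 obtains K and \<rho> :: "'a action" and k where "irrep K \<rho>" "!!a k. iA a : J ==> k : K ==> \<rho> a k = 0" "k : K" "\<rho> g k ~= 0"
  "!!n. 0 < n ==> n <= N ==> cls K \<rho> : iterate_domain ((spectrum - hat (iA -` J)) \<inter> D) dual n ==> (dual ^^ n) (cls K \<rho>) ~= cls K \<rho>"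
proof -
 define V where "V = spectrum - hat (iA -` J)"
 \<comment> \<open>A common multiple of all periods up to N, so that topological freeness is used
   for the single exponent M.\<close>
 define M where "M = (fact (Suc N) :: nat)"
 have M: "0 < M" by (simp add: M_def)
 have "closedin spectrum_topology V"
  unfolding V_def closedin_def using openin_hat[OF preimage_ideal[OF J]] hat_spectrum by (simp add: double_diff[OF hat_spectrum order_refl])
 hence tf: "topologically_free (subtopology spectrum_topology V) (V \<inter> D) dual"
  using free hat_invariant(2)[OF J] unfolding free_map_def V_def by blast
 \<comment> \<open>The hat of this ideal is an open set of classes on which g acts nontrivially, and
   it contains the given class because g lies in the ideal.\<close>
 let ?I = "hull_ideal {c. EX K (\<rho> :: 'a action). irrep K \<rho> & c = cls K \<rho> & (EX k:K. \<rho> g k ~= 0)}"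
 have gI: "g : ?I" unfolding hull_ideal_def by blast
 obtain H' :: "'a ell2 set" and \<pi>' U where H': "irrep H' \<pi>'" "rep_iso H \<pi> H' \<pi>' U" by (rule irreducible_compress'[OF irr])
 have "cls H \<pi> : hat ?I" unfolding cls_hat[OF irr] using gI g by blast
 moreover have "cls H \<pi> : V" unfolding V_def using cls_spectrum[OF irr] cls_hat[OF irr] kill by blast
 ultimately have ne: "hat ?I \<inter> V ~= {}" by blast
 have op: "openin (subtopology spectrum_topology V) (hat ?I \<inter> V)"
  using openin_hat[OF hull_ideal_ideal] by (auto simp: openin_subtopology)
 have "\<not> hat ?I \<inter> V <= {x : iterate_domain (V \<inter> D) dual M. (dual ^^ M) x = x}"
 proof
  assume "hat ?I \<inter> V <= {x : iterate_domain (V \<inter> D) dual M. (dual ^^ M) x = x}"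
  hence "hat ?I \<inter> V <= subtopology spectrum_topology V interior_of {x : iterate_domain (V \<inter> D) dual M. (dual ^^ M) x = x}"
   by (rule interior_of_maximal[OF _ op])
  thus False using tf M ne unfolding topologically_free_def by blast
 qed
 then obtain c where c: "c : hat ?I" "c : V" "c : iterate_domain (V \<inter> D) dual M ==> (dual ^^ M) c ~= c" by blast
 obtain K \<rho> k where p: "irreducible_rep (K, \<rho> :: 'a action)" "c = cls K \<rho>" "k : K" "\<rho> g k ~= 0"
  using subsetD[OF hat_hull_subset c(1)] by blast
 show thesis
 proof (rule that[OF p(1) _ p(3,4)])
  show "\<rho> a k = 0" if "iA a : J" "k : K" for a k using c(2) that unfolding p(2) V_def using cls_hat[OF p(1)] by blast
  fix n assume n: "0 < n" "n <= N" and it: "cls K \<rho> : iterate_domain ((spectrum - hat (iA -` J)) \<inter> D) dual n"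
  show "(dual ^^ n) (cls K \<rho>) ~= cls K \<rho>"
  proof
   assume e: "(dual ^^ n) (cls K \<rho>) = cls K \<rho>"
   have per: "(dual ^^ (n * q)) c = c" for q
    by (induction q) (use e in "simp_all add: p(2) funpow_add")
   \<comment> \<open>A point of period n visits only its first n iterates, so its whole orbit stays
     in the domain.\<close>
   have "(dual ^^ m) c : V \<inter> D" for m
   proof -
    have "(dual ^^ (m mod n + n * (m div n))) c = (dual ^^ (m mod n)) c" unfolding funpow_add by (simp add: per)
    moreover have "m mod n < n" using n(1) by simp
    ultimately show ?thesis using it by (simp add: iterate_domain_def p(2) V_def)
   qed
   hence "c : iterate_domain (V \<inter> D) dual M" by (simp add: iterate_domain_def)
   moreover have "n dvd M" unfolding M_def using n by (intro dvd_fact) auto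
   hence "(dual ^^ M) c = c" using per by (auto simp: dvd_def)
   ultimately show False using c(3) by blast
  qed
 qed
qed

text \<open>In an extension \<open>\<Phi>\<close> of an irreducible representation \<open>\<rho>\<close> without periods up to \<open>N\<close>, the homogeneous
 elements of degree \<open>n\<close> map the space of \<open>\<rho>\<close> to that of \<open>h^n(\<rho>)\<close>, which is orthogonal to it by Schur's lemma.\<close>

lemma compress_degree_zero:
 assumes J: "cstar_ideal J" and \<Phi>: "representation K \<Phi>" "!!j k. j : J ==> k : K ==> \<Phi> j k = 0"
  and L0: "irreducible_rep (L0, %a. \<Phi> (iA a))" "L0 <= K"
  and per: "!!n. 0 < n ==> n <= N ==> cls L0 (%a. \<Phi> (iA a)) : iterate_domain ((spectrum - hat (iA -` J)) \<inter> D) dual n ==>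
   (dual ^^ n) (cls L0 (%a. \<Phi> (iA a))) ~= cls L0 (%a. \<Phi> (iA a))"
  and b: "b : G k" "k ~= 0" "\<bar>k\<bar> <= int N" and uv: "u : L0" "v : L0"
 shows "cinner u (\<Phi> b v) = 0"
proof -
 define \<sigma> where "\<sigma> a = \<Phi> (iA a)" for a
 note r = \<Phi>(1) and H = rep_hilbert[OF \<Phi>(1)]
 note KD = hsubD[OF H]
 have \<sigma>: "representation K \<sigma>" unfolding \<sigma>_def by (rule rep_restrict[OF r hom])
 have irr: "irrep L0 \<sigma>" using L0(1) by (simp only: \<sigma>_def[abs_def])
 define V where "V = spectrum - hat (iA -` J)"
 \<comment> \<open>L n is the closed span of n factors of X applied to L0; unless it is zero, it
   represents the n-th image of the class of L0.\<close>
 define L where "L = rec_nat L0 (%_ M. closure (cspan {\<Phi> (iX x) h |x h. h : M}))"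
 have L: "L 0 = L0" "L (Suc n) = closure (cspan {\<Phi> (iX x) h |x h. h : L n})" for n by (simp_all add: L_def)
 have XL: "\<Phi> (iX x) h : L (Suc n)" if "h : L n" for x h n
  unfolding L by (rule subsetD[OF closure_subset]) (use that in "blast intro: complex_vector.span_base")
 have main: "L n <= K & good (L n) \<sigma> & (L n ~= {0} --> cls L0 \<sigma> : iterate_domain (V \<inter> D) dual n & cls (L n) \<sigma> = (dual ^^ n) (cls L0 \<sigma>))" for n
 proof (induction n)
  case 0
  show ?case using L0(2) irr irrepD(1)[OF irr] by (simp add: L good_def iterate_domain_def)
 next
  case (Suc n)
  hence IH: "L n <= K" "good (L n) \<sigma>" by simp_all
  have rn: "representation (L n) \<sigma>" using IH(2) by (simp add: good_def)
  note Hn = rep_hilbert[OF rn]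
  let ?S = "{\<Phi> (iX x) h |x h. h : L n}"
  have SK: "?S <= K" using IH(1) rep_in[OF r] by blast
  have LK: "L (Suc n) <= K" unfolding L by (rule cspan_closure_subset[OF H SK])
  have HL: "hilbert_subspace (L (Suc n))" unfolding L by (rule hsub_closure[OF complex_vector.subspace_span])
  have \<sigma>L: "\<sigma> a k : L (Suc n)" if k: "k : L (Suc n)" for a k
  proof (rule clin_on_closure[OF rep_clin[OF \<sigma>] rep_norm[OF \<sigma>] H SK HL _ k[unfolded L]])
   fix s assume "s : ?S"
   then obtain x h where s: "s = \<Phi> (iX x) h" "h : L n" by blast
   have "\<sigma> a s = \<Phi> (iX (lact a x)) h" using s IH(1) by (auto simp: \<sigma>_def iX rep_mult[OF r])
   thus "\<sigma> a s : L (Suc n)" using XL[OF s(2)] by simp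
  qed
  have rL: "representation (L (Suc n)) \<sigma>" by (rule subrep[OF \<sigma> HL LK \<sigma>L])
  have SL: "\<Phi> (star (iX x)) k : L n" if k: "k : L (Suc n)" for x k
  proof (rule clin_on_closure[OF rep_clin[OF r] rep_norm[OF r] H SK Hn _ k[unfolded L]])
   fix s assume "s : ?S"
   then obtain y h where s: "s = \<Phi> (iX y) h" "h : L n" by blast
   have "\<Phi> (star (iX x)) s = \<sigma> (innerR x y) h" using s IH(1) by (auto simp: \<sigma>_def iX rep_mult[OF r])
   thus "\<Phi> (star (iX x)) s : L n" using rep_in[OF rn s(2)] by simp
  qed
  have sub: "clin_on M (\<Phi> b)" if "M <= K" for M b using rep_clin[OF r, of b] that unfolding clin_on_def by blast
  have l: "xlink (L n) \<sigma> (L (Suc n)) \<sigma> (%x. \<Phi> (iX x)) (%x. \<Phi> (star (iX x)))"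
   unfolding link_def
   by (intro conjI allI ballI sub IH(1) LK XL SL)
    (use IH(1) LK in "auto simp: subset_iff \<sigma>_def iX rep_add[OF r] rep_scale[OF r] rep_mult[OF r] rep_star(2)[OF r] rep_in[OF r]")
  have g: "good (L (Suc n)) \<sigma>" by (rule link_good[OF l IH(2) rL]) (simp only: L)
  have "cls L0 \<sigma> : iterate_domain (V \<inter> D) dual (Suc n) & cls (L (Suc n)) \<sigma> = (dual ^^ Suc n) (cls L0 \<sigma>)" if nz: "L (Suc n) ~= {0}"
  proof -
   have irS: "irreducible_rep (L (Suc n), \<sigma>)" using g nz by (simp add: good_def)
   have "EX x. EX h:L n. \<Phi> (iX x) h ~= 0"
   proof (rule ccontr)
    assume "\<not> ?thesis"
    hence "?S <= {0}" by blast
    hence "cspan ?S <= {0}" by (rule complex_vector.span_minimal) simp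
    hence "L (Suc n) <= {0}" unfolding L by (rule closure_minimal) simp
    thus False using nz hsubD(3)[OF HL] by blast
   qed
   then obtain x h where h: "h : L n" "\<Phi> (iX x) h ~= 0" by blast
   hence n0: "L n ~= {0}" using rep_vzero[OF r] by auto
   hence irn: "irrep (L n) \<sigma>" using IH(2) by (simp add: good_def)
   have "cls (L n) \<sigma> : D" unfolding hat_inner[OF l irn rL] using h by blast
   moreover have "cls (L n) \<sigma> : V"
    unfolding V_def using cls_spectrum[OF irn] cls_hat[OF irn] \<Phi>(2) IH(1) by (auto simp: \<sigma>_def)
   ultimately show ?thesis
    using Suc n0 dual_map_cls[OF l irn irS h] by (auto simp: iterate_domain_def less_Suc_eq)
  qed
  thus ?case using LK g by blast
 qed
 have per': "(dual ^^ n) (cls L0 \<sigma>) ~= cls L0 \<sigma>"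
  if "0 < n" "n <= N" "cls L0 \<sigma> : iterate_domain (V \<inter> D) dual n" for n
  using per[OF that(1,2)] that(3) by (simp only: V_def \<sigma>_def[abs_def] not_False_eq_True simp_thms)
 have LnK: "L n <= K" for n using main[of n] by simp
 have wordL: "\<Phi> w h : L n" if "w : word n" "h : L0" for w n h
  using that(1)
 proof (induction n arbitrary: w rule: word.induct)
  case 1
  thus ?case using rep_in[OF irrepD(1)[OF irr] that(2)] by (auto simp: L \<sigma>_def)
 next
  case 2
  thus ?case using XL[of h 0] that(2) L(1) by auto
 next
  case (3 n)
  then obtain x v where v: "w = iX x * v" "v : word (Suc n)" by auto
  have "h : K" using that(2) L0(2) by blast
  hence "\<Phi> w h = \<Phi> (iX x) (\<Phi> v h)" by (simp add: v(1) rep_mult[OF r])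
  thus ?case using XL[OF "3.IH"[OF v(2)]] by simp
 qed
 have orth: "cinner u v = 0" if u: "u : L0" and v: "v : L n" and n: "0 < n" "n <= N" for u v n
 proof (rule ccontr)
  assume nz: "cinner u v ~= 0"
  have n0: "L n ~= {0}"
  proof
   assume "L n = {0}"
   hence "v = 0" using v by blast
   thus False using nz by simp
  qed
  have irn: "irrep (L n) \<sigma>" using main[of n] n0 unfolding good_def by blast
  have eq: "cls L0 \<sigma> = cls (L n) \<sigma>" unfolding cls_eq[OF irr irn]
   by (rule irreducible_orthogonal[OF \<sigma> irr L0(2) irn LnK u v nz])
  have a: "cls L0 \<sigma> : iterate_domain (V \<inter> D) dual n" "cls (L n) \<sigma> = (dual ^^ n) (cls L0 \<sigma>)" using main[of n] n0 by blast+
  have "(dual ^^ n) (cls L0 \<sigma>) = cls L0 \<sigma>" by (rule trans[OF a(2)[symmetric] eq[symmetric]])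
  thus False using per'[OF n a(1)] by (rule notE[rotated])
 qed
 have pw: "cinner u (\<Phi> w v) = 0" if w: "w : pword k" and uv: "u : L0" "v : L0" for w u v
  using w
 proof (cases rule: pword_cases)
  case (pos n)
  thus ?thesis using orth[OF uv(1) wordL[OF pos(2) uv(2)]] b(2,3) by simp
 next
  case (neg n w')
  have "cinner v (\<Phi> w' u) = 0" using orth[OF uv(2) wordL[OF neg(3) uv(1)]] b(3) neg(1) by simp
  moreover have "cinner u (\<Phi> w v) = cinner (\<Phi> w' u) v"
   unfolding neg(2) by (rule rep_star(2)[OF r, symmetric]) (use uv L0(2) in blast)+
  ultimately show ?thesis by (metis cinner_commute complex_cnj_zero)
 qed
 have "cinner u (\<Phi> b v) = 0" using b(1) unfolding G_def
 proof (induction rule: complex_vector.span_induct_alt)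
  case base
  thus ?case using uv(2) L0(2) by (simp add: rep_zero[OF r] subset_iff)
 next
  case (step c w b)
  have "v : K" using uv(2) L0(2) by blast
  thus ?case using step pw[OF step(1) uv] by (simp add: rep_add[OF r] rep_scale[OF r] cinner_add_right cinner_scaleC_right)
 qed
 thus ?thesis .
qed

text \<open>Freeness gives points near pi only, so e is put strictly between the two norms, and g,
  the positive part of a* a - e^2, marks an open set around pi. At a point rho without small periods
  in it, some unit vector w1 has norm (rho(a) w1) >= e. Extended to a representation killing J and
  tested against rho(a) w1, c - j acts as its component of degree zero, whence e <= norm (c -
  j).\<close>

lemma degree_zero_bound:
 assumes free: "free_map spectrum_topology D dual" and J: "cstar_ideal J"
  and w: "!!k. w k : G k" "w 0 = iA a" and j: "j : J"
  and irr: "irreducible_rep (H, \<pi> :: 'a action)" and kill: "ALL a:iA -` J. ALL h:H. \<pi> a h = 0" and h: "h : H" "norm h = 1"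
 shows "norm (\<pi> a h) <= norm ((\<Sum>k\<in>{- int N..int N}. w k) - j)" (is "_ <= norm (?c - j)")
proof (rule ccontr)
 assume "\<not> ?thesis"
 then obtain e where e: "norm (?c - j) < e" "e < norm (\<pi> a h)" using dense not_le by blast
 have e0: "0 < e" using e(1) norm_ge_zero[of "?c - j"] by linarith
 note r = irrepD(1)[OF irr]
 define x where "x = star a * a"
 have sx: "star x = x" by (simp add: x_def star_mult star_star)
 obtain g kk m where g: "star g = g" "star kk = kk" "star m = m" "kk * kk = g" "x * g = (e^2) *R g + g * g" "x = g + (2 * e) *R m - m * m"
  by (rule threshold_elements[OF sx e0])
 have \<pi>x: "cinner k (\<rho> x k) = cor ((norm (\<rho> a k))^2)" if r: "representation M \<rho>" and k: "k : M" for M \<rho> and k :: "'a ell2"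
  unfolding cinner_self[symmetric] rep_star(2)[OF r k rep_in[OF r k]] by (simp add: x_def rep_mult[OF r k])
 have sr: "\<rho> (t *R c) k = cor t *C \<rho> c k" if "representation M \<rho>" "k : M" for M \<rho> t c and k :: "'a ell2"
  using that by (simp add: scaleR_conv_scaleC rep_scale)
 \<comment> \<open>If g killed h, the certificate x = g + 2 e m - m m would give (norm (pi a h))^2
   <= 2 e norm v - (norm v)^2 <= e^2.\<close>
 have "\<pi> g h ~= 0"
 proof
  assume z: "\<pi> g h = 0"
  define v where "v = \<pi> m h"
  have vH: "v : H" unfolding v_def by (rule rep_in[OF r h(1)])
  have hv: "cinner h (\<pi> m v) = cinner v v" using rep_star(2)[OF r h(1) vH, of m] by (simp add: v_def g(3))
  have "cinner h (\<pi> x h) = cor (2 * e) * cinner h v - cinner v v"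
   unfolding hv[symmetric] by (subst g(6)) (simp add: rep_diff[OF r h(1)] rep_add[OF r h(1)] sr[OF r h(1)] rep_mult[OF r h(1)] z cinner_diff_right cinner_scaleC_right flip: v_def)
  hence "cor ((norm (\<pi> a h))^2) = cor (2 * e) * cinner h v - cor ((norm v)^2)"
   unfolding \<pi>x[OF r h(1)] cinner_self .
  from arg_cong[OF this, of Re] have 1: "(norm (\<pi> a h))^2 = 2 * e * Re (cinner h v) - (norm v)^2" by simp
  have "Re (cinner h v) <= norm v" using complex_Re_le_cmod[of "cinner h v"] cauchy_schwarz[of h v] h(2) by simp
  hence "2 * e * Re (cinner h v) <= 2 * e * norm v" using e0 by simp
  moreover have "2 * e * norm v - (norm v)^2 <= e^2" using zero_le_power2[of "e - norm v"] by (simp add: power2_diff algebra_simps)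
  ultimately have "(norm (\<pi> a h))^2 <= e^2" using 1 by linarith
  hence "norm (\<pi> a h) <= e" by (rule power2_le_imp_le) (use e0 in simp)
  thus False using e(2) by simp
 qed
 then obtain M \<rho> k where p: "irreducible_rep (M, \<rho> :: 'a action)" "!!a k. iA a : J ==> k : M ==> \<rho> a k = 0" "k : M" "\<rho> g k ~= 0"
  "!!n. 0 < n ==> n <= N ==> cls M \<rho> : iterate_domain ((spectrum - hat (iA -` J)) \<inter> D) dual n ==> (dual ^^ n) (cls M \<rho>) ~= cls M \<rho>"
  using free_point[OF free J irr kill h(1), of g N] by metis
 note r\<rho> = irrepD(1)[OF p(1)]
 note MD = hsubD[OF rep_hilbert[OF r\<rho>]]
 \<comment> \<open>x g = e^2 g + g g with g = kk kk positive, so at vectors in the range of g the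
   expectation of x is at least e^2 times the norm square.\<close>
 define w0 where "w0 = \<rho> g k"
 have w0: "w0 : M" "w0 ~= 0" using rep_in[OF r\<rho> p(3)] p(4) by (simp_all add: w0_def)
 have "cinner w0 (\<rho> x w0) = cor (e^2) * cinner w0 w0 + cinner w0 (\<rho> g w0)"
 proof -
  have "\<rho> x w0 = cor (e^2) *C w0 + \<rho> g w0"
   unfolding w0_def rep_mult[OF r\<rho> p(3), symmetric] g(5) by (simp add: rep_add[OF r\<rho> p(3)] sr[OF r\<rho> p(3)] rep_mult[OF r\<rho> p(3)])
  thus ?thesis by (simp add: cinner_add_right cinner_scaleC_right)
 qed
 moreover have "cinner w0 (\<rho> g w0) = cor ((norm (\<rho> kk w0))^2)"
  unfolding cinner_self[symmetric] rep_star(2)[OF r\<rho> w0(1) rep_in[OF r\<rho> w0(1)]] by (simp add: g(2) g(4)[symmetric] rep_mult[OF r\<rho> w0(1)])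
 ultimately have "cor ((norm (\<rho> a w0))^2) = cor (e^2 * (norm w0)^2 + (norm (\<rho> kk w0))^2)"
  unfolding \<pi>x[OF r\<rho> w0(1)] cinner_self by simp
 hence "(norm (\<rho> a w0))^2 = e^2 * (norm w0)^2 + (norm (\<rho> kk w0))^2" unfolding of_real_eq_iff .
 hence "(e * norm w0)^2 <= (norm (\<rho> a w0))^2" by (simp add: power_mult_distrib)
 hence ew0: "e * norm w0 <= norm (\<rho> a w0)" by (rule power2_le_imp_le) simp
 define w1 where "w1 = cor (1 / norm w0) *C w0"
 have w1: "w1 : M" "norm w1 = 1" using w0 MD(6) by (simp_all add: w1_def norm_scaleC_h norm_divide)
 have ew1: "e <= norm (\<rho> a w1)" using ew0 w0(2) by (simp add: w1_def rep_vscale[OF r\<rho> w0(1)] norm_scaleC_h norm_divide field_simps)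
 obtain K :: "'b unitz ell2 set" and \<Phi> \<eta> where \<Phi>: "representation K \<Phi>" "\<eta> : K" "!!j k. j : J ==> k : K ==> \<Phi> j k = 0"
  "!!b. cinner \<eta> (\<Phi> (iA b) \<eta>) = cinner w1 (\<rho> b w1)"
  using state_extension[OF hom J r\<rho> p(2) w1] by metis
 define \<sigma> where "\<sigma> b = \<Phi> (iA b)" for b
 have r\<sigma>: "representation K \<sigma>" unfolding \<sigma>_def by (rule rep_restrict[OF \<Phi>(1) hom])
 have "w1 ~= 0" using w1(2) by auto
 have cyc: "closure (range (%b. \<rho> b w1)) = M"
  by (rule irreducible_cyclic[OF p(1) _ _ _ _ p(3,4) w1(1) `w1 ~= 0`, of UNIV]) (auto simp: complex_vector.subspace_UNIV)
 have cM: "closure (cspan (range (%b. \<rho> b w1))) = M"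
  using cyc csubspace_orbit[OF r\<rho> w1(1), of UNIV] by (simp add: complex_vector.subspace_UNIV complex_vector.span_eq_iff[THEN iffD2])
 \<comment> \<open>The cyclic subspace of eta under A. Its Gram matrix is that of the orbit of w1,
   so it is a copy of rho inside the extension.\<close>
 define L0 where "L0 = closure (cspan (range (%b. \<sigma> b \<eta>)))"
 have gram: "cinner (\<sigma> b \<eta>) (\<sigma> c \<eta>) = cinner (\<rho> b w1) (\<rho> c w1)" for b c
  using \<Phi>(4)[of "star b * c"]
  by (simp add: \<sigma>_def rep_star(2)[OF \<Phi>(1,2)] rep_star(2)[OF r\<rho> w1(1)] rep_in[OF \<Phi>(1,2)] rep_in[OF r\<rho> w1(1)] star_homD[OF hom]
    rep_mult[OF \<Phi>(1,2)] rep_mult[OF r\<rho> w1(1)])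
 obtain U where U: "clin_on M U" "U ` M = L0" "!!x y. x : M ==> y : M ==> cinner (U x) (U y) = cinner x y" "!!b. U (\<rho> b w1) = \<sigma> b \<eta>"
  using gram_isometry[of UNIV "%b. \<sigma> b \<eta>" "%b. \<rho> b w1", unfolded cM L0_def[symmetric]] gram by auto
 have L0K: "L0 <= K" unfolding L0_def by (rule cspan_closure_subset[OF rep_hilbert[OF r\<sigma>]]) (use rep_in[OF r\<sigma> \<Phi>(2)] in auto)
 have nU: "norm (U y) = norm y" if "y : M" for y by (rule isometry_norm[OF _ that]) (rule U(3))
 have int: "U (\<rho> b y) = \<sigma> b (U y)" if y: "y : M" for b y
 proof (rule isometry_intertwines[OF r\<rho> r\<sigma> U(1) _ U(3) cM[symmetric] _ y])
  show "U ` M <= K" using U(2) L0K by simp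
  fix y assume "y : range (%b. \<rho> b w1)"
  then obtain c where c: "y = \<rho> c w1" by blast
  have "U (\<rho> b (\<rho> c w1)) = U (\<rho> (b * c) w1)" by (simp add: rep_mult[OF r\<rho> w1(1)])
  thus "U (\<rho> b y) = \<sigma> b (U y)" unfolding c U(4) by (simp add: rep_mult[OF r\<sigma> \<Phi>(2)])
 qed
 have iso: "rep_iso M \<rho> L0 \<sigma> U" using U int by (simp add: rep_iso_def)
 have hL0: "hilbert_subspace L0" unfolding L0_def by (rule hsub_closure[OF complex_vector.subspace_span])
 have "\<sigma> b y : L0" if "y : L0" for b y
 proof -
  obtain z where z: "z : M" "y = U z" using `y : L0` U(2) by blast
  show ?thesis unfolding z(2) int[OF z(1), symmetric] U(2)[symmetric] by (rule imageI[OF rep_in[OF r\<rho> z(1)]])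
 qed
 from irreducible_iso[OF p(1) subrep[OF r\<sigma> hL0 L0K this] iso] have irr0: "irrep L0 \<sigma>" .
 have cl: "cls L0 \<sigma> = cls M \<rho>" using cls_eq[OF p(1) irr0] iso by blast
 define v where "v = U w1"
 define u where "u = \<sigma> a v"
 have v: "v : L0" "norm v = 1" using w1 U(2) nU by (auto simp: v_def)
 have u: "u : L0" unfolding u_def by (rule rep_in[OF irrepD(1)[OF irr0] v(1)])
 have vK: "v : K" and uK: "u : K" using v(1) u L0K by auto
 have nu: "e <= norm u" unfolding u_def v_def int[OF w1(1), symmetric] nU[OF rep_in[OF r\<rho> w1(1)]] by (rule ew1)
 have cz: "cinner u (\<Phi> (w n) v) = 0" if "n ~= 0" "\<bar>n\<bar> <= int N" for n
  by (rule compress_degree_zero[OF J \<Phi>(1,3) irr0[unfolded \<sigma>_def[abs_def]] L0K _ w(1) that u v(1)])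
   (use p(5) cl in "simp_all add: \<sigma>_def[abs_def]")
 have sum: "cinner u (\<Phi> (\<Sum>k\<in>F. w k) v) = (\<Sum>k\<in>F. cinner u (\<Phi> (w k) v))" if "finite F" for F
  using that by (induction F rule: finite_induct) (simp_all add: rep_zero[OF \<Phi>(1) vK] rep_add[OF \<Phi>(1) vK] cinner_add_right)
 have "(\<Sum>k\<in>{- int N..int N}. cinner u (\<Phi> (w k) v)) = (\<Sum>k\<in>{- int N..int N}. if k = 0 then cinner u u else 0)"
  by (rule sum.cong) (use cz in "auto simp: w(2) u_def \<sigma>_def")
 \<comment> \<open>j acts as 0, components of nonzero degree move v into the orthogonal complement
   of u, and a moves v to u.\<close>
 hence E: "cinner u (\<Phi> (?c - j) v) = cinner u u"
  by (simp add: sum rep_diff[OF \<Phi>(1) vK] \<Phi>(3)[OF j vK] del: sum.cong)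
 have "(norm u)^2 <= norm u * norm (\<Phi> (?c - j) v)"
  using cauchy_schwarz[of u "\<Phi> (?c - j) v"] unfolding E cinner_self by (simp add: norm_power)
 also have "... <= norm u * norm (?c - j)" using mult_left_mono[OF rep_norm[OF \<Phi>(1) vK, of "?c - j"], of "norm u"] v(2) by simp
 finally have m: "norm u * norm u <= norm u * norm (?c - j)" unfolding power2_eq_square .
 have "0 < norm u" using nu e0 by linarith
 hence "norm u <= norm (?c - j)" by (rule mult_left_le_imp_le[OF m])
 thus False using nu e(1) by simp
qed

end

subsection \<open>Comparison of ideals\<close>

text \<open>(c* c)^(2^n) by repeated squaring: all factors are self-adjoint, so the norms are exact
  powers of norm c.\<close>

primrec sq :: "nat => 'b::cstar_algebra => 'b" where
 "sq 0 c = star c * c" | "sq (Suc n) c = sq n c * sq n c"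

lemma sq_selfadj: "star (sq n c) = sq n c"
 by (induction n) (simp_all add: star_mult star_star)

lemma norm_sq: "norm (sq n c) = norm c ^ (2 ^ Suc n)"
proof (induction n)
 case (Suc n)
 have "norm (sq (Suc n) c) = (norm (sq n c))^2" by (simp add: selfadj_square_norm[OF sq_selfadj])
 thus ?case by (simp add: Suc power_mult[symmetric] mult.commute)
qed (simp add: cstar_identity)

text \<open>c and c - j are congruent modulo J, hence so are their powers. The difference is the
  element of J to be subtracted from \<open>sq n c\<close>.\<close>

lemma sq_ideal:
 assumes J: "cstar_ideal J" and j: "j : J" shows "sq n c - sq n (c - j) : J"
proof (induction n)
 case 0
 have "sq 0 c - sq 0 (c - j) = star (c - j) * j + star j * c" by (simp add: algebra_simps star_diff)
 thus ?case using csub(2)[OF cidealD(1)[OF J]] cidealD(3,4)[OF J] j ideal_star[OF J j] by simp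
next
 case (Suc n)
 have "sq (Suc n) c - sq (Suc n) (c - j) = sq n c * (sq n c - sq n (c - j)) + (sq n c - sq n (c - j)) * sq n (c - j)"
  by (simp add: algebra_simps)
 thus ?case using csub(2)[OF cidealD(1)[OF J]] cidealD(3,4)[OF J] Suc by simp
qed

lemma rep_sq:
 assumes r: "representation K \<Psi>" and h: "h : K" "norm h = 1" shows "norm (\<Psi> c h) ^ (2 ^ Suc n) <= norm (\<Psi> (sq n c) h)"
proof (induction n)
 have s: "(norm (\<Psi> d h))^2 <= norm (\<Psi> (star d * d) h)" for d
 proof -
  have "cinner (\<Psi> d h) (\<Psi> d h) = cinner h (\<Psi> (star d * d) h)"
   by (simp add: rep_star(2)[OF r h(1) rep_in[OF r h(1)]] rep_mult[OF r h(1)])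
  hence "(norm (\<Psi> d h))^2 = cmod (cinner h (\<Psi> (star d * d) h))" unfolding cinner_self by (metis norm_of_real abs_power2)
  thus ?thesis using cauchy_schwarz[of h "\<Psi> (star d * d) h"] h(2) by simp
 qed
 case 0
 show ?case using s[of c] by simp
 case (Suc n)
 have "norm (\<Psi> c h) ^ (2 ^ Suc (Suc n)) = (norm (\<Psi> c h) ^ (2 ^ Suc n))^2" by (simp add: power_mult[symmetric] mult.commute)
 also have "... <= (norm (\<Psi> (sq n c) h))^2" by (rule power_mono[OF Suc]) simp
 also have "... <= norm (\<Psi> (sq (Suc n) c) h)" using s[of "sq n c"] by (simp add: sq_selfadj)
 finally show ?case .
qed

text \<open>If u > v, the ratio (u/v)^p outgrows every quadratic polynomial in p.\<close>

lemma power_growth: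
 fixes u v :: real
 assumes u: "0 <= u" and v: "0 <= v" and le: "!!n. u ^ (2 ^ Suc n) <= (2 * real N * 2 ^ Suc n + 1)^2 * v ^ (2 ^ Suc n)"
 shows "u <= v"
proof (rule ccontr)
 assume "\<not> ?thesis"
 hence uv: "v < u" by simp
 show False
 proof (cases "v = 0")
  case True
  hence "u * u <= 0" "0 < u" using le[of 0] uv by (simp_all add: power2_eq_square)
  thus False using mult_pos_pos[of u u] by linarith
 next
  case False
  define r where "r = u / v"
  have r: "1 < r" using uv False v by (simp add: r_def)
  have "(%p::nat. (real p)^2 / r ^ p) ----> 0" using r by real_asymp
  from tendsto_mult_right_zero[OF this, of "(2 * real N + 1)^2"]
  have "\<forall>\<^sub>F p in sequentially. (2 * real N + 1)^2 * ((real p)^2 / r ^ p) < 1" by (rule order_tendstoD) simp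
  then obtain P where P: "!!p. P <= p ==> (2 * real N + 1)^2 * ((real p)^2 / r ^ p) < 1" unfolding eventually_sequentially by blast
  have "P <= 2 ^ Suc P" using less_exp[of "Suc P"] by simp
  from P[OF this] have "((2 * real N + 1) * 2 ^ Suc P)^2 < r ^ (2 ^ Suc P)" using r by (simp add: power_mult_distrib divide_less_eq)
  moreover have "(2 * real N * 2 ^ Suc P + 1)^2 <= ((2 * real N + 1) * 2 ^ Suc P)^2"
   using one_le_power[of "2::real" "Suc P"] by (intro power_mono) (simp_all add: distrib_right)
  ultimately have "(2 * real N * 2 ^ Suc P + 1)^2 < r ^ (2 ^ Suc P)" by linarith
  hence "(2 * real N * 2 ^ Suc P + 1)^2 * v ^ (2 ^ Suc P) < u ^ (2 ^ Suc P)"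
   using v False by (simp add: r_def power_divide less_divide_eq)
  thus False using le[of P] by simp
 qed
qed

context crossed
begin

lemma degree_zero_rep_bound:
 assumes free: "free_map spectrum_topology D dual" and J: "cstar_ideal J"
  and w: "!!k. w k : G k" "w 0 = iA a" and j: "j : J" and r: "representation K \<rho>"
  and kill: "!!b k. iA b : J ==> k : K ==> \<rho> b k = 0" and h: "h : K"
 shows "norm (\<rho> a h) <= norm ((\<Sum>k\<in>{- int N..int N}. w k) - j) * norm h"
proof (rule rep_bound[OF preimage_ideal[OF J] r _ norm_ge_zero _ h])
 show "\<rho> b k = 0" if "b : iA -` J" "k : K" for b k using that kill by simp
 fix M and \<pi> :: "'a action" and k
 assume "irrep M \<pi>" "ALL b:iA -` J. ALL k:M. \<pi> b k = 0" "k : M" "norm k = 1"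
 thus "norm (\<pi> a k) <= norm ((\<Sum>k\<in>{- int N..int N}. w k) - j)" by (rule degree_zero_bound[OF free J w j])
qed

text \<open>The component of degree zero of w_k* c is w_k* w_k, so the bound for degree zero
  controls every single component.\<close>

lemma component_bound:
 assumes free: "free_map spectrum_topology D dual" and J: "cstar_ideal J"
  and w: "!!k. w k : G k" and j: "j : J" and r: "representation K \<Psi>"
  and kill: "!!b k. iA b : J ==> k : K ==> \<Psi> (iA b) k = 0" and h: "h : K" "norm h = 1" and k: "\<bar>k\<bar> <= int N"
 shows "(norm (\<Psi> (w k) h))^2 <= norm (w k) * norm ((\<Sum>k\<in>{- int N..int N}. w k) - j)"
proof -
 let ?c = "\<Sum>k\<in>{- int N..int N}. w k"
 define v where "v l = (if \<bar>l\<bar> <= int N then w l else 0)" for l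
 \<comment> \<open>Degrees are shifted by - k. As |k| <= N, the range up to 2 N contains all nonzero
   u m; v cuts w off outside the given range.\<close>
 define u where "u m = star (w k) * v (m + k)" for m
 have vG: "v l : G l" for l using w csub(1)[OF G_subspace] by (simp add: v_def)
 have uG: "u m : G m" for m using G_mult[OF G_star[OF w[of k]] vG[of "m + k"]] by (simp add: u_def)
 obtain a where a: "u 0 = iA a" using G_0[OF uG[of 0]] by blast
 have u0: "u 0 = star (w k) * w k" using k by (simp add: u_def v_def)
 have "(\<Sum>m\<in>{- int (2 * N)..int (2 * N)}. u m) = (\<Sum>l\<in>(%m. m + k) ` {- int (2 * N)..int (2 * N)}. star (w k) * v l)"
  by (subst sum.reindex) (simp_all add: u_def)
 also have "... = (\<Sum>l\<in>{- int N..int N}. star (w k) * v l)"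
 proof (rule sum.mono_neutral_right)
  show "{- int N..int N} <= (%m. m + k) ` {- int (2 * N)..int (2 * N)}"
  proof
   fix l assume "l : {- int N..int N}"
   thus "l : (%m. m + k) ` {- int (2 * N)..int (2 * N)}" using k by (intro image_eqI[of _ _ "l - k"]) auto
  qed
 qed (auto simp: v_def)
 also have "... = star (w k) * ?c" by (auto simp: sum_distrib_left v_def intro!: sum.cong)
 finally have S: "(\<Sum>m\<in>{- int (2 * N)..int (2 * N)}. u m) = star (w k) * ?c" .
 have "cinner (\<Psi> (w k) h) (\<Psi> (w k) h) = cinner h (\<Psi> (iA a) h)"
  unfolding a[symmetric] u0 by (simp add: rep_star(2)[OF r h(1) rep_in[OF r h(1)]] rep_mult[OF r h(1)])
 hence "(norm (\<Psi> (w k) h))^2 = cmod (cinner h (\<Psi> (iA a) h))" unfolding cinner_self by (metis norm_of_real abs_power2)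
 also have "... <= norm (\<Psi> (iA a) h)" using cauchy_schwarz[of h "\<Psi> (iA a) h"] h(2) by simp
 also have "... <= norm (star (w k) * ?c - star (w k) * j) * norm h"
  unfolding S[symmetric]
  by (rule degree_zero_rep_bound[OF free J uG a cidealD(3)[OF J j] rep_restrict[OF r hom] kill h(1)])
 also have "... <= norm (w k) * norm (?c - j)"
  using norm_mult_ineq[of "star (w k)" "?c - j"] h(2) by (simp add: right_diff_distrib norm_star)
 finally show ?thesis .
qed

text \<open>The zero ideal and a norming irreducible representation of the crossed product: freeness
  alone makes the passage to a component contractive.\<close>

lemma component_norm:
 assumes free: "free_map spectrum_topology D dual" and w: "!!k. w k : G k" and k: "\<bar>k\<bar> <= int N"
 shows "norm (w k) <= norm (\<Sum>k\<in>{- int N..int N}. w k)"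
proof (cases "w k = 0")
 case False
 obtain K :: "'b ell2 set" and \<Psi> h where K: "irrep K \<Psi>" "h : K" "norm h = 1" "norm (w k) <= norm (\<Psi> (w k) h)"
  by (rule irreducible_norming[OF False])
 note r = irrepD(1)[OF K(1)]
 have "(norm (w k))^2 <= (norm (\<Psi> (w k) h))^2" by (rule power_mono[OF K(4)]) simp
 also have "... <= norm (w k) * norm ((\<Sum>k\<in>{- int N..int N}. w k) - 0)"
  by (rule component_bound[OF free cstar_ideal_zero w _ r _ K(2,3) k]) (simp_all add: rep_zero[OF r])
 finally have m: "norm (w k) * norm (w k) <= norm (w k) * norm (\<Sum>k\<in>{- int N..int N}. w k)" by (simp add: power2_eq_square)
 have "0 < norm (w k)" using False by simp
 thus ?thesis by (rule mult_left_le_imp_le[OF m])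
qed simp

lemma gr_sq:
 assumes z: "cmod z = 1" and g: "gr z N c c'" shows "gr z (N * 2 ^ Suc n) (sq n c) (sq n c')"
proof (induction n)
 have z0: "z ~= 0" using z by auto
 case 0
 show ?case using gr_mult[OF z0 gr_star[OF z g] g] by (simp add: mult_2_right)
 case (Suc n)
 show ?case using gr_mult[OF z0 Suc Suc] by (simp add: mult_2 distrib_left mult.commute)
qed

lemma card_interval: "card {- int M..int M} = 2 * M + 1" by simp

text \<open>Let p = 2^(n + 1). Each of the 2 N p + 1 components of \<open>sq n c\<close> acts on h
  with norm at most the square root of (norm c * norm (c - j))^p. Adding them costs a polynomial
  factor, which \<open>power_growth\<close> removes.\<close>

lemma rep_graded_bound:
 assumes free: "free_map spectrum_topology D dual" and J: "cstar_ideal J" and g: "gr 1 N c c'" and j: "j : J" and r: "representation K \<Psi>"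
  and kill: "!!b k. iA b : J ==> k : K ==> \<Psi> (iA b) k = 0" and h: "h : K" "norm h = 1"
 shows "(norm (\<Psi> c h))^2 <= norm c * norm (c - j)"
proof (rule power_growth[where N = N])
 fix n
 let ?p = "2 ^ Suc n :: nat" and ?y = "norm c * norm (c - j)"
 define M where "M = N * ?p"
 define S where "S = sq n c"
 have "gr 1 M S (sq n c')" unfolding S_def M_def by (rule gr_sq[OF _ g]) simp
 from gr_sum[OF this] obtain w where w: "!!k. w k : G k" "S = (\<Sum>k\<in>{- int M..int M}. w k)" by blast
 have jJ: "S - sq n (c - j) : J" unfolding S_def by (rule sq_ideal[OF J j])
 have "norm (\<Psi> (w k) h) <= sqrt (?y ^ ?p)" if k: "\<bar>k\<bar> <= int M" for k
 proof (rule real_le_rsqrt)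
  have "(norm (\<Psi> (w k) h))^2 <= norm (w k) * norm (S - (S - sq n (c - j)))"
   by (rule component_bound[OF free J w(1) jJ r kill h k, folded w(2)])
  also have "... <= norm S * norm (sq n (c - j))"
   using component_norm[OF free w(1) k, folded w(2)] by (simp add: mult_right_mono)
  finally show "(norm (\<Psi> (w k) h))^2 <= ?y ^ ?p" unfolding S_def norm_sq power_mult_distrib .
 qed
 hence "(\<Sum>k\<in>{- int M..int M}. norm (\<Psi> (w k) h)) <= of_nat (card {- int M..int M}) * sqrt (?y ^ ?p)"
  by (intro sum_bounded_above) auto
 moreover
 have "norm (\<Psi> (\<Sum>k\<in>F. w k) h) <= (\<Sum>k\<in>F. norm (\<Psi> (w k) h))" if "finite F" for F
  using that by (induction F rule: finite_induct) (simp_all add: rep_zero[OF r h(1)] rep_add[OF r h(1)] norm_triangle_le)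
 from this[of "{- int M..int M}"] have "norm (\<Psi> S h) <= (\<Sum>k\<in>{- int M..int M}. norm (\<Psi> (w k) h))" by (simp add: w(2))
 ultimately have "norm (\<Psi> S h) <= (2 * real M + 1) * sqrt (?y ^ ?p)" unfolding card_interval by (simp add: add.commute)
 hence "norm (\<Psi> c h) ^ ?p <= (2 * real M + 1) * sqrt (?y ^ ?p)" using rep_sq[OF r h, of c n] unfolding S_def by linarith
 hence "(norm (\<Psi> c h) ^ ?p)^2 <= ((2 * real M + 1) * sqrt (?y ^ ?p))^2" by (rule power_mono) simp
 hence "(norm (\<Psi> c h) ^ ?p)^2 <= (2 * real M + 1)^2 * ?y ^ ?p" unfolding power_mult_distrib[of "2 * real M + 1"] by simp
 moreover have "(norm (\<Psi> c h) ^ ?p)^2 = ((norm (\<Psi> c h))^2) ^ ?p" unfolding power_mult[symmetric] by (simp only: mult.commute)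
 ultimately show "((norm (\<Psi> c h))^2) ^ ?p <= (2 * real N * 2 ^ Suc n + 1)^2 * ?y ^ ?p" unfolding M_def of_nat_mult of_nat_power of_nat_numeral by (simp only: mult.assoc)
qed simp_all

text \<open>Approximate b in J by graded elements c and take j = b. In an irreducible representation
  killing \<open>J'\<close>, hence the preimage of J, the bound norm c * norm (c - b) tends to 0 and
  makes b act as 0.\<close>

lemma ideal_le:
 assumes free: "free_map spectrum_topology D dual" and J: "cstar_ideal J" "cstar_ideal J'" and sub: "iA -` J <= iA -` J'"
 shows "J <= J'"
proof (rule subsetI, rule ccontr)
 fix b assume b: "b : J" "b ~: J'"
 obtain K :: "'b ell2 set" and \<Psi> h0 where K: "irrep K \<Psi>" "ALL j:J'. ALL k:K. \<Psi> j k = 0" "h0 : K" "\<Psi> b h0 ~= 0"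
  by (rule irreducible_separation[OF J(2) b(2)])
 note r = irrepD(1)[OF K(1)]
 have h0: "h0 ~= 0" using K(4) rep_vzero[OF r] by auto
 define h where "h = cor (1 / norm h0) *C h0"
 have h: "h : K" "norm h = 1" "\<Psi> b h ~= 0"
  using h0 K(3,4) hsubD(6)[OF rep_hilbert[OF r]] by (simp_all add: h_def norm_scaleC_h norm_divide rep_vscale[OF r])
 obtain s s' where s: "!!n. EX N. gr 1 N (s n) (s' n)" "s ----> b" by (rule graded_dense[of 1 b]) (simp, blast)
 have "(norm (\<Psi> (s n) h))^2 <= norm (s n) * norm (s n - b)" for n
 proof -
  obtain N where "gr 1 N (s n) (s' n)" using s(1) by blast
  thus ?thesis by (rule rep_graded_bound[OF free J(1) _ b(1) r _ h(1,2)]) (use K(2) sub in auto)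
 qed
 moreover have "(%n. (norm (\<Psi> (s n) h))^2) ----> (norm (\<Psi> b h))^2" by (intro tendsto_power tendsto_norm rep_tendsto_alg[OF r h(1) s(2)])
 moreover have "(%n. norm (s n) * norm (s n - b)) ----> norm b * 0"
  using s(2) by (intro tendsto_mult tendsto_norm tendsto_norm_zero LIM_zero)
 ultimately have "(norm (\<Psi> b h))^2 <= norm b * 0" by (meson LIMSEQ_le)
 thus False using h(3) by simp
qed

subsection \<open>The gauge action\<close>

text \<open>Multiplying components by z^k keeps their norms, and each is bounded by the whole
  element. The number of components is again removed by taking powers.\<close>

lemma gr_contractive:
 assumes free: "free_map spectrum_topology D dual" and z: "cmod z = 1" and g: "gr z N c c'"
 shows "norm c' <= norm c"
proof (rule power_growth[where N = N])
 fix n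
 let ?p = "2 ^ Suc n :: nat"
 define M where "M = N * ?p"
 obtain w where w: "!!k. w k : G k" "sq n c = (\<Sum>k\<in>{- int M..int M}. w k)" "sq n c' = (\<Sum>k\<in>{- int M..int M}. z powi k *C w k)"
  using gr_sum[OF gr_sq[OF z g]] unfolding M_def by blast
 have "norm (sq n c') <= of_nat (card {- int M..int M}) * norm (sq n c)"
  unfolding w(3)
 proof (rule order_trans[OF norm_sum sum_bounded_above])
  fix k assume "k : {- int M..int M}"
  hence "\<bar>k\<bar> <= int M" by auto
  from component_norm[OF free w(1) this] show "norm (z powi k *C w k) <= norm (sq n c)" by (simp add: norm_scaleC norm_power_int z w(2))
 qed
 hence 1: "norm c' ^ ?p <= (2 * real M + 1) * norm c ^ ?p" unfolding norm_sq card_interval by (simp add: add.commute)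
 have "(2 * real M + 1) * 1 <= (2 * real M + 1) * (2 * real M + 1)" by (rule mult_left_mono) simp_all
 hence "(2 * real M + 1) * norm c ^ ?p <= (2 * real M + 1)^2 * norm c ^ ?p" by (intro mult_right_mono) (simp_all add: power2_eq_square)
 with 1 have "norm c' ^ ?p <= (2 * real M + 1)^2 * norm c ^ ?p" by linarith
 thus "norm c' ^ ?p <= (2 * real N * 2 ^ Suc n + 1)^2 * norm c ^ ?p" unfolding M_def of_nat_mult of_nat_power of_nat_numeral by (simp only: mult.assoc)
qed simp_all

text \<open>The closure of the graph of \<open>gr\<close>. Contractivity and density make it the
  graph of an everywhere defined map, the gauge automorphism.\<close>

definition gl :: "complex => 'b => 'b => bool"
 where "gl z b b' <-> (EX s s'. (ALL n. EX N. gr z N (s n) (s' n)) & s ----> b & s' ----> b')"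

lemma gl_gr: "gr z N b b' ==> gl z b b'"
 unfolding gl_def by (intro exI[of _ "%_. b"] exI[of _ "%_. b'"]) auto

lemma gr_add: "EX N. gr z N b b' ==> EX N. gr z N c c' ==> EX N. gr z N (b + c) (b' + c')"
 by (meson gr.add gr_mono max.cobounded1 max.cobounded2)

lemma gl_ops:
 assumes z: "cmod z = 1" and b: "gl z b b'"
 shows "gl z c c' ==> gl z (b + c) (b' + c')" "gl z c c' ==> gl z (b * c) (b' * c')" "gl z (t *C b) (t *C b')" "gl z (star b) (star b')" "gl (inverse z) b' b"
proof -
 have z0: "z ~= 0" using z by auto
 obtain s s' where s: "ALL n. EX N. gr z N (s n) (s' n)" "s ----> b" "s' ----> b'" using b unfolding gl_def by blast
 show "gl z (b + c) (b' + c')" "gl z (b * c) (b' * c')" if c: "gl z c c'"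
 proof -
  obtain t t' where t: "ALL n. EX N. gr z N (t n) (t' n)" "t ----> c" "t' ----> c'" using c unfolding gl_def by blast
  show "gl z (b + c) (b' + c')" unfolding gl_def
   by (intro exI[of _ "%n. s n + t n"] exI[of _ "%n. s' n + t' n"] conjI allI gr_add tendsto_add s t) (use s(1) t(1) in auto)
  show "gl z (b * c) (b' * c')" unfolding gl_def
   by (intro exI[of _ "%n. s n * t n"] exI[of _ "%n. s' n * t' n"] conjI allI tendsto_mult s t) (use s(1) t(1) gr_mult[OF z0] in meson)
 qed
 show "gl z (t *C b) (t *C b')" unfolding gl_def
  by (intro exI[of _ "%n. t *C s n"] exI[of _ "%n. t *C s' n"] conjI allI tendsto_scaleC_alg s) (use s(1) gr_scale in meson)
 show "gl z (star b) (star b')" unfolding gl_def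
  by (intro exI[of _ "%n. star (s n)"] exI[of _ "%n. star (s' n)"] conjI allI tendsto_star s) (use s(1) gr_star[OF z] in meson)
 have inv: "gr (inverse z) N c' c" if "gr z N c c'" for N c c'
  using that
 proof (induction rule: gr.induct)
  case (base c k N)
  have "gr (inverse z) N (z powi k *C c) (inverse z powi k *C z powi k *C c)"
   using base by (intro gr.base csub(4)[OF G_subspace])
  thus ?case using z0 by (simp add: power_int_inverse)
 qed (rule gr.add)
 show "gl (inverse z) b' b" unfolding gl_def
  by (intro exI[of _ s'] exI[of _ s] conjI allI s) (use s(1) inv in meson)
qed

lemma gl_contractive:
 assumes free: "free_map spectrum_topology D dual" and z: "cmod z = 1" and b: "gl z b b'" shows "norm b' <= norm b"
proof -
 obtain s s' where s: "ALL n. EX N. gr z N (s n) (s' n)" "s ----> b" "s' ----> b'" using b unfolding gl_def by blast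
 have "norm (s' n) <= norm (s n)" for n using s(1) gr_contractive[OF free z] by blast
 thus ?thesis by (intro LIMSEQ_le[OF tendsto_norm[OF s(3)] tendsto_norm[OF s(2)]]) blast
qed

lemma gl_total:
 assumes free: "free_map spectrum_topology D dual" and z: "cmod z = 1" shows "EX! b'. gl z b b'"
proof (rule ex_ex1I)
 have d: "EX N. gr z N (x - y) (x' - y')" if "EX N. gr z N x x'" "EX N. gr z N y y'" for x x' y y'
 proof -
  have "EX N. gr z N ((-1) *C y) ((-1) *C y')" using that(2) gr_scale by blast
  from gr_add[OF that(1) this] show ?thesis by simp
 qed
 obtain s s' where s: "!!n. EX N. gr z N (s n) (s' n)" "s ----> b" by (rule graded_dense[OF z, of b]) blast
 have "Cauchy s'"
 proof (rule metric_CauchyI)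
  fix e :: real assume "0 < e"
  then obtain M where "ALL m>=M. ALL n>=M. dist (s m) (s n) < e" using metric_CauchyD[OF LIMSEQ_imp_Cauchy[OF s(2)]] by blast
  moreover have "dist (s' m) (s' n) <= dist (s m) (s n)" for m n
   using d[OF s(1) s(1), of m n] gr_contractive[OF free z] by (auto simp: dist_norm)
  ultimately show "EX M. ALL m>=M. ALL n>=M. dist (s' m) (s' n) < e" by (meson le_less_trans)
 qed
 then obtain b' where "s' ----> b'" using Cauchy_convergent convergent_def by blast
 thus "EX b'. gl z b b'" unfolding gl_def using s by blast
 fix x y assume "gl z b x" "gl z b y"
 hence "gl z (b + (-1) *C b) (x + (-1) *C y)" using gl_ops(1,3)[OF z] by blast
 from gl_contractive[OF free z this] show "x = y" by simp
qed

text \<open>\<open>gauge_action\<close> is a definite description. Freeness supplies existence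
  through \<open>gl\<close>, and agreement on generators gives uniqueness.\<close>

lemma gauge_automorphism:
 assumes free: "free_map spectrum_topology D dual" and z: "cmod z = 1"
 obtains \<gamma> where "gauge_action iA iX z = \<gamma>" "star_hom \<gamma>" "bij \<gamma>" "!!a. \<gamma> (iA a) = iA a"
proof -
 define \<gamma> where "\<gamma> b = (THE b'. gl z b b')" for b
 have gl: "gl z b (\<gamma> b)" for b unfolding \<gamma>_def by (rule theI'[OF gl_total[OF free z]])
 have eq: "\<gamma> b = b'" if "gl z b b'" for b b' unfolding \<gamma>_def by (rule the1_equality[OF gl_total[OF free z] that])
 have \<gamma>: "star_hom \<gamma>"
  unfolding star_hom_def Vector_Spaces.linear_iff
  by (intro conjI allI complex_vector.vector_space_axioms eq gl_ops[OF z gl] gl)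
 have z': "cmod (inverse z) = 1" using z by (simp add: norm_inverse)
 have bij: "bij \<gamma>"
 proof (rule bijI)
  show "inj \<gamma>"
  proof (rule injI)
   fix x y assume "\<gamma> x = \<gamma> y"
   hence "gl (inverse z) (\<gamma> x) x" "gl (inverse z) (\<gamma> x) y" using gl_ops(5)[OF z gl] by metis+
   thus "x = y" using gl_total[OF free z'] by blast
  qed
  show "surj \<gamma>"
  proof (rule surjI)
   fix b
   have "gl (inverse z) b (THE b'. gl (inverse z) b b')" by (rule theI'[OF gl_total[OF free z']])
   from gl_ops(5)[OF z' this] show "\<gamma> (THE b'. gl (inverse z) b b') = b" by (intro eq) simp
  qed
 qed
 have gA: "\<gamma> (iA a) = iA a" for a by (rule eq[OF gl_gr[OF gr_generators(1)]])
 have gX: "\<gamma> (iX x) = z *C iX x" for x by (rule eq[OF gl_gr[OF gr_generators(2)]])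
 have "gauge_action iA iX z = \<gamma>"
  unfolding gauge_action_def
 proof (rule the_equality)
  show "star_hom \<gamma> & bij \<gamma> & (ALL a. \<gamma> (iA a) = iA a) & (ALL x. \<gamma> (iX x) = z *C iX x)" using \<gamma> bij gA gX by blast
  fix \<delta> assume \<delta>: "star_hom \<delta> & bij \<delta> & (ALL a. \<delta> (iA a) = iA a) & (ALL x. \<delta> (iX x) = z *C iX x)"
  note d = conjunct1[OF \<delta>]
  have bl: "bounded_linear f" if f: "star_hom f" for f :: "'b => 'b"
   by (rule bounded_linear_intro[where K = 1]) (simp_all add: star_homD(1)[OF f] hom_more(4)[OF f] star_hom_norm[OF f])
  have "cstar_subalgebra {b. \<delta> b = \<gamma> b}"
   unfolding cstar_subalgebra_def
  proof (intro conjI csubspaceI)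
   show "closed {b. \<delta> b = \<gamma> b}"
    by (rule closed_Collect_eq) (simp_all add: linear_continuous_on bl d \<gamma>)
  qed (simp_all add: star_homD[OF d] star_homD[OF \<gamma>] hom_more(1)[OF d] hom_more(1)[OF \<gamma>])
  moreover have "range iA \<union> range iX <= {b. \<delta> b = \<gamma> b}" using \<delta> gA gX by auto
  ultimately have "cstar_generated (range iA \<union> range iX) <= {b. \<delta> b = \<gamma> b}" unfolding cstar_generated_def by (intro Inter_lower) simp
  moreover have "cstar_generated (range iA \<union> range iX) = UNIV" using cp by (simp add: is_crossed_product_def)
  ultimately show "\<delta> = \<gamma>" by auto
 qed
 thus thesis by (rule that[OF _ \<gamma> bij gA])
qed

text \<open>The automorphism fixes A, so J and its image have the same preimage in A, and
  \<open>ideal_le\<close> applies in both directions.\<close>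

lemma ideals_gauge_invariant:
 assumes free: "free_map spectrum_topology D dual" and J: "cstar_ideal J" shows "gauge_invariant iA iX J"
 unfolding gauge_invariant_def
proof (intro allI impI)
 fix z :: complex assume z: "cmod z = 1"
 obtain \<gamma> where \<gamma>: "gauge_action iA iX z = \<gamma>" "star_hom \<gamma>" "bij \<gamma>" "!!a. \<gamma> (iA a) = iA a" by (rule gauge_automorphism[OF free z]) blast
 note i = bij_is_inj[OF \<gamma>(3)] and s = star_homD[OF \<gamma>(2)]
 have inv: "inv \<gamma> b = c <-> b = \<gamma> c" for b c using \<gamma>(3) by (metis bij_inv_eq_iff)
 have g: "\<gamma> (inv \<gamma> b) = b" for b using inv by metis
 have hom': "star_hom (inv \<gamma>)"
  unfolding star_hom_def Vector_Spaces.linear_iff by (intro conjI allI complex_vector.vector_space_axioms) (simp_all add: inv s g)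
 have im: "\<gamma> ` J = inv \<gamma> -` J" by (simp add: bij_vimage_eq_inv_image bij_imp_bij_inv inv_inv_eq \<gamma>(3))
 have J': "cstar_ideal (\<gamma> ` J)" unfolding im by (rule star_hom_vimage_ideal[OF hom' J])
 have "iA -` (\<gamma> ` J) = iA -` J" unfolding im using inv \<gamma>(4) by (auto simp: vimage_def) (metis \<gamma>(4) inv)+
 thus "gauge_action iA iX z ` J = J" unfolding \<gamma>(1) using ideal_le[OF free J J'] ideal_le[OF free J' J] by blast
qed

end

subsection \<open>The lattice isomorphism\<close>

definition lub :: "'p set set => 'p set => 'p set => 'p set => bool"
 where "lub F A B S <-> S : F & A <= S & B <= S & (ALL T:F. A <= T --> B <= T --> S <= T)"

definition glb :: "'p set set => 'p set => 'p set => 'p set => bool"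
 where "glb F A B S <-> S : F & S <= A & S <= B & (ALL T:F. T <= A --> T <= B --> T <= S)"

lemma inclusion_lub:
 assumes "A : F" "B : F"
 shows "least (inclusion_order F) S (Upper (inclusion_order F) {A, B}) <-> lub F A B S"
  "greatest (inclusion_order F) S (Lower (inclusion_order F) {A, B}) <-> glb F A B S"
proof -
 let ?L = "inclusion_order F"
 have c: "carrier ?L = F" "!!A B. le ?L A B <-> A <= B" by (simp_all add: inclusion_order_def)
 have U: "u : Upper ?L {A, B} <-> u : F & A <= u & B <= u" "u : Lower ?L {A, B} <-> u : F & u <= A & u <= B" for u
  unfolding Upper_def Lower_def c using assms by blast+
 have UF: "Upper ?L {A, B} <= F" "Lower ?L {A, B} <= F" using U by blast+
 show "least ?L S (Upper ?L {A, B}) <-> lub F A B S" "greatest ?L S (Lower ?L {A, B}) <-> glb F A B S"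
  by (simp_all add: least_def greatest_def c UF Ball_def U lub_def glb_def imp_conjL)
qed

lemma inclusion_join:
 assumes "A : F" "B : F"
 shows "lub F A B S ==> join (inclusion_order F) A B = S" "glb F A B S ==> meet (inclusion_order F) A B = S"
 unfolding join_def meet_def sup_def inf_def inclusion_lub[OF assms]
 by (rule some_equality, assumption, simp add: lub_def glb_def subset_antisym)+

lemma inclusion_lattice:
 assumes "!!A B. A : F ==> B : F ==> (EX S. lub F A B S) & (EX S. glb F A B S)"
 shows "lattice (inclusion_order F)"
proof -
 interpret partial_order "inclusion_order F" by unfold_locales (auto simp: inclusion_order_def)
 show ?thesis
 proof
  fix A B assume AB: "A : carrier (inclusion_order F)" "B : carrier (inclusion_order F)"
  hence F: "A : F" "B : F" by (simp_all add: inclusion_order_def)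
  show "EX S. least (inclusion_order F) S (Upper (inclusion_order F) {A, B})"
   "EX S. greatest (inclusion_order F) S (Lower (inclusion_order F) {A, B})"
   unfolding inclusion_lub[OF F] using assms[OF F] by blast+
 qed
qed

text \<open>An order isomorphism carries bounds along, so their existence is checked for ideals only
  and inherited by the invariant open sets.\<close>

lemma inclusion_lattice_iso:
 assumes bij: "bij_betw f F F'" and mono: "!!A B. A : F ==> B : F ==> f A <= f B <-> A <= B"
  and ex: "!!A B. A : F ==> B : F ==> (EX S. lub F A B S) & (EX S. glb F A B S)"
 shows "lattice_iso (inclusion_order F) (inclusion_order F') f"
proof -
 have im: "F' = f ` F" using bij by (simp add: bij_betw_def)
 have 1: "lub F' (f A) (f B) (f S)" if "lub F A B S" "A : F" "B : F" for A B S
  using that mono unfolding lub_def im by simp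
 have 2: "glb F' (f A) (f B) (f S)" if "glb F A B S" "A : F" "B : F" for A B S
  using that mono unfolding glb_def im by simp
 have l: "lattice (inclusion_order F)" by (rule inclusion_lattice[OF ex])
 have l': "lattice (inclusion_order F')"
 proof (rule inclusion_lattice)
  fix A B assume "A : F'" "B : F'"
  then obtain A' B' where "A' : F" "B' : F" "A = f A'" "B = f B'" unfolding im by blast
  thus "(EX S. lub F' A B S) & (EX S. glb F' A B S)" using ex 1 2 by blast
 qed
 have F': "f A : F'" if "A : F" for A using that im by blast
 have j: "f (join (inclusion_order F) A B) = join (inclusion_order F') (f A) (f B)"
  "f (meet (inclusion_order F) A B) = meet (inclusion_order F') (f A) (f B)" if AB: "A : F" "B : F" for A B
 proof -
  obtain S T where S: "lub F A B S" and T: "glb F A B T" using ex[OF AB] by blast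
  show "f (join (inclusion_order F) A B) = join (inclusion_order F') (f A) (f B)"
   unfolding inclusion_join(1)[OF AB S] inclusion_join(1)[OF F'[OF AB(1)] F'[OF AB(2)] 1[OF S AB]] ..
  show "f (meet (inclusion_order F) A B) = meet (inclusion_order F') (f A) (f B)"
   unfolding inclusion_join(2)[OF AB T] inclusion_join(2)[OF F'[OF AB(1)] F'[OF AB(2)] 2[OF T AB]] ..
 qed
 have c: "carrier (inclusion_order E) = E" for E :: "'z set set" by (simp add: inclusion_order_def)
 show ?thesis unfolding lattice_iso_def join_pres_def meet_pres_def c using bij l l' j by blast
qed

text \<open>The join is taken as an intersection, which sidesteps closedness of the sum of two
  ideals.\<close>

lemma ideal_lattice:
 assumes "cstar_ideal A" "cstar_ideal B"
 shows "(EX S. lub {J. cstar_ideal J} A B S) & (EX S. glb {J. cstar_ideal J} A B S)"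
proof
 have "cstar_ideal (\<Inter>{J. cstar_ideal J & A <= J & B <= J})" by (rule cstar_ideal_Inter) simp
 thus "EX S. lub {J. cstar_ideal J} A B S" by (intro exI[of _ "\<Inter>{J. cstar_ideal J & A <= J & B <= J}"]) (auto simp: lub_def)
 have "cstar_ideal (\<Inter>{A, B})" by (rule cstar_ideal_Inter) (use assms in auto)
 thus "EX S. glb {J. cstar_ideal J} A B S" by (intro exI[of _ "A \<inter> B"]) (auto simp: glb_def)
qed

context crossed
begin

text \<open>The ideal is the common kernel of the representations whose restrictions to \<open>A\<close> kill \<open>I\<close>; the orbit
 representations show that it meets \<open>A\<close> only in \<open>I\<close>.\<close>

lemma ideal_exists:
 assumes op: "openin spectrum_topology U" and inv: "invariant_set D dual U"
 shows "EX J. cstar_ideal J & hat (iA -` J) = U"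
proof -
 define I where "I = hull_ideal U"
 have U: "U = hat I" unfolding I_def by (rule openin_hull[OF op])
 have I: "cstar_ideal I" unfolding I_def by (rule hull_ideal_ideal)
 \<comment> \<open>The space is \<open>('a + 'x) ell2\<close>, since this is where the universal
   property provides representations.\<close>
 let ?R = "{p :: ('b, ('a + 'x) ell2) rep. representation (fst p) (snd p) & (ALL a:I. ALL k:fst p. snd p (iA a) k = 0)}"
 let ?k = "%p. {b. ALL k:fst p. snd p b k = 0}"
 define J where "J = \<Inter>(?k ` ?R)"
 have J: "cstar_ideal J" unfolding J_def
 proof (rule cstar_ideal_Inter)
  fix L assume "L : ?k ` ?R"
  then obtain p where p: "p : ?R" "L = ?k p" by blast
  show "cstar_ideal L" unfolding p(2) by (rule rep_kernel_ideal) (use p(1) in simp)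
 qed
 have "a ~: iA -` J" if a: "a ~: I" for a
 proof -
  obtain H :: "'a ell2 set" and \<pi> h where irr: "irrep H \<pi>" and \<pi>: "ALL i:I. ALL k:H. \<pi> i k = 0" "h : H" "\<pi> a h ~= 0"
   by (rule irreducible_separation[OF I a])
  \<comment> \<open>Constant along nonzero links: invariance of U gives one direction, and with
    injectivity of the dual map the other.\<close>
  define P where "P H \<pi> <-> H = {0} \<or> cls H \<pi> ~: U" for H and \<pi> :: "'a action"
  have nz: "H ~= {0}" if "irrep H \<pi>" for H and \<pi> :: "'a action"
   using irrepD(2)[OF that] rep_vzero[OF irrepD(1)[OF that]] by auto
  have "EX (K :: ('a + 'x) ell2 set) \<pi>A \<pi>X. covariant_rep lact ract innerL innerR K \<pi>A \<pi>X &
   (ALL a:I. ALL h:K. \<pi>A a h = 0) & (ALL a h. h : H --> \<pi> a h ~= 0 --> (EX h:K. \<pi>A a h ~= 0))"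
  proof (rule orbit_covariant[where P = P, OF irr])
   show "P H \<pi>" unfolding P_def U cls_hat[OF irr] using \<pi>(1) by blast
   show "P {0} \<rho>" for \<rho> by (simp add: P_def)
  next
   fix H K :: "'a ell2 set" and \<pi> \<rho> T S x h
   assume l: "irrep H \<pi>" "irreducible_rep (K, \<rho> :: 'a action)" "xlink H \<pi> K \<rho> T S" "h : H" "T x h ~= 0"
   have cD: "cls H \<pi> : D" using hat_inner[OF l(3,1) irrepD(1)[OF l(2)]] l(4,5) by blast
   have d: "dual (cls H \<pi>) = cls K \<rho>" by (rule dual_map_cls[OF l(3,1,2,4,5)])
   have "cls K \<rho> : U <-> cls H \<pi> : U"
   proof
    assume "cls H \<pi> : U"
    thus "cls K \<rho> : U" using inv cD d unfolding invariant_set_def by blast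
   next
    assume "cls K \<rho> : U"
    hence "dual (cls H \<pi>) : dual ` (U \<inter> D)" using inv cD unfolding invariant_set_def d[symmetric] by blast
    then obtain c where "c : U" "c : D" "dual (cls H \<pi>) = dual c" by blast
    thus "cls H \<pi> : U" using dual_map_inj[OF cD] by blast
   qed
   thus "P H \<pi> <-> P K \<rho>" using nz[OF l(1)] nz[OF l(2)] by (simp add: P_def)
  next
   fix H and \<pi> :: "'a action" and b h assume g: "good H \<pi>" "P H \<pi>" "b : I" "h : H"
   have r: "representation H \<pi>" using g(1) by (simp add: good_def)
   show "\<pi> b h = 0"
   proof (cases "H = {0}")
    case True
    thus ?thesis using g(4) rep_vzero[OF r] by simp
   next
    case False
    hence i: "irrep H \<pi>" using g(1) by (simp add: good_def)
    show ?thesis using g(2-4) False unfolding P_def U cls_hat[OF i] by blast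
   qed
  qed
  then obtain K :: "('a + 'x) ell2 set" and \<pi>A \<pi>X where c': "covariant_rep lact ract innerL innerR K \<pi>A \<pi>X &
   (ALL a:I. ALL h:K. \<pi>A a h = 0) & (ALL a h. h : H --> \<pi> a h ~= 0 --> (EX h:K. \<pi>A a h ~= 0))" by (elim exE)
  have c: "covariant_rep lact ract innerL innerR K \<pi>A \<pi>X" "ALL a:I. ALL h:K. \<pi>A a h = 0" "EX h:K. \<pi>A a h ~= 0"
   using c' \<pi>(2,3) by simp_all
  have "EX \<Phi> :: 'b => ('a + 'x) ell2 => ('a + 'x) ell2. representation K \<Phi> &
    (ALL a. ALL h:K. \<Phi> (iA a) h = \<pi>A a h) & (ALL x. ALL h:K. \<Phi> (iX x) h = \<pi>X x h)"
   using cp c(1) by (simp add: is_crossed_product_def)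
  then obtain \<Phi> where "representation K \<Phi> & (ALL a. ALL h:K. \<Phi> (iA a) h = \<pi>A a h) & (ALL x. ALL h:K. \<Phi> (iX x) h = \<pi>X x h)" by (elim exE)
  hence \<Phi>: "representation K \<Phi>" "ALL a. ALL h:K. \<Phi> (iA a) h = \<pi>A a h" by simp_all
  hence "(K, \<Phi>) : ?R" using c(2) by simp
  moreover have "iA a ~: ?k (K, \<Phi>)" using c(3) \<Phi>(2) by simp
  ultimately show ?thesis unfolding J_def by blast
 qed
 moreover have "I <= iA -` J" unfolding J_def by auto
 ultimately have "iA -` J = I" by blast
 thus ?thesis using J U by auto
qed

end

theorem theorem2p5:
  fixes lact :: "'a::cstar_algebra \<Rightarrow> 'x::complex_vector \<Rightarrow> 'x"
    and ract :: "'x \<Rightarrow> 'a \<Rightarrow> 'x"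
    and innerL innerR :: "'x \<Rightarrow> 'x \<Rightarrow> 'a"
    and iA :: "'a \<Rightarrow> 'b::cstar_algebra"
    and iX :: "'x \<Rightarrow> 'b"
  assumes "hilbert_bimodule lact ract innerL innerR"
    and "is_crossed_product lact ract innerL innerR iA iX"
    and "free_map spectrum_topology (hat (inner_ideal innerR)) (dual_map lact innerR)"
  shows "(\<forall>J. cstar_ideal J \<longrightarrow> gauge_invariant iA iX J) \<and>
    lattice_iso
      (inclusion_order {J. cstar_ideal J})
      (inclusion_order {U. openin spectrum_topology U \<and>
        invariant_set (hat (inner_ideal innerR)) (dual_map lact innerR) U})
      (\<lambda>J. hat (iA -` J))"
proof -
 interpret crossed lact ract innerL innerR iA iX
  by (intro crossed.intro crossed_axioms.intro assms(1,2))
 note free = assms(3)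
 \<comment> \<open>Hats separate ideals of A, and preimages in A separate ideals of the crossed
   product.\<close>
 have mono: "hat (iA -` A) <= hat (iA -` B) <-> A <= B" if "cstar_ideal A" "cstar_ideal B" for A B
  unfolding hat_subset_iff[OF preimage_ideal[OF that(2)]] using ideal_le[OF free that] by blast
 have "bij_betw (%J. hat (iA -` J)) {J. cstar_ideal J} {U. openin spectrum_topology U & invariant_set D dual U}"
  unfolding bij_betw_def
 proof
  show "inj_on (%J. hat (iA -` J)) {J. cstar_ideal J}"
  proof (rule inj_onI)
   fix A B assume "A : {J. cstar_ideal J}" "B : {J. cstar_ideal J}" "hat (iA -` A) = hat (iA -` B)"
   thus "A = B" using mono[of A B] mono[of B A] by simp
  qed
  show "(%J. hat (iA -` J)) ` {J. cstar_ideal J} = {U. openin spectrum_topology U & invariant_set D dual U}"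
  proof (intro equalityI subsetI)
   fix U assume "U : (%J. hat (iA -` J)) ` {J. cstar_ideal J}"
   then obtain J where "cstar_ideal J" "U = hat (iA -` J)" by blast
   thus "U : {U. openin spectrum_topology U & invariant_set D dual U}"
    using openin_hat[OF preimage_ideal] hat_invariant(1) by blast
  next
   fix U assume "U : {U. openin spectrum_topology U & invariant_set D dual U}"
   then obtain J where "cstar_ideal J" "hat (iA -` J) = U" using ideal_exists by blast
   thus "U : (%J. hat (iA -` J)) ` {J. cstar_ideal J}" by blast
  qed
 qed
 hence "lattice_iso (inclusion_order {J. cstar_ideal J}) (inclusion_order {U. openin spectrum_topology U & invariant_set D dual U}) (%J. hat (iA -` J))"
  by (rule inclusion_lattice_iso) (simp_all add: mono ideal_lattice)
 thus ?thesis using ideals_gauge_invariant[OF free] by blast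
qed

end
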